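(* Let $k\ge2$ and let $\mathcal M(R,F)$ be a quantum matrix algebra of type $O(k)$. Then the generators $g,a_0,a_1,\dots,a_k$ of its characteristic subalgebra satisfy the reciprocal relations $$g^{k-i}\,a_i=a_k\,a_{k-i}\qquad\text{for all } i=0,1,\dots,k .$$
   Context: Operators. $V$ is a complex vector space of finite dimension $N$ with a fixed basis (operators on $V^{\otimes n}$ are matrices), $I$ the identity, $P$ the flip on $V\otimes V$. For $X\in\mathrm{End}(V^{\otimes 2})$, $X_{mr}$ is $X$ acting in the tensor factors $m,r$ and trivially elsewhere, $X_m:=X_{m\,m+1}$; for an $N\times N$ matrix $Y$, $Y_m$ is $Y$ in factor $m$. $\mathrm{Tr}_{(i)}$ is the trace over the $i$-th factor. $X$ is skew invertible if there is $\Psi_X\in\mathrm{End}(V^{\otimes2})$ with $\mathrm{Tr}_{(2)}X_{12}(\Psi_X)_{23}=\mathrm{Tr}_{(2)}(\Psi_X)_{12}X_{23}=P_{13}$; then $C_X:=\mathrm{Tr}_{(1)}(\Psi_X)_{12}$, $D_X:=\mathrm{Tr}_{(2)}(\Psi_X)_{12}$, and $X$ is strict skew invertible if $C_X$ or $D_X$ is invertible. An R-matrix is an invertible $R\in\mathrm{End}(V^{\otimes 2})$ with $R_1R_2R_1=R_2R_1R_2$; it gives representations $\rho_R$ of the braid groups $\mathcal B_n$ (generators $\sigma_1,\dots,\sigma_{n-1}$) and of $\mathbb C\mathcal B_n$ on $V^{\otimes n}$, $\sigma_i\mapsto R_i$. A pair $\{R,F\}$ is compatible if $R_1F_2F_1=F_2F_1R_2$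 and $R_2F_1F_2=F_1F_2R_1$. For skew invertible $R$ the R-trace over spaces $i_1,\dots,i_s$ is $\mathrm{Tr}_{R(i_1,\dots,i_s)}X:=\mathrm{Tr}_{(i_1,\dots,i_s)}\big((D_R)_{i_1}\cdots(D_R)_{i_s}X\big)$. BMW-type. Let $q\in\mathbb C\setminus\{0,\pm1\}$, $\mu\in\mathbb C\setminus\{0,q,-q^{-1}\}$, $i_q:=(q^i-q^{-i})/(q-q^{-1})$, $\eta:=\frac{(q-\mu)(q^{-1}+\mu)}{\mu(q-q^{-1})}$. An R-matrix $R$ is of BMW-type if its minimal polynomial relation is $(qI-R)(q^{-1}I+R)(\mu I-R)=0$ and $K:=\mu^{-1}(q-q^{-1})^{-1}(qI-R)(q^{-1}I+R)$ satisfies $K_2K_1=R_1^{\pm1}R_2^{\pm1}K_1$ and $K_1K_2K_1=K_1$. Put $\kappa_i:=\frac{(q-\sigma_i)(q^{-1}+\sigma_i)}{\mu(q-q^{-1})}$, $\sigma_i^-(x):=1+\frac{x-1}{q-q^{-1}}\sigma_i+\frac{x-1}{q\mu^{-1}x+1}\kappa_i$. Antisymmetrizers: $a^{(1)}:=1$, $a^{(i+1)}:=\frac{q^i}{(i+1)_q}a^{(i)}\sigma^-_i(q^{-2i})a^{(i)}$. For $\alpha\in\mathbb C\mathcal B_n$, $\alpha^{\uparrow m}\in\mathbb C\mathcal B_{n+m}$ is its image under $\sigma_i\mapsto\sigma_{i+m}$. Type $O(k)$. A skew invertible BMW-type R-matrix is of type $O(k)$, $k\ge2$, if $i_q\ne0$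 for $i=2,\dots,k$, $\mu=q^{1-k}$, $\rho_R(a^{(i)})\neq0$ for $i=2,\dots,k$, $\rho_R\big(a^{(k)\uparrow1}\sigma_1^-(q^{-2k})a^{(k)\uparrow1}\big)=0$, and $\mathrm{rk}\,\rho_R(a^{(k)})=1$. Quantum matrix algebra. Let $\{R,F\}$ be a compatible pair of strict skew invertible R-matrices. For an $N\times N$ matrix $M$ put $M_{\overline1}:=M_1$, $M_{\overline i}:=F_{i-1}M_{\overline{i-1}}F_{i-1}^{-1}$. $\mathcal M(R,F)$ is the unital associative $\mathbb C$-algebra generated by the entries $M_a^b$ of $M$ with relations $R_1M_{\overline1}M_{\overline2}=M_{\overline1}M_{\overline2}R_1$; it is of type $O(k)$ if $R$ is. For $\alpha\in\mathbb C\mathcal B_n$ put $ch(\alpha):=\mathrm{Tr}_{R(1,\dots,n)}(M_{\overline1}\cdots M_{\overline n}\,\rho_R(\alpha))$; these elements and $1$ span a commutative subalgebra $\mathcal C(R,F)$ (the characteristic subalgebra). Set $a_0:=1$, $a_i:=ch(a^{(i)})$, $g:=\eta^{-1}ch(\kappa_1)$ (the 2-contraction). *)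

theory Defs
  imports
    Complex_Main
    "HOL-Library.Poly_Mapping"
    "HOL-Algebra.QuotRing"
    "HOL-Computational_Algebra.Polynomial"
    "Jordan_Normal_Form.Gauss_Jordan_Elimination"
    "Jordan_Normal_Form.DL_Rank"
begin

text \<open>
  Conventions. \<open>V = \<complex>\<^sup>N\<close>, and an operator on the n-th tensor power of \<open>V\<close> is a square matrix of
  size \<open>N ^ n\<close>. A basis vector \<open>e(i\<^sub>1) \<otimes> \<dots> \<otimes> e(i\<^sub>n)\<close>, with every \<open>i\<^sub>j < N\<close>, has as its index the
  number with base \<open>N\<close> digits \<open>i\<^sub>1 \<dots> i\<^sub>n\<close> (\<open>i\<^sub>1\<close> is the most significant one). Tensor factors and
  generators of braid groups are numbered from 1.
\<close>

section \<open>Operators on tensor powers\<close>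

definition kron :: "'a::semiring_1 mat \<Rightarrow> 'a mat \<Rightarrow> 'a mat" where
  "kron A B = mat (dim_row A * dim_row B) (dim_col A * dim_col B)
     (\<lambda>(i, j). A $$ (i div dim_row B, j div dim_col B) * B $$ (i mod dim_row B, j mod dim_col B))"

text \<open>\<open>op_at N n m s X\<close>: an operator \<open>X\<close> on \<open>s\<close> factors, acting in the factors \<open>m, \<dots>, m + s - 1\<close>
  out of \<open>n\<close>. So \<open>X\<^sub>m\<close> is \<open>op_at N n m 2 X\<close> for \<open>X \<in> End (V \<otimes> V)\<close>, and \<open>op_at N n m 1 X\<close> for
  \<open>X \<in> End V\<close>.\<close>

definition op_at :: "nat \<Rightarrow> nat \<Rightarrow> nat \<Rightarrow> nat \<Rightarrow> 'a::semiring_1 mat \<Rightarrow> 'a mat" where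
  "op_at N n m s X = kron (1\<^sub>m (N ^ (m - 1))) (kron X (1\<^sub>m (N ^ (n + 1 - m - s))))"

definition flip :: "nat \<Rightarrow> complex mat" where
  "flip N = mat (N ^ 2) (N ^ 2)
     (\<lambda>(i, j). if i div N = j mod N \<and> i mod N = j div N then 1 else 0)"

definition mat_trace :: "'a::comm_monoid_add mat \<Rightarrow> 'a" where
  "mat_trace A = (\<Sum>i<dim_row A. A $$ (i, i))"

text \<open>The trace over the i-th of \<open>n\<close> factors; the result acts on the remaining \<open>n - 1\<close> factors.\<close>

definition ptrace :: "nat \<Rightarrow> nat \<Rightarrow> nat \<Rightarrow> complex mat \<Rightarrow> complex mat" where
  "ptrace N n i X = (let r = N ^ (n - i) in mat (N ^ (n - 1)) (N ^ (n - 1))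
     (\<lambda>(a, b). \<Sum>t<N. X $$ ((a div r * N + t) * r + a mod r, (b div r * N + t) * r + b mod r)))"

definition minv :: "complex mat \<Rightarrow> complex mat" where
  "minv A = the (mat_inverse A)"

definition mprod :: "nat \<Rightarrow> 'a::semiring_1 mat list \<Rightarrow> 'a mat" where
  "mprod d As = foldr (*) As (1\<^sub>m d)"

definition poly_mat :: "nat \<Rightarrow> complex poly \<Rightarrow> complex mat \<Rightarrow> complex mat" where
  "poly_mat d p A = mat d d (\<lambda>(i, j). \<Sum>m\<le>degree p. coeff p m * (A ^\<^sub>m m) $$ (i, j))"

definition is_min_poly :: "nat \<Rightarrow> complex mat \<Rightarrow> complex poly \<Rightarrow> bool" where
  "is_min_poly d A p \<longleftrightarrow> lead_coeff p = 1 \<and> poly_mat d p A = 0\<^sub>m d d \<and>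
     (\<forall>r. r \<noteq> 0 \<and> poly_mat d r A = 0\<^sub>m d d \<longrightarrow> degree p \<le> degree r)"


section \<open>R-matrices\<close>

definition R_matrix :: "nat \<Rightarrow> complex mat \<Rightarrow> bool" where
  "R_matrix N R \<longleftrightarrow> R \<in> carrier_mat (N ^ 2) (N ^ 2) \<and> invertible_mat R \<and>
     op_at N 3 1 2 R * op_at N 3 2 2 R * op_at N 3 1 2 R =
     op_at N 3 2 2 R * op_at N 3 1 2 R * op_at N 3 2 2 R"

text \<open>Below, \<open>ptrace N 3 2\<close> yields an operator on the factors 1 and 3, so that \<open>P\<^sub>1\<^sub>3\<close> becomes
  \<open>flip N\<close>.\<close>

definition is_skew_inverse :: "nat \<Rightarrow> complex mat \<Rightarrow> complex mat \<Rightarrow> bool" where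
  "is_skew_inverse N X Psi \<longleftrightarrow> Psi \<in> carrier_mat (N ^ 2) (N ^ 2) \<and>
     ptrace N 3 2 (op_at N 3 1 2 X * op_at N 3 2 2 Psi) = flip N \<and>
     ptrace N 3 2 (op_at N 3 1 2 Psi * op_at N 3 2 2 X) = flip N"

definition skew_invertible :: "nat \<Rightarrow> complex mat \<Rightarrow> bool" where
  "skew_invertible N X \<longleftrightarrow> (\<exists>Psi. is_skew_inverse N X Psi)"

text \<open>A skew inverse is unique: the two conditions say that the matrices of \<open>X\<close> and \<open>\<Psi>\<^sub>X\<close>,
  with their indices suitably regrouped, are inverse to each other.\<close>

definition skew_inverse :: "nat \<Rightarrow> complex mat \<Rightarrow> complex mat" where
  "skew_inverse N X = (THE Psi. is_skew_inverse N X Psi)"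

definition C_mat :: "nat \<Rightarrow> complex mat \<Rightarrow> complex mat" where
  "C_mat N X = ptrace N 2 1 (skew_inverse N X)"

definition D_mat :: "nat \<Rightarrow> complex mat \<Rightarrow> complex mat" where
  "D_mat N X = ptrace N 2 2 (skew_inverse N X)"

definition strict_skew_invertible :: "nat \<Rightarrow> complex mat \<Rightarrow> bool" where
  "strict_skew_invertible N X \<longleftrightarrow>
     skew_invertible N X \<and> (invertible_mat (C_mat N X) \<or> invertible_mat (D_mat N X))"

definition compatible_pair :: "nat \<Rightarrow> complex mat \<Rightarrow> complex mat \<Rightarrow> bool" where
  "compatible_pair N R F \<longleftrightarrow>
     op_at N 3 1 2 R * op_at N 3 2 2 F * op_at N 3 1 2 F =
       op_at N 3 2 2 F * op_at N 3 1 2 F * op_at N 3 2 2 R \<and>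
     op_at N 3 2 2 R * op_at N 3 1 2 F * op_at N 3 2 2 F =
       op_at N 3 1 2 F * op_at N 3 2 2 F * op_at N 3 1 2 R"

definition K_mat :: "nat \<Rightarrow> complex \<Rightarrow> complex \<Rightarrow> complex mat \<Rightarrow> complex mat" where
  "K_mat N q \<mu> R = (1 / (\<mu> * (q - 1 / q))) \<cdot>\<^sub>m
     ((q \<cdot>\<^sub>m 1\<^sub>m (N ^ 2) - R) * ((1 / q) \<cdot>\<^sub>m 1\<^sub>m (N ^ 2) + R))"

text \<open>The minimal polynomial is written with leading coefficient 1.\<close>

definition BMW_type :: "nat \<Rightarrow> complex \<Rightarrow> complex \<Rightarrow> complex mat \<Rightarrow> bool" where
  "BMW_type N q \<mu> R \<longleftrightarrow> R_matrix N R \<and>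
     is_min_poly (N ^ 2) R ([:- q, 1:] * [:1 / q, 1:] * [:- \<mu>, 1:]) \<and>
     (let K\<^sub>1 = op_at N 3 1 2 (K_mat N q \<mu> R); K\<^sub>2 = op_at N 3 2 2 (K_mat N q \<mu> R) in
        K\<^sub>2 * K\<^sub>1 = op_at N 3 1 2 R * op_at N 3 2 2 R * K\<^sub>1 \<and>
        K\<^sub>2 * K\<^sub>1 = op_at N 3 1 2 (minv R) * op_at N 3 2 2 (minv R) * K\<^sub>1 \<and>
        K\<^sub>1 * K\<^sub>2 * K\<^sub>1 = K\<^sub>1)"


section \<open>Associative algebras given by generators and relations\<close>

text \<open>The free monoid, written additively because the product of \<open>poly_mapping\<close> is the
  convolution with respect to an additive monoid of exponents.\<close>

datatype 'x gword = GWord (letters: "'x list")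

instantiation gword :: (type) monoid_add
begin
definition zero_gword :: "'a gword" where "zero_gword = GWord []"
definition plus_gword :: "'a gword \<Rightarrow> 'a gword \<Rightarrow> 'a gword" where
  "plus_gword u v = GWord (letters u @ letters v)"
instance by standard (simp_all add: zero_gword_def plus_gword_def)
end

type_synonym 'x ncpoly = "'x gword \<Rightarrow>\<^sub>0 complex"

definition gen :: "'x \<Rightarrow> 'x ncpoly" where
  "gen x = Poly_Mapping.single (GWord [x]) 1"

definition const :: "complex \<Rightarrow> 'x ncpoly" where
  "const c = Poly_Mapping.single 0 c"

text \<open>The free unital associative \<open>\<complex>\<close>-algebra on the set \<open>X\<close>.\<close>

definition free_algebra :: "'x set \<Rightarrow> 'x ncpoly ring" where
  "free_algebra X =
     \<lparr>carrier = {p. \<forall>w \<in> Poly_Mapping.keys p. set (letters w) \<subseteq> X},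
      mult = (*), one = 1, zero = 0, add = (+)\<rparr>"

text \<open>The algebra with generators \<open>X\<close> and relations \<open>s = 0\<close> for \<open>s \<in> S\<close>, and the class in it of a
  noncommutative polynomial. Ideals are two-sided; an ideal of the ring \<open>free_algebra X\<close> is
  automatically a \<open>\<complex>\<close>-subspace.\<close>

definition presented_algebra :: "'x set \<Rightarrow> 'x ncpoly set \<Rightarrow> 'x ncpoly set ring" where
  "presented_algebra X S = free_algebra X Quot (Idl\<^bsub>free_algebra X\<^esub> S)"

definition presented_class :: "'x set \<Rightarrow> 'x ncpoly set \<Rightarrow> 'x ncpoly \<Rightarrow> 'x ncpoly set" where
  "presented_class X S p = (Idl\<^bsub>free_algebra X\<^esub> S) +>\<^bsub>free_algebra X\<^esub> p"


section \<open>Group algebras of braid groups\<close>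

datatype braid_gen = Sigma nat | Sigma_inv nat

definition braid_gens :: "nat \<Rightarrow> braid_gen set" where
  "braid_gens n = Sigma ` {1..<n} \<union> Sigma_inv ` {1..<n}"

definition braid_relations :: "nat \<Rightarrow> braid_gen ncpoly set" where
  "braid_relations n =
     {gen (Sigma i) * gen (Sigma_inv i) - 1 | i. i \<in> {1..<n}} \<union>
     {gen (Sigma_inv i) * gen (Sigma i) - 1 | i. i \<in> {1..<n}} \<union>
     {gen (Sigma i) * gen (Sigma j) - gen (Sigma j) * gen (Sigma i) | i j.
        i \<in> {1..<n} \<and> j \<in> {1..<n} \<and> i + 2 \<le> j} \<union>
     {gen (Sigma i) * gen (Sigma (i + 1)) * gen (Sigma i) -
      gen (Sigma (i + 1)) * gen (Sigma i) * gen (Sigma (i + 1)) | i.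
        i \<in> {1..<n} \<and> i + 1 \<in> {1..<n}}"

text \<open>The group algebra of the group with Artin's presentation is the algebra with generators
  \<open>\<sigma>\<^sub>i\<close>, \<open>\<sigma>\<^sub>i\<^sup>-\<^sup>1\<close> and the same relations.\<close>

definition braid_algebra :: "nat \<Rightarrow> braid_gen ncpoly set ring" where
  "braid_algebra n = presented_algebra (braid_gens n) (braid_relations n)"

definition braid_class :: "nat \<Rightarrow> braid_gen ncpoly \<Rightarrow> braid_gen ncpoly set" where
  "braid_class n = presented_class (braid_gens n) (braid_relations n)"

definition bconst :: "nat \<Rightarrow> complex \<Rightarrow> braid_gen ncpoly set" where
  "bconst n c = braid_class n (const c)"

definition sigma :: "nat \<Rightarrow> nat \<Rightarrow> braid_gen ncpoly set" where
  "sigma n i = braid_class n (gen (Sigma i))"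

text \<open>\<open>braid_shift n m\<close> is the map \<open>\<alpha> \<mapsto> \<alpha>\<^sup>\<up>\<^sup>m\<close> from the algebra for \<open>n\<close> to the one for \<open>n + m\<close>. Here and
  for \<open>rho\<close> a homomorphism out of a quotient is the value shared by all representatives.\<close>

fun shift_gen :: "nat \<Rightarrow> braid_gen \<Rightarrow> braid_gen" where
  "shift_gen m (Sigma i) = Sigma (i + m)"
| "shift_gen m (Sigma_inv i) = Sigma_inv (i + m)"

definition shift_poly :: "nat \<Rightarrow> braid_gen ncpoly \<Rightarrow> braid_gen ncpoly" where
  "shift_poly m p = (\<Sum>w \<in> Poly_Mapping.keys p.
     Poly_Mapping.single (map_gword (shift_gen m) w) (Poly_Mapping.lookup p w))"

definition braid_shift :: "nat \<Rightarrow> nat \<Rightarrow> braid_gen ncpoly set \<Rightarrow> braid_gen ncpoly set" where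
  "braid_shift n m \<alpha> = the_elem ((\<lambda>p. braid_class (n + m) (shift_poly m p)) ` \<alpha>)"

fun rho_gen :: "nat \<Rightarrow> complex mat \<Rightarrow> nat \<Rightarrow> braid_gen \<Rightarrow> complex mat" where
  "rho_gen N R n (Sigma i) = op_at N n i 2 R"
| "rho_gen N R n (Sigma_inv i) = op_at N n i 2 (minv R)"

definition rho_poly :: "nat \<Rightarrow> complex mat \<Rightarrow> nat \<Rightarrow> braid_gen ncpoly \<Rightarrow> complex mat" where
  "rho_poly N R n p = mat (N ^ n) (N ^ n) (\<lambda>(i, j). \<Sum>w \<in> Poly_Mapping.keys p.
     Poly_Mapping.lookup p w * mprod (N ^ n) (map (rho_gen N R n) (letters w)) $$ (i, j))"

definition rho :: "nat \<Rightarrow> complex mat \<Rightarrow> nat \<Rightarrow> braid_gen ncpoly set \<Rightarrow> complex mat" where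
  "rho N R n \<alpha> = the_elem (rho_poly N R n ` \<alpha>)"


section \<open>Antisymmetrizers\<close>

definition qnum :: "complex \<Rightarrow> nat \<Rightarrow> complex" where
  "qnum q i = (q ^ i - (1 / q) ^ i) / (q - 1 / q)"

text \<open>In the following, \<open>n\<close> is the number of strands of the braid algebra in which the element
  is taken.\<close>

definition kappa :: "nat \<Rightarrow> complex \<Rightarrow> complex \<Rightarrow> nat \<Rightarrow> braid_gen ncpoly set" where
  "kappa n q \<mu> i = bconst n (1 / (\<mu> * (q - 1 / q))) \<otimes>\<^bsub>braid_algebra n\<^esub>
     ((bconst n q \<ominus>\<^bsub>braid_algebra n\<^esub> sigma n i) \<otimes>\<^bsub>braid_algebra n\<^esub>
      (bconst n (1 / q) \<oplus>\<^bsub>braid_algebra n\<^esub> sigma n i))"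

definition sigma_minus ::
  "nat \<Rightarrow> complex \<Rightarrow> complex \<Rightarrow> nat \<Rightarrow> complex \<Rightarrow> braid_gen ncpoly set" where
  "sigma_minus n q \<mu> i x = \<one>\<^bsub>braid_algebra n\<^esub>
     \<oplus>\<^bsub>braid_algebra n\<^esub> bconst n ((x - 1) / (q - 1 / q)) \<otimes>\<^bsub>braid_algebra n\<^esub> sigma n i
     \<oplus>\<^bsub>braid_algebra n\<^esub> bconst n ((x - 1) / (q * (1 / \<mu>) * x + 1)) \<otimes>\<^bsub>braid_algebra n\<^esub> kappa n q \<mu> i"

text \<open>\<open>antisym n q \<mu> i\<close> is \<open>a\<^sup>(\<^sup>i\<^sup>)\<close>, for \<open>1 \<le> i \<le> n\<close>; the first clause is a dummy.\<close>

fun antisym :: "nat \<Rightarrow> complex \<Rightarrow> complex \<Rightarrow> nat \<Rightarrow> braid_gen ncpoly set" where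
  "antisym n q \<mu> 0 = \<one>\<^bsub>braid_algebra n\<^esub>"
| "antisym n q \<mu> (Suc 0) = \<one>\<^bsub>braid_algebra n\<^esub>"
| "antisym n q \<mu> (Suc (Suc j)) = (let i = Suc j in
     bconst n (q ^ i / qnum q (i + 1)) \<otimes>\<^bsub>braid_algebra n\<^esub>
     (antisym n q \<mu> i \<otimes>\<^bsub>braid_algebra n\<^esub> sigma_minus n q \<mu> i ((1 / q) ^ (2 * i))
        \<otimes>\<^bsub>braid_algebra n\<^esub> antisym n q \<mu> i))"

definition type_O :: "nat \<Rightarrow> complex \<Rightarrow> complex \<Rightarrow> nat \<Rightarrow> complex mat \<Rightarrow> bool" where
  "type_O N q \<mu> k R \<longleftrightarrow> BMW_type N q \<mu> R \<and> skew_invertible N R \<and>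
     (\<forall>i \<in> {2..k}. qnum q i \<noteq> 0) \<and>
     \<mu> = q powi (1 - int k) \<and>
     (\<forall>i \<in> {2..k}. rho N R i (antisym i q \<mu> i) \<noteq> 0\<^sub>m (N ^ i) (N ^ i)) \<and>
     rho N R (k + 1) (braid_shift k 1 (antisym k q \<mu> k)
       \<otimes>\<^bsub>braid_algebra (k + 1)\<^esub> sigma_minus (k + 1) q \<mu> 1 ((1 / q) ^ (2 * k))
       \<otimes>\<^bsub>braid_algebra (k + 1)\<^esub> braid_shift k 1 (antisym k q \<mu> k))
       = 0\<^sub>m (N ^ (k + 1)) (N ^ (k + 1)) \<and>
     vec_space.rank (N ^ k) (rho N R k (antisym k q \<mu> k)) = 1"


section \<open>Quantum matrix algebras\<close>

text \<open>The generator \<open>gen (a, b)\<close> is the entry in row \<open>a\<close> and column \<open>b\<close> of the matrix \<open>M\<close>.\<close>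

type_synonym qpoly = "(nat \<times> nat) ncpoly"

definition M_gen :: "nat \<Rightarrow> qpoly mat" where
  "M_gen N = mat N N gen"

definition cmat :: "complex mat \<Rightarrow> qpoly mat" where
  "cmat A = map_mat const A"

text \<open>\<open>Mbar N F n i\<close> is \<open>M\<close> with the barred index \<open>i\<close>, for \<open>1 \<le> i \<le> n\<close>, acting on \<open>n\<close> factors;
  the first clause is a dummy.\<close>

fun Mbar :: "nat \<Rightarrow> complex mat \<Rightarrow> nat \<Rightarrow> nat \<Rightarrow> qpoly mat" where
  "Mbar N F n 0 = 1\<^sub>m (N ^ n)"
| "Mbar N F n (Suc 0) = op_at N n 1 1 (M_gen N)"
| "Mbar N F n (Suc (Suc j)) = (let i = Suc j in
     cmat (op_at N n i 2 F) * Mbar N F n i * cmat (op_at N n i 2 (minv F)))"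

definition qma_gens :: "nat \<Rightarrow> (nat \<times> nat) set" where
  "qma_gens N = {..<N} \<times> {..<N}"

definition qma_relations :: "nat \<Rightarrow> complex mat \<Rightarrow> complex mat \<Rightarrow> qpoly set" where
  "qma_relations N R F = elements_mat
     (cmat R * Mbar N F 2 1 * Mbar N F 2 2 - Mbar N F 2 1 * Mbar N F 2 2 * cmat R)"

definition qma :: "nat \<Rightarrow> complex mat \<Rightarrow> complex mat \<Rightarrow> qpoly set ring" where
  "qma N R F = presented_algebra (qma_gens N) (qma_relations N R F)"

definition qma_class :: "nat \<Rightarrow> complex mat \<Rightarrow> complex mat \<Rightarrow> qpoly \<Rightarrow> qpoly set" where
  "qma_class N R F = presented_class (qma_gens N) (qma_relations N R F)"

text \<open>The R-trace over all of the factors \<open>1, \<dots>, n\<close>.\<close>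

definition R_trace :: "nat \<Rightarrow> complex mat \<Rightarrow> nat \<Rightarrow> qpoly mat \<Rightarrow> qpoly" where
  "R_trace N R n X =
     mat_trace (cmat (mprod (N ^ n) (map (\<lambda>i. op_at N n i 1 (D_mat N R)) [1..<n + 1])) * X)"

definition ch ::
  "nat \<Rightarrow> complex mat \<Rightarrow> complex mat \<Rightarrow> nat \<Rightarrow> braid_gen ncpoly set \<Rightarrow> qpoly set" where
  "ch N R F n \<alpha> = qma_class N R F
     (R_trace N R n (mprod (N ^ n) (map (Mbar N F n) [1..<n + 1]) * cmat (rho N R n \<alpha>)))"

definition a_elem ::
  "nat \<Rightarrow> complex mat \<Rightarrow> complex mat \<Rightarrow> complex \<Rightarrow> complex \<Rightarrow> nat \<Rightarrow> qpoly set" where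
  "a_elem N R F q \<mu> i =
     (if i = 0 then \<one>\<^bsub>qma N R F\<^esub> else ch N R F i (antisym i q \<mu> i))"

definition eta :: "complex \<Rightarrow> complex \<Rightarrow> complex" where
  "eta q \<mu> = (q - \<mu>) * (1 / q + \<mu>) / (\<mu> * (q - 1 / q))"

definition contraction ::
  "nat \<Rightarrow> complex mat \<Rightarrow> complex mat \<Rightarrow> complex \<Rightarrow> complex \<Rightarrow> qpoly set" where
  "contraction N R F q \<mu> =
     qma_class N R F (const (1 / eta q \<mu>)) \<otimes>\<^bsub>qma N R F\<^esub> ch N R F 2 (kappa 2 q \<mu> 1)"

end

theory Submission imports Defs begin

text \<open>Let \<open>k = i + m\<close>. On \<open>k + m\<close> strands one bends the last \<open>m\<close> strands of \<open>a\<^sup>(\<^sup>k\<^sup>)\<close> back with \<open>m\<close> nested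
  cups \<open>W\<close> and, mirrored, \<open>W'\<close>. Repeated use of \<open>\<kappa>\<^sub>j a\<^sup>(\<^sup>j\<^sup>) \<kappa>\<^sub>j = c\<^sub>j a\<^sup>(\<^sup>j\<^sup>-\<^sup>1\<^sup>) \<kappa>\<^sub>j\<close> gives
  \<open>W a\<^sup>(\<^sup>k\<^sup>) W' = c a\<^sup>(\<^sup>i\<^sup>) \<otimes> K \<otimes> \<dots> \<otimes> K\<close>, where \<open>\<mu> = q\<^sup>1\<^sup>-\<^sup>k\<close> ensures \<open>c \<noteq> 0\<close>.
  In the other order, \<open>a\<^sup>(\<^sup>k\<^sup>) W' W a\<^sup>(\<^sup>k\<^sup>) = a\<^sup>(\<^sup>k\<^sup>) \<otimes> e\<close>, because \<open>a\<^sup>(\<^sup>k\<^sup>) = u v\<close> has rank one. The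
  operator \<open>e\<close> on the last \<open>m\<close> factors absorbs \<open>a\<^sup>(\<^sup>m\<^sup>)\<close>. It equals \<open>c \<eta>\<^sup>m a\<^sup>(\<^sup>m\<^sup>)\<close>: the cups identify the
  ranges of \<open>a\<^sup>(\<^sup>i\<^sup>)\<close> and \<open>a\<^sup>(\<^sup>m\<^sup>)\<close>, since those for \<open>(i, m)\<close> and for \<open>(m, i)\<close> provide one-sided inverses in both
  directions. The R-trace is cyclic modulo the defining relations and multiplicative for
  juxtaposition of operators, so comparing the characters of the two products yields
  \<open>c a\<^sub>i (\<eta> g)\<^sup>m = c \<eta>\<^sup>m a\<^sub>k a\<^sub>m\<close>; finally \<open>g\<close> commutes with \<open>a\<^sub>i\<close>.\<close>

text \<open>Cyclicity is the obstacle that shapes the argument: under the R-trace only operators in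
  the image of the braid algebra can be moved around, and the factors \<open>u\<close>,
  \<open>v\<close> of the rank-one antisymmetrizer are not of this kind. The cups therefore have to
  be words in the \<open>K j\<close>, while \<open>u\<close>, \<open>v\<close> serve only to
  evaluate one matrix product. The facts on antisymmetrizers rest on their being eigenvectors of the
  generators with eigenvalue \<open>-1/q\<close> on both sides, which is obtained by fusion of
  neighbouring factors \<open>Sm\<close>. That c does not vanish reduces to two facts:
  \<open>q powi e = -1\<close> is impossible for \<open>\<bar>e\<bar> \<le> k\<close>, and
  \<open>qnum q (k - j + 1)\<close> is nonzero. Multiplicativity of the characters is an identity in
  the free algebra and comes from compatibility of \<open>R\<close> and \<open>F\<close>. The
  defining relations enter only through cyclicity, in the form that the product of all
  \<open>M\<close> commutes with braid operators; the second ingredient there is that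
  \<open>D\<close> on two factors commutes with \<open>R\<close>. Operator identities are proved in
  an abstract ring, free of size conditions, and carried over to matrices by a faithful
  representation.\<close>

abbreviation sq_mats :: "nat \<Rightarrow> 'a mat set" where
  "sq_mats d \<equiv> carrier_mat d d"

lemmas sq_assoc = assoc_mult_mat[of _ d d _ d _ d] for d

lemmas sq_one = left_mult_one_mat[of _ d d] right_mult_one_mat[of _ d d] for d

section \<open>Rings with BMW relations\<close>

text \<open>A complex algebra whose scalar action is a parameter: the underlying type only has to be
  a ring, so the simplifier's ring rules apply without carrier conditions.\<close>

locale complex_algebra =
  fixes sm :: "complex \<Rightarrow> 'a::ring_1 \<Rightarrow> 'a" (infixr \<open>\<star>\<close> 75)
  assumes sm_add_right: "c \<star> (x + y) = c \<star> x + c \<star> y"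
    and sm_add_left: "(c + d) \<star> x = c \<star> x + d \<star> x"
    and sm_sm: "c \<star> d \<star> x = (c * d) \<star> x"
    and sm_one: "1 \<star> x = x"
    and sm_mult_left: "(c \<star> x) * y = c \<star> (x * y)"
    and sm_mult_right: "x * (c \<star> y) = c \<star> (x * y)"
begin

lemma sm_zero_left: "0 \<star> x = 0"
  using sm_add_left[of 0 0 x] by simp

lemma sm_zero_right: "c \<star> 0 = 0"
  using sm_add_right[of c 0 0] by simp

lemma sm_minus_left: "(- c) \<star> x = - (c \<star> x)"
  by (rule minus_unique[symmetric]) (simp flip: sm_add_left add: sm_zero_left)

lemma sm_minus_right: "c \<star> (- x) = - (c \<star> x)"
  by (rule minus_unique[symmetric]) (simp flip: sm_add_right add: sm_zero_right)

lemma sm_diff_right: "c \<star> (x - y) = c \<star> x - c \<star> y"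
  using sm_add_right[of c x "- y"] by (simp add: sm_minus_right)

lemma sm_diff_left: "(c - d) \<star> x = c \<star> x - d \<star> x"
  using sm_add_left[of c "- d" x] by (simp add: sm_minus_left)

lemmas sm_simps = sm_add_right sm_diff_right sm_minus_right sm_sm sm_mult_left sm_mult_right
  sm_zero_right sm_zero_left sm_one

lemma sm_move: "c \<noteq> 0 \<Longrightarrow> c \<star> x = y \<Longrightarrow> x = (1 / c) \<star> y"
  by (auto simp: sm_sm sm_one)

text \<open>The vectors \<open>X\<close>, \<open>s2 X\<close>, \<open>k2 X\<close>, \<open>s1 s2 X\<close>, \<open>s1 k2 X\<close>, \<open>k1 k2 X\<close> span a space that is stable
  under \<open>s2\<close>; the equations for the scalars say that the coordinates of the fused vector form an
  eigenvector of this action.\<close>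

lemma left_pencil:
  assumes "s1 * X = c \<star> X" "k1 * X = 0"
    and "s2 * (s2 * X) = X + l \<star> (s2 * X) - (l * m) \<star> (k2 * X)"
    and "s2 * (k2 * X) = m \<star> (k2 * X)"
    and "k1 * (s2 * X) = d \<star> (k1 * (k2 * X))"
    and "s2 * (s1 * (s2 * X)) = c \<star> (s1 * (s2 * X))"
    and "s2 * (k1 * (k2 * X)) = s1 * (k2 * X) - l \<star> (k2 * X) + l \<star> (k1 * (k2 * X))"
    and "s2 * (s1 * (k2 * X)) = k1 * (k2 * X)"
    and e: "e = b * b' + b * a' * d"
    and c: "a' = c * (1 + a * c)" "(1 + a * c) + a' * l = c * a'"
      "b' * m = c * b' + a' * l * m + l * e" "e = c * a * b'" "a * b' + l * e = c * e"
  shows "s2 * ((1 + a \<star> s1 + b \<star> k1) * ((1 + a' \<star> s2 + b' \<star> k2) * X)) =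
    c \<star> ((1 + a \<star> s1 + b \<star> k1) * ((1 + a' \<star> s2 + b' \<star> k2) * X))"
proof -
  \<comment> \<open>The coordinate \<open>e\<close> on \<open>k1 (k2 X)\<close> has two sources:
    \<open>b * b'\<close> directly, and \<open>b * a' * d\<close> because \<open>k1 (s2 X)\<close>
    is \<open>d\<close> times the same vector. The term \<open>k1 X\<close> vanishes.\<close>
  have v: "(1 + a \<star> s1 + b \<star> k1) * ((1 + a' \<star> s2 + b' \<star> k2) * X) =
     (1 + a * c) \<star> X + a' \<star> (s2 * X) + b' \<star> (k2 * X) + (a * a') \<star> (s1 * (s2 * X))
     + (a * b') \<star> (s1 * (k2 * X)) + e \<star> (k1 * (k2 * X))"
    unfolding e using assms(1-8)
    by (simp add: distrib_left distrib_right sm_simps sm_add_left ac_simps)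
  have "s2 * ((1 + a \<star> s1 + b \<star> k1) * ((1 + a' \<star> s2 + b' \<star> k2) * X)) =
     a' \<star> X + ((1 + a * c) + a' * l) \<star> (s2 * X) + (b' * m - a' * l * m - l * e) \<star> (k2 * X)
     + (c * a * a') \<star> (s1 * (s2 * X)) + e \<star> (s1 * (k2 * X)) + (a * b' + l * e) \<star> (k1 * (k2 * X))"
    unfolding v using assms(1-8)
    by (simp add: distrib_left distrib_right right_diff_distrib sm_simps sm_add_left sm_diff_left ac_simps)
  also have "\<dots> = c \<star> ((1 + a \<star> s1 + b \<star> k1) * ((1 + a' \<star> s2 + b' \<star> k2) * X))"
    unfolding v c(2) c(3) c(5) using c(1,4)
    by (simp add: sm_simps ac_simps)
  finally show ?thesis .
qed

lemma right_pencil: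
  assumes "X * s1 = c \<star> X" "X * k1 = 0"
    and "(X * s2) * s2 = X + l \<star> (X * s2) - (l * m) \<star> (X * k2)"
    and "(X * k2) * s2 = m \<star> (X * k2)"
    and "(X * s2) * k1 = d \<star> (X * k2 * k1)"
    and "X * s2 * s1 * s2 = c \<star> (X * s2 * s1)"
    and "X * k2 * k1 * s2 = X * k2 * s1 - l \<star> (X * k2) + l \<star> (X * k2 * k1)"
    and "X * k2 * s1 * s2 = X * k2 * k1"
    and e: "e = b * b' + b * a' * d"
    and c: "a' = c * (1 + a * c)" "(1 + a * c) + a' * l = c * a'"
      "b' * m = c * b' + a' * l * m + l * e" "e = c * a * b'" "a * b' + l * e = c * e"
  shows "(X * (1 + a' \<star> s2 + b' \<star> k2)) * (1 + a \<star> s1 + b \<star> k1) * s2 =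
    c \<star> ((X * (1 + a' \<star> s2 + b' \<star> k2)) * (1 + a \<star> s1 + b \<star> k1))"
proof -
  have v: "(X * (1 + a' \<star> s2 + b' \<star> k2)) * (1 + a \<star> s1 + b \<star> k1) =
     (1 + a * c) \<star> X + a' \<star> (X * s2) + b' \<star> (X * k2) + (a * a') \<star> (X * s2 * s1)
     + (a * b') \<star> (X * k2 * s1) + e \<star> (X * k2 * k1)"
    unfolding e using assms(1-8)
    by (simp add: distrib_left distrib_right sm_simps sm_add_left ac_simps)
  have "(X * (1 + a' \<star> s2 + b' \<star> k2)) * (1 + a \<star> s1 + b \<star> k1) * s2 =
     a' \<star> X + ((1 + a * c) + a' * l) \<star> (X * s2) + (b' * m - a' * l * m - l * e) \<star> (X * k2)
     + (c * a * a') \<star> (X * s2 * s1) + e \<star> (X * k2 * s1) + (a * b' + l * e) \<star> (X * k2 * k1)"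
    unfolding v using assms(1-8)
    by (simp add: distrib_left distrib_right left_diff_distrib sm_simps sm_add_left sm_diff_left ac_simps)
  also have "\<dots> = c \<star> ((X * (1 + a' \<star> s2 + b' \<star> k2)) * (1 + a \<star> s1 + b \<star> k1))"
    unfolding v c(2) c(3) c(5) using c(1,4)
    by (simp add: sm_simps ac_simps)
  finally show ?thesis .
qed

end

text \<open>The relations between \<open>K j\<close> and \<open>K (Suc j)\<close> are assumed only
  in the orientation in which \<open>BMW_type\<close> provides them; the opposite orientation is
  derived below. The bounds \<open>0 < j\<close> and \<open>j < n\<close> single out the generators
  that exist on \<open>n\<close> strands.\<close>

locale bmw_rep = complex_algebra sm for sm :: "complex \<Rightarrow> 'a::ring_1 \<Rightarrow> 'a" (infixr \<open>\<star>\<close> 75) +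
  fixes n :: nat and q \<mu> :: complex and R Ri K :: "nat \<Rightarrow> 'a"
  assumes q0: "q \<noteq> 0" and q1: "q - 1 / q \<noteq> 0" and mu0: "\<mu> \<noteq> 0"
    and R_Ri: "0 < j \<Longrightarrow> j < n \<Longrightarrow> R j * Ri j = 1"
    and Ri_R: "0 < j \<Longrightarrow> j < n \<Longrightarrow> Ri j * R j = 1"
    and skein: "0 < j \<Longrightarrow> j < n \<Longrightarrow> R j - Ri j = (q - 1 / q) \<star> (1 - K j)"
    and R_K: "0 < j \<Longrightarrow> j < n \<Longrightarrow> R j * K j = \<mu> \<star> K j"
    and K_R: "0 < j \<Longrightarrow> j < n \<Longrightarrow> K j * R j = \<mu> \<star> K j"
    and braid: "0 < j \<Longrightarrow> Suc j < n \<Longrightarrow> R j * R (Suc j) * R j = R (Suc j) * R j * R (Suc j)"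
    and far: "0 < i \<Longrightarrow> i + 2 \<le> j \<Longrightarrow> j < n \<Longrightarrow> R i * R j = R j * R i"
    and K_K_up: "0 < j \<Longrightarrow> Suc j < n \<Longrightarrow> K (Suc j) * K j = R j * R (Suc j) * K j"
    and K_K_up_inv: "0 < j \<Longrightarrow> Suc j < n \<Longrightarrow> K (Suc j) * K j = Ri j * Ri (Suc j) * K j"
    and K_K_K_up: "0 < j \<Longrightarrow> Suc j < n \<Longrightarrow> K j * K (Suc j) * K j = K j"
begin

abbreviation lam :: complex where "lam \<equiv> q - 1 / q"

text \<open>The value of a closed loop, in the form in which the skein relation produces it. It
  equals \<open>eta q \<mu>\<close> of the statement by \<open>eta_eq\<close>.\<close>

definition eta' :: complex where "eta' = 1 + (1 / \<mu> - \<mu>) / lam"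

lemma K_eq: "0 < j \<Longrightarrow> j < n \<Longrightarrow> K j = 1 - (1 / lam) \<star> (R j - Ri j)"
  using skein[of j] q1 by (simp add: sm_sm sm_one)

lemma Ri_K: assumes "0 < j" "j < n" shows "Ri j * K j = (1 / \<mu>) \<star> K j"
proof -
  have "K j = Ri j * (R j * K j)" using Ri_R[OF assms] by (simp flip: mult.assoc)
  also have "\<dots> = \<mu> \<star> (Ri j * K j)" using R_K[OF assms] by (simp add: sm_mult_right)
  finally show ?thesis using mu0 sm_move by metis
qed

lemma K_Ri: assumes "0 < j" "j < n" shows "K j * Ri j = (1 / \<mu>) \<star> K j"
proof -
  have "K j = (K j * R j) * Ri j" using R_Ri[OF assms] by (simp add: mult.assoc)
  also have "\<dots> = \<mu> \<star> (K j * Ri j)" using K_R[OF assms] by (simp add: sm_mult_left)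
  finally show ?thesis using mu0 sm_move by metis
qed

lemma K_sq: assumes "0 < j" "j < n" shows "K j * K j = eta' \<star> K j"
proof -
  have "K j * K j = (1 - (1 / lam) \<star> (R j - Ri j)) * K j" using K_eq[OF assms] by simp
  also have "\<dots> = K j - (1 / lam) \<star> (\<mu> \<star> K j - (1 / \<mu>) \<star> K j)"
    using R_K[OF assms] Ri_K[OF assms] by (simp add: algebra_simps sm_simps)
  also have "\<dots> = eta' \<star> K j"
    unfolding eta'_def by (simp add: sm_add_left sm_diff_left sm_diff_right sm_sm sm_one diff_divide_distrib mult.commute)
  finally show ?thesis .
qed

lemma R_sq: assumes "0 < j" "j < n" shows "R j * R j = 1 + lam \<star> R j - (lam * \<mu>) \<star> K j"
proof -
  have "R j * R j = R j * (Ri j + lam \<star> (1 - K j))" using skein[OF assms] by (metis add_diff_cancel_left' diff_add_cancel)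
  also have "\<dots> = 1 + lam \<star> R j - (lam * \<mu>) \<star> K j"
    using R_Ri[OF assms] R_K[OF assms] by (simp add: algebra_simps sm_simps)
  finally show ?thesis .
qed

section \<open>Relations between neighbouring and between distant generators\<close>

definition adj :: "nat \<Rightarrow> nat \<Rightarrow> bool" where
  "adj i j \<longleftrightarrow> 0 < i \<and> 0 < j \<and> i < n \<and> j < n \<and> (j = Suc i \<or> i = Suc j)"

lemma adj_sym: "adj i j \<Longrightarrow> adj j i" by (auto simp: adj_def)

lemma adjD: "adj i j \<Longrightarrow> 0 < i \<and> i < n \<and> 0 < j \<and> j < n" by (auto simp: adj_def)

lemma braid_adj: "adj i j \<Longrightarrow> R i * R j * R i = R j * R i * R j"
  using braid by (auto simp: adj_def)

lemma R_cancel: assumes "0 < j" "j < n"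
  shows "R j * (Ri j * x) = x" "Ri j * (R j * x) = x"
  using R_Ri[OF assms] Ri_R[OF assms] by (simp_all flip: mult.assoc)

text \<open>By the skein relation \<open>K\<close> is an affine combination of \<open>R\<close> and
  its inverse, so whatever intertwines these two intertwines \<open>K\<close>.\<close>

lemma K_intertwine:
  assumes "0 < i" "i < n" "0 < j" "j < n" "R j * x = x * R i" "Ri j * x = x * Ri i"
  shows "K j * x = x * K i"
  unfolding K_eq[OF assms(1,2)] K_eq[OF assms(3,4)] using assms(5,6)
  by (simp add: left_diff_distrib right_diff_distrib sm_diff_right sm_mult_left sm_mult_right)

lemma Ri_slide: assumes "adj i j" shows "Ri j * R i * R j = R i * R j * Ri i"
proof -
  have ij: "0 < i" "i < n" "0 < j" "j < n" using adjD[OF assms] by auto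
  have "Ri j * (R j * R i * R j) * Ri i = Ri j * (R i * R j * R i) * Ri i"
    using braid_adj[OF assms] by simp
  then show ?thesis using ij by (simp add: mult.assoc R_cancel R_Ri)
qed

lemma K_slide: assumes "adj i j" shows "K j * (R i * R j) = R i * R j * K i"
proof -
  have ij: "0 < i" "i < n" "0 < j" "j < n" using adjD[OF assms] by auto
  show ?thesis using Ri_slide[OF assms] braid_adj[OF assms] ij
    by (intro K_intertwine) (simp_all add: mult.assoc)
qed

lemma Ri_braid: assumes "adj i j" shows "Ri i * Ri j * Ri i = Ri j * Ri i * Ri j"
proof -
  have ij: "0 < i" "i < n" "0 < j" "j < n" using adjD[OF assms] by auto
  have "Ri i * Ri j * Ri i = (Ri i * Ri j * Ri i) * ((R j * R i * R j) * (Ri j * Ri i * Ri j))"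
    using ij by (simp add: mult.assoc R_cancel R_Ri)
  also have "\<dots> = (Ri i * Ri j * Ri i) * ((R i * R j * R i) * (Ri j * Ri i * Ri j))"
    using braid_adj[OF assms] by simp
  also have "\<dots> = Ri j * Ri i * Ri j"
    using ij by (simp add: mult.assoc R_cancel Ri_R)
  finally show ?thesis .
qed

lemma R_slide_inv: assumes "adj i j" shows "R j * Ri i * Ri j = Ri i * Ri j * R i"
proof -
  have ij: "0 < i" "i < n" "0 < j" "j < n" using adjD[OF assms] by auto
  have "R j * (Ri j * Ri i * Ri j) * R i = R j * (Ri i * Ri j * Ri i) * R i"
    using Ri_braid[OF assms] by simp
  then show ?thesis using ij by (simp add: mult.assoc R_cancel Ri_R)
qed

lemma K_slide_inv: assumes "adj i j" shows "K j * (Ri i * Ri j) = Ri i * Ri j * K i"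
proof -
  have ij: "0 < i" "i < n" "0 < j" "j < n" using adjD[OF assms] by auto
  show ?thesis using R_slide_inv[OF assms] Ri_braid[OF assms] ij
    by (intro K_intertwine) (simp_all add: mult.assoc)
qed

context
  fixes j assumes j1: "0 < j" and jn: "Suc j < n"
begin

lemma adj_j: "adj j (Suc j)" "adj (Suc j) j" using j1 jn by (auto simp: adj_def)

text \<open>Removing a kink: in \<open>K j * K (Suc j) * K j = K j\<close> the product
  \<open>K (Suc j) * K j\<close> is replaced by its expression in inverse crossings, and the first
  of these is absorbed by \<open>K j\<close> at the cost of \<open>1 / \<mu>\<close>.\<close>

lemma K_Ri_K_up: "K j * Ri (Suc j) * K j = \<mu> \<star> K j"
proof -
  have "K j = K j * (Ri j * Ri (Suc j) * K j)"
    using K_K_K_up[OF j1 jn] K_K_up_inv[OF j1 jn] by (simp add: mult.assoc)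
  also have "\<dots> = (1 / \<mu>) \<star> (K j * Ri (Suc j) * K j)"
    using K_Ri[of j] j1 jn by (simp flip: mult.assoc add: sm_mult_left)
  finally show ?thesis using mu0 by (metis divide_self_if mult.commute sm_one sm_sm times_divide_eq_left mult_1)
qed

lemma K_R_K_up: "K j * R (Suc j) * K j = (1 / \<mu>) \<star> K j"
proof -
  have "K j = K j * (R j * R (Suc j) * K j)"
    using K_K_K_up[OF j1 jn] K_K_up[OF j1 jn] by (simp add: mult.assoc)
  also have "\<dots> = \<mu> \<star> (K j * R (Suc j) * K j)"
    using K_R[of j] j1 jn by (simp flip: mult.assoc add: sm_mult_left)
  finally show ?thesis using mu0 sm_move by metis
qed

text \<open>\<open>K_slide\<close> makes \<open>K (Suc j)\<close> a conjugate of \<open>K j\<close>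
  by \<open>R j * R (Suc j)\<close>. After this substitution only the kink relations for
  \<open>K j\<close> are needed.\<close>

lemma K_K_K_down: "K (Suc j) * K j * K (Suc j) = K (Suc j)"
proof -
  have r: "0 < j" "j < n" "0 < Suc j" "Suc j < n" using j1 jn by auto
  have k2: "K (Suc j) = R j * R (Suc j) * K j * Ri (Suc j) * Ri j"
    using K_slide[OF adj_j(1)] r by (metis R_Ri mult.assoc mult.right_neutral)
  have "K (Suc j) * K j * K (Suc j)
    = R j * R (Suc j) * (K j * Ri (Suc j) * (Ri j * K j) * R j * R (Suc j) * K j) * Ri (Suc j) * Ri j"
    by (simp add: k2 mult.assoc)
  also have "Ri j * K j = (1 / \<mu>) \<star> K j" using Ri_K r by simp
  also have "K j * Ri (Suc j) * ((1 / \<mu>) \<star> K j) * R j * R (Suc j) * K j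
    = (1 / \<mu>) \<star> ((K j * Ri (Suc j) * K j) * R j * R (Suc j) * K j)" by (simp add: sm_simps)
  also have "\<dots> = (K j * R j) * R (Suc j) * K j" using mu0 by (simp add: K_Ri_K_up sm_simps)
  also have "\<dots> = \<mu> \<star> (K j * R (Suc j) * K j)" using K_R r by (simp add: sm_simps)
  also have "\<dots> = K j" using mu0 by (simp add: K_R_K_up sm_simps)
  finally show ?thesis using k2 by simp
qed

text \<open>The assumed relation with inverse crossings, solved for \<open>K j\<close>, is
  multiplied by \<open>K (Suc j)\<close> from the right; \<open>K_K_K_down\<close> then shortens the
  left side.\<close>

lemma K_K_down: "K j * K (Suc j) = R (Suc j) * R j * K (Suc j)"
proof -
  have r: "0 < j" "j < n" "0 < Suc j" "Suc j < n" using j1 jn by auto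
  have "R (Suc j) * R j * (K (Suc j) * K j) = K j"
    unfolding K_K_up_inv[OF j1 jn] using r by (simp add: mult.assoc R_cancel)
  then have "R (Suc j) * R j * (K (Suc j) * K j) * K (Suc j) = K j * K (Suc j)" by simp
  then show ?thesis using K_K_K_down by (simp add: mult.assoc)
qed

lemma K_K_down_inv: "K j * K (Suc j) = Ri (Suc j) * Ri j * K (Suc j)"
proof -
  have r: "0 < j" "j < n" "0 < Suc j" "Suc j < n" using j1 jn by auto
  have "Ri (Suc j) * Ri j * (K (Suc j) * K j) = K j"
    unfolding K_K_up[OF j1 jn] using r by (simp add: mult.assoc R_cancel)
  then have "Ri (Suc j) * Ri j * (K (Suc j) * K j) * K (Suc j) = K j * K (Suc j)" by simp
  then show ?thesis using K_K_K_down by (simp add: mult.assoc)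
qed

end

lemma K_K: assumes "adj i j" shows "K i * K j = R j * R i * K j"
  using assms K_K_up[of j] K_K_down[of i] by (auto simp: adj_def)

lemma K_K_inv: assumes "adj i j" shows "K i * K j = Ri j * Ri i * K j"
  using assms K_K_up_inv[of j] K_K_down_inv[of i] by (auto simp: adj_def)

lemma K_K_K: assumes "adj i j" shows "K i * K j * K i = K i"
  using assms K_K_K_up[of i] K_K_K_down[of j] by (auto simp: adj_def)

lemma K_K': assumes "adj i j" shows "K i * K j = K i * R j * R i"
  using K_K[OF assms] K_slide[OF adj_sym[OF assms]] by (simp add: mult.assoc)

lemma K_K_inv': assumes "adj i j" shows "K i * K j = K i * Ri j * Ri i"
  using K_K_inv[OF assms] K_slide_inv[OF adj_sym[OF assms]] by (simp add: mult.assoc)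

text \<open>This and the next three lemmas are the tangle moves that rotate a crossing around an
  arc, which changes its sign. They are what later moves crossings along nested cups.\<close>

lemma R_K_rot: assumes "adj i j" shows "R i * K j = Ri j * K i * K j"
  using K_K[OF assms] adjD[OF assms] by (simp add: mult.assoc R_cancel)

lemma Ri_K_rot: assumes "adj i j" shows "Ri i * K j = R j * K i * K j"
  using K_K_inv[OF assms] adjD[OF assms] by (simp add: mult.assoc R_cancel)

lemma K_R_rot: assumes "adj i j" shows "K j * R i = K j * K i * Ri j"
  using K_K'[OF adj_sym[OF assms]] adjD[OF assms] by (simp add: mult.assoc R_Ri)

lemma K_Ri_rot: assumes "adj i j" shows "K j * Ri i = K j * K i * R j"
  using K_K_inv'[OF adj_sym[OF assms]] adjD[OF assms] by (simp add: mult.assoc Ri_R)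

lemma K_R_K: assumes "adj i j" shows "K i * R j * K i = (1 / \<mu>) \<star> K i"
proof -
  have "K i * R j * K i = K i * Ri i * K j * K i" by (simp add: mult.assoc R_K_rot[OF adj_sym[OF assms]])
  then show ?thesis using K_Ri[of i] adjD[OF assms] K_K_K[OF assms] by (simp add: sm_simps)
qed

lemma comm_inv: assumes "0 < j" "j < n" "x * R j = R j * x" shows "x * Ri j = Ri j * x"
proof -
  have "Ri j * (x * R j) * Ri j = Ri j * (R j * x) * Ri j" using assms by simp
  then show ?thesis using assms(1,2) by (simp add: mult.assoc R_cancel R_Ri)
qed

lemma comm_K: assumes "0 < j" "j < n" "x * R j = R j * x" shows "x * K j = K j * x"
  using K_intertwine[OF assms(1,2,1,2), of x] assms(3) comm_inv[OF assms] by simp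

definition farr :: "nat \<Rightarrow> nat \<Rightarrow> bool" where
  "farr i j \<longleftrightarrow> 0 < i \<and> 0 < j \<and> i < n \<and> j < n \<and> (i + 2 \<le> j \<or> j + 2 \<le> i)"

lemma far_RR: "farr i j \<Longrightarrow> R i * R j = R j * R i"
  unfolding farr_def using far[of i j] far[of j i] by auto

lemma far_RK: "farr i j \<Longrightarrow> R i * K j = K j * R i"
  using comm_K[of j "R i"] far_RR by (auto simp: farr_def)

lemma far_KR: "farr i j \<Longrightarrow> K i * R j = R j * K i"
  using far_RK[of j i] by (auto simp: farr_def)

lemma far_KK: "farr i j \<Longrightarrow> K i * K j = K j * K i"
  using comm_K[of j "K i"] far_KR by (auto simp: farr_def)

end

section \<open>Antisymmetrizers\<close>

text \<open>\<open>den_nz\<close> says that the coefficient of \<open>K\<close> in \<open>Sm\<close>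
  is a genuine fraction for every spectral parameter \<open>q^(-2j)\<close> occurring in the
  antisymmetrizers up to \<open>k\<close>; \<open>qnum_nz\<close> does the same for their
  normalisations.\<close>

locale bmw_antisym = bmw_rep sm n q \<mu> R Ri K
  for sm :: "complex \<Rightarrow> 'a::ring_1 \<Rightarrow> 'a" (infixr \<open>\<star>\<close> 75) and n q \<mu> R Ri K +
  fixes k :: nat
  assumes qnum_nz: "2 \<le> i \<Longrightarrow> i \<le> k \<Longrightarrow> qnum q i \<noteq> 0"
    and den_nz: "0 < j \<Longrightarrow> j < k \<Longrightarrow> q * (1 / \<mu>) * (1 / q) ^ (2 * j) + 1 \<noteq> 0"
begin

definition Sm :: "nat \<Rightarrow> complex \<Rightarrow> 'a" where
  "Sm j x = 1 + ((x - 1) / lam) \<star> R j + ((x - 1) / (q * (1 / \<mu>) * x + 1)) \<star> K j"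

text \<open>The antisymmetrizer on the strands \<open>s + 1, ..., s + j\<close>, hence built from
  the generators \<open>s + 1, ..., s + j - 1\<close>. The offset \<open>s\<close> is needed because
  the cups produce an antisymmetrizer on the last strands.\<close>

fun A :: "nat \<Rightarrow> nat \<Rightarrow> 'a" where
  "A s 0 = 1"
| "A s (Suc 0) = 1"
| "A s (Suc (Suc j)) = (q ^ Suc j / qnum q (Suc j + 1)) \<star>
    (A s (Suc j) * Sm (s + Suc j) ((1 / q) ^ (2 * Suc j)) * A s (Suc j))"

lemma A_Suc: "0 < j \<Longrightarrow> A s (Suc j) = (q ^ j / qnum q (j + 1)) \<star>
    (A s j * Sm (s + j) ((1 / q) ^ (2 * j)) * A s j)"
  by (cases j) auto

definition antiL :: "nat \<Rightarrow> nat \<Rightarrow> 'a \<Rightarrow> bool" where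
  "antiL s j X \<longleftrightarrow> (\<forall>l. 0 < l \<longrightarrow> l < j \<longrightarrow> R (s + l) * X = (- 1 / q) \<star> X)"

definition antiR :: "nat \<Rightarrow> nat \<Rightarrow> 'a \<Rightarrow> bool" where
  "antiR s j X \<longleftrightarrow> (\<forall>l. 0 < l \<longrightarrow> l < j \<longrightarrow> X * R (s + l) = (- 1 / q) \<star> X)"

text \<open>On such an \<open>X\<close> the inverse crossing acts by \<open>- q\<close>, so
  \<open>R i - Ri i\<close> acts by \<open>q - 1 / q\<close>. The skein relation gives the same
  value minus a multiple of \<open>K i * X\<close>, which must therefore vanish.\<close>

lemma K_annihilates: assumes "0 < i" "i < n" "R i * X = (- 1 / q) \<star> X" shows "K i * X = 0"
proof -
  have "\<mu> \<star> (K i * X) = K i * (R i * X)" using K_R[OF assms(1,2)] by (simp flip: mult.assoc add: sm_mult_left)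
  then have "\<mu> \<star> (K i * X) = (- 1 / q) \<star> (K i * X)" using assms(3) by (simp add: sm_mult_right)
  have "X = (- 1 / q) \<star> (Ri i * X)" using R_cancel(2)[OF assms(1,2), of X] assms(3) by (simp add: sm_mult_right)
  then have "(- q) \<star> X = (- q) \<star> ((- 1 / q) \<star> (Ri i * X))" by simp
  then have "Ri i * X = (- q) \<star> X" using q0 by (simp add: sm_sm sm_one)
  then have "(R i - Ri i) * X = lam \<star> X"
    using assms(3) by (simp add: left_diff_distrib flip: sm_diff_left)
  moreover have "(R i - Ri i) * X = lam \<star> X - lam \<star> (K i * X)"
    using skein[OF assms(1,2)] by (simp add: sm_simps left_diff_distrib)
  ultimately have "lam \<star> (K i * X) = 0" by simp
  then show ?thesis using q1 sm_move by (metis sm_zero_right)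
qed

lemma K_annihilates': assumes "0 < i" "i < n" "X * R i = (- 1 / q) \<star> X" shows "X * K i = 0"
proof -
  have "X = (X * R i) * Ri i" using R_Ri[OF assms(1,2)] by (simp add: mult.assoc)
  then have "X = (- 1 / q) \<star> (X * Ri i)" using assms(3) by (simp add: sm_mult_left)
  then have "(- q) \<star> X = (- q) \<star> ((- 1 / q) \<star> (X * Ri i))" by simp
  then have "X * Ri i = (- q) \<star> X" using q0 by (simp add: sm_sm sm_one)
  then have "X * (R i - Ri i) = lam \<star> X"
    using assms(3) by (simp add: right_diff_distrib flip: sm_diff_left)
  moreover have "X * (R i - Ri i) = lam \<star> X - lam \<star> (X * K i)"
    using skein[OF assms(1,2)] by (simp add: sm_simps right_diff_distrib)
  ultimately have "lam \<star> (X * K i) = 0" by simp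
  then show ?thesis using q1 sm_move by (metis sm_zero_right)
qed

text \<open>On an antisymmetric vector \<open>Sm\<close> at \<open>q^(-2j)\<close> acts by
  \<open>q^(-j) * qnum q (j + 1)\<close>. The prefactor in the recursion is the inverse of this
  number, which is what makes the antisymmetrizers idempotent.\<close>

lemma A_coeff: assumes "0 < j" "j < k"
  shows "q ^ j / qnum q (j + 1) * (1 - ((1 / q) ^ (2 * j) - 1) / lam * (1 / q)) = 1"
proof -
  have "qnum q (j + 1) \<noteq> 0" using qnum_nz[of "j + 1"] assms by simp
  moreover have "q ^ j * (1 - ((1 / q) ^ (2 * j) - 1) / lam * (1 / q)) = qnum q (j + 1)"
    unfolding qnum_def using q0 q1
    by (simp add: field_simps power_mult power2_eq_square power_divide flip: power_mult_distrib)
  ultimately show ?thesis by (simp add: field_simps)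
qed

lemma Sm_antiL: assumes "0 < i" "i < n" "R i * X = (- 1 / q) \<star> X"
  shows "Sm i x * X = (1 - (x - 1) / lam * (1 / q)) \<star> X"
  unfolding Sm_def using assms(3) K_annihilates[OF assms]
  by (simp add: distrib_right sm_simps sm_diff_left sm_minus_left)

lemma Sm_antiR: assumes "0 < i" "i < n" "X * R i = (- 1 / q) \<star> X"
  shows "X * Sm i x = (1 - (x - 1) / lam * (1 / q)) \<star> X"
  unfolding Sm_def using assms(3) K_annihilates'[OF assms]
  by (simp add: distrib_left sm_simps sm_diff_left sm_minus_left)

text \<open>Only the eigenvalue of each generator on \<open>X\<close> matters: every factor
  \<open>Sm\<close> acts as a scalar, cancelled by the normalisation through \<open>A_coeff\<close>.
  With \<open>X\<close> an antisymmetrizer this yields idempotency and mutual absorption in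
  \<open>A_A\<close>.\<close>

lemma A_absorb_left: "antiL s j X \<Longrightarrow> j \<le> k \<Longrightarrow> s + j \<le> n \<Longrightarrow> A s j * X = X"
proof (induction s j rule: A.induct)
  case (3 s j)
  let ?j = "Suc j"
  have a: "antiL s ?j X" using "3.prems"(1) unfolding antiL_def by auto
  have r: "R (s + ?j) * X = (- 1 / q) \<star> X" using "3.prems"(1) unfolding antiL_def by auto
  have IH: "A s ?j * X = X" using "3.IH" a "3.prems" by simp
  have "A s (Suc ?j) * X = (q ^ ?j / qnum q (?j + 1)) \<star> ((1 - ((1 / q) ^ (2 * ?j) - 1) / lam * (1 / q)) \<star> X)"
    unfolding A.simps using IH Sm_antiL[of "s + ?j" X] r "3.prems"
    by (simp only: sm_simps mult.assoc)
  then show ?case using A_coeff[of ?j] "3.prems" by (simp only: sm_simps)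
qed auto

lemma A_absorb_right: "antiR s j X \<Longrightarrow> j \<le> k \<Longrightarrow> s + j \<le> n \<Longrightarrow> X * A s j = X"
proof (induction s j rule: A.induct)
  case (3 s j)
  let ?j = "Suc j"
  have a: "antiR s ?j X" using "3.prems"(1) unfolding antiR_def by auto
  have r: "X * R (s + ?j) = (- 1 / q) \<star> X" using "3.prems"(1) unfolding antiR_def by auto
  have IH: "X * A s ?j = X" using "3.IH" a "3.prems" by simp
  have "X * A s (Suc ?j) = (q ^ ?j / qnum q (?j + 1)) \<star> ((1 - ((1 / q) ^ (2 * ?j) - 1) / lam * (1 / q)) \<star> X)"
    unfolding A.simps using IH Sm_antiR[of "s + ?j" X] r "3.prems"
    by (simp only: sm_simps flip: mult.assoc)
  then show ?case using A_coeff[of ?j] "3.prems" by (simp only: sm_simps)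
qed auto

lemma comm_mult: "x * a = a * x \<Longrightarrow> x * b = b * x \<Longrightarrow> x * (a * b) = (a * b) * (x :: 'a)"
  by (metis mult.assoc)

lemma A_comm: "(\<And>l. 0 < l \<Longrightarrow> l < j \<Longrightarrow> x * R (s + l) = R (s + l) * x) \<Longrightarrow> s + j \<le> n
   \<Longrightarrow> x * A s j = A s j * x"
proof (induction s j rule: A.induct)
  case (3 s j)
  let ?j = "Suc j"
  have IH: "x * A s ?j = A s ?j * x" using 3 by simp
  have r: "x * R (s + ?j) = R (s + ?j) * x" using "3.prems"(1)[of ?j] by simp
  have kk: "x * K (s + ?j) = K (s + ?j) * x" using comm_K[of "s + ?j" x] r "3.prems" by simp
  have S: "x * Sm (s + ?j) y = Sm (s + ?j) y * x" for y
    unfolding Sm_def using r kk by (simp add: distrib_left distrib_right sm_simps)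
  have "x * (A s ?j * Sm (s + ?j) y * A s ?j) = (A s ?j * Sm (s + ?j) y * A s ?j) * x" for y
    using comm_mult[OF comm_mult[OF IH S] IH] .
  then show ?case unfolding A.simps by (simp only: sm_simps)
qed auto

text \<open>Solves the scalar equations of \<open>left_pencil\<close> and
  \<open>right_pencil\<close> for \<open>c = -1/q\<close>, \<open>l = lam\<close>,
  \<open>m = \<mu>\<close>, \<open>d = -q\<close>. The condition on the spectral parameters is the
  fusion condition \<open>y = x / q^2\<close>. \<open>X\<close> and \<open>Y\<close> are the
  denominators of \<open>b\<close> and \<open>b'\<close> up to harmless factors.\<close>

lemma pencil_coeffs:
  fixes x y :: complex
  assumes "y = x / q\<^sup>2" "q * (1 / \<mu>) * x + 1 \<noteq> 0" "q * (1 / \<mu>) * y + 1 \<noteq> 0"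
  defines "a \<equiv> (x - 1) / lam" and "a' \<equiv> (y - 1) / lam"
    and "b \<equiv> (x - 1) / (q * (1 / \<mu>) * x + 1)" and "b' \<equiv> (y - 1) / (q * (1 / \<mu>) * y + 1)"
  defines "e \<equiv> b * b' + b * a' * (- q)"
  shows "a' = (- 1 / q) * (1 + a * (- 1 / q))"
      "(1 + a * (- 1 / q)) + a' * lam = (- 1 / q) * a'"
      "b' * \<mu> = (- 1 / q) * b' + a' * lam * \<mu> + lam * e"
      "e = (- 1 / q) * a * b'"
      "a * b' + lam * e = (- 1 / q) * e"
proof -
  define X where "X = q * x + \<mu>"
  define Y where "Y = x + q * \<mu>"
  have "q * (1 / \<mu>) * x + 1 = X / \<mu>" unfolding X_def using mu0 by (simp add: field_simps)
  then have X0: "X \<noteq> 0" and b: "b = (x - 1) * \<mu> / X" using assms(2) unfolding b_def by auto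
  have "q * (1 / \<mu>) * y + 1 = Y / (q * \<mu>)" unfolding Y_def assms(1) using mu0 q0
    by (simp add: field_simps power2_eq_square)
  then have Y0: "Y \<noteq> 0" and b': "b' = (y - 1) * (q * \<mu>) / Y" using assms(3) unfolding b'_def by auto
  have q2: "q * q - 1 \<noteq> 0" using q1 q0 by (auto simp: field_simps)
  have l: "lam = (q * q - 1) / q" using q0 by (simp add: field_simps)
  define L where "L = lam"
  have L0: "L \<noteq> 0" and il: "L = q - 1 / q" using q1 unfolding L_def by simp_all
  have la: "L * a = x - 1" and la': "L * a' = x / q\<^sup>2 - 1"
    unfolding a_def a'_def assms(1) L_def using q1 by simp_all
  have "L * ((- 1 / q) * (1 + a * (- 1 / q))) = (- 1 / q) * (L - (L * a) / q)"
    by (simp add: right_diff_distrib)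
  also have "\<dots> = L * a'" unfolding la la' unfolding il using q0 by (simp add: field_simps power2_eq_square)
  finally show "a' = (- 1 / q) * (1 + a * (- 1 / q))" using L0 by (metis mult_left_cancel)
  have "L * (1 + a * (- 1 / q) + a' * L + a' / q) = L - (L * a) / q + (L * a') * (L + 1 / q)"
    by (simp add: distrib_left distrib_right right_diff_distrib)
  also have "\<dots> = 0" unfolding la la' unfolding il using q0 by (simp add: field_simps power2_eq_square)
  finally have "1 + a * (- 1 / q) + a' * L + a' / q = 0" using L0 by (metis mult_eq_0_iff)
  then show "(1 + a * (- 1 / q)) + a' * lam = (- 1 / q) * a'" unfolding L_def by (simp add: eq_neg_iff_add_eq_0)
  \<comment> \<open>Since \<open>e = b * (b' - q * a')\<close>, it suffices to put
    \<open>b' - q * a'\<close> over one denominator: its numerator collapses to a multiple of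
    \<open>X\<close>, which cancels the denominator of \<open>b\<close>.\<close>
  have "b' - q * a' = (y - 1) * (q * \<mu> / Y - q / L)" unfolding b' a'_def L_def
    by (simp only: right_diff_distrib) (simp add: algebra_simps)
  also have "q * \<mu> / Y - q / L = - q * X / (q * L * Y)"
  proof -
    have "L * (q * \<mu>) - Y * q = - X" 
      unfolding il X_def Y_def using q0 by (simp add: field_simps)
    then have "(q * \<mu> * L - q * Y) / (Y * L) = - X / (Y * L)" by (simp add: mult.commute)
    then show ?thesis using diff_frac_eq[OF Y0 L0, of "q * \<mu>" q] q0 by (simp add: mult.commute)
  qed
  finally have bq: "b' - q * a' = (y - 1) * (- q * X / (q * L * Y))" .
  have "e = b * (b' - q * a')" unfolding e_def by (simp add: algebra_simps)
  also have "\<dots> = (x - 1) * \<mu> / X * ((y - 1) * (- q * X / (q * L * Y)))"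
    unfolding bq b ..
  also have "\<dots> = (- 1 / q) * a * b'"
    unfolding a_def b' L_def[symmetric] using X0 q0 by simp
  finally show e: "e = (- 1 / q) * a * b'" .
  have "(- 1 / q) * e - L * e = - q * e" unfolding il by (simp add: algebra_simps)
  also have "\<dots> = a * b'" using e q0 by simp
  finally show "a * b' + lam * e = (- 1 / q) * e" unfolding L_def by (metis add.commute diff_add_cancel)
  have "\<mu> + 1 / q + (x - 1) / q = Y / q" unfolding Y_def using q0 by (simp add: field_simps)
  then have "b' * (\<mu> + 1 / q + (x - 1) / q) = (y - 1) * \<mu>"
    unfolding b' using Y0 q0 by simp
  then have h: "b' * \<mu> + b' / q + (x - 1) / q * b' = (y - 1) * \<mu>"
    by (simp add: distrib_left mult.commute)
  have "L * e = - ((L * a) / q * b')" unfolding e by simp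
  then have Le: "L * e = - ((x - 1) / q * b')" unfolding la .
  have La: "a' * L = y - 1" using la' assms(1) by (simp add: mult.commute)
  show "b' * \<mu> = (- 1 / q) * b' + a' * lam * \<mu> + lam * e"
    unfolding L_def[symmetric] Le La h[symmetric] by simp
qed

text \<open>The consequence of the Yang-Baxter equation that fusion requires: a vector antisymmetric
  for \<open>R i\<close> is turned into one antisymmetric for \<open>R (Suc i)\<close>. It is
  checked on the six spanning vectors of \<open>left_pencil\<close>, whose hypotheses on the action
  are verified one by one.\<close>

lemma fuse_left:
  assumes i: "0 < i" "Suc i < n" and X: "R i * X = (- 1 / q) \<star> X"
    and xy: "y = x / q\<^sup>2" "q * (1 / \<mu>) * x + 1 \<noteq> 0" "q * (1 / \<mu>) * y + 1 \<noteq> 0"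
  shows "R (Suc i) * (Sm i x * (Sm (Suc i) y * X)) = (- 1 / q) \<star> (Sm i x * (Sm (Suc i) y * X))"
proof -
  have a: "adj i (Suc i)" "adj (Suc i) i" and b: "i < n" "0 < Suc i" using i by (auto simp: adj_def)
  have 5: "K i * (R (Suc i) * X) = (- q) \<star> (K i * (K (Suc i) * X))"
  proof -
    have "K i * (K (Suc i) * X) = K i * R (Suc i) * (R i * X)"
      using K_K'[OF a(1)] by (simp flip: mult.assoc)
    then show ?thesis using X q0 by (simp add: sm_simps mult.assoc)
  qed
  have 6: "R (Suc i) * (R i * (R (Suc i) * X)) = (- 1 / q) \<star> (R i * (R (Suc i) * X))"
  proof -
    have "R (Suc i) * (R i * (R (Suc i) * X)) = R i * (R (Suc i) * (R i * X))"
      using braid_adj[OF a(1)] by (simp flip: mult.assoc)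
    then show ?thesis using X by (simp add: sm_simps)
  qed
  have 7: "R (Suc i) * (K i * (K (Suc i) * X)) =
      R i * (K (Suc i) * X) - lam \<star> (K (Suc i) * X) + lam \<star> (K i * (K (Suc i) * X))"
  proof -
    have "R (Suc i) * (K i * (K (Suc i) * X)) = Ri i * (K (Suc i) * X)"
      using Ri_K_rot[OF a(1)] by (simp flip: mult.assoc)
    also have "Ri i = R i - lam \<star> (1 - K i)" using skein[of i] i by (simp add: algebra_simps)
    finally show ?thesis by (simp add: left_diff_distrib right_diff_distrib sm_simps mult.assoc)
  qed
  have 8: "R (Suc i) * (R i * (K (Suc i) * X)) = K i * (K (Suc i) * X)"
    using R_K_rot[OF a(1)] R_cancel[OF b(2) i(2)] by (metis mult.assoc)
  have 3: "R (Suc i) * (R (Suc i) * X) = X + lam \<star> (R (Suc i) * X) - (lam * \<mu>) \<star> (K (Suc i) * X)"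
    using R_sq[OF b(2) i(2)]
    by (simp flip: mult.assoc) (simp add: distrib_right left_diff_distrib sm_simps)
  have 4: "R (Suc i) * (K (Suc i) * X) = \<mu> \<star> (K (Suc i) * X)"
    using R_K[OF b(2) i(2)] by (simp flip: mult.assoc add: sm_mult_left)
  show ?thesis unfolding Sm_def
    by (rule left_pencil[OF X K_annihilates[OF i(1) b(1) X] 3 4 5 6 7 8 refl pencil_coeffs[OF xy]])
qed

lemma fuse_right:
  assumes i: "0 < i" "Suc i < n" and X: "X * R i = (- 1 / q) \<star> X"
    and xy: "y = x / q\<^sup>2" "q * (1 / \<mu>) * x + 1 \<noteq> 0" "q * (1 / \<mu>) * y + 1 \<noteq> 0"
  shows "(X * Sm (Suc i) y) * Sm i x * R (Suc i) = (- 1 / q) \<star> ((X * Sm (Suc i) y) * Sm i x)"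
proof -
  have a: "adj i (Suc i)" "adj (Suc i) i" and b: "i < n" "0 < Suc i" using i by (auto simp: adj_def)
  have 5: "(X * R (Suc i)) * K i = (- q) \<star> (X * K (Suc i) * K i)"
  proof -
    have "X * K (Suc i) * K i = (X * R i) * R (Suc i) * K i"
      using K_K[OF a(2)] by (simp add: mult.assoc)
    then show ?thesis using X q0 by (simp add: sm_simps mult.assoc)
  qed
  have 6: "X * R (Suc i) * R i * R (Suc i) = (- 1 / q) \<star> (X * R (Suc i) * R i)"
  proof -
    have "X * R (Suc i) * R i * R (Suc i) = (X * R i) * R (Suc i) * R i"
      using braid_adj[OF a(1)] by (simp add: mult.assoc)
    then show ?thesis using X by (simp add: sm_simps mult.assoc)
  qed
  have 7: "X * K (Suc i) * K i * R (Suc i) =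
      X * K (Suc i) * R i - lam \<star> (X * K (Suc i)) + lam \<star> (X * K (Suc i) * K i)"
  proof -
    have "X * K (Suc i) * K i * R (Suc i) = X * K (Suc i) * Ri i"
      using K_Ri_rot[OF a(1)] by (simp add: mult.assoc)
    also have "Ri i = R i - lam \<star> (1 - K i)" using skein[of i] i by (simp add: algebra_simps)
    finally show ?thesis by (simp add: left_diff_distrib right_diff_distrib sm_simps mult.assoc)
  qed
  have 8: "X * K (Suc i) * R i * R (Suc i) = X * K (Suc i) * K i"
    using K_R_rot[OF a(1)] Ri_R[OF b(2) i(2)] by (simp add: mult.assoc)
  have 3: "(X * R (Suc i)) * R (Suc i) = X + lam \<star> (X * R (Suc i)) - (lam * \<mu>) \<star> (X * K (Suc i))"
    using R_sq[OF b(2) i(2)]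
    by (simp add: mult.assoc) (simp add: distrib_left right_diff_distrib sm_simps)
  have 4: "(X * K (Suc i)) * R (Suc i) = \<mu> \<star> (X * K (Suc i))"
    using K_R[OF b(2) i(2)] by (simp add: mult.assoc sm_mult_right)
  show ?thesis unfolding Sm_def
    by (rule right_pencil[OF X K_annihilates'[OF i(1) b(1) X] 3 4 5 6 7 8 refl pencil_coeffs[OF xy]])
qed

text \<open>The start of the fusion: at \<open>x = 1 / q^2\<close> the coefficient of
  \<open>R i\<close> in \<open>Sm\<close> becomes \<open>-1/q\<close>, and with the quadratic
  relation for \<open>R i\<close> the whole element is an eigenvector on both sides.\<close>

lemma Sm_base: assumes i: "0 < i" "i < n" and x: "x = 1 / q\<^sup>2" "q * (1 / \<mu>) * x + 1 \<noteq> 0"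
  shows "R i * Sm i x = (- 1 / q) \<star> Sm i x" "Sm i x * R i = (- 1 / q) \<star> Sm i x"
proof -
  define b where "b = (x - 1) / (q * (1 / \<mu>) * x + 1)"
  have a: "(x - 1) / lam = - 1 / q"
    using q0 q1 by (simp add: x(1) power2_eq_square divide_eq_eq) (simp add: field_simps)
  have "q * (1 / \<mu>) * x + 1 = (1 / q + \<mu>) / \<mu>" unfolding x(1) using mu0 q0
    by (simp add: field_simps power2_eq_square)
  then have b: "b * (1 / q + \<mu>) = (x - 1) * \<mu>" unfolding b_def using mu0 x(2) by auto
  then have b': "lam * \<mu> / q + b * \<mu> = - b / q"
    unfolding x(1) using q0 by (simp add: field_simps power2_eq_square)
  have S: "Sm i x = 1 + (- 1 / q) \<star> R i + b \<star> K i"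
    unfolding Sm_def a b_def ..
  have r: "R i * R i = 1 + lam \<star> R i - (lam * \<mu>) \<star> K i" by (rule R_sq[OF i])
  have l: "1 + (- 1 / q) * lam = 1 / q\<^sup>2" using q0 by (simp add: field_simps power2_eq_square)
  have "R i + (- 1 / q) \<star> (1 + L \<star> R i - (L * \<mu>) \<star> K i) + (b * \<mu>) \<star> K i
     = (- 1 / q) \<star> 1 + (1 + (- 1 / q) * L) \<star> R i + (L * \<mu> / q + b * \<mu>) \<star> K i" for L
    by (simp add: sm_simps sm_add_left sm_minus_left sm_diff_left)
  from this[of lam] have "R i + (- 1 / q) \<star> (1 + lam \<star> R i - (lam * \<mu>) \<star> K i) + (b * \<mu>) \<star> K i
     = (- 1 / q) \<star> Sm i x"
    unfolding l b' S by (simp add: sm_simps power2_eq_square sm_minus_left)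
  note e = this
  show "R i * Sm i x = (- 1 / q) \<star> Sm i x"
    unfolding e[symmetric] unfolding S using R_K[OF i] r by (simp add: distrib_left sm_mult_right sm_sm)
  show "Sm i x * R i = (- 1 / q) \<star> Sm i x"
    unfolding e[symmetric] unfolding S using K_R[OF i] r by (simp add: distrib_right sm_mult_left sm_sm)
qed

text \<open>Strong induction. All generators but the last are handled by the outer copies of
  \<open>A s j\<close>. For the last one, a copy of \<open>A s j\<close> is unfolded into
  \<open>A s i\<close> and \<open>Sm (s + i)\<close>; the inner \<open>A s i\<close> is far from the
  generators of \<open>Sm (s + j)\<close>, passes through it and is absorbed by the other copy. What
  remains contains the product treated by \<open>fuse_left\<close> and
  \<open>fuse_right\<close>.\<close>

lemma anti_A: "j \<le> k \<Longrightarrow> s + j \<le> n \<Longrightarrow> antiL s j (A s j) \<and> antiR s j (A s j)"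
proof (induction j rule: less_induct)
  case (less m)
  show ?case
  proof (cases "m \<le> 1")
    case True
    then show ?thesis by (auto simp: antiL_def antiR_def)
  next
    case False
    then obtain j where m: "m = Suc j" and j: "0 < j" by (cases m) auto
    define x where "x = (1 / q) ^ (2 * j)"
    define c where "c = q ^ j / qnum q (j + 1)"
    have A: "A s m = c \<star> (A s j * Sm (s + j) x * A s j)" unfolding m c_def x_def using j by (rule A_Suc)
    have al: "antiL s j (A s j)" and ar: "antiR s j (A s j)" using less m by auto
    have jk: "j < k" and sj: "0 < s + j" "s + j < n" using less.prems m j by auto
    have dx: "q * (1 / \<mu>) * x + 1 \<noteq> 0" unfolding x_def using den_nz[OF j jk] .
    have top: "R (s + j) * (A s j * Sm (s + j) x * A s j) = (- 1 / q) \<star> (A s j * Sm (s + j) x * A s j)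
      \<and> (A s j * Sm (s + j) x * A s j) * R (s + j) = (- 1 / q) \<star> (A s j * Sm (s + j) x * A s j)"
    proof (cases "j = 1")
      case True
      then show ?thesis using Sm_base[OF sj, of x] dx by (simp add: x_def power_divide)
    next
      case False
      then obtain i where ji: "j = Suc i" and i: "0 < i" using j by (cases j) auto
      define y where "y = (1 / q) ^ (2 * i)"
      define d where "d = q ^ i / qnum q (i + 1)"
      have Aj: "A s j = d \<star> (A s i * Sm (s + i) y * A s i)" unfolding ji d_def y_def using i by (rule A_Suc)
      have xy: "x = y / q\<^sup>2" unfolding x_def y_def ji by (simp add: power2_eq_square power_divide)
      have dy: "q * (1 / \<mu>) * y + 1 \<noteq> 0" unfolding y_def using den_nz[of i] i jk ji by simp
      have si: "0 < s + i" "Suc (s + i) < n" using i sj ji by auto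
      have ai: "antiL s i (A s j)" "antiR s i (A s j)" using al ar ji by (auto simp: antiL_def antiR_def)
      have ab: "A s i * A s j = A s j" "A s j * A s i = A s j"
        using A_absorb_left[OF ai(1)] A_absorb_right[OF ai(2)] jk ji sj by auto
      have cR: "R (s + j) * A s i = A s i * R (s + j)"
        using sj ji by (intro A_comm far_RR) (auto simp: farr_def)
      have cK: "K (s + j) * A s i = A s i * K (s + j)"
        using sj ji by (intro A_comm far_KR) (auto simp: farr_def)
      have cS: "Sm (s + j) x * A s i = A s i * Sm (s + j) x"
        unfolding Sm_def using cR cK by (simp add: distrib_left distrib_right sm_simps)
      have rj: "R (s + i) * A s j = (- 1 / q) \<star> A s j" "A s j * R (s + i) = (- 1 / q) \<star> A s j"
        using al ar i ji by (auto simp: antiL_def antiR_def)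
      \<comment> \<open>The left copy of \<open>A s j\<close> is unfolded for the action from the
        left; for the action from the right, below, it is the right copy.\<close>
      have "A s j * Sm (s + j) x * A s j = d \<star> (A s i * (Sm (s + i) y * (A s i * Sm (s + j) x * A s j)))"
        by (subst (1) Aj) (simp add: sm_simps mult.assoc)
      also have "A s i * Sm (s + j) x * A s j = Sm (s + j) x * (A s i * A s j)"
        using cS by (simp flip: mult.assoc)
      finally have e1: "A s j * Sm (s + j) x * A s j = d \<star> (A s i * (Sm (s + i) y * (Sm (s + j) x * A s j)))"
        using ab by simp
      have "A s j * Sm (s + j) x * A s j = d \<star> ((A s j * (Sm (s + j) x * A s i)) * Sm (s + i) y * A s i)"
        by (subst (2) Aj) (simp add: sm_simps mult.assoc)
      also have "A s j * (Sm (s + j) x * A s i) = (A s j * A s i) * Sm (s + j) x"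
        using cS by (simp add: mult.assoc)
      finally have e2: "A s j * Sm (s + j) x * A s j = d \<star> ((A s j * Sm (s + j) x) * Sm (s + i) y * A s i)"
        using ab by simp
      have "R (s + j) * (A s i * (Sm (s + i) y * (Sm (s + j) x * A s j)))
          = A s i * (R (s + j) * (Sm (s + i) y * (Sm (s + j) x * A s j)))"
        using cR by (simp flip: mult.assoc)
      also have "\<dots> = (- 1 / q) \<star> (A s i * (Sm (s + i) y * (Sm (s + j) x * A s j)))"
        using fuse_left[OF si rj(1) xy dy dx] ji by (simp add: sm_mult_right)
      finally have t1: "R (s + j) * (A s i * (Sm (s + i) y * (Sm (s + j) x * A s j)))
        = (- 1 / q) \<star> (A s i * (Sm (s + i) y * (Sm (s + j) x * A s j)))" .
      have "((A s j * Sm (s + j) x) * Sm (s + i) y * A s i) * R (s + j)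
          = ((A s j * Sm (s + j) x) * Sm (s + i) y * R (s + j)) * A s i"
        using cR by (simp add: mult.assoc)
      also have "\<dots> = (- 1 / q) \<star> ((A s j * Sm (s + j) x) * Sm (s + i) y * A s i)"
        using fuse_right[OF si rj(2) xy dy dx] ji by (simp add: sm_mult_left)
      finally have t2: "((A s j * Sm (s + j) x) * Sm (s + i) y * A s i) * R (s + j)
          = (- 1 / q) \<star> ((A s j * Sm (s + j) x) * Sm (s + i) y * A s i)" .
      have "R (s + j) * (A s j * Sm (s + j) x * A s j) = (- 1 / q) \<star> (A s j * Sm (s + j) x * A s j)"
        unfolding e1 sm_mult_right t1 by (simp add: sm_sm mult.commute)
      moreover have "(A s j * Sm (s + j) x * A s j) * R (s + j) = (- 1 / q) \<star> (A s j * Sm (s + j) x * A s j)"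
        unfolding e2 sm_mult_left t2 by (simp add: sm_sm mult.commute)
      ultimately show ?thesis ..
    qed
    have "R (s + l) * (A s j * Sm (s + j) x * A s j) = (- 1 / q) \<star> (A s j * Sm (s + j) x * A s j)"
      if l: "0 < l" "l < m" for l
    proof (cases "l = j")
      case False
      then have "R (s + l) * A s j = (- 1 / q) \<star> A s j" using l al m by (auto simp: antiL_def)
      then show ?thesis by (simp flip: mult.assoc add: sm_mult_left)
    qed (use top in simp)
    moreover have "(A s j * Sm (s + j) x * A s j) * R (s + l) = (- 1 / q) \<star> (A s j * Sm (s + j) x * A s j)"
      if l: "0 < l" "l < m" for l
    proof (cases "l = j")
      case False
      then have "A s j * R (s + l) = (- 1 / q) \<star> A s j" using l ar m by (auto simp: antiR_def)
      then show ?thesis by (simp add: mult.assoc sm_mult_right)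
    qed (use top in simp)
    ultimately show ?thesis unfolding antiL_def antiR_def A
      by (simp add: sm_mult_left sm_mult_right sm_sm mult.commute)
  qed
qed

lemma A_A: assumes "i \<le> j" "j \<le> k" "s + j \<le> n"
  shows "A s i * A s j = A s j" "A s j * A s i = A s j"
proof -
  have "antiL s i (A s j)" "antiR s i (A s j)" using anti_A[of j s] assms by (auto simp: antiL_def antiR_def)
  then show "A s i * A s j = A s j" "A s j * A s i = A s j"
    using A_absorb_left A_absorb_right assms by auto
qed

text \<open>The constant \<open>c_j\<close> of the overview. The bracket is the result of enclosing
  \<open>Sm\<close> between two copies of the next \<open>K\<close>: the unit contributes a loop,
  the crossing a kink \<open>1 / \<mu>\<close>, and the \<open>K\<close> term 1. For
  \<open>j = 1\<close> it is just the loop value.\<close>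

definition kap :: "nat \<Rightarrow> complex" where
  "kap j = (let x = (1 / q) ^ (2 * (j - 1)) in q ^ (j - 1) / qnum q j *
     (eta' + (x - 1) / lam * (1 / \<mu>) + (x - 1) / (q * (1 / \<mu>) * x + 1)))"

text \<open>The two copies of the smaller antisymmetrizer in the recursion commute with
  \<open>K (s + j)\<close>, so only the factor \<open>Sm\<close> is caught between the two
  \<open>K (s + j)\<close>, where each of its three terms is known.\<close>

lemma K_A_K: assumes j: "0 < j" "j \<le> k" "s + j < n"
  shows "K (s + j) * A s j * K (s + j) = kap j \<star> (A s (j - 1) * K (s + j))"
proof (cases "j = 1")
  case True
  have "qnum q 1 = 1" unfolding qnum_def using q1 by simp
  then show ?thesis using True K_sq[of "s + 1"] j by (simp add: kap_def)
next
  case False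
  then obtain i where ji: "j = Suc i" and i: "0 < i" using j by (cases j) auto
  define x where "x = (1 / q) ^ (2 * i)"
  define c where "c = q ^ i / qnum q (i + 1)"
  have Aj: "A s j = c \<star> (A s i * Sm (s + i) x * A s i)" unfolding ji c_def x_def using i by (rule A_Suc)
  have cK: "K (s + j) * A s i = A s i * K (s + j)"
    using j ji by (intro A_comm far_KR) (auto simp: farr_def)
  have a: "adj (s + j) (s + i)" and b: "0 < s + j" using j ji i by (auto simp: adj_def)
  have S: "K (s + j) * Sm (s + i) x * K (s + j) =
     (eta' + (x - 1) / lam * (1 / \<mu>) + (x - 1) / (q * (1 / \<mu>) * x + 1)) \<star> K (s + j)"
    unfolding Sm_def using K_R_K[OF a] K_K_K[OF a] K_sq[OF b j(3)]
    by (simp add: distrib_left distrib_right sm_simps sm_add_left)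
  have "K (s + j) * (A s i * Sm (s + i) x * A s i) * K (s + j)
     = (K (s + j) * A s i) * Sm (s + i) x * (A s i * K (s + j))"
    by (simp add: mult.assoc)
  also have "\<dots> = (A s i * K (s + j)) * Sm (s + i) x * (K (s + j) * A s i)"
    by (simp only: cK)
  also have "\<dots> = A s i * (K (s + j) * Sm (s + i) x * K (s + j)) * A s i"
    by (simp only: mult.assoc)
  also have "\<dots> = (eta' + (x - 1) / lam * (1 / \<mu>) + (x - 1) / (q * (1 / \<mu>) * x + 1)) \<star> (A s i * (A s i * K (s + j)))"
    unfolding S using cK by (simp add: sm_simps mult.assoc)
  also have "A s i * (A s i * K (s + j)) = A s i * K (s + j)"
    using A_A(1)[of i i s] j ji by (simp flip: mult.assoc)
  finally have e: "K (s + j) * (A s i * Sm (s + i) x * A s i) * K (s + j) =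
    (eta' + (x - 1) / lam * (1 / \<mu>) + (x - 1) / (q * (1 / \<mu>) * x + 1)) \<star> (A s i * K (s + j))" .
  have "K (s + j) * A s j * K (s + j) = c \<star> (K (s + j) * (A s i * Sm (s + i) x * A s i) * K (s + j))"
    unfolding Aj by (simp only: sm_mult_left sm_mult_right)
  also have "\<dots> = kap j \<star> (A s (j - 1) * K (s + j))"
    unfolding e kap_def Let_def by (simp add: sm_sm ji x_def c_def)
  finally show ?thesis .
qed

section \<open>Nested cups\<close>

text \<open>In terms of Brauer diagrams, \<open>Wd i m\<close> joins the \<open>m\<close> adjacent arcs of \<open>E i m\<close> on one side to
  \<open>m\<close> nested arcs on the other, centred between the strands \<open>i + m\<close> and \<open>i + m + 1\<close>; \<open>Wu i m\<close> is
  its mirror image.\<close>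

fun rd :: "nat \<Rightarrow> nat \<Rightarrow> 'a" where
  "rd a 0 = K a" | "rd a (Suc l) = K (a + Suc l) * rd a l"

fun Wd :: "nat \<Rightarrow> nat \<Rightarrow> 'a" where
  "Wd i 0 = 1" | "Wd i (Suc m) = Wd i m * rd (i + m + 1) m"

fun ru :: "nat \<Rightarrow> nat \<Rightarrow> 'a" where
  "ru a 0 = K a" | "ru a (Suc l) = ru a l * K (a + Suc l)"

fun Wu :: "nat \<Rightarrow> nat \<Rightarrow> 'a" where
  "Wu i 0 = 1" | "Wu i (Suc m) = ru (i + m + 1) m * Wu i m"

fun E :: "nat \<Rightarrow> nat \<Rightarrow> 'a" where
  "E i 0 = 1" | "E i (Suc m) = E i m * K (i + 2 * m + 1)"

text \<open>The constant c of the overview, one factor \<open>kap\<close> for each bent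
  strand.\<close>

fun kaps :: "nat \<Rightarrow> nat \<Rightarrow> complex" where
  "kaps i 0 = 1" | "kaps i (Suc m) = kap (i + m + 1) * kaps i m"

lemma rd_comm: "(\<And>j. a \<le> j \<Longrightarrow> j \<le> a + l \<Longrightarrow> x * K j = K j * x) \<Longrightarrow> x * rd a l = rd a l * x"
  by (induction l) (auto intro!: comm_mult)

lemma ru_comm: "(\<And>j. a \<le> j \<Longrightarrow> j \<le> a + l \<Longrightarrow> x * K j = K j * x) \<Longrightarrow> x * ru a l = ru a l * x"
  by (induction l) (auto intro!: comm_mult)

lemma Wu_comm: "(\<And>j. i < j \<Longrightarrow> j < i + 2 * m \<Longrightarrow> x * K j = K j * x) \<Longrightarrow> x * Wu i m = Wu i m * x"
  by (induction m) (auto intro!: comm_mult ru_comm)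

text \<open>The innermost pair of \<open>K\<close> shortens the antisymmetrizer by
  \<open>K_A_K\<close>. The \<open>K p\<close> left behind is carried to the end of the staircase by
  the zigzag relation \<open>K_K_K\<close>.\<close>

lemma rd_A_ru: "0 < p \<Longrightarrow> p \<le> k \<Longrightarrow> p + l < n \<Longrightarrow>
   rd p l * A 0 p * ru p l = kap p \<star> (A 0 (p - 1) * K (p + l))"
proof (induction l)
  case 0
  then show ?case using K_A_K[of p 0] by simp
next
  case (Suc l)
  have c: "K (p + Suc l) * A 0 (p - 1) = A 0 (p - 1) * K (p + Suc l)"
    using Suc.prems by (intro A_comm far_KR) (auto simp: farr_def)
  have a: "adj (p + Suc l) (p + l)" using Suc.prems by (auto simp: adj_def)
  have "rd p (Suc l) * A 0 p * ru p (Suc l) = K (p + Suc l) * (rd p l * A 0 p * ru p l) * K (p + Suc l)"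
    by (simp add: mult.assoc)
  also have "\<dots> = kap p \<star> ((K (p + Suc l) * A 0 (p - 1)) * K (p + l) * K (p + Suc l))"
    using Suc by (simp add: sm_simps mult.assoc)
  also have "\<dots> = kap p \<star> (A 0 (p - 1) * K (p + Suc l))"
    unfolding c using K_K_K[OF a] by (simp add: mult.assoc)
  finally show ?case .
qed

text \<open>One strand is bent at a time, beginning with the outermost factor of
  \<open>Wd (Suc m)\<close> next to \<open>A\<close>. The \<open>K\<close> released by
  \<open>rd_A_ru\<close> lies beyond all generators of \<open>Wu i m\<close>, so it can be moved out
  and becomes the next factor of \<open>E\<close>.\<close>

lemma Wd_A_Wu: "i + m \<le> k \<Longrightarrow> i + 2 * m \<le> n \<Longrightarrow>
   Wd i m * A 0 (i + m) * Wu i m = kaps i m \<star> (A 0 i * E i m)"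
proof (induction m)
  case 0
  then show ?case by (simp add: sm_one)
next
  case (Suc m)
  let ?p = "i + m + 1"
  have c: "K (i + 2 * m + 1) * Wu i m = Wu i m * K (i + 2 * m + 1)"
    using Suc.prems by (intro Wu_comm far_KK) (auto simp: farr_def)
  have "Wd i (Suc m) * A 0 (i + Suc m) * Wu i (Suc m) = Wd i m * (rd ?p m * A 0 ?p * ru ?p m) * Wu i m"
    by (simp add: mult.assoc)
  also have "rd ?p m * A 0 ?p * ru ?p m = kap ?p \<star> (A 0 (?p - 1) * K (?p + m))"
    using Suc.prems by (intro rd_A_ru) auto
  also have "Wd i m * (kap ?p \<star> (A 0 (?p - 1) * K (?p + m))) * Wu i m
      = kap ?p \<star> ((Wd i m * A 0 (i + m)) * (K (i + 2 * m + 1) * Wu i m))"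
    by (simp add: sm_simps mult.assoc mult_2 add.assoc)
  also have "\<dots> = kap ?p \<star> ((Wd i m * A 0 (i + m) * Wu i m) * K (i + 2 * m + 1))"
    unfolding c by (simp add: mult.assoc)
  also have "\<dots> = kaps i (Suc m) \<star> (A 0 i * E i (Suc m))"
    using Suc by (simp add: sm_simps mult.assoc)
  finally show ?case .
qed

lemma ru_K: "0 < a \<Longrightarrow> a + l < n \<Longrightarrow> ru a l * K (a + l) = eta' \<star> ru a l"
  by (cases l) (auto simp: K_sq sm_simps mult.assoc)

text \<open>Each staircase \<open>ru\<close> ends with the very \<open>K\<close> that
  \<open>E\<close> multiplies on, so every factor of \<open>E\<close> closes one loop.\<close>

lemma Wu_E: "i + 2 * m \<le> n \<Longrightarrow> Wu i m * E i m = eta' ^ m \<star> Wu i m"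
proof (induction m)
  case 0
  then show ?case by (simp add: sm_one)
next
  case (Suc m)
  let ?p = "i + m + 1"
  have c: "K (i + 2 * m + 1) * Wu i m = Wu i m * K (i + 2 * m + 1)"
    using Suc.prems by (intro Wu_comm far_KK) (auto simp: farr_def)
  have "Wu i (Suc m) * E i (Suc m) = ru ?p m * (Wu i m * E i m) * K (i + 2 * m + 1)"
    by (simp add: mult.assoc)
  also have "\<dots> = eta' ^ m \<star> (ru ?p m * (Wu i m * K (i + 2 * m + 1)))"
    using Suc.prems Suc.IH by (simp add: sm_simps mult.assoc)
  also have "\<dots> = eta' ^ m \<star> ((ru ?p m * K (?p + m)) * Wu i m)"
    unfolding c[symmetric] by (simp add: mult.assoc mult_2 add.assoc)
  also have "ru ?p m * K (?p + m) = eta' \<star> ru ?p m"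
    using Suc.prems by (intro ru_K) auto
  finally show ?case by (simp add: sm_simps mult.commute)
qed

section \<open>Crossings sliding along nested arcs\<close>

lemma R_A_below: "0 < l \<Longrightarrow> l < j \<Longrightarrow> j \<le> k \<Longrightarrow> j \<le> n \<Longrightarrow> R l * A 0 j = (- 1 / q) \<star> A 0 j"
  using anti_A[of j 0] by (simp add: antiL_def)

lemma A_R_below: "0 < l \<Longrightarrow> l < j \<Longrightarrow> j \<le> k \<Longrightarrow> j \<le> n \<Longrightarrow> A 0 j * R l = (- 1 / q) \<star> A 0 j"
  using anti_A[of j 0] by (simp add: antiR_def)

lemma rd_head: "\<exists>Z. rd a l = K (a + l) * Z"
proof (cases l)
  case 0
  then show ?thesis by (intro exI[of _ 1]) simp
qed auto

lemma rd_tail: "\<exists>Z. rd a l = Z * K a"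
proof (induction l)
  case (Suc l)
  then obtain Z where "rd a l = Z * K a" by auto
  then have "rd a (Suc l) = (K (a + Suc l) * Z) * K a" by (simp add: mult.assoc)
  then show ?case by blast
qed (auto intro!: exI[of _ 1])

lemma rd_Suc_bottom: "rd a (Suc l) = rd (Suc a) l * K a"
  by (induction l) (simp_all add: mult.assoc)

text \<open>The staircase connects the strands above its lower arc straight through, displaced by
  two positions; a crossing of two such strands is displaced with them.\<close>

lemma rd_slide: "0 < a \<Longrightarrow> a + l < n \<Longrightarrow> a + 2 \<le> j \<Longrightarrow> j \<le> a + l \<Longrightarrow> rd a l * R j = R (j - 2) * rd a l"
proof (induction l)
  case (Suc l)
  show ?case
  proof (cases "j \<le> a + l")
    case True
    have "rd a (Suc l) * R j = (K (a + Suc l) * R (j - 2)) * rd a l"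
      using Suc True by (simp add: mult.assoc)
    also have "K (a + Suc l) * R (j - 2) = R (j - 2) * K (a + Suc l)"
      using Suc.prems True by (intro far_KR) (auto simp: farr_def)
    finally show ?thesis by (simp add: mult.assoc)
  next
    case False
    \<comment> \<open>The crossing now sits at the top of the staircase. It is rotated around the
      topmost arc into an inverse crossing one position lower and around the next arc back into a
      crossing two positions lower.\<close>
    then obtain l' where l': "l = Suc l'" using Suc.prems by (cases l) auto
    then have j: "j = Suc (Suc (a + l'))" using False Suc.prems by linarith
    let ?i = "a + l'"
    obtain Z where Z: "rd a l' = K ?i * Z" using rd_head[of a l'] by blast
    have adj: "adj (Suc ?i) ?i" "adj (Suc ?i) (Suc (Suc ?i))" using Suc.prems j by (auto simp: adj_def)
    have c: "R j * rd a l' = rd a l' * R j"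
      using Suc.prems j by (intro rd_comm far_RK) (auto simp: farr_def)
    have c2: "K j * R ?i = R ?i * K j" using Suc.prems j by (intro far_KR) (auto simp: farr_def)
    have "rd a (Suc l) * R j = (K j * K (Suc ?i) * R j) * rd a l'"
      using c by (simp add: l' j mult.assoc)
    also have "K j * K (Suc ?i) * R j = K j * Ri (Suc ?i)" using K_Ri_rot[OF adj(2)] j by simp
    also have "K j * Ri (Suc ?i) * rd a l' = K j * (Ri (Suc ?i) * K ?i) * Z" unfolding Z by (simp add: mult.assoc)
    also have "\<dots> = (K j * R ?i) * K (Suc ?i) * rd a l'" unfolding Ri_K_rot[OF adj(1)] Z by (simp add: mult.assoc)
    also have "\<dots> = R ?i * rd a (Suc l)" unfolding c2 by (simp add: l' j mult.assoc)
    finally show ?thesis using j by simp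
  qed
qed simp

text \<open>On two nested arcs, crossing the right feet is the same as crossing the left feet: both
  sides equal \<open>K (Suc p) * K (p - 1) * Ri p\<close>.\<close>

lemma nested_turn: assumes "1 < p" "Suc p < n"
  shows "K (Suc p) * K (p - 1) * K p * R (Suc p) = K (Suc p) * K (p - 1) * K p * R (p - 1)"
proof -
  have a: "adj p (Suc p)" "adj p (p - 1)" and f: "farr (Suc p) (p - 1)" using assms by (auto simp: adj_def farr_def)
  have "K (Suc p) * K (p - 1) * K p * R (Suc p) = K (p - 1) * (K (Suc p) * K p * R (Suc p))"
    using far_KK[OF f] by (simp add: mult.assoc)
  also have "\<dots> = (K (p - 1) * K (Suc p)) * Ri p" using K_Ri_rot[OF a(1)] by (simp add: mult.assoc)
  also have "\<dots> = K (Suc p) * (K (p - 1) * Ri p)"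
    using far_KK[OF f] by (simp flip: mult.assoc)
  also have "\<dots> = K (Suc p) * (K (p - 1) * K p * R (p - 1))" using K_Ri_rot[OF a(2)] by simp
  finally show ?thesis by (simp add: mult.assoc)
qed

text \<open>Reflection of a crossing in the centre of the nested arcs. The innermost case is
  \<open>nested_turn\<close>. Otherwise \<open>rd_slide\<close> moves the crossing into the smaller
  family of arcs, where it is reflected by induction, and its mirror image is far enough from
  \<open>rd\<close> to be moved back out.\<close>

lemma Wd_slide: "i + 2 * m \<le> n \<Longrightarrow> 0 < l \<Longrightarrow> l < m \<Longrightarrow> Wd i m * R (i + m + l) = Wd i m * R (i + m - l)"
proof (induction m arbitrary: l)
  case (Suc m)
  let ?p = "i + m + 1"
  show ?case
  proof (cases "l = 1")
    case True
    then obtain m' where m: "m = Suc m'" using Suc.prems by (cases m) auto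
    obtain Y where Y: "rd (?p - 1) m' = Y * K (?p - 1)" using rd_tail by blast
    obtain X where X: "rd (Suc ?p) m' = X * K (Suc ?p)" using rd_tail by blast
    have c: "K (?p - 1) * rd (Suc ?p) m' = rd (Suc ?p) m' * K (?p - 1)"
      using Suc.prems m by (intro rd_comm far_KK) (auto simp: farr_def)
    have "Wd i (Suc m) = Wd i m' * Y * (K (?p - 1) * rd (Suc ?p) m') * K ?p"
      using Y by (simp add: m mult.assoc rd_Suc_bottom del: rd.simps)
    also have "\<dots> = Wd i m' * Y * X * (K (Suc ?p) * K (?p - 1) * K ?p)"
      unfolding c unfolding X by (simp add: mult.assoc)
    finally have W: "Wd i (Suc m) = Wd i m' * Y * X * (K (Suc ?p) * K (?p - 1) * K ?p)" .
    have "i + Suc m + l = Suc ?p" "i + Suc m - l = ?p - 1" using True by auto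
    then show ?thesis unfolding W mult.assoc[of _ _ "R _"] using nested_turn[of ?p] Suc.prems m by (simp add: mult.assoc)
  next
    case False
    then obtain l' where l: "l = Suc l'" and l': "0 < l'" "l' < m" using Suc.prems by (cases l) auto
    have "Wd i (Suc m) * R (i + Suc m + l) = Wd i m * (rd ?p m * R (?p + l))"
      by (simp add: mult.assoc)
    also have "rd ?p m * R (?p + l) = R (?p + l - 2) * rd ?p m"
      using Suc.prems l' l by (intro rd_slide) auto
    also have "Wd i m * (R (?p + l - 2) * rd ?p m) = (Wd i m * R (i + m + l')) * rd ?p m"
      by (simp add: l mult.assoc)
    also have "\<dots> = Wd i m * (R (i + m - l') * rd ?p m)"
      using Suc.IH[of l'] Suc.prems l' by (simp add: mult.assoc)
    also have "R (i + m - l') * rd ?p m = rd ?p m * R (i + m - l')"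
      using Suc.prems l l' by (intro rd_comm far_RK) (auto simp: farr_def)
    finally show ?thesis by (simp add: l mult.assoc)
  qed
qed simp

text \<open>A crossing of the last \<open>m\<close> strands commutes with
  \<open>A 0 (i + m)\<close>, is reflected by the arcs into a crossing of the first
  \<open>i + m\<close> strands, and is absorbed there with eigenvalue \<open>-1/q\<close>. So the
  product is antisymmetric in the last strands as well.\<close>

lemma Wd_absorb: assumes "i + m \<le> k" "i + 2 * m \<le> n"
  shows "Wd i m * A 0 (i + m) * A (i + m) m = Wd i m * A 0 (i + m)"
proof (intro A_absorb_right)
  show "antiR (i + m) m (Wd i m * A 0 (i + m))"
    unfolding antiR_def
  proof (intro allI impI)
    fix l assume l: "0 < l" "l < m"
    have c: "R (i + m + l) * A 0 (i + m) = A 0 (i + m) * R (i + m + l)"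
      using l assms by (intro A_comm far_RR) (auto simp: farr_def)
    have r: "R (i + m - l) * A 0 (i + m) = (- 1 / q) \<star> A 0 (i + m)"
      using R_A_below[of "i + m - l" "i + m"] assms l by simp
    have "Wd i m * A 0 (i + m) * R (i + m + l) = (Wd i m * R (i + m + l)) * A 0 (i + m)"
      using c by (simp add: mult.assoc)
    also have "\<dots> = Wd i m * (R (i + m - l) * A 0 (i + m))"
      using Wd_slide[of i m l] assms l by (simp add: mult.assoc)
    also have "\<dots> = (- 1 / q) \<star> (Wd i m * A 0 (i + m))" unfolding r by (simp add: sm_mult_right)
    finally show "Wd i m * A 0 (i + m) * R (i + m + l) = (- 1 / q) \<star> (Wd i m * A 0 (i + m))" .
  qed
qed (use assms in auto)

section \<open>The mirror images of these slides, for \<open>ru\<close> and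
  \<open>Wu\<close>\<close>

lemma ru_head: "\<exists>Z. ru a l = Z * K (a + l)"
proof (cases l)
  case 0
  then show ?thesis by (intro exI[of _ 1]) simp
qed auto

lemma ru_tail: "\<exists>Z. ru a l = K a * Z"
proof (induction l)
  case (Suc l)
  then obtain Z where "ru a l = K a * Z" by auto
  then have "ru a (Suc l) = K a * (Z * K (a + Suc l))" by (simp add: mult.assoc)
  then show ?case by blast
qed (auto intro!: exI[of _ 1])

lemma ru_Suc_bottom: "ru a (Suc l) = K a * ru (Suc a) l"
  by (induction l) (simp_all flip: mult.assoc)

lemma ru_slide: "0 < a \<Longrightarrow> a + l < n \<Longrightarrow> a + 2 \<le> j \<Longrightarrow> j \<le> a + l \<Longrightarrow> R j * ru a l = ru a l * R (j - 2)"
proof (induction l)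
  case (Suc l)
  show ?case
  proof (cases "j \<le> a + l")
    case True
    have "R j * ru a (Suc l) = ru a l * (R (j - 2) * K (a + Suc l))"
      using Suc True by (simp flip: mult.assoc)
    also have "R (j - 2) * K (a + Suc l) = K (a + Suc l) * R (j - 2)"
      using Suc.prems True by (intro far_RK) (auto simp: farr_def)
    finally show ?thesis by (simp add: mult.assoc)
  next
    case False
    then obtain l' where l': "l = Suc l'" using Suc.prems by (cases l) auto
    then have j: "j = Suc (Suc (a + l'))" using False Suc.prems by linarith
    let ?i = "a + l'"
    obtain Z where Z: "ru a l' = Z * K ?i" using ru_head[of a l'] by blast
    have adj: "adj (Suc ?i) ?i" "adj (Suc ?i) (Suc (Suc ?i))" using Suc.prems j by (auto simp: adj_def)
    have c: "R j * ru a l' = ru a l' * R j"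
      using Suc.prems j by (intro ru_comm far_RK) (auto simp: farr_def)
    have c2: "K j * R ?i = R ?i * K j" using Suc.prems j by (intro far_KR) (auto simp: farr_def)
    have "R j * ru a (Suc l) = ru a l' * (R j * K (Suc ?i) * K j)"
      using c by (simp add: l' j flip: mult.assoc)
    also have "R j * K (Suc ?i) * K j = Ri (Suc ?i) * K j" using Ri_K_rot[OF adj(2)] j by simp
    also have "ru a l' * (Ri (Suc ?i) * K j) = Z * (K ?i * Ri (Suc ?i)) * K j" unfolding Z by (simp add: mult.assoc)
    also have "\<dots> = ru a l' * K (Suc ?i) * (R ?i * K j)" unfolding K_Ri_rot[OF adj(1)] Z by (simp add: mult.assoc)
    also have "\<dots> = ru a (Suc l) * R ?i" unfolding c2[symmetric] by (simp add: l' j mult.assoc)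
    finally show ?thesis using j by simp
  qed
qed simp

lemma nested_turn': assumes "1 < p" "Suc p < n"
  shows "R (Suc p) * (K p * K (p - 1) * K (Suc p)) = R (p - 1) * (K p * K (p - 1) * K (Suc p))"
proof -
  have a: "adj p (Suc p)" "adj p (p - 1)" and f: "farr (Suc p) (p - 1)" using assms by (auto simp: adj_def farr_def)
  have "R (Suc p) * (K p * K (p - 1) * K (Suc p)) = (R (Suc p) * K p * K (Suc p)) * K (p - 1)"
    using far_KK[OF f] by (simp add: mult.assoc)
  also have "\<dots> = Ri p * (K (Suc p) * K (p - 1))"
    unfolding Ri_K_rot[OF a(1), symmetric] by (simp add: mult.assoc)
  also have "\<dots> = (Ri p * K (p - 1)) * K (Suc p)"
    using far_KK[OF f] by (simp add: mult.assoc)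
  also have "\<dots> = (R (p - 1) * K p * K (p - 1)) * K (Suc p)"
    using Ri_K_rot[OF a(2)] by simp
  finally show ?thesis by (simp add: mult.assoc)
qed

lemma Wu_slide: "i + 2 * m \<le> n \<Longrightarrow> 0 < l \<Longrightarrow> l < m \<Longrightarrow> R (i + m + l) * Wu i m = R (i + m - l) * Wu i m"
proof (induction m arbitrary: l)
  case (Suc m)
  let ?p = "i + m + 1"
  show ?case
  proof (cases "l = 1")
    case True
    then obtain m' where m: "m = Suc m'" using Suc.prems by (cases m) auto
    obtain Y where Y: "ru (?p - 1) m' = K (?p - 1) * Y" using ru_tail by blast
    obtain X where X: "ru (Suc ?p) m' = K (Suc ?p) * X" using ru_tail by blast
    have c: "K (?p - 1) * ru (Suc ?p) m' = ru (Suc ?p) m' * K (?p - 1)"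
      using Suc.prems m by (intro ru_comm far_KK) (auto simp: farr_def)
    have "Wu i (Suc m) = K ?p * (ru (Suc ?p) m' * K (?p - 1)) * Y * Wu i m'"
      using Y by (simp add: m mult.assoc ru_Suc_bottom del: ru.simps)
    also have "\<dots> = (K ?p * K (?p - 1) * K (Suc ?p)) * (X * Y * Wu i m')"
      unfolding c[symmetric] unfolding X by (simp add: mult.assoc)
    finally have W: "Wu i (Suc m) = (K ?p * K (?p - 1) * K (Suc ?p)) * (X * Y * Wu i m')" .
    have "i + Suc m + l = Suc ?p" "i + Suc m - l = ?p - 1" using True by auto
    then show ?thesis unfolding W mult.assoc[of _ "_ * _ * _" "_ * _ * _", symmetric] using nested_turn'[of ?p] Suc.prems m by simp
  next
    case False
    then obtain l' where l: "l = Suc l'" and l': "0 < l'" "l' < m" using Suc.prems by (cases l) auto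
    have "R (i + Suc m + l) * Wu i (Suc m) = (R (?p + l) * ru ?p m) * Wu i m"
      by (simp add: mult.assoc)
    also have "R (?p + l) * ru ?p m = ru ?p m * R (?p + l - 2)"
      using Suc.prems l' l by (intro ru_slide) auto
    also have "ru ?p m * R (?p + l - 2) * Wu i m = ru ?p m * (R (i + m + l') * Wu i m)"
      by (simp add: l mult.assoc)
    also have "\<dots> = (ru ?p m * R (i + m - l')) * Wu i m"
      using Suc.IH[of l'] Suc.prems l' by (simp add: mult.assoc)
    also have "ru ?p m * R (i + m - l') = R (i + m - l') * ru ?p m"
      using Suc.prems l l' by (intro ru_comm[symmetric] far_RK) (auto simp: farr_def)
    finally show ?thesis by (simp add: l mult.assoc)
  qed
qed simp

lemma Wu_absorb: assumes "i + m \<le> k" "i + 2 * m \<le> n"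
  shows "A (i + m) m * (A 0 (i + m) * Wu i m) = A 0 (i + m) * Wu i m"
proof (intro A_absorb_left)
  show "antiL (i + m) m (A 0 (i + m) * Wu i m)"
    unfolding antiL_def
  proof (intro allI impI)
    fix l assume l: "0 < l" "l < m"
    have c: "R (i + m + l) * A 0 (i + m) = A 0 (i + m) * R (i + m + l)"
      using l assms by (intro A_comm far_RR) (auto simp: farr_def)
    have r: "A 0 (i + m) * R (i + m - l) = (- 1 / q) \<star> A 0 (i + m)"
      using A_R_below[of "i + m - l" "i + m"] assms l by simp
    have "R (i + m + l) * (A 0 (i + m) * Wu i m) = A 0 (i + m) * (R (i + m + l) * Wu i m)"
      using c by (simp flip: mult.assoc)
    also have "\<dots> = (A 0 (i + m) * R (i + m - l)) * Wu i m"
      using Wu_slide[of i m l] assms l by (simp add: mult.assoc)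
    also have "\<dots> = (- 1 / q) \<star> (A 0 (i + m) * Wu i m)" unfolding r by (simp add: sm_mult_left)
    finally show "R (i + m + l) * (A 0 (i + m) * Wu i m) = (- 1 / q) \<star> (A 0 (i + m) * Wu i m)" .
  qed
qed (use assms in auto)

end

section \<open>Kronecker products and operators on tensor powers\<close>

lemma sum_split_mult:
  fixes f :: "nat \<Rightarrow> 'a::comm_monoid_add"
  shows "(\<Sum>k<b * d. f k) = (\<Sum>k<b. \<Sum>l<d. f (k * d + l))"
proof -
  have "(\<Sum>k<b * d. f k) = (\<Sum>k<b. sum f {k * d..<k * d + d})" by (rule sum.nat_group[symmetric])
  also have "\<dots> = (\<Sum>k<b. \<Sum>l<d. f (k * d + l))"
  proof (rule sum.cong[OF refl])
    fix k
    show "sum f {k * d..<k * d + d} = (\<Sum>l<d. f (k * d + l))"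
      using sum.shift_bounds_nat_ivl[of f 0 "k * d" d] by (simp add: atLeast0LessThan add.commute)
  qed
  finally show ?thesis .
qed

lemma pair_index_less: "(k::nat) < b \<Longrightarrow> l < d \<Longrightarrow> k * d + l < b * d"
  using mult_le_mono1[of "Suc k" b d] by simp

lemma index_split: "(i::nat) < a * c \<Longrightarrow> i div c < a \<and> i mod c < c"
  by (metis less_mult_imp_div_less mod_less_divisor mult_0_right not_less_zero bot_nat_0.not_eq_extremum)

lemma index_mult_mat_sum:
  assumes "A \<in> carrier_mat m n" "B \<in> carrier_mat n p" "i < m" "j < p"
  shows "(A * B) $$ (i, j) = (\<Sum>k<n. A $$ (i, k) * B $$ (k, j))"
  using assms by (simp add: scalar_prod_def atLeast0LessThan)

lemma kron_carrier[simp]: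
  "A \<in> carrier_mat a b \<Longrightarrow> B \<in> carrier_mat c d \<Longrightarrow> kron A B \<in> carrier_mat (a * c) (b * d)"
  by (auto simp: kron_def)

lemma kron_dim[simp]: "dim_row (kron A B) = dim_row A * dim_row B" "dim_col (kron A B) = dim_col A * dim_col B"
  by (auto simp: kron_def)

lemma kron_index:
  assumes "A \<in> carrier_mat a b" "B \<in> carrier_mat c d" "i < a * c" "j < b * d"
  shows "kron A B $$ (i, j) = A $$ (i div c, j div d) * B $$ (i mod c, j mod d)"
  using assms by (auto simp: kron_def)

lemma kron_index_pair:
  assumes "A \<in> carrier_mat a b" "B \<in> carrier_mat c d" "i < a" "s < c" "j < b" "t < d"
  shows "kron A B $$ (i * c + s, j * d + t) = A $$ (i, j) * B $$ (s, t)"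
  using assms by (simp add: kron_index[OF assms(1,2)] pair_index_less)

lemma eq_mat_pairI:
  assumes "A \<in> carrier_mat (a * c) (b * d)" "B \<in> carrier_mat (a * c) (b * d)"
    and "\<And>i s j t. i < a \<Longrightarrow> s < c \<Longrightarrow> j < b \<Longrightarrow> t < d \<Longrightarrow> A $$ (i * c + s, j * d + t) = B $$ (i * c + s, j * d + t)"
  shows "A = B"
proof (rule eq_matI)
  fix x y assume "x < dim_row B" "y < dim_col B"
  then have x: "x < a * c" and y: "y < b * d" using assms(2) by auto
  show "A $$ (x, y) = B $$ (x, y)"
    using assms(3)[of "x div c" "x mod c" "y div d" "y mod d"] index_split[OF x] index_split[OF y] by simp
qed (use assms in auto)

lemma kron_assoc: "kron (kron A B) C = kron A (kron B (C :: 'a::semiring_1 mat))"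
proof -
  obtain a b c d e f where A: "A \<in> carrier_mat a b" and B: "B \<in> carrier_mat c d" and C: "C \<in> carrier_mat e f"
    by (metis carrier_matI)
  show ?thesis
  proof (rule eq_mat_pairI[where a = "a * c" and c = e and b = "b * d" and d = f])
    fix i s j t assume i: "i < a * c" and s: "s < e" and j: "j < b * d" and t: "t < f"
    note ii = index_split[OF i] and jj = index_split[OF j]
    have "kron (kron A B) C $$ (i * e + s, j * f + t) = A $$ (i div c, j div d) * B $$ (i mod c, j mod d) * C $$ (s, t)"
      using i j s t by (simp add: kron_index_pair[OF kron_carrier[OF A B] C] kron_index[OF A B])
    moreover have "i * e + s = (i div c) * (c * e) + ((i mod c) * e + s)" "j * f + t = (j div d) * (d * f) + ((j mod d) * f + t)"
      by (metis add.assoc add_mult_distrib div_mult_mod_eq mult.assoc)+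
    moreover have "kron A (kron B C) $$ ((i div c) * (c * e) + ((i mod c) * e + s), (j div d) * (d * f) + ((j mod d) * f + t))
       = A $$ (i div c, j div d) * (B $$ (i mod c, j mod d) * C $$ (s, t))"
      using ii jj s t by (simp add: kron_index_pair[OF A kron_carrier[OF B C]] kron_index_pair[OF B C] pair_index_less)
    ultimately show "kron (kron A B) C $$ (i * e + s, j * f + t) = kron A (kron B C) $$ (i * e + s, j * f + t)"
      by (simp only: mult.assoc)
  qed (use A B C in \<open>auto simp: mult.assoc\<close>)
qed

text \<open>Entries may be noncommutative, since operators over the free algebra occur later. The
  mixed product rule then needs the entries of \<open>B\<close> to pass those of
  \<open>C\<close>.\<close>

lemma kron_mult:
  fixes A :: "'a::semiring_1 mat"
  assumes A: "A \<in> carrier_mat a b" and B: "B \<in> carrier_mat c d"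
    and C: "C \<in> carrier_mat b e" and D: "D \<in> carrier_mat d f"
    and comm: "\<And>i j k l. i < c \<Longrightarrow> j < d \<Longrightarrow> k < b \<Longrightarrow> l < e \<Longrightarrow> B $$ (i, j) * C $$ (k, l) = C $$ (k, l) * B $$ (i, j)"
  shows "kron A B * kron C D = kron (A * C) (B * D)"
proof (rule eq_mat_pairI[where a = a and c = c and b = e and d = f])
  fix i s j t assume *: "i < a" "s < c" "j < e" "t < f"
  have "(kron A B * kron C D) $$ (i * c + s, j * f + t) =
     (\<Sum>k<b. \<Sum>l<d. kron A B $$ (i * c + s, k * d + l) * kron C D $$ (k * d + l, j * f + t))"
    using * by (simp add: index_mult_mat_sum[OF kron_carrier[OF A B] kron_carrier[OF C D]] pair_index_less sum_split_mult)
  also have "\<dots> = (\<Sum>k<b. \<Sum>l<d. (A $$ (i, k) * C $$ (k, j)) * (B $$ (s, l) * D $$ (l, t)))"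
  proof (intro sum.cong refl)
    fix k l assume kl: "k \<in> {..<b}" "l \<in> {..<d}"
    have "kron A B $$ (i * c + s, k * d + l) * kron C D $$ (k * d + l, j * f + t)
       = A $$ (i, k) * (B $$ (s, l) * C $$ (k, j)) * D $$ (l, t)"
      using * kl by (simp add: kron_index_pair[OF A B] kron_index_pair[OF C D] mult.assoc)
    then show "kron A B $$ (i * c + s, k * d + l) * kron C D $$ (k * d + l, j * f + t)
       = (A $$ (i, k) * C $$ (k, j)) * (B $$ (s, l) * D $$ (l, t))"
      using comm[of s l k j] * kl by (simp add: mult.assoc) (simp flip: mult.assoc)
  qed
  also have "\<dots> = (\<Sum>k<b. A $$ (i, k) * C $$ (k, j)) * (\<Sum>l<d. B $$ (s, l) * D $$ (l, t))"
    by (simp add: sum_product)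
  also have "\<dots> = kron (A * C) (B * D) $$ (i * c + s, j * f + t)"
    using * by (simp add: kron_index_pair[OF mult_carrier_mat[OF A C] mult_carrier_mat[OF B D]]
        index_mult_mat_sum[OF A C] index_mult_mat_sum[OF B D])
  finally show "(kron A B * kron C D) $$ (i * c + s, j * f + t) = kron (A * C) (B * D) $$ (i * c + s, j * f + t)" .
qed (use A B C D in auto)

lemma kron_mult_complex:
  fixes A :: "complex mat"
  assumes "A \<in> carrier_mat a b" "B \<in> carrier_mat c d" "C \<in> carrier_mat b e" "D \<in> carrier_mat d f"
  shows "kron A B * kron C D = kron (A * C) (B * D)"
  by (rule kron_mult[OF assms]) simp

lemma kron_one[simp]: "kron (1\<^sub>m a) (1\<^sub>m b) = (1\<^sub>m (a * b) :: 'a::semiring_1 mat)"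
proof (rule eq_mat_pairI[where a = a and c = b and b = a and d = b])
  fix i s j t assume *: "i < a" "s < b" "j < a" "t < b"
  have "i * b + s = j * b + t \<longleftrightarrow> i = j \<and> s = t"
    by (metis * add.commute div_mult_self3 div_less mod_less mod_mult_self3 add_cancel_right_left gr_implies_not0)
  then show "kron (1\<^sub>m a) (1\<^sub>m b) $$ (i * b + s, j * b + t) = (1\<^sub>m (a * b) :: 'a mat) $$ (i * b + s, j * b + t)"
    using * by (simp add: kron_index_pair[of _ a a _ b b] pair_index_less)
qed auto

lemma kron_one_right[simp]: "kron A (1\<^sub>m (Suc 0)) = (A :: 'a::semiring_1 mat)"
  by (rule eq_matI) (auto simp: kron_def)

lemma kron_one_left[simp]: "kron (1\<^sub>m (Suc 0)) A = (A :: 'a::semiring_1 mat)"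
  by (rule eq_matI) (auto simp: kron_def)

lemma kron_add_left:
  assumes "A \<in> carrier_mat a b" "B \<in> carrier_mat a b" "C \<in> carrier_mat c d"
  shows "kron (A + B) C = kron A C + kron B (C :: 'a::semiring_1 mat)"
  using assms by (intro eq_mat_pairI[where a = a and b = b and c = c and d = d])
     (auto simp: kron_index_pair[of _ a b _ c d] pair_index_less distrib_right)

lemma kron_add_right:
  assumes "A \<in> carrier_mat c d" "B \<in> carrier_mat c d" "C \<in> carrier_mat a b"
  shows "kron C (A + B) = kron C A + kron C (B :: 'a::semiring_1 mat)"
  using assms by (intro eq_mat_pairI[where a = a and b = b and c = c and d = d])
     (auto simp: kron_index_pair[of _ a b _ c d] pair_index_less distrib_left)

lemma kron_smult_left: "kron (c \<cdot>\<^sub>m A) B = c \<cdot>\<^sub>m kron A (B :: 'a::semiring_1 mat)"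
  by (rule eq_matI) (auto simp: kron_def mult.assoc index_split)

lemma kron_smult_right: "kron A (c \<cdot>\<^sub>m B) = c \<cdot>\<^sub>m kron A (B :: 'a::comm_semiring_1 mat)"
  by (rule eq_matI) (auto simp: kron_def ac_simps index_split)

text \<open>The side condition of \<open>kron_mult\<close>. It is automatic for complex matrices and
  whenever one of the two matrices is scalar or an identity, which covers all uses over the free
  algebra.\<close>

definition ecomm :: "'a::semiring_1 mat \<Rightarrow> 'a mat \<Rightarrow> bool" where
  "ecomm A B \<longleftrightarrow> (\<forall>i<dim_row A. \<forall>j<dim_col A. \<forall>k<dim_row B. \<forall>l<dim_col B.
     A $$ (i, j) * B $$ (k, l) = B $$ (k, l) * A $$ (i, j))"

lemma ecomm_sym: "ecomm A B \<Longrightarrow> ecomm B A"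
  by (auto simp: ecomm_def)

lemma ecomm_complex[simp]: "ecomm A (B :: complex mat)"
  by (auto simp: ecomm_def)

lemma ecomm_one[simp]: "ecomm (1\<^sub>m n) A" "ecomm A (1\<^sub>m n)"
  by (auto simp: ecomm_def)

lemma ecomm_kron_left: assumes "ecomm A C" "ecomm B C" shows "ecomm (kron A B) (C :: 'a::semiring_1 mat)"
proof -
  have "kron A B $$ (i, j) * C $$ (k, l) = C $$ (k, l) * kron A B $$ (i, j)"
    if *: "i < dim_row A * dim_row B" "j < dim_col A * dim_col B" "k < dim_row C" "l < dim_col C" for i j k l
  proof -
    define x where "x = A $$ (i div dim_row B, j div dim_col B)"
    define y where "y = B $$ (i mod dim_row B, j mod dim_col B)"
    have "x * C $$ (k, l) = C $$ (k, l) * x" "y * C $$ (k, l) = C $$ (k, l) * y"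
      using assms * index_split[OF *(1)] index_split[OF *(2)] unfolding ecomm_def x_def y_def by auto
    moreover have "kron A B $$ (i, j) = x * y" using * by (simp add: kron_def x_def y_def)
    ultimately show ?thesis by (metis mult.assoc)
  qed
  then show ?thesis by (simp add: ecomm_def)
qed

lemma ecomm_kron_right: "ecomm C A \<Longrightarrow> ecomm C B \<Longrightarrow> ecomm C (kron A B)"
  using ecomm_kron_left ecomm_sym by blast

lemma kron_mult_ecomm:
  fixes A :: "'a::semiring_1 mat"
  assumes "A \<in> carrier_mat a b" "B \<in> carrier_mat c d" "C \<in> carrier_mat b e" "D \<in> carrier_mat d f" "ecomm B C"
  shows "kron A B * kron C D = kron (A * C) (B * D)"
  using assms by (intro kron_mult[OF assms(1-4)]) (auto simp: ecomm_def)

lemma op_at_carrier[simp]: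
  assumes "X \<in> sq_mats (N ^ s)" "0 < m" "m + s \<le> Suc n"
  shows "op_at N n m s X \<in> sq_mats (N ^ n)"
proof -
  have "n = (m - 1) + (s + (Suc n - m - s))" using assms by auto
  then have "N ^ n = N ^ (m - 1) * (N ^ s * N ^ (Suc n - m - s))" by (metis power_add)
  then show ?thesis unfolding op_at_def using assms(1) by simp
qed

lemma op_at_mult:
  assumes "X \<in> sq_mats (N ^ s)" "Y \<in> sq_mats (N ^ s)"
  shows "op_at N n m s (X * Y :: 'a::semiring_1 mat) = op_at N n m s X * op_at N n m s Y"
proof -
  let ?a = "N ^ (m - 1)" and ?b = "N ^ s" and ?c = "N ^ (n + 1 - m - s)"
  have "kron X (1\<^sub>m ?c) * kron Y (1\<^sub>m ?c) = kron (X * Y) (1\<^sub>m ?c)"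
    using kron_mult_ecomm[of X ?b ?b "1\<^sub>m ?c" ?c ?c Y ?b "1\<^sub>m ?c" ?c] assms by simp
  moreover have "kron (1\<^sub>m ?a) (kron X (1\<^sub>m ?c)) * kron (1\<^sub>m ?a) (kron Y (1\<^sub>m ?c))
     = kron (1\<^sub>m ?a) (kron X (1\<^sub>m ?c) * kron Y (1\<^sub>m ?c))"
    using kron_mult_ecomm[of "1\<^sub>m ?a" ?a ?a "kron X (1\<^sub>m ?c)" "?b * ?c" "?b * ?c" "1\<^sub>m ?a" ?a "kron Y (1\<^sub>m ?c)" "?b * ?c"] assms by simp
  ultimately show ?thesis unfolding op_at_def by simp
qed

lemma op_at_add:
  assumes "X \<in> sq_mats (N ^ s)" "Y \<in> sq_mats (N ^ s)"
  shows "op_at N n m s (X + Y :: 'a::semiring_1 mat) = op_at N n m s X + op_at N n m s Y"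
proof -
  let ?a = "N ^ (m - 1)" and ?b = "N ^ s" and ?c = "N ^ (n + 1 - m - s)"
  show ?thesis unfolding op_at_def
    using kron_add_left[OF assms, of "1\<^sub>m ?c" ?c ?c]
      kron_add_right[of "kron X (1\<^sub>m ?c)" "?b * ?c" "?b * ?c" "kron Y (1\<^sub>m ?c)" "1\<^sub>m ?a" ?a ?a] assms by simp
qed

lemma op_at_smult: "op_at N n m s (c \<cdot>\<^sub>m X :: 'a::comm_semiring_1 mat) = c \<cdot>\<^sub>m op_at N n m s X"
  unfolding op_at_def by (simp add: kron_smult_left kron_smult_right)

lemma op_at_one[simp]:
  assumes "0 < m" "m + s \<le> Suc n"
  shows "op_at N n m s (1\<^sub>m (N ^ s) :: 'a::semiring_1 mat) = 1\<^sub>m (N ^ n)"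
proof -
  have "n = (m - 1) + (s + (Suc n - m - s))" using assms by auto
  then have "N ^ n = N ^ (m - 1) * (N ^ s * N ^ (Suc n - m - s))" by (metis power_add)
  then show ?thesis unfolding op_at_def by simp
qed

lemma op_at_op_at:
  assumes "X \<in> sq_mats (N ^ t)" "0 < m" "m + s \<le> Suc n" "0 < l" "l + t \<le> Suc s"
  shows "op_at N n m s (op_at N s l t X) = op_at N n (m + l - 1) t (X :: 'a::semiring_1 mat)"
proof -
  have e1: "m + l - 1 - 1 = (m - 1) + (l - 1)" and e2: "n + 1 - (m + l - 1) - t = (s + 1 - l - t) + (n + 1 - m - s)"
    using assms by auto
  show ?thesis unfolding op_at_def e1 e2 power_add kron_one[symmetric] kron_assoc ..
qed

lemma op_at_left: "X \<in> sq_mats (N ^ s) \<Longrightarrow> op_at N (s + r) 1 s X = kron X (1\<^sub>m (N ^ r) :: 'a::semiring_1 mat)"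
  by (simp add: op_at_def)

lemma op_at_right: "X \<in> sq_mats (N ^ s) \<Longrightarrow> op_at N (r + s) (Suc r) s X = kron (1\<^sub>m (N ^ r) :: 'a::semiring_1 mat) X"
  by (simp add: op_at_def)

lemma op_at_full[simp]: "op_at N s (Suc 0) s (X :: 'a::semiring_1 mat) = X"
  by (simp add: op_at_def)

lemma kron_op_at_left:
  assumes "X \<in> sq_mats (N ^ s)" "0 < m" "m + s \<le> Suc n"
  shows "kron (op_at N n m s X) (1\<^sub>m (N ^ r)) = op_at N (n + r) m s (X :: 'a::semiring_1 mat)"
  using op_at_op_at[of X N s 1 n "n + r" m] assms op_at_left[of "op_at N n m s X" N n r] by simp

lemma kron_op_at_right:
  assumes "X \<in> sq_mats (N ^ s)" "0 < m" "m + s \<le> Suc n"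
  shows "kron (1\<^sub>m (N ^ r)) (op_at N n m s X) = op_at N (r + n) (r + m) s (X :: 'a::semiring_1 mat)"
  using op_at_op_at[of X N s "Suc r" n "r + n" m] assms op_at_right[of "op_at N n m s X" N n r] by simp

text \<open>Cutting the tensor power before factor \<open>j\<close> puts \<open>X\<close> entirely
  into the left and \<open>Y\<close> entirely into the right part; both products are then the same
  Kronecker product.\<close>

lemma op_at_comm:
  assumes X: "X \<in> sq_mats (N ^ s)" and Y: "Y \<in> sq_mats (N ^ t)"
    and i: "0 < i" "i + s \<le> j" "j + t \<le> Suc n" and e: "ecomm X Y"
  shows "op_at N n i s X * op_at N n j t Y = op_at N n j t Y * op_at N n i s (X :: 'a::semiring_1 mat)"
proof -
  define r where "r = n - (j - 1)"
  have n: "n = (j - 1) + r" and j: "j = Suc (j - 1)" using i r_def by auto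
  let ?X = "op_at N (j - 1) i s X" and ?Y = "op_at N r 1 t Y" and ?a = "N ^ (j - 1)" and ?b = "N ^ r"
  have Xc: "?X \<in> sq_mats ?a" and Yc: "?Y \<in> sq_mats ?b" using X Y i n by auto
  have "op_at N n i s X = kron ?X (1\<^sub>m ?b)"
    using kron_op_at_left[OF X, of i "j - 1" r] i n by simp
  moreover have "op_at N n j t Y = kron (1\<^sub>m ?a) ?Y"
    using kron_op_at_right[OF Y, of 1 r "j - 1"] i n j by simp
  moreover have "ecomm ?X ?Y" unfolding op_at_def using e
    by (auto intro!: ecomm_kron_left ecomm_kron_right)
  then have "ecomm ?Y ?X" by (rule ecomm_sym)
  then have "kron (1\<^sub>m ?a) ?Y * kron ?X (1\<^sub>m ?b) = kron ?X ?Y"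
    using kron_mult_ecomm[of "1\<^sub>m ?a" ?a ?a ?Y ?b ?b ?X ?a "1\<^sub>m ?b" ?b] Xc Yc by simp
  moreover have "kron ?X (1\<^sub>m ?b) * kron (1\<^sub>m ?a) ?Y = kron ?X ?Y"
    using kron_mult_ecomm[of ?X ?a ?a "1\<^sub>m ?b" ?b ?b "1\<^sub>m ?a" ?a ?Y ?b] Xc Yc by simp
  ultimately show ?thesis by simp
qed

section \<open>Scalars and scalar matrices over the free algebra\<close>

lemma const_add: "const (a + b) = const a + const b"
  by (simp add: const_def single_add)

lemma const_mult: "const (a * b) = const a * const b"
  by (simp add: const_def mult_single)

lemma const_one[simp]: "const 1 = 1"
  by (simp add: const_def)

lemma const_zero[simp]: "const 0 = 0"
  by (simp add: const_def)

lemma poly_mapping_add_induct[case_names zero add]: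
  assumes "P (0 :: 'a \<Rightarrow>\<^sub>0 'b::monoid_add)"
    and "\<And>f a b. a \<notin> Poly_Mapping.keys f \<Longrightarrow> b \<noteq> 0 \<Longrightarrow> P f \<Longrightarrow> P (Poly_Mapping.single a b + f)"
  shows "P f"
proof (induction f rule: update_induct)
  case (update f a b)
  have "Poly_Mapping.update a b f = Poly_Mapping.single a b + f"
    using update(1) by (intro poly_mapping_eqI)
      (auto simp: lookup_update lookup_add lookup_single when_def in_keys_iff)
  then show ?case using assms(2)[OF update(1,2,3)] by simp
qed (rule assms(1))

lemma const_central: "const c * p = p * const c"
proof (induction p rule: poly_mapping_add_induct)
  case (add f a b)
  have "const c * Poly_Mapping.single a b = Poly_Mapping.single a b * const c"
    by (simp add: const_def mult_single mult.commute)
  then show ?case using add by (simp add: distrib_left distrib_right)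
qed simp

interpretation const_hom: semiring_hom const
  by unfold_locales (simp_all add: const_add const_mult)

lemma const_sum: "const (sum f S) = (\<Sum>x\<in>S. const (f x))"
  by (induction S rule: infinite_finite_induct) (simp_all add: const_add)

lemma cmat_carrier[simp]: "A \<in> carrier_mat a b \<Longrightarrow> cmat A \<in> carrier_mat a b"
  by (simp add: cmat_def)

lemma cmat_mult: "A \<in> carrier_mat a b \<Longrightarrow> B \<in> carrier_mat b c \<Longrightarrow> cmat (A * B) = cmat A * cmat B"
  unfolding cmat_def by (rule const_hom.mat_hom_mult)

lemma cmat_one[simp]: "cmat (1\<^sub>m n) = 1\<^sub>m n"
  unfolding cmat_def by (rule const_hom.mat_hom_one)

lemma cmat_add: "A \<in> carrier_mat a b \<Longrightarrow> B \<in> carrier_mat a b \<Longrightarrow> cmat (A + B) = cmat A + cmat B"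
  unfolding cmat_def by (auto simp: const_add)

lemma cmat_kron: "cmat (kron A B) = kron (cmat A) (cmat B)"
  unfolding cmat_def by (rule eq_matI) (auto simp: kron_def const_mult index_split)

lemma cmat_op_at: "cmat (op_at N n m s X) = op_at N n m s (cmat X)"
  by (simp add: op_at_def cmat_kron)

lemma cmat_index: "i < dim_row A \<Longrightarrow> j < dim_col A \<Longrightarrow> cmat A $$ (i, j) = const (A $$ (i, j))"
  by (simp add: cmat_def)

lemma cmat_dim[simp]: "dim_row (cmat A) = dim_row A" "dim_col (cmat A) = dim_col A"
  by (simp_all add: cmat_def)

lemma ecomm_cmat[simp]: "ecomm (cmat A) B" "ecomm B (cmat A)"
  by (auto simp: ecomm_def cmat_index const_central)

section \<open>Matrices as elements of one ring\<close>

text \<open>Linear maps on the space of all complex sequences. Matrices of a fixed size do not form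
  a type, whereas the BMW computations above need a type of class \<open>ring_1\<close>; this one
  receives square matrices of every positive size.\<close>

typedef linop = "{f :: (nat \<Rightarrow> complex) \<Rightarrow> nat \<Rightarrow> complex.
   (\<forall>x y. f (\<lambda>i. x i + y i) = (\<lambda>i. f x i + f y i)) \<and> (\<forall>c x. f (\<lambda>i. c * x i) = (\<lambda>i. c * f x i))}"
  by (rule exI[of _ "\<lambda>x. x"]) auto

setup_lifting type_definition_linop

instantiation linop :: ring_1
begin

lift_definition zero_linop :: linop is "\<lambda>x i. 0" by simp
lift_definition one_linop :: linop is "\<lambda>x. x" by simp
lift_definition plus_linop :: "linop \<Rightarrow> linop \<Rightarrow> linop" is "\<lambda>f g x i. f x i + g x i"
  by (auto simp: fun_eq_iff algebra_simps)
lift_definition minus_linop :: "linop \<Rightarrow> linop \<Rightarrow> linop" is "\<lambda>f g x i. f x i - g x i"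
  by (auto simp: fun_eq_iff algebra_simps)
lift_definition uminus_linop :: "linop \<Rightarrow> linop" is "\<lambda>f x i. - f x i"
  by (auto simp: fun_eq_iff)
lift_definition times_linop :: "linop \<Rightarrow> linop \<Rightarrow> linop" is "\<lambda>f g x. f (g x)"
  by auto

instance
proof
  show "(0 :: linop) \<noteq> 1"
    by transfer (auto simp: fun_eq_iff intro!: exI[of _ "\<lambda>_. 1"])
qed (transfer; auto simp: fun_eq_iff algebra_simps)+

end

lift_definition lin_scale :: "complex \<Rightarrow> linop \<Rightarrow> linop" is "\<lambda>c f x i. c * f x i"
  by (auto simp: fun_eq_iff algebra_simps)

interpretation linop: complex_algebra lin_scale
  by unfold_locales (transfer; auto simp: fun_eq_iff algebra_simps)+

text \<open>A matrix of size \<open>d\<close> acts on each of the consecutive blocks of \<open>d\<close> coordinates. This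
  represents square matrices of any fixed size \<open>d > 0\<close> in one and the same ring, with \<open>1\<^sub>m d\<close>
  acting as the identity.\<close>

lift_definition block_op :: "nat \<Rightarrow> complex mat \<Rightarrow> linop"
  is "\<lambda>d A x i. \<Sum>j<d. A $$ (i mod d, j) * x (i div d * d + j)"
  by (auto simp: fun_eq_iff algebra_simps sum.distrib sum_distrib_left)

context
  fixes d :: nat assumes d: "0 < d"
begin

lemma block_op_one: "block_op d (1\<^sub>m d) = 1"
proof (transfer fixing: d, intro ext)
  fix x :: "nat \<Rightarrow> complex" and i
  have "(\<Sum>j<d. 1\<^sub>m d $$ (i mod d, j) * x (i div d * d + j)) = (\<Sum>j<d. if j = i mod d then x (i div d * d + j) else 0)"
    using d by (intro sum.cong) auto
  then show "(\<Sum>j<d. 1\<^sub>m d $$ (i mod d, j) * x (i div d * d + j)) = x i" using d by simp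
qed

lemma block_op_mult:
  assumes A: "A \<in> sq_mats d" and B: "B \<in> sq_mats d"
  shows "block_op d (A * B) = block_op d A * block_op d B"
  using assms
proof (transfer fixing: d, intro ext)
  fix A B :: "complex mat" and x :: "nat \<Rightarrow> complex" and i
  assume A: "A \<in> sq_mats d" and B: "B \<in> sq_mats d"
  have "(\<Sum>j<d. (A * B) $$ (i mod d, j) * x (i div d * d + j))
      = (\<Sum>j<d. \<Sum>k<d. A $$ (i mod d, k) * (B $$ (k, j) * x (i div d * d + j)))"
    using d A B by (intro sum.cong refl) (simp add: scalar_prod_def atLeast0LessThan sum_distrib_right mult.assoc)
  also have "\<dots> = (\<Sum>k<d. \<Sum>j<d. A $$ (i mod d, k) * (B $$ (k, j) * x (i div d * d + j)))"
    by (rule sum.swap)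
  also have "\<dots> = (\<Sum>k<d. A $$ (i mod d, k) *
            (\<Sum>j<d. B $$ ((i div d * d + k) mod d, j) * x ((i div d * d + k) div d * d + j)))"
    using d by (intro sum.cong refl) (simp add: sum_distrib_left)
  finally show "(\<Sum>j<d. (A * B) $$ (i mod d, j) * x (i div d * d + j)) =
       (\<Sum>k<d. A $$ (i mod d, k) *
            (\<Sum>j<d. B $$ ((i div d * d + k) mod d, j) * x ((i div d * d + k) div d * d + j)))" .
qed

lemma block_op_add:
  assumes "A \<in> sq_mats d" "B \<in> sq_mats d"
  shows "block_op d (A + B) = block_op d A + block_op d B"
  using assms d by (transfer fixing: d) (auto simp: fun_eq_iff distrib_right sum.distrib)

lemma block_op_diff:
  assumes "A \<in> sq_mats d" "B \<in> sq_mats d"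
  shows "block_op d (A - B) = block_op d A - block_op d B"
  using assms d by (transfer fixing: d) (auto simp: fun_eq_iff left_diff_distrib sum_subtractf)

lemma block_op_smult:
  assumes "A \<in> sq_mats d"
  shows "block_op d (c \<cdot>\<^sub>m A) = lin_scale c (block_op d A)"
  using assms d by (transfer fixing: d) (auto simp: fun_eq_iff sum_distrib_left mult.assoc)

text \<open>Faithfulness, tested on the unit sequences of the first block. This is what allows
  identities proved in \<open>linop\<close> to be read back as identities of matrices.\<close>

lemma block_op_inject:
  assumes "A \<in> sq_mats d" "B \<in> sq_mats d"
  shows "block_op d A = block_op d B \<longleftrightarrow> A = B"
proof
  assume h: "block_op d A = block_op d B"
  have *: "(\<Sum>j<d. A $$ (i mod d, j) * x (i div d * d + j)) = (\<Sum>j<d. B $$ (i mod d, j) * x (i div d * d + j))" for x i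
    using arg_cong[OF h, of "\<lambda>f. Rep_linop f x i"] by (simp only: block_op.rep_eq)
  show "A = B"
  proof (rule eq_matI)
    fix i j assume "i < dim_row B" "j < dim_col B"
    then have ij: "i < d" "j < d" using assms by auto
    have "(\<Sum>l<d. M $$ (i, l) * (if l = j then 1 else 0)) = M $$ (i, j)" for M :: "complex mat"
    proof -
      have "(\<Sum>l<d. M $$ (i, l) * (if l = j then 1 else 0)) = (\<Sum>l<d. if l = j then M $$ (i, l) else 0)"
        by (intro sum.cong) auto
      then show ?thesis using ij by simp
    qed
    then show "A $$ (i, j) = B $$ (i, j)"
      using *[of i "\<lambda>l. if l = j then 1 else 0"] ij by simp
  qed (use assms in auto)
qed simp

end

section \<open>Scalars of type \<open>O(k)\<close>\<close>

text \<open>Were it equal to -1, then \<open>q ^ n = -1\<close> for \<open>n = \<bar>e\<bar>\<close>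
  too, hence \<open>q ^ n\<close> equals its own inverse and \<open>qnum q n = 0\<close>. This is
  excluded for \<open>2 \<le> n \<le> k\<close>; the cases \<open>n = 0\<close> and
  \<open>n = 1\<close> are excluded by the choice of \<open>q\<close>.\<close>

lemma powi_ne_minus_one:
  fixes q :: complex
  assumes q: "q \<noteq> 0" "q \<noteq> 1" "q \<noteq> -1" and nz: "\<And>i. 2 \<le> i \<Longrightarrow> i \<le> k \<Longrightarrow> qnum q i \<noteq> 0"
    and e: "\<bar>e\<bar> \<le> int k"
  shows "q powi e \<noteq> -1"
proof
  assume *: "q powi e = -1"
  define n where "n = nat \<bar>e\<bar>"
  have n: "n \<le> k" unfolding n_def using e by simp
  have qn: "q ^ n = -1"
  proof (cases "e \<ge> 0")
    case True
    then show ?thesis using * unfolding n_def by (simp add: power_int_def)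
  next
    case False
    then have "inverse q ^ n = -1" using * unfolding n_def by (simp add: power_int_def)
    then show ?thesis using q by (metis inverse_inverse_eq inverse_minus_eq inverse_1 power_inverse)
  qed
  have "n \<noteq> 0" by (rule notI) (use qn in simp)
  moreover have "n \<noteq> 1" by (rule notI) (use qn q(3) in simp)
  ultimately have "2 \<le> n" by simp
  moreover have "qnum q n = 0" unfolding qnum_def by (simp add: qn power_divide)
  ultimately show False using nz n by blast
qed

text \<open>With \<open>\<mu> = q^(1-k)\<close> the first summand is the power
  \<open>q powi (k - 2 * j)\<close>, whose exponent is at most \<open>k\<close> in absolute
  value.\<close>

lemma O_type_denominator:
  fixes q \<mu> :: complex
  assumes q: "q \<noteq> 0" "q \<noteq> 1" "q \<noteq> -1" and nz: "\<And>i. 2 \<le> i \<Longrightarrow> i \<le> k \<Longrightarrow> qnum q i \<noteq> 0"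
    and mu: "\<mu> = q powi (1 - int k)" and j: "j \<le> k"
  shows "q * (1 / \<mu>) * (1 / q) ^ (2 * j) + 1 \<noteq> 0"
proof -
  have "q * (1 / \<mu>) * (1 / q) ^ (2 * j) = q powi (int k - 2 * int j)"
  proof -
    have "int k - 2 * int j = 1 + - (1 - int k) + - int (2 * j)" by simp
    then have "q powi (int k - 2 * int j) = q powi 1 * q powi (- (1 - int k)) * q powi (- int (2 * j))"
      using q by (metis power_int_add)
    then show ?thesis unfolding mu using q
      by (simp add: power_int_minus power_int_of_nat inverse_eq_divide power_one_over
          del: minus_diff_eq of_nat_mult)
  qed
  moreover have "\<bar>int k - 2 * int j\<bar> \<le> int k" using j by simp
  ultimately show ?thesis using powi_ne_minus_one[where e = "int k - 2 * int j" and k = k, OF q nz]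
    by (simp add: eq_neg_iff_add_eq_0)
qed

text \<open>Over a common denominator the bracket has the numerator
  \<open>(x + q * \<mu>) * (q * q * x - \<mu> * \<mu>) / q\<close>. Vanishing of the first factor
  would mean \<open>q powi (k - 2 * j) = -1\<close>; vanishing of the second would mean
  \<open>q ^ (2 * (k - j + 1)) = 1\<close>, that is \<open>qnum q (k - j + 1) = 0\<close>.\<close>

lemma O_type_kap_nonzero:
  fixes q \<mu> :: complex
  assumes q: "q \<noteq> 0" "q \<noteq> 1" "q \<noteq> -1" and nz: "\<And>i. 2 \<le> i \<Longrightarrow> i \<le> k \<Longrightarrow> qnum q i \<noteq> 0"
    and mu: "\<mu> = q powi (1 - int k)" and j: "0 < j" "j \<le> k" and l0: "q - 1 / q \<noteq> 0"
  defines "x \<equiv> (1 / q) ^ (2 * (j - 1))"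
  shows "q ^ (j - 1) / qnum q j * (1 + (1 / \<mu> - \<mu>) / (q - 1 / q) + (x - 1) / (q - 1 / q) * (1 / \<mu>)
    + (x - 1) / (q * (1 / \<mu>) * x + 1)) \<noteq> 0"
proof -
  define L where "L = q - 1 / q"
  define X where "X = q * x + \<mu>"
  have L0: "L \<noteq> 0" using l0 L_def by simp
  have mu0: "\<mu> \<noteq> 0" using mu q by simp
  have xp: "x = q powi (2 - 2 * int j)"
  proof -
    have "2 - 2 * int j = - int (2 * (j - 1))" using j by (simp add: algebra_simps)
    then show ?thesis unfolding x_def using q by (simp add: power_int_minus power_int_of_nat inverse_eq_divide power_one_over del: of_nat_mult)
  qed
  have "q * (1 / \<mu>) * x + 1 \<noteq> 0" unfolding x_def using O_type_denominator[OF q nz mu] j by simp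
  moreover have d: "q * (1 / \<mu>) * x + 1 = X / \<mu>" unfolding X_def using mu0 by (simp add: field_simps)
  ultimately have X0: "X \<noteq> 0" by auto
  have qL: "q * L = q * q - 1" unfolding L_def using q by (simp add: field_simps)
  have "q * ((x + L * \<mu> - \<mu> * \<mu>) * X + (x - 1) * \<mu> * \<mu> * L)
    = q * x * X + (q * L) * \<mu> * X - q * \<mu> * \<mu> * X + (x - 1) * \<mu> * \<mu> * (q * L)" by (simp add: algebra_simps)
  also have "\<dots> = (x + q * \<mu>) * (q * q * x - \<mu> * \<mu>)" unfolding qL X_def by (simp add: algebra_simps)
  finally have key: "(x + L * \<mu> - \<mu> * \<mu>) * X + (x - 1) * \<mu> * \<mu> * L = (x + q * \<mu>) * (q * q * x - \<mu> * \<mu>) / q"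
    using q by (simp add: eq_divide_eq mult.commute)
  have "1 + (1 / \<mu> - \<mu>) / L + (x - 1) / L * (1 / \<mu>) + (x - 1) / (X / \<mu>)
     = ((x + L * \<mu> - \<mu> * \<mu>) * X + (x - 1) * \<mu> * \<mu> * L) / (\<mu> * L * X)"
    using X0 mu0 L0 by (simp add: field_simps)
  also have "\<dots> \<noteq> 0"
  proof -
    have "x + q * \<mu> \<noteq> 0"
    proof
      assume "x + q * \<mu> = 0"
      then have "x / (q * \<mu>) = -1" using q mu0 by (simp add: field_simps eq_neg_iff_add_eq_0)
      moreover have "q * \<mu> = q powi (2 - int k)" unfolding mu using q power_int_add[of q 1 "1 - int k"] by simp
      ultimately have "q powi (int k - 2 * int j) = -1" unfolding xp using q
        by (simp flip: power_int_diff)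
      then show False using powi_ne_minus_one[where e = "int k - 2 * int j" and k = k, OF q nz] j by simp
    qed
    moreover have "q * q * x - \<mu> * \<mu> \<noteq> 0"
    proof
      assume "q * q * x - \<mu> * \<mu> = 0"
      then have "q * q * x / (\<mu> * \<mu>) = 1" using mu0 by simp
      moreover have "q * q * x = q powi (4 - 2 * int j)" unfolding xp
        using q power_int_add[of q 2 "2 - 2 * int j"] by (simp add: power2_eq_square)
      moreover have "\<mu> * \<mu> = q powi (2 - 2 * int k)" unfolding mu using q
        by (simp flip: power_int_add)
      ultimately have "q powi (4 - 2 * int j) / q powi (2 - 2 * int k) = 1" by simp
      moreover have "q powi (4 - 2 * int j) / q powi (2 - 2 * int k) = q powi ((4 - 2 * int j) - (2 - 2 * int k))"
        using q by (intro power_int_diff[symmetric]) simp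
      moreover have "(4 - 2 * int j) - (2 - 2 * int k) = 2 * int k - 2 * int j + 2" by simp
      ultimately have "q powi (2 * int k - 2 * int j + 2) = 1" by simp
      moreover have "2 * int k - 2 * int j + 2 = int (2 * (k - j + 1))" using j by (simp add: algebra_simps)
      ultimately have "q ^ (2 * (k - j + 1)) = 1" by (metis power_int_of_nat)
      then have "q ^ (k - j + 1) * q ^ (k - j + 1) = 1" by (metis mult_2 power_add)
      then have "q ^ (k - j + 1) = (1 / q) ^ (k - j + 1)"
        by (simp add: power_one_over eq_divide_eq q)
      then have z: "qnum q (k - j + 1) = 0" unfolding qnum_def by simp
      have "qnum q 1 \<noteq> 0" unfolding qnum_def using l0 by simp
      then have "qnum q (k - j + 1) \<noteq> 0" using nz[of "k - j + 1"] j by (cases "k = j") auto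
      then show False using z by simp
    qed
    ultimately show ?thesis unfolding key using X0 mu0 L0 q by simp
  qed
  finally have s: "1 + (1 / \<mu> - \<mu>) / L + (x - 1) / L * (1 / \<mu>) + (x - 1) / (q * (1 / \<mu>) * x + 1) \<noteq> 0"
    unfolding d .
  have "qnum q 1 \<noteq> 0" unfolding qnum_def using l0 by simp
  then have "qnum q j \<noteq> 0" using nz[of j] j by (cases "j = 1") auto
  then show ?thesis using s q unfolding L_def by simp
qed

lemma minv_inverse:
  assumes "R \<in> sq_mats d" "invertible_mat R"
  shows "minv R \<in> sq_mats d" "R * minv R = 1\<^sub>m d" "minv R * R = 1\<^sub>m d"
proof -
  obtain B where B: "R * B = 1\<^sub>m d" "B * R = 1\<^sub>m (dim_row B)"
    using assms unfolding invertible_mat_def inverts_mat_def by auto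
  have "dim_col B = d" using B(1) by (metis index_mult_mat(3) index_one_mat(3))
  moreover have "dim_row B = d" using B(2) assms by (metis carrier_matD(2) index_mult_mat(3) index_one_mat(3))
  ultimately have Bc: "B \<in> sq_mats d" by auto
  have "R \<in> Units (ring_mat TYPE(complex) d ())"
    unfolding Units_def using assms(1) Bc B by (auto simp: ring_mat_simps intro!: bexI[of _ B])
  then obtain C where C: "mat_inverse R = Some C"
    using mat_inverse(1)[OF assms(1)] by fastforce
  note mat_inverse(2)[OF assms(1) C]
  then show "minv R \<in> sq_mats d" "R * minv R = 1\<^sub>m d" "minv R * R = 1\<^sub>m d"
    unfolding minv_def C by auto
qed

section \<open>R-matrices of BMW type\<close>

lemma sq_mult_carrier[simp]: "A \<in> sq_mats d \<Longrightarrow> B \<in> sq_mats d \<Longrightarrow> A * B \<in> sq_mats d"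
  by (rule mult_carrier_mat)

lemma op_at_mult3:
  assumes "X \<in> sq_mats (N ^ s)" "Y \<in> sq_mats (N ^ s)" "Z \<in> sq_mats (N ^ s)"
  shows "op_at N n m s (X * Y * Z :: 'a::semiring_1 mat) = op_at N n m s X * op_at N n m s Y * op_at N n m s Z"
  using op_at_mult[OF sq_mult_carrier[OF assms(1,2)] assms(3)] op_at_mult[OF assms(1,2)] by simp

lemma op3:
  assumes "0 < j" "Suc j < n" "X \<in> sq_mats (N ^ 2)"
  shows "op_at N n j 2 X = op_at N n j 3 (op_at N 3 1 2 X)"
    "op_at N n (Suc j) 2 X = op_at N n j 3 (op_at N 3 2 2 (X :: complex mat))"
  using assms op_at_op_at[of X N 2 j 3 n 1] op_at_op_at[of X N 2 j 3 n 2] by auto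

locale bmw_mat =
  fixes N :: nat and q \<mu> :: complex and R :: "complex mat"
  assumes q_ne: "q \<noteq> 0" "q \<noteq> 1" "q \<noteq> -1"
    and mu_ne: "\<mu> \<noteq> 0" "\<mu> \<noteq> q" "\<mu> \<noteq> - (1 / q)"
    and bmw: "BMW_type N q \<mu> R"
begin

abbreviation "Ri \<equiv> minv R"
abbreviation "Km \<equiv> K_mat N q \<mu> R"

lemma lam_ne: "q - 1 / q \<noteq> 0"
proof
  assume "q - 1 / q = 0"
  then have "(q - 1) * (q + 1) = 0" using q_ne by (simp add: field_simps)
  then show False using q_ne by (simp add: eq_neg_iff_add_eq_0)
qed

lemma eta_ne: "eta q \<mu> \<noteq> 0"
  using mu_ne lam_ne q_ne unfolding eta_def by (simp add: add_eq_0_iff)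

lemma eta_eq: "eta q \<mu> = 1 + (1 / \<mu> - \<mu>) / (q - 1 / q)"
proof -
  have "(q - \<mu>) * (1 / q + \<mu>) = 1 + (q - 1 / q) * \<mu> - \<mu> * \<mu>" using q_ne by (simp add: field_simps)
  then have "eta q \<mu> = (1 + (q - 1 / q) * \<mu> - \<mu> * \<mu>) / (\<mu> * (q - 1 / q))" unfolding eta_def by simp
  also have "\<dots> = ((q - 1 / q) + (1 / \<mu> - \<mu>)) / (q - 1 / q)"
  proof -
    have "1 + (q - 1 / q) * \<mu> - \<mu> * \<mu> = \<mu> * ((q - 1 / q) + (1 / \<mu> - \<mu>))"
      using mu_ne by (simp add: algebra_simps)
    then show ?thesis using mu_ne by simp
  qed
  finally show ?thesis using lam_ne by (simp add: add_divide_distrib)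
qed

lemma R_carrier[simp]: "R \<in> sq_mats (N ^ 2)"
  and R_inv: "invertible_mat R"
  using bmw unfolding BMW_type_def R_matrix_def by auto

lemma Ri_carrier[simp]: "Ri \<in> sq_mats (N ^ 2)"
  and R_Ri: "R * Ri = 1\<^sub>m (N ^ 2)" and Ri_R: "Ri * R = 1\<^sub>m (N ^ 2)"
  using minv_inverse[OF R_carrier R_inv] by auto

lemma K_carrier[simp]: "Km \<in> sq_mats (N ^ 2)"
  unfolding K_mat_def by (intro smult_carrier_mat sq_mult_carrier minus_carrier_mat add_carrier_mat R_carrier one_carrier_mat)

lemma min_poly: "is_min_poly (N ^ 2) R ([:- q, 1:] * [:1 / q, 1:] * [:- \<mu>, 1:])"
  using bmw unfolding BMW_type_def by auto

lemma quadratic_index: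
  assumes "i < N ^ 2" "j < N ^ 2"
  shows "Km $$ (i, j) = 1 / (\<mu> * (q - 1 / q)) * (1\<^sub>m (N ^ 2) $$ (i, j) + (q - 1 / q) * R $$ (i, j) - (R * R) $$ (i, j))"
proof -
  let ?I = "1\<^sub>m (N ^ 2) :: complex mat"
  have "(q \<cdot>\<^sub>m ?I - R) * ((1 / q) \<cdot>\<^sub>m ?I + R)
    = q \<cdot>\<^sub>m ?I * ((1 / q) \<cdot>\<^sub>m ?I + R) - R * ((1 / q) \<cdot>\<^sub>m ?I + R)"
    by (rule minus_mult_distrib_mat[of _ "N ^ 2" "N ^ 2" _ _ "N ^ 2"]) auto
  also have "q \<cdot>\<^sub>m ?I * ((1 / q) \<cdot>\<^sub>m ?I + R) = q \<cdot>\<^sub>m ((1 / q) \<cdot>\<^sub>m ?I + R)"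
    using mult_smult_assoc_mat[of ?I "N ^ 2" "N ^ 2" "(1 / q) \<cdot>\<^sub>m ?I + R" "N ^ 2" q]
      left_mult_one_mat[of "(1 / q) \<cdot>\<^sub>m ?I + R" "N ^ 2" "N ^ 2"] by simp
  also have "R * ((1 / q) \<cdot>\<^sub>m ?I + R) = (1 / q) \<cdot>\<^sub>m R + R * R"
    by (subst mult_add_distrib_mat[of _ "N ^ 2" "N ^ 2" _ "N ^ 2"]) (use mult_smult_distrib[OF R_carrier one_carrier_mat, of "1 / q"] R_carrier in simp_all)
  finally have e: "(q \<cdot>\<^sub>m ?I - R) * ((1 / q) \<cdot>\<^sub>m ?I + R) = q \<cdot>\<^sub>m ((1 / q) \<cdot>\<^sub>m ?I + R) - ((1 / q) \<cdot>\<^sub>m R + R * R)" .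
  note RD = carrier_matD[OF R_carrier]
  have "(q \<cdot>\<^sub>m ((1 / q) \<cdot>\<^sub>m ?I + R) - ((1 / q) \<cdot>\<^sub>m R + R * R)) $$ (i, j)
    = q * (1 / q * ?I $$ (i, j) + R $$ (i, j)) - (1 / q * R $$ (i, j) + (R * R) $$ (i, j))"
    using assms RD by (simp del: index_mult_mat(1) index_one_mat(1))
  also have "\<dots> = ?I $$ (i, j) + (q - 1 / q) * R $$ (i, j) - (R * R) $$ (i, j)"
    using q_ne by (simp add: algebra_simps del: index_mult_mat(1) index_one_mat(1))
  finally have f: "(q \<cdot>\<^sub>m ((1 / q) \<cdot>\<^sub>m ?I + R) - ((1 / q) \<cdot>\<^sub>m R + R * R)) $$ (i, j)
    = ?I $$ (i, j) + (q - 1 / q) * R $$ (i, j) - (R * R) $$ (i, j)" .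
  show ?thesis unfolding K_mat_def e f[symmetric] using assms RD by (intro index_smult_mat(1)) auto
qed

text \<open>If \<open>Km\<close> vanished, \<open>R\<close> would be a root of a quadratic
  polynomial, against the degree 3 of its minimal polynomial.\<close>

lemma K_nonzero: "Km \<noteq> 0\<^sub>m (N ^ 2) (N ^ 2)"
proof
  assume 0: "Km = 0\<^sub>m (N ^ 2) (N ^ 2)"
  define p :: "complex poly" where "p = [:- q, 1:] * [:1 / q, 1:]"
  have p: "p = [:-1, - (q - 1 / q), 1:]" unfolding p_def using q_ne by simp
  have "poly_mat (N ^ 2) p R = 0\<^sub>m (N ^ 2) (N ^ 2)"
  proof (rule eq_matI)
    fix i j assume "i < dim_row (0\<^sub>m (N ^ 2) (N ^ 2) :: complex mat)" "j < dim_col (0\<^sub>m (N ^ 2) (N ^ 2) :: complex mat)"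
    then have ij: "i < N ^ 2" "j < N ^ 2" by auto
    have "poly_mat (N ^ 2) p R $$ (i, j) = - (1\<^sub>m (N ^ 2) $$ (i, j) + (q - 1 / q) * R $$ (i, j) - (R * R) $$ (i, j))"
      unfolding poly_mat_def p using ij R_carrier
      by (simp add: numeral_2_eq_2 atMost_Suc del: index_mult_mat(1)) (simp add: algebra_simps)
    also have "\<dots> = 0" using quadratic_index[OF ij] 0 ij mu_ne lam_ne by (simp del: index_mult_mat(1))
    finally show "poly_mat (N ^ 2) p R $$ (i, j) = (0\<^sub>m (N ^ 2) (N ^ 2)) $$ (i, j)" using ij by simp
  qed (auto simp: poly_mat_def)
  moreover have "p \<noteq> 0" by (simp add: p)
  ultimately have "degree ([:- q, 1:] * [:1 / q, 1:] * [:- \<mu>, 1:]) \<le> degree p"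
    using min_poly unfolding is_min_poly_def by blast
  then show False by (simp add: p)
qed

text \<open>For \<open>N = 0\<close> every matrix of this size is the zero matrix, contradicting
  \<open>K_nonzero\<close>.\<close>

lemma N_pos: "0 < N"
proof (rule ccontr)
  assume "\<not> 0 < N"
  then have "Km = 0\<^sub>m (N ^ 2) (N ^ 2)" using K_carrier by (intro eq_matI) auto
  then show False using K_nonzero by simp
qed

lemma K_R: "Km * R = \<mu> \<cdot>\<^sub>m Km" and R_K: "R * Km = \<mu> \<cdot>\<^sub>m Km"
  and skein: "R - Ri = (q - 1 / q) \<cdot>\<^sub>m (1\<^sub>m (N ^ 2) - Km)"
proof -
  let ?d = "N ^ 2"
  have d: "0 < ?d" using N_pos by simp
  note bl = block_op_mult[OF d] block_op_add[OF d] block_op_diff[OF d] block_op_smult[OF d] block_op_one[OF d]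
  define r where "r = block_op ?d R"
  define s where "s = block_op ?d Ri"
  define k where "k = block_op ?d Km"
  define l where "l = q - 1 / q"
  have l0: "l \<noteq> 0" and l: "q - 1 / q = l" using lam_ne l_def by auto
  have rs: "r * s = 1" "s * r = 1" unfolding r_def s_def using R_Ri Ri_R
    by (simp_all add: bl(5) flip: bl(1))
  have K: "Km = (1 / (\<mu> * l)) \<cdot>\<^sub>m (1\<^sub>m ?d + l \<cdot>\<^sub>m R - R * R)"
  proof (rule eq_matI)
    fix i j assume "i < dim_row ((1 / (\<mu> * l)) \<cdot>\<^sub>m (1\<^sub>m ?d + l \<cdot>\<^sub>m R - R * R))"
      "j < dim_col ((1 / (\<mu> * l)) \<cdot>\<^sub>m (1\<^sub>m ?d + l \<cdot>\<^sub>m R - R * R))"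
    then have ij: "i < ?d" "j < ?d" using R_carrier by auto
    show "Km $$ (i, j) = ((1 / (\<mu> * l)) \<cdot>\<^sub>m (1\<^sub>m ?d + l \<cdot>\<^sub>m R - R * R)) $$ (i, j)"
      using quadratic_index[OF ij] ij carrier_matD[OF R_carrier] by (simp add: l del: index_mult_mat(1))
  qed (use carrier_matD[OF R_carrier] carrier_matD[OF K_carrier] in auto)
  have k: "k = lin_scale (1 / (\<mu> * l)) (1 + lin_scale l r - r * r)"
    unfolding k_def K r_def by (simp add: bl smult_carrier_mat minus_carrier_mat)
  \<comment> \<open>The minimal polynomial evaluated at \<open>R\<close> and solved for the cube,
    with \<open>l = q - 1 / q\<close>.\<close>
  have cub: "R * R * R = (q - 1 / q + \<mu>) \<cdot>\<^sub>m (R * R) + (1 - l * \<mu>) \<cdot>\<^sub>m R - \<mu> \<cdot>\<^sub>m 1\<^sub>m ?d"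
  proof (rule eq_matI)
    let ?p = "[:- q, 1:] * [:1 / q, 1:] * [:- \<mu>, 1:]"
    have p: "?p = [:\<mu>, l * \<mu> - 1, - (q - 1 / q + \<mu>), 1:]" unfolding l_def using q_ne by (simp add: algebra_simps)
    fix i j assume "i < dim_row ((q - 1 / q + \<mu>) \<cdot>\<^sub>m (R * R) + (1 - l * \<mu>) \<cdot>\<^sub>m R - \<mu> \<cdot>\<^sub>m 1\<^sub>m ?d)"
       "j < dim_col ((q - 1 / q + \<mu>) \<cdot>\<^sub>m (R * R) + (1 - l * \<mu>) \<cdot>\<^sub>m R - \<mu> \<cdot>\<^sub>m 1\<^sub>m ?d)"
    then have ij: "i < ?d" "j < ?d" by auto
    have "poly_mat ?d ?p R $$ (i, j) = 0" using min_poly ij unfolding is_min_poly_def by simp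
    then have "\<mu> * 1\<^sub>m ?d $$ (i, j) + (l * \<mu> - 1) * R $$ (i, j) - (q - 1 / q + \<mu>) * (R * R) $$ (i, j) + (R * R * R) $$ (i, j) = 0"
      unfolding poly_mat_def p using ij R_carrier
      by (simp add: numeral_3_eq_3 atMost_Suc assoc_mult_mat[OF R_carrier R_carrier R_carrier]
          del: index_mult_mat(1) index_one_mat(1)) (simp add: algebra_simps del: index_mult_mat(1) index_one_mat(1))
    moreover have "x = (q - 1 / q + \<mu>) * z + (1 - l * \<mu>) * y - \<mu> * a"
      if "\<mu> * a + (l * \<mu> - 1) * y - (q - 1 / q + \<mu>) * z + x = 0" for a x y z
    proof -
      have "x = x - (\<mu> * a + (l * \<mu> - 1) * y - (q - 1 / q + \<mu>) * z + x)" using that by simp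
      then show ?thesis by (simp add: algebra_simps)
    qed
    moreover have "((q - 1 / q + \<mu>) \<cdot>\<^sub>m (R * R) + (1 - l * \<mu>) \<cdot>\<^sub>m R - \<mu> \<cdot>\<^sub>m 1\<^sub>m ?d) $$ (i, j)
      = (q - 1 / q + \<mu>) * (R * R) $$ (i, j) + (1 - l * \<mu>) * R $$ (i, j) - \<mu> * 1\<^sub>m ?d $$ (i, j)"
      using ij carrier_matD[OF R_carrier] by (simp del: index_mult_mat(1) index_one_mat(1))
    ultimately show "(R * R * R) $$ (i, j) = ((q - 1 / q + \<mu>) \<cdot>\<^sub>m (R * R) + (1 - l * \<mu>) \<cdot>\<^sub>m R - \<mu> \<cdot>\<^sub>m 1\<^sub>m ?d) $$ (i, j)"
      by metis
  qed (use carrier_matD[OF R_carrier] in auto)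
  have c3: "r * r * r = lin_scale (l + \<mu>) (r * r) + lin_scale (1 - l * \<mu>) r - lin_scale \<mu> 1"
    using arg_cong[OF cub, of "block_op ?d"] unfolding r_def l by (simp add: bl)
  note sm = linop.sm_simps linop.sm_add_left linop.sm_diff_left
  have e1: "(1 + lin_scale l r - r * r) * r = lin_scale \<mu> (1 + lin_scale l r - r * r)"
    by (simp add: left_diff_distrib distrib_right c3 sm mult.commute)
  then have kr: "k * r = lin_scale \<mu> k" unfolding k linop.sm_mult_left by (simp add: sm mult.commute)
  have "r * (1 + lin_scale l r - r * r) = (1 + lin_scale l r - r * r) * r"
    by (simp add: algebra_simps sm)
  then have rk: "r * k = lin_scale \<mu> k" using kr unfolding k by (simp only: linop.sm_mult_left linop.sm_mult_right)
  \<comment> \<open>As \<open>k r = \<mu> k\<close>, also \<open>k = \<mu> (k s)\<close>. Writing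
    \<open>k\<close> on the right as a quadratic polynomial in \<open>r\<close> and cancelling
    \<open>s\<close> against one \<open>r\<close> gives the skein relation.\<close>
  have "k = (k * r) * s" using rs by (simp add: mult.assoc)
  also have "\<dots> = lin_scale \<mu> (k * s)" unfolding kr by (simp add: sm)
  also have "k * s = lin_scale (1 / (\<mu> * l)) (s + lin_scale l 1 - r)"
    unfolding k using rs by (simp add: sm left_diff_distrib distrib_right mult.assoc)
  finally have "lin_scale l k = s + lin_scale l 1 - r" using l0 mu_ne by (simp add: sm)
  then have sk: "r - s = lin_scale l (1 - k)" by (simp add: sm)
  show "Km * R = \<mu> \<cdot>\<^sub>m Km" using kr unfolding k_def r_def
    by (subst block_op_inject[OF d, symmetric, of _ "\<mu> \<cdot>\<^sub>m Km"]) (auto simp: bl intro: mult_carrier_mat[OF K_carrier R_carrier])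
  show "R * Km = \<mu> \<cdot>\<^sub>m Km" using rk unfolding k_def r_def
    by (subst block_op_inject[OF d, symmetric, of _ "\<mu> \<cdot>\<^sub>m Km"]) (auto simp: bl intro: mult_carrier_mat[OF R_carrier K_carrier])
  show "R - Ri = (q - 1 / q) \<cdot>\<^sub>m (1\<^sub>m ?d - Km)" using sk unfolding k_def r_def s_def l_def
    by (subst block_op_inject[OF d, symmetric, of _ "(q - 1 / q) \<cdot>\<^sub>m (1\<^sub>m ?d - Km)"]) (auto simp: bl minus_carrier_mat)
qed

abbreviation "Rn n j \<equiv> op_at N n j 2 R"
abbreviation "Rin n j \<equiv> op_at N n j 2 Ri"
abbreviation "Kn n j \<equiv> op_at N n j 2 Km"

lemma braid_n: assumes "0 < j" "Suc j < n"
  shows "Rn n j * Rn n (Suc j) * Rn n j = Rn n (Suc j) * Rn n j * Rn n (Suc j)"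
proof -
  have c: "op_at N 3 1 2 R \<in> sq_mats (N ^ 3)" "op_at N 3 2 2 R \<in> sq_mats (N ^ 3)" by auto
  have "op_at N 3 1 2 R * op_at N 3 2 2 R * op_at N 3 1 2 R = op_at N 3 2 2 R * op_at N 3 1 2 R * op_at N 3 2 2 R"
    using bmw unfolding BMW_type_def R_matrix_def by simp
  then show ?thesis unfolding op3[OF assms R_carrier]
    unfolding op_at_mult3[OF c(1,2,1), symmetric] op_at_mult3[OF c(2,1,2), symmetric] by simp
qed

lemma KK_n: assumes "0 < j" "Suc j < n"
  shows "Kn n (Suc j) * Kn n j = Rn n j * Rn n (Suc j) * Kn n j"
    "Kn n (Suc j) * Kn n j = Rin n j * Rin n (Suc j) * Kn n j"
    "Kn n j * Kn n (Suc j) * Kn n j = Kn n j"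
proof -
  have c: "op_at N 3 1 2 X \<in> sq_mats (N ^ 3)" "op_at N 3 2 2 X \<in> sq_mats (N ^ 3)"
    if "X \<in> sq_mats (N ^ 2)" for X :: "complex mat" using that by auto
  note cs = c[OF R_carrier] c[OF Ri_carrier] c[OF K_carrier]
  have b: "op_at N 3 2 2 Km * op_at N 3 1 2 Km = op_at N 3 1 2 R * op_at N 3 2 2 R * op_at N 3 1 2 Km"
    "op_at N 3 2 2 Km * op_at N 3 1 2 Km = op_at N 3 1 2 Ri * op_at N 3 2 2 Ri * op_at N 3 1 2 Km"
    "op_at N 3 1 2 Km * op_at N 3 2 2 Km * op_at N 3 1 2 Km = op_at N 3 1 2 Km"
    using bmw unfolding BMW_type_def Let_def by auto
  show "Kn n (Suc j) * Kn n j = Rn n j * Rn n (Suc j) * Kn n j"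
    unfolding op3[OF assms R_carrier] op3[OF assms K_carrier]
    unfolding op_at_mult3[OF cs(1,2,5), symmetric] op_at_mult[OF cs(6,5), symmetric] b(1) ..
  show "Kn n (Suc j) * Kn n j = Rin n j * Rin n (Suc j) * Kn n j"
    unfolding op3[OF assms Ri_carrier] op3[OF assms K_carrier]
    unfolding op_at_mult3[OF cs(3,4,5), symmetric] op_at_mult[OF cs(6,5), symmetric] b(2) ..
  show "Kn n j * Kn n (Suc j) * Kn n j = Kn n j"
    unfolding op3[OF assms K_carrier] unfolding op_at_mult3[OF cs(5,6,5), symmetric] b(3) ..
qed

lemma op_at_diff:
  assumes "X \<in> sq_mats (N ^ s)" "Y \<in> sq_mats (N ^ s)" "0 < m" "m + s \<le> Suc n"
  shows "op_at N n m s (X - Y :: complex mat) = op_at N n m s X - op_at N n m s Y"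
proof -
  have "X - Y = X + (-1) \<cdot>\<^sub>m Y" using assms by (intro eq_matI) auto
  moreover have "op_at N n m s X + (-1) \<cdot>\<^sub>m op_at N n m s Y = op_at N n m s X - op_at N n m s Y"
    using op_at_carrier[OF assms(1,3,4)] op_at_carrier[OF assms(2,3,4)] by (intro eq_matI) auto
  ultimately show ?thesis using assms by (simp add: op_at_add op_at_smult)
qed

text \<open>The relations on two or three factors, supplied by \<open>BMW_type\<close> and the
  lemmas above, are placed at position \<open>j\<close> by \<open>op_at\<close> and then mapped into
  \<open>linop\<close>. Distant generators commute because they act in disjoint factors.\<close>

lemma rep: "bmw_rep lin_scale n q \<mu> (\<lambda>j. block_op (N ^ n) (Rn n j)) (\<lambda>j. block_op (N ^ n) (Rin n j))
   (\<lambda>j. block_op (N ^ n) (Kn n j))"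
proof -
  have d: "0 < N ^ n" using N_pos by simp
  note bl = block_op_mult[OF d] block_op_add[OF d] block_op_diff[OF d] block_op_smult[OF d] block_op_one[OF d]
  have c: "op_at N n j 2 X \<in> sq_mats (N ^ n)"
    if "0 < j" "j < n" "X \<in> sq_mats (N ^ 2)" for j and X :: "complex mat" using that by auto
  note cs = c[OF _ _ R_carrier] c[OF _ _ Ri_carrier] c[OF _ _ K_carrier]
  have one: "op_at N n j 2 (1\<^sub>m (N ^ 2)) = (1\<^sub>m (N ^ n) :: complex mat)" if "0 < j" "j < n" for j
    using that by simp
  show ?thesis
  proof
    show "q \<noteq> 0" "q - 1 / q \<noteq> 0" "\<mu> \<noteq> 0" using q_ne lam_ne mu_ne by auto
    fix j :: nat assume j: "0 < j" "j < n"
    note cj = cs[OF j]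
    show "block_op (N ^ n) (Rn n j) * block_op (N ^ n) (Rin n j) = 1"
      using cj one[OF j] by (simp flip: bl(1,5) op_at_mult add: R_Ri)
    show "block_op (N ^ n) (Rin n j) * block_op (N ^ n) (Rn n j) = 1"
      using cj one[OF j] by (simp flip: bl(1,5) op_at_mult add: Ri_R)
    show "block_op (N ^ n) (Rn n j) - block_op (N ^ n) (Rin n j) = lin_scale (q - 1 / q) (1 - block_op (N ^ n) (Kn n j))"
      using arg_cong[OF skein, of "\<lambda>X. block_op (N ^ n) (op_at N n j 2 X)"] cj one[OF j] j
      by (simp add: bl op_at_diff op_at_smult minus_carrier_mat[OF cj(3)])
    show "block_op (N ^ n) (Rn n j) * block_op (N ^ n) (Kn n j) = lin_scale \<mu> (block_op (N ^ n) (Kn n j))"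
      using arg_cong[OF R_K, of "\<lambda>X. block_op (N ^ n) (op_at N n j 2 X)"] cj
      by (simp add: bl op_at_mult op_at_smult)
    show "block_op (N ^ n) (Kn n j) * block_op (N ^ n) (Rn n j) = lin_scale \<mu> (block_op (N ^ n) (Kn n j))"
      using arg_cong[OF K_R, of "\<lambda>X. block_op (N ^ n) (op_at N n j 2 X)"] cj
      by (simp add: bl op_at_mult op_at_smult)
  next
    fix j :: nat assume j: "0 < j" "Suc j < n"
    have j1: "j < n" "0 < Suc j" using j by auto
    note cj = cs[OF j(1) j1(1)] cs[OF j1(2) j(2)]
    show "block_op (N ^ n) (Rn n j) * block_op (N ^ n) (Rn n (Suc j)) * block_op (N ^ n) (Rn n j) =
      block_op (N ^ n) (Rn n (Suc j)) * block_op (N ^ n) (Rn n j) * block_op (N ^ n) (Rn n (Suc j))"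
      using arg_cong[OF braid_n[OF j], of "block_op (N ^ n)"] cj
      by (simp add: bl mult.assoc)
    show "block_op (N ^ n) (Kn n (Suc j)) * block_op (N ^ n) (Kn n j) =
        block_op (N ^ n) (Rn n j) * block_op (N ^ n) (Rn n (Suc j)) * block_op (N ^ n) (Kn n j)"
      using arg_cong[OF KK_n(1)[OF j], of "block_op (N ^ n)"] cj
      by (simp add: bl mult.assoc)
    show "block_op (N ^ n) (Kn n (Suc j)) * block_op (N ^ n) (Kn n j) =
        block_op (N ^ n) (Rin n j) * block_op (N ^ n) (Rin n (Suc j)) * block_op (N ^ n) (Kn n j)"
      using arg_cong[OF KK_n(2)[OF j], of "block_op (N ^ n)"] cj
      by (simp add: bl mult.assoc)
    show "block_op (N ^ n) (Kn n j) * block_op (N ^ n) (Kn n (Suc j)) * block_op (N ^ n) (Kn n j) = block_op (N ^ n) (Kn n j)"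
      using arg_cong[OF KK_n(3)[OF j], of "block_op (N ^ n)"] cj
      by (simp add: bl mult.assoc)
  next
    fix i j :: nat assume ij: "0 < i" "i + 2 \<le> j" "j < n"
    have "Rn n i * Rn n j = Rn n j * Rn n i" using ij by (intro op_at_comm) auto
    then show "block_op (N ^ n) (Rn n i) * block_op (N ^ n) (Rn n j) = block_op (N ^ n) (Rn n j) * block_op (N ^ n) (Rn n i)"
      using ij cs(1)[of i] cs(1)[of j] by (simp flip: bl(1))
  qed
qed

end

section \<open>Presented algebras and the braid representation\<close>

lemma free_algebra_carrier: "p \<in> carrier (free_algebra X) \<longleftrightarrow> (\<forall>w\<in>Poly_Mapping.keys p. set (letters w) \<subseteq> X)"
  by (simp add: free_algebra_def)

lemma free_algebra_simps[simp]:
  "mult (free_algebra X) = (*)" "one (free_algebra X) = 1" "zero (free_algebra X) = 0" "add (free_algebra X) = (+)"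
  by (simp_all add: free_algebra_def)

lemma free_add: "p \<in> carrier (free_algebra X) \<Longrightarrow> r \<in> carrier (free_algebra X) \<Longrightarrow> p + r \<in> carrier (free_algebra X)"
  using keys_add[of p r] unfolding free_algebra_carrier by blast

lemma letters_plus[simp]: "letters (u + v) = letters u @ letters v"
  by (simp add: plus_gword_def)

lemma letters_zero[simp]: "letters 0 = []"
  by (simp add: zero_gword_def)

lemma free_mult: "p \<in> carrier (free_algebra X) \<Longrightarrow> r \<in> carrier (free_algebra X) \<Longrightarrow> p * r \<in> carrier (free_algebra X)"
  using keys_mult[of p r] unfolding free_algebra_carrier by fastforce

lemma free_zero: "0 \<in> carrier (free_algebra X)"
  by (simp add: free_algebra_carrier)

lemma free_const: "const c \<in> carrier (free_algebra X)"
  by (simp add: free_algebra_carrier const_def)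

lemma free_one: "1 \<in> carrier (free_algebra X)"
  using free_const[of 1] by simp

lemma free_gen: "x \<in> X \<Longrightarrow> gen x \<in> carrier (free_algebra X)"
  by (simp add: free_algebra_carrier gen_def)

lemma free_uminus: "p \<in> carrier (free_algebra X) \<Longrightarrow> - p \<in> carrier (free_algebra X)"
  by (simp add: free_algebra_carrier)

lemma free_diff: "p \<in> carrier (free_algebra X) \<Longrightarrow> r \<in> carrier (free_algebra X) \<Longrightarrow> p - r \<in> carrier (free_algebra X)"
  using free_add[OF _ free_uminus] by fastforce

lemma free_sum: "(\<And>x. x \<in> S \<Longrightarrow> f x \<in> carrier (free_algebra X)) \<Longrightarrow> sum f S \<in> carrier (free_algebra X)"
  by (induction S rule: infinite_finite_induct) (auto intro: free_add free_zero)

lemmas free_closed = free_add free_mult free_zero free_const free_one free_gen free_uminus free_diff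

lemma ring_free_algebra: "ring (free_algebra X)"
proof (rule ringI)
  show "abelian_group (free_algebra X)"
    by (rule abelian_groupI) (auto simp: algebra_simps intro: free_closed bexI[of _ "- _"])
  show "monoid (free_algebra X)"
    by (rule monoidI) (auto simp: algebra_simps intro: free_closed)
qed (auto simp: algebra_simps)

lemma free_a_inv: assumes "p \<in> carrier (free_algebra X)" shows "\<ominus>\<^bsub>free_algebra X\<^esub> p = - p"
proof -
  interpret ring "free_algebra X" by (rule ring_free_algebra)
  show ?thesis using assms by (intro minus_equality) (auto intro: free_uminus)
qed

locale presented =
  fixes X :: "'x set" and S :: "'x ncpoly set"
  assumes rel: "S \<subseteq> carrier (free_algebra X)"
begin

abbreviation "FA \<equiv> free_algebra X"
abbreviation "PA \<equiv> presented_algebra X S"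
abbreviation "cl \<equiv> presented_class X S"
definition I where "I = Idl\<^bsub>FA\<^esub> S"

lemma ideal_I: "ideal I FA"
  unfolding I_def using ring.genideal_ideal[OF ring_free_algebra rel] .

lemma S_I: "S \<subseteq> I"
  unfolding I_def using ring.genideal_self[OF ring_free_algebra rel] .

lemma I_add: "p \<in> I \<Longrightarrow> r \<in> I \<Longrightarrow> p + r \<in> I"
  using additive_subgroup.a_closed[OF ideal.axioms(1)[OF ideal_I]] by simp

lemma I_zero: "0 \<in> I"
  using additive_subgroup.zero_closed[OF ideal.axioms(1)[OF ideal_I]] by simp

lemma I_mult_left: "p \<in> I \<Longrightarrow> r \<in> carrier FA \<Longrightarrow> r * p \<in> I"
  using ideal.I_l_closed[OF ideal_I] by simp

lemma I_mult_right: "p \<in> I \<Longrightarrow> r \<in> carrier FA \<Longrightarrow> p * r \<in> I"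
  using ideal.I_r_closed[OF ideal_I] by simp

lemma I_uminus: "p \<in> I \<Longrightarrow> - p \<in> I"
  using I_mult_left[of p "- 1"] free_uminus[OF free_one[of X]] by simp

lemma I_diff: "p \<in> I \<Longrightarrow> r \<in> I \<Longrightarrow> p - r \<in> I"
  using I_add[OF _ I_uminus] by fastforce

lemma I_sum: "(\<And>x. x \<in> T \<Longrightarrow> f x \<in> I) \<Longrightarrow> sum f T \<in> I"
  by (induction T rule: infinite_finite_induct) (auto intro: I_add I_zero)

lemma cl_eq: "cl p = {h + p | h. h \<in> I}"
  unfolding presented_class_def I_def[symmetric] a_r_coset_def' by auto

lemma cl_iff: assumes "p \<in> carrier FA" "r \<in> carrier FA" shows "cl p = cl r \<longleftrightarrow> p - r \<in> I"
proof
  assume "cl p = cl r"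
  then have "p \<in> cl r" unfolding cl_eq using I_zero by force
  then show "p - r \<in> I" unfolding cl_eq by auto
next
  assume a: "p - r \<in> I"
  show "cl p = cl r" unfolding cl_eq
  proof safe
    fix h assume "h \<in> I"
    then have "h + p = (h + (p - r)) + r" "h + (p - r) \<in> I" using a by (auto intro: I_add)
    then show "\<exists>h'. h + p = h' + r \<and> h' \<in> I" by blast
  next
    fix h assume "h \<in> I"
    then have "h + r = (h - (p - r)) + p" "h - (p - r) \<in> I" using a by (auto intro: I_diff)
    then show "\<exists>h'. h + r = h' + p \<and> h' \<in> I" by blast
  qed
qed

lemma PA_eq: "PA = FA Quot I"
  by (simp add: presented_algebra_def I_def)

lemma cl_coset: "cl p = I +>\<^bsub>FA\<^esub> p"
  by (simp add: presented_class_def I_def)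

lemma cl_mult: "p \<in> carrier FA \<Longrightarrow> r \<in> carrier FA \<Longrightarrow> cl p \<otimes>\<^bsub>PA\<^esub> cl r = cl (p * r)"
  unfolding PA_eq cl_coset using ideal.rcoset_mult_add[OF ideal_I, of p r] by (simp add: FactRing_def)

lemma cl_add: "p \<in> carrier FA \<Longrightarrow> r \<in> carrier FA \<Longrightarrow> cl p \<oplus>\<^bsub>PA\<^esub> cl r = cl (p + r)"
  unfolding PA_eq cl_coset using ideal.a_rcos_sum[OF ideal_I, of p r] by (simp add: FactRing_def)

lemma cl_one: "\<one>\<^bsub>PA\<^esub> = cl 1"
  unfolding PA_eq cl_coset by (simp add: FactRing_def)

lemma ring_PA: "ring PA"
  unfolding PA_eq using ideal.quotient_is_ring[OF ideal_I] .

lemma cl_carrier: "p \<in> carrier FA \<Longrightarrow> cl p \<in> carrier PA"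
  unfolding PA_eq cl_coset by (auto simp: FactRing_def A_RCOSETS_def')

lemma cl_uminus: assumes "p \<in> carrier FA" shows "\<ominus>\<^bsub>PA\<^esub> cl p = cl (- p)"
proof -
  interpret PA: ring PA by (rule ring_PA)
  have "cl (- p) \<oplus>\<^bsub>PA\<^esub> cl p = cl 0" using cl_add[OF free_uminus[OF assms] assms] by simp
  moreover have "cl 0 = \<zero>\<^bsub>PA\<^esub>" unfolding PA_eq cl_eq by (auto simp: FactRing_def)
  ultimately show ?thesis using assms by (intro PA.minus_equality) (auto intro: cl_carrier free_uminus)
qed

lemma cl_minus: "p \<in> carrier FA \<Longrightarrow> r \<in> carrier FA \<Longrightarrow> cl p \<ominus>\<^bsub>PA\<^esub> cl r = cl (p - r)"
  by (simp add: a_minus_def cl_uminus cl_add free_uminus)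

lemma cl_pow: "p \<in> carrier FA \<Longrightarrow> cl p [^]\<^bsub>PA\<^esub> (n::nat) = cl (p ^ n) \<and> p ^ n \<in> carrier FA"
proof (induction n)
  case 0
  interpret PA: ring PA by (rule ring_PA)
  show ?case by (simp add: cl_one free_one)
next
  case (Suc n)
  interpret PA: ring PA by (rule ring_PA)
  show ?case using Suc by (simp add: cl_mult power_commutes[symmetric] free_mult power_Suc2 del: power_Suc)
qed

text \<open>The carrier elements with property \<open>P\<close> form an ideal that contains
  \<open>S\<close>, hence the generated one; closure under negation comes from multiplication by
  \<open>- 1\<close>.\<close>

lemma I_induct:
  assumes "\<And>s. s \<in> S \<Longrightarrow> P s" and "P 0"
    and "\<And>p r. P p \<Longrightarrow> P r \<Longrightarrow> p \<in> carrier FA \<Longrightarrow> r \<in> carrier FA \<Longrightarrow> P (p + r)"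
    and "\<And>p r. P p \<Longrightarrow> p \<in> carrier FA \<Longrightarrow> r \<in> carrier FA \<Longrightarrow> P (r * p)"
    and "\<And>p r. P p \<Longrightarrow> p \<in> carrier FA \<Longrightarrow> r \<in> carrier FA \<Longrightarrow> P (p * r)"
    and "p \<in> I"
  shows "P p"
proof -
  let ?J = "{p \<in> carrier FA. P p}"
  have "ideal ?J FA"
  proof (rule idealI[OF ring_free_algebra])
    have inv: "P (- p)" if "P p" "p \<in> carrier FA" for p
      using assms(4)[OF that, of "- 1"] free_uminus[OF free_one[of X]] by simp
    interpret ring FA by (rule ring_free_algebra)
    show "subgroup ?J (add_monoid FA)"
    proof
      fix p assume p: "p \<in> ?J"
      have "inv\<^bsub>add_monoid FA\<^esub> p = - p" using free_a_inv[of p X] p unfolding a_inv_def by auto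
      then show "inv\<^bsub>add_monoid FA\<^esub> p \<in> ?J" using p inv by (auto intro: free_uminus)
    qed (auto simp: assms(2) intro: assms(3) free_closed)
  qed (auto intro: free_closed assms(4,5))
  then have "I \<subseteq> ?J" unfolding I_def
    using rel assms(1) by (intro ring.genideal_minimal[OF ring_free_algebra]) auto
  then show ?thesis using assms(6) by auto
qed

end

lemma ncpoly_expand:
  fixes p :: "'x ncpoly"
  assumes "finite W" "Poly_Mapping.keys p \<subseteq> W"
  shows "(\<Sum>w\<in>Poly_Mapping.keys p. Poly_Mapping.lookup p w * f w) = (\<Sum>w\<in>W. Poly_Mapping.lookup p w * f w)"
  using assms by (intro sum.mono_neutral_left) (auto simp: in_keys_iff)

lemma mprod_carrier: "(\<And>M. M \<in> set Ms \<Longrightarrow> M \<in> sq_mats d) \<Longrightarrow> mprod d Ms \<in> sq_mats d"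
  by (induction Ms) (auto simp: mprod_def)

lemma mprod_append: "(\<And>M. M \<in> set Ms \<union> set Ls \<Longrightarrow> M \<in> sq_mats d) \<Longrightarrow> mprod d (Ms @ Ls) = mprod d Ms * mprod d Ls"
proof (induction Ms)
  case Nil
  have "mprod d Ls \<in> sq_mats d" using Nil by (intro mprod_carrier) auto
  then show ?case by (simp add: mprod_def)
next
  case (Cons M Ms)
  have "mprod d Ls \<in> sq_mats d" "mprod d Ms \<in> sq_mats d" "M \<in> sq_mats d"
    using Cons.prems by (auto intro!: mprod_carrier)
  then show ?case using Cons assoc_mult_mat[of M d d "mprod d Ms" d "mprod d Ls" d] by (simp add: mprod_def)
qed

lemma smult_smult_mat: "a \<cdot>\<^sub>m (b \<cdot>\<^sub>m A) = (a * b :: 'a::semigroup_mult) \<cdot>\<^sub>m A"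
  by (intro eq_matI) (auto simp: mult.assoc)

lemma keys_single_plus:
  fixes f :: "'a \<Rightarrow>\<^sub>0 'b::monoid_add"
  shows "a \<notin> Poly_Mapping.keys f \<Longrightarrow> b \<noteq> 0 \<Longrightarrow>
    Poly_Mapping.keys (Poly_Mapping.single a b + f) = insert a (Poly_Mapping.keys f)"
  by (auto simp: in_keys_iff lookup_add lookup_single when_def split: if_splits)

section \<open>The braid representation on words and on classes of words\<close>

context bmw_mat begin

definition wordm where "wordm n w = mprod (N ^ n) (map (rho_gen N R n) (letters w))"

lemma rho_gen_carrier: "x \<in> braid_gens n \<Longrightarrow> rho_gen N R n x \<in> sq_mats (N ^ n)"
  unfolding braid_gens_def by auto

lemma wordm_carrier: "set (letters w) \<subseteq> braid_gens n \<Longrightarrow> wordm n w \<in> sq_mats (N ^ n)"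
  unfolding wordm_def by (intro mprod_carrier) (auto intro!: rho_gen_carrier)

lemma wordm_plus: "set (letters u) \<subseteq> braid_gens n \<Longrightarrow> set (letters v) \<subseteq> braid_gens n \<Longrightarrow> wordm n (u + v) = wordm n u * wordm n v"
  unfolding wordm_def letters_plus map_append by (intro mprod_append) (auto intro!: rho_gen_carrier)

lemma rho_poly_carrier[simp]: "rho_poly N R n p \<in> sq_mats (N ^ n)"
  by (simp add: rho_poly_def)

lemma rho_poly_index: "i < N ^ n \<Longrightarrow> j < N ^ n \<Longrightarrow> finite W \<Longrightarrow> Poly_Mapping.keys p \<subseteq> W \<Longrightarrow>
  rho_poly N R n p $$ (i, j) = (\<Sum>w\<in>W. Poly_Mapping.lookup p w * wordm n w $$ (i, j))"
  unfolding rho_poly_def by (simp add: ncpoly_expand wordm_def)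

lemma rho_poly_add: "rho_poly N R n (p + r) = rho_poly N R n p + rho_poly N R n r"
proof (rule eq_matI)
  let ?W = "Poly_Mapping.keys p \<union> Poly_Mapping.keys r"
  fix i j assume "i < dim_row (rho_poly N R n p + rho_poly N R n r)" "j < dim_col (rho_poly N R n p + rho_poly N R n r)"
  then have ij: "i < N ^ n" "j < N ^ n" by (auto simp: rho_poly_def)
  have "rho_poly N R n (p + r) $$ (i, j) = rho_poly N R n p $$ (i, j) + rho_poly N R n r $$ (i, j)"
    using ij keys_add[of p r] by (simp add: rho_poly_index[where W = ?W] lookup_add distrib_right sum.distrib)
  then show "rho_poly N R n (p + r) $$ (i, j) = (rho_poly N R n p + rho_poly N R n r) $$ (i, j)"
    using ij by (simp add: rho_poly_def)
qed (auto simp: rho_poly_def)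

lemma rho_poly_single: "set (letters w) \<subseteq> braid_gens n \<Longrightarrow> rho_poly N R n (Poly_Mapping.single w c) = c \<cdot>\<^sub>m wordm n w"
  using carrier_matD[OF wordm_carrier[of w n]]
  by (intro eq_matI) (auto simp: rho_poly_index[where W = "{w}"] carrier_matD[OF rho_poly_carrier])

lemma rho_poly_zero: "rho_poly N R n 0 = 0\<^sub>m (N ^ n) (N ^ n)"
  by (intro eq_matI) (auto simp: rho_poly_def)

lemma rho_poly_mult:
  assumes "p \<in> carrier (free_algebra (braid_gens n))" "r \<in> carrier (free_algebra (braid_gens n))"
  shows "rho_poly N R n (p * r) = rho_poly N R n p * rho_poly N R n r"
  using assms
proof (induction p rule: poly_mapping_add_induct)
  case zero
  then show ?case by (simp add: rho_poly_zero left_mult_zero_mat[OF rho_poly_carrier])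
next
  case (add f u c)
  have ku: "Poly_Mapping.keys (Poly_Mapping.single u c + f) = insert u (Poly_Mapping.keys f)"
    using add(1,2) by (rule keys_single_plus)
  then have u: "set (letters u) \<subseteq> braid_gens n" and f: "f \<in> carrier (free_algebra (braid_gens n))"
    using add(4) unfolding free_algebra_carrier by auto
  have s: "rho_poly N R n (Poly_Mapping.single u c * r) = rho_poly N R n (Poly_Mapping.single u c) * rho_poly N R n r"
    using add(5)
  proof (induction r rule: poly_mapping_add_induct)
    case zero
    then show ?case by (simp add: rho_poly_zero right_mult_zero_mat[OF rho_poly_carrier])
  next
    case (add g v e)
    have kv: "Poly_Mapping.keys (Poly_Mapping.single v e + g) = insert v (Poly_Mapping.keys g)"
      using add(1,2) by (rule keys_single_plus)
    then have v: "set (letters v) \<subseteq> braid_gens n" and g: "g \<in> carrier (free_algebra (braid_gens n))"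
      using add(4) unfolding free_algebra_carrier by auto
    have uv: "set (letters (u + v)) \<subseteq> braid_gens n" using u v by simp
    have "rho_poly N R n (Poly_Mapping.single u c * Poly_Mapping.single v e)
      = rho_poly N R n (Poly_Mapping.single u c) * rho_poly N R n (Poly_Mapping.single v e)"
      unfolding mult_single rho_poly_single[OF uv] rho_poly_single[OF u] rho_poly_single[OF v] wordm_plus[OF u v]
      using wordm_carrier[OF u] wordm_carrier[OF v]
      by (simp add: mult_smult_assoc_mat[of _ "N ^ n" "N ^ n"] mult_smult_distrib[of _ "N ^ n" "N ^ n"] smult_smult_mat mult.commute)
    then show ?case using add(3)[OF g]
      by (simp add: distrib_left rho_poly_add mult_add_distrib_mat[of _ "N ^ n" "N ^ n" _ "N ^ n"])
  qed
  then show ?case using add(3)[OF f add(5)]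
    by (simp add: distrib_right rho_poly_add add_mult_distrib_mat[of _ "N ^ n" "N ^ n" _ _ "N ^ n"])
qed

lemma rho_poly_const: "rho_poly N R n (const c) = c \<cdot>\<^sub>m 1\<^sub>m (N ^ n)"
  unfolding const_def by (subst rho_poly_single) (auto simp: wordm_def mprod_def)

lemma rho_poly_uminus: "rho_poly N R n (- p) = - rho_poly N R n p"
  by (intro eq_matI) (auto simp: rho_poly_def sum_negf)

lemma rho_poly_diff: "rho_poly N R n (p - r) = rho_poly N R n p - rho_poly N R n r"
  using rho_poly_add[of n p "- r"] by (simp add: rho_poly_uminus minus_add_uminus_mat[OF rho_poly_carrier rho_poly_carrier])

lemma rho_poly_gen:
  "0 < i \<Longrightarrow> i < n \<Longrightarrow> rho_poly N R n (gen (Sigma i)) = Rn n i"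
  "0 < i \<Longrightarrow> i < n \<Longrightarrow> rho_poly N R n (gen (Sigma_inv i)) = Rin n i"
proof -
  have g: "rho_poly N R n (gen x) = rho_gen N R n x" if x: "x \<in> braid_gens n" for x
  proof -
    have "1 \<cdot>\<^sub>m (rho_gen N R n x * 1\<^sub>m (N ^ n)) = rho_gen N R n x"
      unfolding right_mult_one_mat[OF rho_gen_carrier[OF x]] by (intro eq_matI) auto
    then show ?thesis unfolding gen_def using x by (subst rho_poly_single) (auto simp: wordm_def mprod_def)
  qed
  show "0 < i \<Longrightarrow> i < n \<Longrightarrow> rho_poly N R n (gen (Sigma i)) = Rn n i"
    "0 < i \<Longrightarrow> i < n \<Longrightarrow> rho_poly N R n (gen (Sigma_inv i)) = Rin n i"
    by (subst g; auto simp: braid_gens_def)+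
qed

lemma gens_carrier:
  "0 < i \<Longrightarrow> i < n \<Longrightarrow> gen (Sigma i) \<in> carrier (free_algebra (braid_gens n))"
  "0 < i \<Longrightarrow> i < n \<Longrightarrow> gen (Sigma_inv i) \<in> carrier (free_algebra (braid_gens n))"
  by (auto intro!: free_gen simp: braid_gens_def)

end

sublocale bmw_mat \<subseteq> br: presented "braid_gens n" "braid_relations n" for n
proof
  show "braid_relations n \<subseteq> carrier (free_algebra (braid_gens n))"
    unfolding braid_relations_def by (auto intro!: free_diff free_mult free_one gens_carrier)
qed

context bmw_mat begin

lemma Rn_Rin: assumes "0 < i" "i < n" shows "Rn n i * Rin n i = 1\<^sub>m (N ^ n)" "Rin n i * Rn n i = 1\<^sub>m (N ^ n)"
  using assms by (simp_all add: R_Ri Ri_R flip: op_at_mult)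

text \<open>Each defining relation of the braid algebra holds for the matrices, so
  \<open>rho_poly\<close> is constant on cosets. Hence the set of values in the definition of
  \<open>rho\<close> is a singleton.\<close>

lemma rho_poly_I: assumes "p \<in> br.I n" shows "rho_poly N R n p = 0\<^sub>m (N ^ n) (N ^ n)"
proof (rule br.I_induct[where n = n and p = p, OF _ _ _ _ _ assms])
  fix s assume s: "s \<in> braid_relations n"
  have far: "Rn n i * Rn n j = Rn n j * Rn n i" if "Suc 0 \<le> i" "Suc (Suc i) \<le> j" "j < n" for i j
    using that by (intro op_at_comm) auto
  have z: "M - M = 0\<^sub>m (N ^ n) (N ^ n)" if "M \<in> sq_mats (N ^ n)" for M :: "complex mat"
    using that by simp
  have far0: "Rn n i * Rn n j - Rn n j * Rn n i = 0\<^sub>m (N ^ n) (N ^ n)" if "Suc 0 \<le> i" "Suc (Suc i) \<le> j" "j < n" for i j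
    unfolding far[OF that] using that by (intro z) auto
  from s show "rho_poly N R n s = 0\<^sub>m (N ^ n) (N ^ n)" unfolding braid_relations_def
    by (auto simp: rho_poly_diff rho_poly_mult gens_carrier free_mult rho_poly_gen Rn_Rin far0 braid_n
        rho_poly_const[of n 1, simplified] simp del: assoc_mult_mat intro!: z)
qed (auto simp: rho_poly_zero rho_poly_add rho_poly_mult left_mult_zero_mat[OF rho_poly_carrier] right_mult_zero_mat[OF rho_poly_carrier])

lemma rho_class: assumes "p \<in> carrier (free_algebra (braid_gens n))"
  shows "rho N R n (braid_class n p) = rho_poly N R n p"
proof -
  have "rho_poly N R n ` braid_class n p = {rho_poly N R n p}"
  proof (rule Set.set_eqI)
    have "rho_poly N R n (h + p) = rho_poly N R n p" if "h \<in> br.I n" for h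
      using that by (simp add: rho_poly_add rho_poly_I left_add_zero_mat[OF rho_poly_carrier])
    moreover have "p \<in> braid_class n p" unfolding braid_class_def br.cl_eq using br.I_zero by force
    ultimately show "x \<in> rho_poly N R n ` braid_class n p \<longleftrightarrow> x \<in> {rho_poly N R n p}" for x
      unfolding braid_class_def br.cl_eq by auto
  qed
  then show ?thesis unfolding rho_def by simp
qed

text \<open>Keeps a class in the braid algebra together with its matrix through a common
  representative. This relation is stable under the ring operations, so the image of an
  antisymmetrizer can be read off its recursion.\<close>

definition reps :: "nat \<Rightarrow> braid_gen ncpoly set \<Rightarrow> complex mat \<Rightarrow> bool" where
  "reps n \<alpha> M \<longleftrightarrow> (\<exists>p\<in>carrier (free_algebra (braid_gens n)). \<alpha> = braid_class n p \<and> rho_poly N R n p = M)"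

lemma reps_rho: "reps n \<alpha> M \<Longrightarrow> rho N R n \<alpha> = M"
  unfolding reps_def using rho_class by auto

lemma reps_mult: "reps n \<alpha> A \<Longrightarrow> reps n \<beta> B \<Longrightarrow> reps n (\<alpha> \<otimes>\<^bsub>braid_algebra n\<^esub> \<beta>) (A * B)"
  unfolding reps_def braid_algebra_def braid_class_def using br.cl_mult[of _ n] free_mult rho_poly_mult by blast

lemma reps_add: "reps n \<alpha> A \<Longrightarrow> reps n \<beta> B \<Longrightarrow> reps n (\<alpha> \<oplus>\<^bsub>braid_algebra n\<^esub> \<beta>) (A + B)"
  unfolding reps_def braid_algebra_def braid_class_def using br.cl_add[of _ n] free_add rho_poly_add by blast

lemma reps_minus: "reps n \<alpha> A \<Longrightarrow> reps n \<beta> B \<Longrightarrow> reps n (\<alpha> \<ominus>\<^bsub>braid_algebra n\<^esub> \<beta>) (A - B)"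
  unfolding reps_def braid_algebra_def braid_class_def using br.cl_minus[of _ n] free_diff rho_poly_diff by blast

lemma reps_one: "reps n \<one>\<^bsub>braid_algebra n\<^esub> (1\<^sub>m (N ^ n))"
  unfolding reps_def braid_algebra_def braid_class_def
  using br.cl_one[of n] free_one rho_poly_const[of n 1] by (auto intro!: bexI[of _ 1])

lemma reps_const: "reps n (bconst n c) (c \<cdot>\<^sub>m 1\<^sub>m (N ^ n))"
  unfolding reps_def bconst_def using free_const rho_poly_const by blast

lemma reps_sigma: "0 < i \<Longrightarrow> i < n \<Longrightarrow> reps n (sigma n i) (Rn n i)"
  unfolding reps_def sigma_def using gens_carrier rho_poly_gen by blast

lemma reps_scale: assumes "reps n \<alpha> A" shows "reps n (bconst n c \<otimes>\<^bsub>braid_algebra n\<^esub> \<alpha>) (c \<cdot>\<^sub>m A)"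
proof -
  have "A \<in> sq_mats (N ^ n)" using assms unfolding reps_def by auto
  then have "c \<cdot>\<^sub>m 1\<^sub>m (N ^ n) * A = c \<cdot>\<^sub>m A" by (simp add: mult_smult_assoc_mat[of _ "N ^ n" "N ^ n" _ "N ^ n"])
  then show ?thesis using reps_mult[OF reps_const assms, of c] by simp
qed

lemma reps_kappa: assumes "0 < i" "i < n" shows "reps n (kappa n q \<mu> i) (Kn n i)"
proof -
  let ?I = "1\<^sub>m (N ^ 2) :: complex mat"
  have c: "q \<cdot>\<^sub>m ?I - R \<in> sq_mats (N ^ 2)" "(1 / q) \<cdot>\<^sub>m ?I + R \<in> sq_mats (N ^ 2)"
    by (auto intro: minus_carrier_mat)
  have "op_at N n i 2 (q \<cdot>\<^sub>m ?I - R) = q \<cdot>\<^sub>m 1\<^sub>m (N ^ n) - Rn n i"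
    using assms by (simp add: op_at_diff op_at_smult)
  moreover have "op_at N n i 2 ((1 / q) \<cdot>\<^sub>m ?I + R) = (1 / q) \<cdot>\<^sub>m 1\<^sub>m (N ^ n) + Rn n i"
    using assms by (simp add: op_at_add op_at_smult)
  ultimately have "Kn n i = (1 / (\<mu> * (q - 1 / q))) \<cdot>\<^sub>m ((q \<cdot>\<^sub>m 1\<^sub>m (N ^ n) - Rn n i) * ((1 / q) \<cdot>\<^sub>m 1\<^sub>m (N ^ n) + Rn n i))"
    unfolding K_mat_def op_at_smult op_at_mult[OF c] by simp
  then show ?thesis unfolding kappa_def
    by (auto intro!: reps_scale reps_mult reps_add reps_minus reps_const reps_sigma assms)
qed

definition Smat :: "nat \<Rightarrow> nat \<Rightarrow> complex \<Rightarrow> complex mat" where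
  "Smat n i x = 1\<^sub>m (N ^ n) + ((x - 1) / (q - 1 / q)) \<cdot>\<^sub>m Rn n i + ((x - 1) / (q * (1 / \<mu>) * x + 1)) \<cdot>\<^sub>m Kn n i"

text \<open>The matrix on \<open>n\<close> factors of the antisymmetrizer acting in the factors
  \<open>s + 1, ..., s + j\<close>; for \<open>s = 0\<close> it is the image of
  \<open>antisym n q \<mu> j\<close> under \<open>rho\<close>.\<close>

fun AM :: "nat \<Rightarrow> nat \<Rightarrow> nat \<Rightarrow> complex mat" where
  "AM n s 0 = 1\<^sub>m (N ^ n)"
| "AM n s (Suc 0) = 1\<^sub>m (N ^ n)"
| "AM n s (Suc (Suc j)) = (q ^ Suc j / qnum q (Suc j + 1)) \<cdot>\<^sub>m
    (AM n s (Suc j) * Smat n (s + Suc j) ((1 / q) ^ (2 * Suc j)) * AM n s (Suc j))"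

lemma reps_antisym: "j \<le> n \<Longrightarrow> reps n (antisym n q \<mu> j) (AM n 0 j)"
proof (induction j rule: induct_nat_012)
  case (ge2 j)
  then show ?case unfolding antisym.simps Let_def AM.simps sigma_minus_def Smat_def
    by (intro reps_scale reps_mult reps_add reps_one) (simp_all add: reps_sigma reps_kappa)
qed (auto intro: reps_one)

end

section \<open>The R-trace\<close>

locale skew_inv =
  fixes N :: nat and R :: "complex mat"
  assumes N0: "0 < N"
    and Rc: "R \<in> sq_mats (N ^ 2)"
    and skew: "skew_invertible N R"
begin

text \<open>Entries of an operator on two factors: row digits \<open>a, b\<close>, column digits
  \<open>c, d\<close>.\<close>

definition en :: "'a mat \<Rightarrow> nat \<Rightarrow> nat \<Rightarrow> nat \<Rightarrow> nat \<Rightarrow> 'a" where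
  "en X a b c d = X $$ (a * N + b, c * N + d)"

text \<open>The analogue for three factors, with row digits \<open>a, x, t\<close> and column digits
  \<open>b, y, s\<close>; the last of each is the factor that gets traced out below.\<close>

definition en3 :: "'a mat \<Rightarrow> nat \<Rightarrow> nat \<Rightarrow> nat \<Rightarrow> nat \<Rightarrow> nat \<Rightarrow> nat \<Rightarrow> 'a" where
  "en3 X a x t b y s = X $$ ((a * N + x) * N + t, (b * N + y) * N + s)"

lemma pair_lt: "a < N \<Longrightarrow> b < N \<Longrightarrow> a * N + b < N ^ 2"
  using pair_index_less[of a N b N] by (simp add: power2_eq_square)

lemma triple_lt: "a < N \<Longrightarrow> b < N \<Longrightarrow> c < N \<Longrightarrow> (a * N + b) * N + c < N ^ 3"
  using pair_index_less[of "a * N + b" "N * N" c N] pair_lt[of a b] by (simp add: power2_eq_square power3_eq_cube)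

lemma sum_N2: "(\<Sum>k<N ^ 2. f k) = (\<Sum>a<N. \<Sum>b<N. f (a * N + b))"
  by (simp add: power2_eq_square sum_split_mult)

lemma sum_N3: "(\<Sum>k<N ^ 3. f k) = (\<Sum>a<N. \<Sum>b<N. \<Sum>c<N. f ((a * N + b) * N + c))"
proof -
  have "(\<Sum>k<N ^ 3. f k) = (\<Sum>k<N ^ 2 * N. f k)" by (simp add: power2_eq_square power3_eq_cube)
  also have "\<dots> = (\<Sum>a<N. \<Sum>b<N. \<Sum>c<N. f ((a * N + b) * N + c))"
    unfolding sum_split_mult sum_N2 ..
  finally show ?thesis .
qed

lemma en3_12: assumes "X \<in> sq_mats (N ^ 2)" "a < N" "x < N" "t < N" "b < N" "y < N" "s < N"
  shows "en3 (op_at N 3 1 2 X) a x t b y s = (if t = s then en X a x b y else (0::complex))"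
  unfolding op_at_def en3_def en_def using assms pair_lt
  by (simp add: kron_index_pair[of X "N ^ 2" "N ^ 2" "1\<^sub>m N" N N])

lemma en3_23: assumes "X \<in> sq_mats (N ^ 2)" "a < N" "x < N" "t < N" "b < N" "y < N" "s < N"
  shows "en3 (op_at N 3 2 2 X) a x t b y s = (if a = b then en X x t y s else (0::complex))"
proof -
  have e: "(a * N + x) * N + t = a * N ^ 2 + (x * N + t)" "(b * N + y) * N + s = b * N ^ 2 + (y * N + s)"
    by (simp_all add: power2_eq_square algebra_simps)
  show ?thesis
    unfolding op_at_def en3_def en_def e using assms pair_lt
    by (simp add: kron_index_pair[of "1\<^sub>m N" N N X "N ^ 2" "N ^ 2"])
qed

lemma en3_mult: assumes "X \<in> sq_mats (N ^ 3)" "Y \<in> sq_mats (N ^ 3)"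
    "a < N" "x < N" "t < N" "b < N" "y < N" "s < N"
  shows "en3 (X * Y) a x t b y s = (\<Sum>c<N. \<Sum>d<N. \<Sum>e<N. en3 X a x t c d e * (en3 Y c d e b y s :: complex))"
  unfolding en3_def index_mult_mat_sum[OF assms(1,2) triple_lt[OF assms(3-5)] triple_lt[OF assms(6-8)]] sum_N3 ..

lemma en_mult: assumes "X \<in> sq_mats (N ^ 2)" "Y \<in> sq_mats (N ^ 2)"
    "a < N" "x < N" "b < N" "y < N"
  shows "en (X * Y) a x b y = (\<Sum>c<N. \<Sum>d<N. en X a x c d * (en Y c d b y :: complex))"
  unfolding en_def index_mult_mat_sum[OF assms(1,2) pair_lt[OF assms(3,4)] pair_lt[OF assms(5,6)]] sum_N2 ..

lemma en_one: "a < N \<Longrightarrow> x < N \<Longrightarrow> b < N \<Longrightarrow> y < N \<Longrightarrow>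
    en (1\<^sub>m (N ^ 2)) a x b y = (if a = b \<and> x = y then 1 else (0::complex))"
proof -
  assume *: "a < N" "x < N" "b < N" "y < N"
  have "a * N + x = b * N + y \<longleftrightarrow> a = b \<and> x = y"
    by (metis * add.commute div_mult_self3 div_less mod_less mod_mult_self3 add_cancel_right_left gr_implies_not0)
  then show ?thesis using * pair_lt unfolding en_def by simp
qed

lemma en_eqI: assumes "X \<in> sq_mats (N ^ 2)" "Y \<in> sq_mats (N ^ 2)"
  and "\<And>a x b y. a < N \<Longrightarrow> x < N \<Longrightarrow> b < N \<Longrightarrow> y < N \<Longrightarrow> en X a x b y = en Y a x b y"
  shows "X = Y"
  using assms by (intro eq_mat_pairI[of X N N N N]) (auto simp: en_def power2_eq_square)

lemma delta_mult[simp]: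
  fixes g :: "nat \<Rightarrow> complex"
  assumes "u < N"
  shows "(\<Sum>r<N. (if u = r then 1 else 0) * g r) = g u" "(\<Sum>r<N. (if r = u then 1 else 0) * g r) = g u"
    "(\<Sum>r<N. g r * (if u = r then 1 else 0)) = g u" "(\<Sum>r<N. g r * (if r = u then 1 else 0)) = g u"
proof -
  have "(\<Sum>r<N. if r = u then g r else 0) = g u" using assms by simp
  moreover have "(if u = r then 1 else 0) * g r = (if r = u then g r else 0)"
    "(if r = u then 1 else 0) * g r = (if r = u then g r else 0)"
    "g r * (if u = r then 1 else 0) = (if r = u then g r else 0)"
    "g r * (if r = u then 1 else 0) = (if r = u then g r else 0)" for r by auto
  ultimately show "(\<Sum>r<N. (if u = r then 1 else 0) * g r) = g u" "(\<Sum>r<N. (if r = u then 1 else 0) * g r) = g u"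
    "(\<Sum>r<N. g r * (if u = r then 1 else 0)) = g u" "(\<Sum>r<N. g r * (if r = u then 1 else 0)) = g u"
    by presburger+
qed

lemma mult_12: assumes "X \<in> sq_mats (N ^ 2)" "Y \<in> sq_mats (N ^ 3)"
    "a < N" "x < N" "t < N" "b < N" "y < N" "s < N"
  shows "en3 (op_at N 3 1 2 X * Y) a x t b y s = (\<Sum>c<N. \<Sum>d<N. en X a x c d * (en3 Y c d t b y s :: complex))"
proof -
  have i: "(\<Sum>e<N. en3 (op_at N 3 1 2 X) a x t c d e * z e) = en X a x c d * z t" if "c < N" "d < N" for c d z
  proof -
    have "(\<Sum>e<N. en3 (op_at N 3 1 2 X) a x t c d e * z e) = (\<Sum>e<N. if t = e then en X a x c d * z e else 0)"
      using assms that by (intro sum.cong refl) (simp add: en3_12 del: One_nat_def)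
    then show ?thesis using assms by simp
  qed
  have "op_at N 3 1 2 X \<in> sq_mats (N ^ 3)" using assms by simp
  then show ?thesis by (subst en3_mult) (use assms i in \<open>auto simp del: One_nat_def\<close>)
qed

lemma mult_23: assumes "X \<in> sq_mats (N ^ 2)" "Y \<in> sq_mats (N ^ 3)"
    "a < N" "x < N" "t < N" "b < N" "y < N" "s < N"
  shows "en3 (op_at N 3 2 2 X * Y) a x t b y s = (\<Sum>d<N. \<Sum>e<N. en X x t d e * (en3 Y a d e b y s :: complex))"
proof -
  have i: "(\<Sum>d<N. \<Sum>e<N. en3 (op_at N 3 2 2 X) a x t c d e * z c d e)
     = (if c = a then \<Sum>d<N. \<Sum>e<N. en X x t d e * z c d e else 0)" if "c < N" for c z
    using assms that by (auto intro!: sum.cong sum.neutral simp: en3_23)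
  have "op_at N 3 2 2 X \<in> sq_mats (N ^ 3)" using assms by simp
  then have "en3 (op_at N 3 2 2 X * Y) a x t b y s = (\<Sum>c<N. \<Sum>d<N. \<Sum>e<N. en3 (op_at N 3 2 2 X) a x t c d e * en3 Y c d e b y s)"
    using assms by (intro en3_mult)
  also have "\<dots> = (\<Sum>c<N. if c = a then \<Sum>d<N. \<Sum>e<N. en X x t d e * en3 Y c d e b y s else 0)"
    by (rule sum.cong[OF refl]) (use i[of _ "\<lambda>c d e. en3 Y c d e b y s"] in auto)
  finally show ?thesis using assms by simp
qed

lemma ptrace_middle:
  assumes "X \<in> sq_mats (N ^ 3)" "a < N" "c < N" "b < N" "d < N"
  shows "en (ptrace N 3 2 X) a c b d = (\<Sum>t<N. en3 X a t c b t d)"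
  unfolding ptrace_def en_def en3_def Let_def using assms pair_lt by simp

lemma flip_en: "a < N \<Longrightarrow> c < N \<Longrightarrow> b < N \<Longrightarrow> d < N \<Longrightarrow> en (flip N) a c b d = (if a = d \<and> c = b then 1 else 0)"
  unfolding flip_def en_def using pair_lt by auto

text \<open>Skew invertibility as an ordinary matrix inversion: \<open>X\<close> is read as a matrix
  with rows \<open>(a, b)\<close> and columns \<open>(t, w)\<close>, and \<open>Y\<close> as one
  with rows \<open>(t, w)\<close> and columns \<open>(d, c)\<close>.\<close>

lemma skew_index:
  assumes X: "X \<in> sq_mats (N ^ 2)" and Y: "Y \<in> sq_mats (N ^ 2)"
    and fl: "ptrace N 3 2 (op_at N 3 1 2 X * op_at N 3 2 2 Y) = flip N"
    and i: "a < N" "b < N" "c < N" "d < N"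
  shows "(\<Sum>t<N. \<Sum>w<N. en X a t b w * en Y w c t d) = (if a = d \<and> b = c then 1 else 0)"
proof -
  have Y3: "op_at N 3 2 2 Y \<in> sq_mats (N ^ 3)" using Y by simp
  have "(if a = d \<and> b = c then 1 else 0) = en (ptrace N 3 2 (op_at N 3 1 2 X * op_at N 3 2 2 Y)) a c b d"
    unfolding fl using i by (auto simp: flip_en)
  also have "\<dots> = (\<Sum>t<N. en3 (op_at N 3 1 2 X * op_at N 3 2 2 Y) a t c b t d)"
    using X Y i by (intro ptrace_middle sq_mult_carrier) auto
  also have "\<dots> = (\<Sum>t<N. \<Sum>e<N. \<Sum>w<N. en X a t e w * en3 (op_at N 3 2 2 Y) e w c b t d)"
    using mult_12[OF X Y3] i by (intro sum.cong refl) simp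
  also have "\<dots> = (\<Sum>t<N. \<Sum>e<N. if e = b then \<Sum>w<N. en X a t e w * en Y w c t d else 0)"
  proof -
    have "(\<Sum>w<N. en X a t e w * en3 (op_at N 3 2 2 Y) e w c b t d) = (if e = b then \<Sum>w<N. en X a t e w * en Y w c t d else 0)"
      if "t < N" "e < N" for t e using that i by (auto simp: en3_23[OF Y])
    then show ?thesis by (auto intro!: sum.cong)
  qed
  also have "\<dots> = (\<Sum>t<N. \<Sum>w<N. en X a t b w * en Y w c t d)" using i by simp
  finally show ?thesis by simp
qed

text \<open>After the regrouping of indices \<open>P\<close> is a left inverse and \<open>P'\<close>
  a right inverse of \<open>R\<close>, so both equal the triple product of \<open>P\<close>,
  \<open>R\<close>, \<open>P'\<close>. This makes the definite description in
  \<open>skew_inverse\<close> meaningful.\<close>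

lemma skew_unique: assumes "is_skew_inverse N R P" "is_skew_inverse N R P'" shows "P = P'"
proof (rule en_eqI)
  show P: "P \<in> sq_mats (N ^ 2)" and P': "P' \<in> sq_mats (N ^ 2)"
    using assms unfolding is_skew_inverse_def by auto
  fix a e b f assume i: "a < N" "e < N" "b < N" "f < N"
  have 1: "(\<Sum>t<N. \<Sum>w<N. en P a t b w * en R w c t d) = (if a = d \<and> b = c then 1 else 0)" if "c < N" "d < N" for c d
    using skew_index[OF P Rc _ i(1) i(3) that] assms(1) unfolding is_skew_inverse_def by auto
  have 2: "(\<Sum>c<N. \<Sum>d<N. en R w c t d * en P' d e c f) = (if w = f \<and> t = e then 1 else 0)" if "w < N" "t < N" for w t
    using skew_index[OF Rc P' _ that i(2,4)] assms(2) unfolding is_skew_inverse_def by auto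
  have "en P a e b f = (\<Sum>t<N. \<Sum>w<N. en P a t b w * (if w = f \<and> t = e then 1 else 0))"
  proof -
    have "(\<Sum>t<N. \<Sum>w<N. en P a t b w * (if w = f \<and> t = e then 1 else 0))
       = (\<Sum>t<N. if t = e then (\<Sum>w<N. if w = f then en P a t b w else 0) else 0)"
      by (intro sum.cong refl) (auto intro!: sum.cong)
    then show ?thesis using i by simp
  qed
  also have "\<dots> = (\<Sum>t<N. \<Sum>w<N. \<Sum>c<N. \<Sum>d<N. en P a t b w * en R w c t d * en P' d e c f)"
    by (intro sum.cong refl, subst 2[symmetric]) (auto simp: sum_distrib_left mult.assoc)
  also have "\<dots> = (\<Sum>t<N. \<Sum>c<N. \<Sum>w<N. \<Sum>d<N. en P a t b w * en R w c t d * en P' d e c f)"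
    by (rule sum.cong[OF refl], rule sum.swap)
  also have "\<dots> = (\<Sum>c<N. \<Sum>t<N. \<Sum>w<N. \<Sum>d<N. en P a t b w * en R w c t d * en P' d e c f)"
    by (rule sum.swap)
  also have "\<dots> = (\<Sum>c<N. \<Sum>t<N. \<Sum>d<N. \<Sum>w<N. en P a t b w * en R w c t d * en P' d e c f)"
    by (rule sum.cong[OF refl], rule sum.cong[OF refl], rule sum.swap)
  also have "\<dots> = (\<Sum>c<N. \<Sum>d<N. \<Sum>t<N. \<Sum>w<N. en P a t b w * en R w c t d * en P' d e c f)"
    by (rule sum.cong[OF refl], rule sum.swap)
  also have "\<dots> = (\<Sum>c<N. \<Sum>d<N. (if a = d \<and> b = c then 1 else 0) * en P' d e c f)"
    by (intro sum.cong refl, subst 1[symmetric]) (auto simp: sum_distrib_right)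
  also have "\<dots> = (\<Sum>c<N. if c = b then \<Sum>d<N. if d = a then en P' d e c f else 0 else 0)"
    by (intro sum.cong refl) (auto intro!: sum.cong)
  also have "\<dots> = en P' a e b f" using i by simp
  finally show "en P a e b f = en P' a e b f" .
qed

definition "Psi = skew_inverse N R"

lemma Psi: "is_skew_inverse N R Psi"
proof -
  obtain P where "is_skew_inverse N R P" using skew unfolding skew_invertible_def by auto
  then show ?thesis unfolding Psi_def skew_inverse_def by (metis skew_unique theI)
qed

lemma Psi_carrier: "Psi \<in> sq_mats (N ^ 2)"
  using Psi unfolding is_skew_inverse_def by auto

lemma Psi_R: "a < N \<Longrightarrow> b < N \<Longrightarrow> c < N \<Longrightarrow> d < N \<Longrightarrow>
    (\<Sum>t<N. \<Sum>w<N. en Psi a t b w * en R w c t d) = (if a = d \<and> b = c then 1 else 0)"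
  using skew_index[OF Psi_carrier Rc] Psi unfolding is_skew_inverse_def by auto

lemma R_Psi: "a < N \<Longrightarrow> b < N \<Longrightarrow> c < N \<Longrightarrow> d < N \<Longrightarrow>
    (\<Sum>t<N. \<Sum>w<N. en R a t b w * en Psi w c t d) = (if a = d \<and> b = c then 1 else 0)"
  using skew_index[OF Rc Psi_carrier] Psi unfolding is_skew_inverse_def by auto

abbreviation "D \<equiv> D_mat N R"

lemma D_carrier[simp]: "D \<in> sq_mats N"
  unfolding D_mat_def ptrace_def Let_def by simp

lemma D_index: "a < N \<Longrightarrow> b < N \<Longrightarrow> D $$ (a, b) = (\<Sum>t<N. en Psi a t b t)"
  unfolding D_mat_def ptrace_def Let_def Psi_def en_def by simp

text \<open>A linear system whose coefficient matrix is the regrouped \<open>R\<close>; it is solved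
  by applying \<open>Psi\<close>.\<close>

lemma skew_solve:
  assumes "\<And>a b. a < N \<Longrightarrow> b < N \<Longrightarrow> (\<Sum>p<N. \<Sum>r<N. en R a p b r * f p r) = g a b"
    and uv: "u < N" "v < N"
  shows "f v u = (\<Sum>b<N. \<Sum>a<N. en Psi u b v a * g a b)"
proof -
  have "(\<Sum>b<N. \<Sum>a<N. en Psi u b v a * g a b)
     = (\<Sum>b<N. \<Sum>a<N. \<Sum>p<N. \<Sum>r<N. en Psi u b v a * en R a p b r * f p r)"
    by (intro sum.cong refl, subst assms(1)[symmetric]) (auto simp: sum_distrib_left mult.assoc)
  also have "\<dots> = (\<Sum>b<N. \<Sum>p<N. \<Sum>a<N. \<Sum>r<N. en Psi u b v a * en R a p b r * f p r)"
    by (rule sum.cong[OF refl], rule sum.swap)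
  also have "\<dots> = (\<Sum>p<N. \<Sum>b<N. \<Sum>a<N. \<Sum>r<N. en Psi u b v a * en R a p b r * f p r)"
    by (rule sum.swap)
  also have "\<dots> = (\<Sum>p<N. \<Sum>b<N. \<Sum>r<N. \<Sum>a<N. en Psi u b v a * en R a p b r * f p r)"
    by (rule sum.cong[OF refl], rule sum.cong[OF refl], rule sum.swap)
  also have "\<dots> = (\<Sum>p<N. \<Sum>r<N. \<Sum>b<N. \<Sum>a<N. en Psi u b v a * en R a p b r * f p r)"
    by (rule sum.cong[OF refl], rule sum.swap)
  also have "\<dots> = (\<Sum>p<N. \<Sum>r<N. (if u = r \<and> v = p then 1 else 0) * f p r)"
    by (intro sum.cong refl, subst Psi_R[symmetric]) (auto simp: sum_distrib_right uv)
  also have "\<dots> = (\<Sum>p<N. if p = v then \<Sum>r<N. if r = u then f p r else 0 else 0)"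
    by (intro sum.cong refl) (auto intro!: sum.cong)
  also have "\<dots> = f v u" using uv by simp
  finally show ?thesis by simp
qed

text \<open>The R-trace of \<open>R\<close> over its second factor is the identity. Inserting the
  definition of \<open>D\<close> turns the sum into \<open>R_Psi\<close> with two of its free
  indices set equal and summed.\<close>

lemma trace_R: assumes "d < N" "f < N"
  shows "(\<Sum>s<N. \<Sum>t<N. D $$ (s, t) * en R d t f s) = (if d = f then 1 else 0)"
proof -
  have "(\<Sum>s<N. \<Sum>t<N. D $$ (s, t) * en R d t f s)
     = (\<Sum>s<N. \<Sum>t<N. \<Sum>w<N. en R d t f s * en Psi s w t w)"
    by (intro sum.cong refl) (auto simp: D_index sum_distrib_left mult.commute)
  also have "\<dots> = (\<Sum>s<N. \<Sum>w<N. \<Sum>t<N. en R d t f s * en Psi s w t w)"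
    by (rule sum.cong[OF refl], rule sum.swap)
  also have "\<dots> = (\<Sum>w<N. \<Sum>s<N. \<Sum>t<N. en R d t f s * en Psi s w t w)"
    by (rule sum.swap)
  also have "\<dots> = (\<Sum>w<N. \<Sum>t<N. \<Sum>s<N. en R d t f s * en Psi s w t w)"
    by (rule sum.cong[OF refl], rule sum.swap)
  also have "\<dots> = (\<Sum>w<N. if d = w \<and> f = w then 1 else 0)"
    by (intro sum.cong refl) (auto simp: R_Psi assms)
  also have "\<dots> = (\<Sum>w<N. if w = d then (if d = f then 1 else 0) else 0)"
    by (intro sum.cong refl) auto
  finally show ?thesis using assms by simp
qed

text \<open>In indices: conjugating \<open>X \<otimes> 1\<close> by \<open>F\<close> does not change the R-trace over the last factor
  (the skew inverse of \<open>R\<close> turns the compatibility of \<open>R\<close> and \<open>F\<close> into this).\<close>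

lemma trace_conj_index:
  assumes Fc: "F \<in> sq_mats (N ^ 2)" and Gc: "G \<in> sq_mats (N ^ 2)"
    and GF: "G * F = 1\<^sub>m (N ^ 2)"
    and comp: "op_at N 3 2 2 F * (op_at N 3 1 2 R * op_at N 3 2 2 G) = op_at N 3 1 2 G * (op_at N 3 2 2 R * op_at N 3 1 2 F)"
    and i: "x < N" "y < N" "p < N" "r < N"
  shows "(\<Sum>e<N. \<Sum>s<N. \<Sum>t<N. D $$ (s, t) * en F x t p e * en G r e y s) = (if x = y then D $$ (r, p) else 0)"
proof -
  define f where "f p r = (\<Sum>e<N. \<Sum>s<N. \<Sum>t<N. D $$ (s, t) * en F x t p e * en G r e y s)" for p r
  define g :: "nat \<Rightarrow> nat \<Rightarrow> complex" where "g a b = (if a = b \<and> x = y then 1 else 0)" for a b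
  have c3: "op_at N 3 1 2 Z \<in> sq_mats (N ^ 3)" "op_at N 3 2 2 Z \<in> sq_mats (N ^ 3)"
    if "Z \<in> sq_mats (N ^ 2)" for Z :: "complex mat" using that by auto
  have "(\<Sum>p<N. \<Sum>r<N. en R a p b r * f p r) = g a b" if ab: "a < N" "b < N" for a b
  proof -
    \<comment> \<open>\<open>M1\<close> and \<open>M2\<close> are the entries of the two sides of
      \<open>comp\<close>. Contracted with \<open>D\<close> in the third factor, the first becomes a
      linear system for \<open>f\<close> with coefficients \<open>R\<close>; in the second
      \<open>trace_R\<close> removes \<open>R\<close> and leaves \<open>G * F\<close>, the
      identity.\<close>
    have M1: "en3 (op_at N 3 2 2 F * (op_at N 3 1 2 R * op_at N 3 2 2 G)) a x t b y s
       = (\<Sum>p<N. \<Sum>e<N. \<Sum>r<N. en F x t p e * (en R a p b r * en G r e y s))" if "t < N" "s < N" for t s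
    proof -
      have "en3 (op_at N 3 2 2 F * (op_at N 3 1 2 R * op_at N 3 2 2 G)) a x t b y s
        = (\<Sum>p<N. \<Sum>e<N. en F x t p e * (\<Sum>c<N. \<Sum>r<N. en R a p c r * en3 (op_at N 3 2 2 G) c r e b y s))"
        using i ab that c3[OF Fc] c3[OF Gc] c3[OF Rc]
        by (subst mult_23[OF Fc]) (auto intro!: sum.cong simp: mult_12[OF Rc] simp del: One_nat_def)
      also have "\<dots> = (\<Sum>p<N. \<Sum>e<N. en F x t p e * (\<Sum>c<N. if c = b then \<Sum>r<N. en R a p c r * en G r e y s else 0))"
      proof -
        have "(\<Sum>r<N. en R a p c r * en3 (op_at N 3 2 2 G) c r e b y s) = (if c = b then \<Sum>r<N. en R a p c r * en G r e y s else 0)"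
          if "c < N" "e < N" for p c e using that i ab \<open>s < N\<close> by (auto simp: en3_23[OF Gc])
        then show ?thesis by simp
      qed
      also have "\<dots> = (\<Sum>p<N. \<Sum>e<N. \<Sum>r<N. en F x t p e * (en R a p b r * en G r e y s))"
        using ab by (simp add: sum_distrib_left)
      finally show ?thesis .
    qed
    have M2: "en3 (op_at N 3 1 2 G * (op_at N 3 2 2 R * op_at N 3 1 2 F)) a x t b y s
       = (\<Sum>c<N. \<Sum>d<N. \<Sum>h<N. en G a x c d * (en R d t h s * en F c h b y))" if "t < N" "s < N" for t s
    proof -
      have "en3 (op_at N 3 1 2 G * (op_at N 3 2 2 R * op_at N 3 1 2 F)) a x t b y s
        = (\<Sum>c<N. \<Sum>d<N. en G a x c d * (\<Sum>h<N. \<Sum>e<N. en R d t h e * en3 (op_at N 3 1 2 F) c h e b y s))"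
        using i ab that c3[OF Fc] c3[OF Gc] c3[OF Rc]
        by (subst mult_12[OF Gc]) (auto intro!: sum.cong simp: mult_23[OF Rc] simp del: One_nat_def)
      also have "\<dots> = (\<Sum>c<N. \<Sum>d<N. en G a x c d * (\<Sum>h<N. \<Sum>e<N. if e = s then en R d t h e * en F c h b y else 0))"
      proof -
        have "(\<Sum>e<N. en R d t h e * en3 (op_at N 3 1 2 F) c h e b y s) = (\<Sum>e<N. if e = s then en R d t h e * en F c h b y else 0)"
          if "c < N" "h < N" for c d h using that i ab \<open>s < N\<close>
          by (intro sum.cong refl) (auto simp: en3_12[OF Fc] simp del: One_nat_def)
        then show ?thesis by simp
      qed
      also have "\<dots> = (\<Sum>c<N. \<Sum>d<N. \<Sum>h<N. en G a x c d * (en R d t h s * en F c h b y))"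
        using that by (simp add: sum_distrib_left)
      finally show ?thesis .
    qed
    have "(\<Sum>p<N. \<Sum>r<N. en R a p b r * f p r)
      = (\<Sum>p<N. \<Sum>r<N. \<Sum>e<N. \<Sum>s<N. \<Sum>t<N. D $$ (s, t) * (en F x t p e * (en R a p b r * en G r e y s)))"
      unfolding f_def by (simp add: sum_distrib_left ac_simps)
    also have "\<dots> = (\<Sum>s<N. \<Sum>t<N. D $$ (s, t) * (\<Sum>p<N. \<Sum>e<N. \<Sum>r<N. en F x t p e * (en R a p b r * en G r e y s)))"
    proof -
      have "(\<Sum>p<N. \<Sum>r<N. \<Sum>e<N. \<Sum>s<N. \<Sum>t<N. h p r e s t) = (\<Sum>s<N. \<Sum>t<N. \<Sum>p<N. \<Sum>e<N. \<Sum>r<N. h p r e s t)"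
        for h :: "nat \<Rightarrow> nat \<Rightarrow> nat \<Rightarrow> nat \<Rightarrow> nat \<Rightarrow> complex"
        by (simp only: sum.cartesian_product)
          (rule sum.reindex_bij_witness[of _ "\<lambda>(s, t, p, e, r). (p, r, e, s, t)" "\<lambda>(p, r, e, s, t). (s, t, p, e, r)"], auto)
      then show ?thesis by (simp add: sum_distrib_left)
    qed
    also have "\<dots> = (\<Sum>s<N. \<Sum>t<N. D $$ (s, t) * (\<Sum>c<N. \<Sum>d<N. \<Sum>h<N. en G a x c d * (en R d t h s * en F c h b y)))"
      using M1 M2 comp by (intro sum.cong refl) simp
    also have "\<dots> = (\<Sum>s<N. \<Sum>t<N. \<Sum>c<N. \<Sum>d<N. \<Sum>h<N. en G a x c d * en F c h b y * (D $$ (s, t) * en R d t h s))"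
      by (simp add: sum_distrib_left ac_simps)
    also have "\<dots> = (\<Sum>c<N. \<Sum>d<N. \<Sum>h<N. \<Sum>s<N. \<Sum>t<N. en G a x c d * en F c h b y * (D $$ (s, t) * en R d t h s))"
    proof -
      have "(\<Sum>s<N. \<Sum>t<N. \<Sum>c<N. \<Sum>d<N. \<Sum>e<N. h s t c d e) = (\<Sum>c<N. \<Sum>d<N. \<Sum>e<N. \<Sum>s<N. \<Sum>t<N. h s t c d e)"
        for h :: "nat \<Rightarrow> nat \<Rightarrow> nat \<Rightarrow> nat \<Rightarrow> nat \<Rightarrow> complex"
        by (simp only: sum.cartesian_product)
          (rule sum.reindex_bij_witness[of _ "\<lambda>(c, d, e, s, t). (s, t, c, d, e)" "\<lambda>(s, t, c, d, e). (c, d, e, s, t)"], auto)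
      then show ?thesis .
    qed
    also have "\<dots> = (\<Sum>c<N. \<Sum>d<N. \<Sum>h<N. en G a x c d * en F c h b y * (if d = h then 1 else 0))"
      by (intro sum.cong refl, subst trace_R[symmetric]) (auto simp: sum_distrib_left)
    also have "\<dots> = (\<Sum>c<N. \<Sum>d<N. \<Sum>h<N. if h = d then en G a x c d * en F c h b y else 0)"
      by (intro sum.cong refl) auto
    also have "\<dots> = (\<Sum>c<N. \<Sum>d<N. en G a x c d * en F c d b y)" by simp
    also have "\<dots> = en (G * F) a x b y" using en_mult[OF Gc Fc] i ab by simp
    also have "\<dots> = g a b" unfolding GF g_def using en_one i ab by simp
    finally show ?thesis .
  qed
  then have "f p r = (\<Sum>b<N. \<Sum>a<N. en Psi r b p a * g a b)" by (rule skew_solve) (use i in auto)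
  also have "\<dots> = (if x = y then \<Sum>b<N. \<Sum>a<N. if a = b then en Psi r b p a else 0 else 0)"
    unfolding g_def by (auto intro!: sum.cong)
  also have "\<dots> = (if x = y then D $$ (r, p) else 0)" using i by (simp add: D_index)
  finally show ?thesis unfolding f_def .
qed

end

section \<open>Compatible pairs\<close>

locale qma_pair = skew_inv N R for N R +
  fixes F :: "complex mat"
  assumes RR: "R_matrix N R" and RF: "R_matrix N F" and comp: "compatible_pair N R F"
begin

abbreviation "Ri \<equiv> minv R"
abbreviation "Fi \<equiv> minv F"

lemma Ri_carrier[simp]: "Ri \<in> sq_mats (N ^ 2)"
  and R_Ri: "R * Ri = 1\<^sub>m (N ^ 2)" and Ri_R: "Ri * R = 1\<^sub>m (N ^ 2)"
  using minv_inverse[OF Rc] RR unfolding R_matrix_def by auto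

lemma R_carrier[simp]: "R \<in> sq_mats (N ^ 2)" by (rule Rc)

lemma F_carrier[simp]: "F \<in> sq_mats (N ^ 2)"
  using RF unfolding R_matrix_def by auto

lemma Fi_carrier[simp]: "Fi \<in> sq_mats (N ^ 2)"
  and F_Fi: "F * Fi = 1\<^sub>m (N ^ 2)" and Fi_F: "Fi * F = 1\<^sub>m (N ^ 2)"
  using minv_inverse[OF F_carrier] RF unfolding R_matrix_def by auto

abbreviation "rn n j \<equiv> op_at N n j 2 R"
abbreviation "rin n j \<equiv> op_at N n j 2 Ri"
abbreviation "fn n j \<equiv> op_at N n j 2 F"
abbreviation "fin n j \<equiv> op_at N n j 2 Fi"

lemma inv_n:
  assumes "0 < j" "j < n"
  shows "rn n j * rin n j = 1\<^sub>m (N ^ n)" "rin n j * rn n j = 1\<^sub>m (N ^ n)"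
    "fn n j * fin n j = 1\<^sub>m (N ^ n)" "fin n j * fn n j = 1\<^sub>m (N ^ n)"
  using assms by (simp_all add: R_Ri Ri_R F_Fi Fi_F flip: op_at_mult)

lemma op3_carrier: "X \<in> sq_mats (N ^ 2) \<Longrightarrow> op_at N 3 1 2 X \<in> sq_mats (N ^ 3)"
  "X \<in> sq_mats (N ^ 2) \<Longrightarrow> op_at N 3 2 2 X \<in> sq_mats (N ^ 3)"
  by auto

lemma lift3:
  assumes "0 < j" "Suc j < n" and X: "X \<in> sq_mats (N ^ 2)" and Y: "Y \<in> sq_mats (N ^ 2)"
    and Z: "Z \<in> sq_mats (N ^ 2)"
  shows "op_at N 3 1 2 X * op_at N 3 2 2 Y * op_at N 3 1 2 Z = op_at N 3 2 2 Z * op_at N 3 1 2 Y * op_at N 3 2 2 X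
     \<Longrightarrow> op_at N n j 2 X * op_at N n (Suc j) 2 Y * op_at N n j 2 Z
       = op_at N n (Suc j) 2 Z * op_at N n j 2 Y * op_at N n (Suc j) 2 (X :: complex mat)"
    "op_at N 3 2 2 X * op_at N 3 1 2 Y * op_at N 3 2 2 Z = op_at N 3 1 2 Y * op_at N 3 2 2 Z * op_at N 3 1 2 X
     \<Longrightarrow> op_at N n (Suc j) 2 X * op_at N n j 2 Y * op_at N n (Suc j) 2 Z
       = op_at N n j 2 Y * op_at N n (Suc j) 2 Z * op_at N n j 2 (X :: complex mat)"
  unfolding op3[OF assms(1,2) X] op3[OF assms(1,2) Y] op3[OF assms(1,2) Z]
    op_at_mult3[OF op3_carrier(1)[OF X] op3_carrier(2)[OF Y] op3_carrier(1)[OF Z], symmetric]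
    op_at_mult3[OF op3_carrier(2)[OF Z] op3_carrier(1)[OF Y] op3_carrier(2)[OF X], symmetric]
    op_at_mult3[OF op3_carrier(2)[OF X] op3_carrier(1)[OF Y] op3_carrier(2)[OF Z], symmetric]
    op_at_mult3[OF op3_carrier(1)[OF Y] op3_carrier(2)[OF Z] op3_carrier(1)[OF X], symmetric] by simp_all

lemma comp_n: assumes "0 < j" "Suc j < n"
  shows "rn n (Suc j) * fn n j * fn n (Suc j) = fn n j * fn n (Suc j) * rn n j"
    "fn n (Suc j) * fn n j * fn n (Suc j) = fn n j * fn n (Suc j) * fn n j"
    "rn n (Suc j) * rn n j * rn n (Suc j) = rn n j * rn n (Suc j) * rn n j"
proof -
  show "rn n (Suc j) * fn n j * fn n (Suc j) = fn n j * fn n (Suc j) * rn n j"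
    using comp unfolding compatible_pair_def by (intro lift3(2)[OF assms]) auto
  show "fn n (Suc j) * fn n j * fn n (Suc j) = fn n j * fn n (Suc j) * fn n j"
    using RF unfolding R_matrix_def by (intro lift3(2)[OF assms]) auto
  show "rn n (Suc j) * rn n j * rn n (Suc j) = rn n j * rn n (Suc j) * rn n j"
    using RR unfolding R_matrix_def by (intro lift3(2)[OF assms]) auto
qed

lemma comp_n': assumes "0 < j" "Suc j < n"
  shows "rn n j * fn n (Suc j) * fn n j = fn n (Suc j) * fn n j * rn n (Suc j)"
proof -
  note c3 = op3_carrier[OF R_carrier] op3_carrier[OF F_carrier]
  have "op_at N 3 1 2 R * op_at N 3 2 2 F * op_at N 3 1 2 F = op_at N 3 2 2 F * op_at N 3 1 2 F * op_at N 3 2 2 R"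
    using comp unfolding compatible_pair_def by auto
  then show ?thesis
    unfolding op3[OF assms R_carrier] op3[OF assms F_carrier]
      op_at_mult3[OF c3(1,4,3), symmetric] op_at_mult3[OF c3(4,3,2), symmetric] by simp
qed

text \<open>Products \<open>X\<^sub>1 X\<^sub>2 \<dots> X\<^sub>m\<close> on \<open>n\<close> factors; for \<open>X = F\<close> they carry an operator over to the
  next factors, and the trace over the last factors is invariant under this.\<close>

fun strand :: "complex mat \<Rightarrow> nat \<Rightarrow> nat \<Rightarrow> complex mat" where
  "strand X n 0 = 1\<^sub>m (N ^ n)"
| "strand X n (Suc m) = strand X n m * op_at N n (Suc m) 2 X"

fun strand_inv :: "complex mat \<Rightarrow> nat \<Rightarrow> nat \<Rightarrow> complex mat" where
  "strand_inv X n 0 = 1\<^sub>m (N ^ n)"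
| "strand_inv X n (Suc m) = op_at N n (Suc m) 2 X * strand_inv X n m"

lemma strand_carrier[simp]: "X \<in> sq_mats (N ^ 2) \<Longrightarrow> m < n \<Longrightarrow> strand X n m \<in> sq_mats (N ^ n)"
  by (induction m) auto

lemma strand_inv_carrier[simp]: "X \<in> sq_mats (N ^ 2) \<Longrightarrow> m < n \<Longrightarrow> strand_inv X n m \<in> sq_mats (N ^ n)"
  by (induction m) auto

lemma strand_cancel:
  assumes X: "X \<in> sq_mats (N ^ 2)" and Y: "Y \<in> sq_mats (N ^ 2)" and XY: "X * Y = 1\<^sub>m (N ^ 2)"
  shows "m < n \<Longrightarrow> strand X n m * strand_inv Y n m = 1\<^sub>m (N ^ n)"
proof (induction m)
  case (Suc m)
  have c: "strand X n m \<in> sq_mats (N ^ n)" "strand_inv Y n m \<in> sq_mats (N ^ n)"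
    "op_at N n (Suc m) 2 X \<in> sq_mats (N ^ n)" "op_at N n (Suc m) 2 Y \<in> sq_mats (N ^ n)"
    using X Y Suc.prems by auto
  have "strand X n (Suc m) * strand_inv Y n (Suc m)
    = strand X n m * ((op_at N n (Suc m) 2 X * op_at N n (Suc m) 2 Y) * strand_inv Y n m)"
    using c by (simp add: sq_assoc[where d = "N ^ n"])
  also have "op_at N n (Suc m) 2 X * op_at N n (Suc m) 2 Y = 1\<^sub>m (N ^ n)"
    using X Y XY Suc.prems by (simp flip: op_at_mult)
  finally show ?case using Suc c by simp
qed simp

lemma strand_inv_cancel:
  assumes "m < n" shows "strand_inv Fi n m * strand F n m = 1\<^sub>m (N ^ n)"
  using strand_cancel[OF F_carrier Fi_carrier F_Fi assms] assms
  by (intro mat_mult_left_right_inverse[of "strand F n m" "N ^ n"]) auto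

text \<open>The factors of the strand before \<open>j\<close> commute with \<open>Y\<close> at
  \<open>Suc j\<close>, the two factors at \<open>j\<close> and \<open>Suc j\<close> shift it by
  \<open>rel\<close>, and the later ones commute with \<open>Y\<close> at \<open>j\<close>. Used for
  \<open>X = F\<close> with \<open>Y\<close> either \<open>R\<close> or \<open>F\<close>, and for
  \<open>X = Y = R\<close>.\<close>

lemma strand_slide:
  assumes X: "X \<in> sq_mats (N ^ 2)" and Y: "Y \<in> sq_mats (N ^ 2)" and j: "0 < j"
    and rel: "op_at N n (Suc j) 2 Y * op_at N n j 2 X * op_at N n (Suc j) 2 X = op_at N n j 2 X * op_at N n (Suc j) 2 X * op_at N n j 2 Y"
  shows "Suc j \<le> m \<Longrightarrow> m < n \<Longrightarrow> op_at N n (Suc j) 2 Y * strand X n m = strand X n m * op_at N n j 2 Y"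
proof (induction m rule: nat_induct_at_least)
  case base
  obtain i where i: "j = Suc i" using j by (cases j) auto
  have c: "strand X n i \<in> sq_mats (N ^ n)" "op_at N n j 2 X \<in> sq_mats (N ^ n)"
     "op_at N n (Suc j) 2 X \<in> sq_mats (N ^ n)" "op_at N n j 2 Y \<in> sq_mats (N ^ n)"
     "op_at N n (Suc j) 2 Y \<in> sq_mats (N ^ n)"
    using X Y base i by auto
  have comm: "op_at N n (Suc j) 2 Y * strand X n l = strand X n l * op_at N n (Suc j) 2 Y" if "l \<le> i" for l
    using that
  proof (induction l)
    case (Suc l)
    have cl: "strand X n l \<in> sq_mats (N ^ n)" "op_at N n (Suc l) 2 X \<in> sq_mats (N ^ n)"
      using X Suc.prems i base by auto
    have "op_at N n (Suc l) 2 X * op_at N n (Suc j) 2 Y = op_at N n (Suc j) 2 Y * op_at N n (Suc l) 2 X"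
      using X Y Suc.prems i base by (intro op_at_comm) auto
    then show ?case using Suc cl c assoc_mult_mat[OF c(5) cl] assoc_mult_mat[OF cl(1) c(5) cl(2)] assoc_mult_mat[OF cl(1) cl(2) c(5)] by simp
  qed (use c in simp)
  have "op_at N n (Suc j) 2 Y * strand X n (Suc j) = op_at N n (Suc j) 2 Y * strand X n i * (op_at N n j 2 X * op_at N n (Suc j) 2 X)"
    using c by (simp add: i sq_assoc[where d = "N ^ n"])
  also have "\<dots> = strand X n i * (op_at N n (Suc j) 2 Y * op_at N n j 2 X * op_at N n (Suc j) 2 X)"
    unfolding comm[OF order_refl] using c by (simp add: sq_assoc[where d = "N ^ n"])
  also have "\<dots> = strand X n (Suc j) * op_at N n j 2 Y" unfolding rel using c by (simp add: i sq_assoc[where d = "N ^ n"])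
  finally show ?case .
next
  case (Suc m)
  have c: "strand X n m \<in> sq_mats (N ^ n)" "op_at N n (Suc m) 2 X \<in> sq_mats (N ^ n)"
    "op_at N n j 2 Y \<in> sq_mats (N ^ n)" "op_at N n (Suc j) 2 Y \<in> sq_mats (N ^ n)"
    using X Y Suc j by auto
  have "op_at N n j 2 Y * op_at N n (Suc m) 2 X = op_at N n (Suc m) 2 X * op_at N n j 2 Y"
    using X Y Suc j by (intro op_at_comm) auto
  then show ?case using Suc c assoc_mult_mat[OF c(4,1,2)] assoc_mult_mat[OF c(1,3,2)] by simp
qed

text \<open>The image of \<open>\<complex>B\<^sub>n\<close> under \<open>\<rho>\<^sub>R\<close>.\<close>

inductive_set alg :: "nat \<Rightarrow> complex mat set" for n where
  alg_one: "1\<^sub>m (N ^ n) \<in> alg n"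
| alg_R: "0 < j \<Longrightarrow> j < n \<Longrightarrow> rn n j \<in> alg n"
| alg_Ri: "0 < j \<Longrightarrow> j < n \<Longrightarrow> rin n j \<in> alg n"
| alg_add: "A \<in> alg n \<Longrightarrow> B \<in> alg n \<Longrightarrow> A + B \<in> alg n"
| alg_mult: "A \<in> alg n \<Longrightarrow> B \<in> alg n \<Longrightarrow> A * B \<in> alg n"
| alg_smult: "A \<in> alg n \<Longrightarrow> c \<cdot>\<^sub>m A \<in> alg n"

lemma alg_carrier[simp]: "A \<in> alg n \<Longrightarrow> A \<in> sq_mats (N ^ n)"
  by (induction rule: alg.induct) auto

lemma alg_op_at:
  assumes m: "0 < m" "m + s \<le> Suc n"
  shows "A \<in> alg s \<Longrightarrow> op_at N n m s A \<in> alg n"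
proof (induction rule: alg.induct)
  case alg_one
  then show ?case using m by (simp add: alg.alg_one)
next
  case (alg_R j)
  then show ?case using m by (auto simp: op_at_op_at intro!: alg.alg_R)
next
  case (alg_Ri j)
  then show ?case using m by (auto simp: op_at_op_at intro!: alg.alg_Ri)
next
  case (alg_add A B)
  then show ?case by (simp add: op_at_add alg.alg_add)
next
  case (alg_mult A B)
  then show ?case by (simp add: op_at_mult alg.alg_mult)
next
  case (alg_smult A c)
  then show ?case by (simp add: op_at_smult alg.alg_smult)
qed

text \<open>It suffices to know how \<open>U\<close> shifts the generators: sums, products and
  scalars follow at once, and inverse generators by cancelling on both sides.\<close>

lemma alg_intertwine:
  assumes U: "U \<in> sq_mats (N ^ n)" and a: "0 < a" "a + s \<le> Suc n" and b: "0 < b" "b + s \<le> Suc n"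
    and slide: "\<And>j. 0 < j \<Longrightarrow> j < s \<Longrightarrow> rn n (a + j - 1) * U = U * rn n (b + j - 1)"
  shows "A \<in> alg s \<Longrightarrow> op_at N n a s A * U = U * op_at N n b s A"
proof (induction rule: alg.induct)
  case alg_one
  then show ?case using U a b by simp
next
  case (alg_R j)
  then show ?case using a b slide by (simp add: op_at_op_at)
next
  case (alg_Ri j)
  let ?p = "a + j - 1" and ?r = "b + j - 1"
  have c: "rn n ?p \<in> sq_mats (N ^ n)" "rin n ?p \<in> sq_mats (N ^ n)"
    "rn n ?r \<in> sq_mats (N ^ n)" "rin n ?r \<in> sq_mats (N ^ n)" using alg_Ri a b by auto
  have v: "rn n ?r * rin n ?r = 1\<^sub>m (N ^ n)" "rin n ?p * rn n ?p = 1\<^sub>m (N ^ n)"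
    using alg_Ri a b by (auto intro!: inv_n)
  note s = sq_assoc[where d = "N ^ n"] sq_one[where d = "N ^ n"]
  have "rin n ?p * U = rin n ?p * (U * (rn n ?r * rin n ?r))" unfolding v using c U by (simp add: s)
  also have "\<dots> = rin n ?p * (U * rn n ?r) * rin n ?r" using c U by (simp add: s)
  also have "\<dots> = (rin n ?p * rn n ?p) * U * rin n ?r" unfolding slide[OF alg_Ri, symmetric] using c U by (simp add: s)
  also have "\<dots> = U * rin n ?r" unfolding v using c U by (simp add: s)
  finally show ?case using alg_Ri a b by (simp add: op_at_op_at)
next
  case (alg_add A B)
  have c: "op_at N n a s A \<in> sq_mats (N ^ n)" "op_at N n a s B \<in> sq_mats (N ^ n)"
    "op_at N n b s A \<in> sq_mats (N ^ n)" "op_at N n b s B \<in> sq_mats (N ^ n)"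
    using alg_add a b by auto
  show ?case unfolding op_at_add[OF alg_carrier[OF alg_add(1)] alg_carrier[OF alg_add(2)]]
      add_mult_distrib_mat[OF c(1,2) U] mult_add_distrib_mat[OF U c(3,4)] alg_add.IH ..
next
  case (alg_mult A B)
  have c: "op_at N n a s A \<in> sq_mats (N ^ n)" "op_at N n a s B \<in> sq_mats (N ^ n)"
    "op_at N n b s A \<in> sq_mats (N ^ n)" "op_at N n b s B \<in> sq_mats (N ^ n)"
    using alg_mult a b by auto
  show ?case unfolding op_at_mult[OF alg_carrier[OF alg_mult(1)] alg_carrier[OF alg_mult(2)]]
      assoc_mult_mat[OF c(1,2) U] alg_mult.IH assoc_mult_mat[OF c(1) U c(4), symmetric] assoc_mult_mat[OF U c(3,4)] ..
next
  case (alg_smult A e)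
  have c: "op_at N n a s A \<in> sq_mats (N ^ n)" "op_at N n b s A \<in> sq_mats (N ^ n)"
    using alg_smult a b by auto
  show ?case unfolding op_at_smult mult_smult_assoc_mat[OF c(1) U] mult_smult_distrib[OF U c(2)] alg_smult.IH ..
qed

lemma slide_alg:
  assumes "A \<in> alg n"
  shows "op_at N (Suc n) 2 n A * strand F (Suc n) n = strand F (Suc n) n * op_at N (Suc n) 1 n A"
proof (rule alg_intertwine[OF _ _ _ _ _ _ assms])
  show "strand F (Suc n) n \<in> sq_mats (N ^ Suc n)" by (intro strand_carrier F_carrier) simp
  show "rn (Suc n) (2 + j - 1) * strand F (Suc n) n = strand F (Suc n) n * rn (Suc n) (1 + j - 1)" if "0 < j" "j < n" for j
  proof -
    have "rn (Suc n) (Suc j) * strand F (Suc n) n = strand F (Suc n) n * rn (Suc n) j"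
      using that by (intro strand_slide comp_n) auto
    then show ?thesis by simp
  qed
qed auto

section \<open>The weight of the R-trace on several factors commutes with braid operators\<close>

definition Dn :: "nat \<Rightarrow> complex mat" where
  "Dn n = mprod (N ^ n) (map (\<lambda>i. op_at N n i 1 D) [1..<n + 1])"

lemma mprod_kron_one:
  fixes Ms :: "'a::semiring_1 mat list"
  assumes "\<And>M. M \<in> set Ms \<Longrightarrow> M \<in> sq_mats d"
  shows "kron (mprod d Ms) (1\<^sub>m e) = mprod (d * e) (map (\<lambda>M. kron M (1\<^sub>m e)) Ms)"
  using assms
proof (induction Ms)
  case (Cons M Ms)
  have c: "mprod d Ms \<in> sq_mats d" "M \<in> sq_mats d" using Cons.prems by (auto intro!: mprod_carrier)
  have "kron (M * mprod d Ms) (1\<^sub>m e) = kron M (1\<^sub>m e) * kron (mprod d Ms) (1\<^sub>m e)"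
    using kron_mult_ecomm[OF c(2) one_carrier_mat c(1) one_carrier_mat, of e] by simp
  then show ?case using Cons by (simp add: mprod_def)
qed (simp add: mprod_def)

lemma Dn_carrier[simp]: "Dn n \<in> sq_mats (N ^ n)"
  unfolding Dn_def by (rule mprod_carrier) auto

lemma Dn_0: "Dn 0 = 1\<^sub>m 1"
  by (simp add: Dn_def mprod_def)

lemma Dn_Suc: "Dn (Suc n) = kron (Dn n) D"
proof -
  have e: "[1..<Suc n + 1] = [1..<n + 1] @ [Suc n]" by simp
  have m: "map (\<lambda>i. op_at N (Suc n) i 1 D) [1..<n + 1] = map (\<lambda>M. kron M (1\<^sub>m N)) (map (\<lambda>i. op_at N n i 1 D) [1..<n + 1])"
  proof -
    have "op_at N (Suc n) i 1 D = kron (op_at N n i 1 D) (1\<^sub>m N)" if "i \<in> set [1..<n + 1]" for i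
    proof -
      have "0 < i" "i \<le> n" using that by auto
      then show ?thesis using kron_op_at_left[of D N 1 i n 1] by simp
    qed
    then show ?thesis by (simp only: map_map comp_def cong: map_cong)
  qed
  have l: "op_at N (Suc n) (Suc n) 1 D = kron (1\<^sub>m (N ^ n)) D" by (simp add: op_at_def)
  have "Dn (Suc n) = mprod (N ^ Suc n) (map (\<lambda>i. op_at N (Suc n) i 1 D) [1..<n + 1]) * mprod (N ^ Suc n) [op_at N (Suc n) (Suc n) 1 D]"
    unfolding Dn_def e map_append list.map
  proof (rule mprod_append)
    fix M assume "M \<in> set (map (\<lambda>i. op_at N (Suc n) i 1 D) [1..<n + 1]) \<union> set [op_at N (Suc n) (Suc n) 1 D]"
    then have "M \<in> (\<lambda>i. op_at N (Suc n) i 1 D) ` set ([1..<n + 1] @ [Suc n])" by simp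
    then obtain i where "i \<in> set ([1..<n + 1] @ [Suc n])" and M: "M = op_at N (Suc n) i 1 D" by blast
    then have i: "0 < i" "i \<le> Suc n" by auto
    show "M \<in> sq_mats (N ^ Suc n)" unfolding M by (rule op_at_carrier) (use i in auto)
  qed
  also have "mprod (N ^ Suc n) [op_at N (Suc n) (Suc n) 1 D] = kron (1\<^sub>m (N ^ n)) D"
    unfolding mprod_def l using right_mult_one_mat[OF kron_carrier[of "1\<^sub>m (N ^ n)" "N ^ n" "N ^ n" D N N]] by (simp add: mult.commute)
  also have "mprod (N ^ Suc n) (map (\<lambda>i. op_at N (Suc n) i 1 D) [1..<n + 1]) = kron (Dn n) (1\<^sub>m N)"
    unfolding m Dn_def by (subst mprod_kron_one) (auto simp: mult.commute)
  also have "kron (Dn n) (1\<^sub>m N) * kron (1\<^sub>m (N ^ n)) D = kron (Dn n) D"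
    using kron_mult_complex[OF Dn_carrier one_carrier_mat one_carrier_mat D_carrier]
      right_mult_one_mat[OF Dn_carrier] left_mult_one_mat[OF D_carrier] by simp
  finally show ?thesis .
qed

text \<open>Rewrites a relation of braid type as an equality of two conjugates, the form of the
  hypothesis \<open>comp\<close> in \<open>trace_conj_index\<close>.\<close>

lemma conj_swap:
  fixes X :: "complex mat"
  assumes c: "X \<in> sq_mats d" "Y \<in> sq_mats d" "G \<in> sq_mats d" "Gi \<in> sq_mats d" "H \<in> sq_mats d" "Hi \<in> sq_mats d"
    and inv: "G * Gi = 1\<^sub>m d" "Hi * H = 1\<^sub>m d" and eq: "X * H * G = H * G * Y"
  shows "G * (Y * Gi) = Hi * (X * H)"
proof -
  note a = sq_assoc[where d = d] sq_one[where d = d]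
  have "G * (Y * Gi) = (Hi * H) * G * Y * Gi" unfolding inv using c by (simp add: a)
  also have "\<dots> = Hi * (H * G * Y) * Gi" using c by (simp add: a)
  also have "\<dots> = Hi * (X * H) * (G * Gi)" unfolding eq[symmetric] using c by (simp add: a)
  finally show ?thesis unfolding inv using c by (simp add: a)
qed

text \<open>Writing \<open>Psi_21\<close> for \<open>Psi\<close> with its two factors exchanged, the
  braid relation gives \<open>Ri D_2 = D_1 Psi_21\<close> and \<open>D_2 Ri = Psi_21 D_1\<close>.
  Hence \<open>Ri D_1 D_2\<close> and \<open>D_1 D_2 Ri\<close> both equal
  \<open>D_1 Psi_21 D_1\<close>, and the claim for \<open>R\<close> follows by inversion.\<close>

lemma DD_R: "kron D D * R = R * kron D D"
proof -
  have cc: "kron D D \<in> sq_mats (N ^ 2)" using kron_carrier[OF D_carrier D_carrier] by (simp add: power2_eq_square)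
  have R3: "op_at N 3 1 2 R * op_at N 3 2 2 R * op_at N 3 1 2 R = op_at N 3 2 2 R * op_at N 3 1 2 R * op_at N 3 2 2 R"
    using RR unfolding R_matrix_def by auto
  let ?r = "op_at N 3 1 2 R" and ?s = "op_at N 3 2 2 R" and ?ri = "op_at N 3 1 2 Ri" and ?si = "op_at N 3 2 2 Ri"
  note c3 = op3_carrier[OF R_carrier] op3_carrier[OF Ri_carrier]
  have inv: "?r * ?ri = 1\<^sub>m (N ^ 3)" "?ri * ?r = 1\<^sub>m (N ^ 3)" "?s * ?si = 1\<^sub>m (N ^ 3)" "?si * ?s = 1\<^sub>m (N ^ 3)"
    using inv_n[of 1 3] inv_n[of 2 3] by auto
  have A: "?s * (?r * ?si) = ?ri * (?s * ?r)" and B: "?si * (?r * ?s) = ?r * (?s * ?ri)"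
    using conj_swap[OF c3(2,1,2,4,1,3) inv(3,2) R3[symmetric]] conj_swap[OF c3(1,2,1,3,2,4) inv(1,4) R3] by simp_all
  \<comment> \<open>\<open>Ri D_2 = D_1 Psi_21\<close>: \<open>trace_conj_index\<close> for
    conjugation by \<open>R\<close> is a linear system for the left side with coefficients
    \<open>R\<close>, solved by \<open>skew_solve\<close>.\<close>
  have s1: "(\<Sum>s<N. en Ri r u y s * D $$ (s, v)) = (\<Sum>p<N. D $$ (r, p) * en Psi u p v y)"
    if i: "r < N" "u < N" "y < N" "v < N" for r u y v
  proof -
    define h where "h t e = (\<Sum>s<N. en Ri r e y s * D $$ (s, t))" for t e
    have "(\<Sum>t<N. \<Sum>e<N. en R x t p e * h t e) = (if x = y then D $$ (r, p) else 0)" if xp: "x < N" "p < N" for x p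
    proof -
      have "(\<Sum>t<N. \<Sum>e<N. en R x t p e * h t e) = (\<Sum>t<N. \<Sum>e<N. \<Sum>s<N. D $$ (s, t) * en R x t p e * en Ri r e y s)"
        unfolding h_def by (simp add: sum_distrib_left ac_simps)
      also have "\<dots> = (\<Sum>e<N. \<Sum>t<N. \<Sum>s<N. D $$ (s, t) * en R x t p e * en Ri r e y s)" by (rule sum.swap)
      also have "\<dots> = (\<Sum>e<N. \<Sum>s<N. \<Sum>t<N. D $$ (s, t) * en R x t p e * en Ri r e y s)"
        by (rule sum.cong[OF refl], rule sum.swap)
      also have "\<dots> = (if x = y then D $$ (r, p) else 0)"
        using trace_conj_index[OF R_carrier Ri_carrier Ri_R A xp(1) i(3) xp(2) i(1)] .
      finally show ?thesis .
    qed
    then have "h v u = (\<Sum>p<N. \<Sum>x<N. en Psi u p v x * (if x = y then D $$ (r, p) else 0))"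
      by (rule skew_solve) (use i in auto)
    also have "\<dots> = (\<Sum>p<N. \<Sum>x<N. if x = y then en Psi u p v x * D $$ (r, p) else 0)"
      by (intro sum.cong refl) auto
    also have "\<dots> = (\<Sum>p<N. D $$ (r, p) * en Psi u p v y)" using i by (simp add: mult.commute)
    finally show ?thesis unfolding h_def .
  qed
  \<comment> \<open>\<open>D_2 Ri = Psi_21 D_1\<close>, in the same way from conjugation by
    \<open>Ri\<close>, with the other factor of the product as the unknown.\<close>
  have s2: "(\<Sum>t<N. D $$ (u, t) * en Ri x t p v) = (\<Sum>r<N. en Psi u x v r * D $$ (r, p))"
    if i: "u < N" "x < N" "p < N" "v < N" for u x p v
  proof -
    define h where "h e s = (\<Sum>t<N. D $$ (s, t) * en Ri x t p e)" for e s
    have "(\<Sum>e<N. \<Sum>s<N. en R r e y s * h e s) = (if x = y then D $$ (r, p) else 0)" if ry: "r < N" "y < N" for r y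
    proof -
      have "(\<Sum>e<N. \<Sum>s<N. en R r e y s * h e s) = (\<Sum>e<N. \<Sum>s<N. \<Sum>t<N. D $$ (s, t) * en Ri x t p e * en R r e y s)"
        unfolding h_def by (simp add: sum_distrib_left ac_simps)
      also have "\<dots> = (if x = y then D $$ (r, p) else 0)"
        using trace_conj_index[OF Ri_carrier R_carrier R_Ri B i(2) ry(2) i(3) ry(1)] .
      finally show ?thesis .
    qed
    then have "h v u = (\<Sum>y<N. \<Sum>r<N. en Psi u y v r * (if x = y then D $$ (r, p) else 0))"
      by (rule skew_solve) (use i in auto)
    also have "\<dots> = (\<Sum>y<N. if y = x then \<Sum>r<N. en Psi u y v r * D $$ (r, p) else 0)"
      by (intro sum.cong refl) auto
    also have "\<dots> = (\<Sum>r<N. en Psi u x v r * D $$ (r, p))" using i by simp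
    finally show ?thesis unfolding h_def .
  qed
  have enD: "en (kron D D) a b c d = D $$ (a, c) * D $$ (b, d)" if "a < N" "b < N" "c < N" "d < N" for a b c d
    unfolding en_def using kron_index_pair[OF D_carrier D_carrier] that by simp
  have "kron D D * Ri = Ri * kron D D"
  proof (rule en_eqI)
    fix r u x v assume i: "r < N" "u < N" "x < N" "v < N"
    have "en (Ri * kron D D) r u x v = (\<Sum>y<N. \<Sum>s<N. D $$ (y, x) * (en Ri r u y s * D $$ (s, v)))"
      using i by (simp add: en_mult[OF Ri_carrier cc] enD ac_simps)
    also have "\<dots> = (\<Sum>y<N. D $$ (y, x) * (\<Sum>p<N. D $$ (r, p) * en Psi u p v y))"
      using i by (simp flip: s1 sum_distrib_left)
    also have "\<dots> = (\<Sum>y<N. \<Sum>p<N. D $$ (r, p) * (en Psi u p v y * D $$ (y, x)))"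
      by (simp add: sum_distrib_left ac_simps)
    also have "\<dots> = (\<Sum>p<N. \<Sum>y<N. D $$ (r, p) * (en Psi u p v y * D $$ (y, x)))" by (rule sum.swap)
    also have "\<dots> = (\<Sum>p<N. D $$ (r, p) * (\<Sum>y<N. en Psi u p v y * D $$ (y, x)))"
      by (simp add: sum_distrib_left)
    also have "\<dots> = (\<Sum>p<N. D $$ (r, p) * (\<Sum>t<N. D $$ (u, t) * en Ri p t x v))"
      using i by (simp add: s2)
    also have "\<dots> = en (kron D D * Ri) r u x v"
      using i by (simp add: en_mult[OF cc Ri_carrier] enD sum_distrib_left ac_simps)
    finally show "en (kron D D * Ri) r u x v = en (Ri * kron D D) r u x v" by simp
  qed (use cc in auto)
  then have e: "R * (kron D D * Ri) * R = R * (Ri * kron D D) * R" by simp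
  have "R * (kron D D * Ri) * R = R * kron D D * (Ri * R)" using cc by (simp add: sq_assoc[where d = "N ^ 2"])
  moreover have "R * (Ri * kron D D) * R = (R * Ri) * (kron D D * R)" using cc by (simp add: sq_assoc[where d = "N ^ 2"])
  ultimately show ?thesis using e cc
    by (simp add: R_Ri Ri_R sq_one[where d = "N ^ 2"])
qed

lemma Dn_rn: "0 < j \<Longrightarrow> j < n \<Longrightarrow> Dn n * rn n j = rn n j * Dn n"
proof (induction n)
  case (Suc n)
  show ?case
  proof (cases "j < n")
    case True
    have r: "rn (Suc n) j = kron (rn n j) (1\<^sub>m N)" using kron_op_at_left[of R N 2 j n 1] Suc.prems True by simp
    have c: "rn n j \<in> sq_mats (N ^ n)" using True Suc.prems by auto
    show ?thesis unfolding Dn_Suc r kron_mult_complex[OF Dn_carrier D_carrier c one_carrier_mat]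
        kron_mult_complex[OF c one_carrier_mat Dn_carrier D_carrier] left_mult_one_mat[OF D_carrier] right_mult_one_mat[OF D_carrier] using Suc.IH True Suc.prems by simp
  next
    case False
    then obtain m where n: "n = Suc m" using Suc.prems by (cases n) auto
    then have j: "j = Suc m" using False Suc.prems by linarith
    have r: "rn (Suc n) j = kron (1\<^sub>m (N ^ m)) R" unfolding n j by (simp add: op_at_def)
    have cc: "kron D D \<in> sq_mats (N ^ 2)" using kron_carrier[OF D_carrier D_carrier] by (simp add: power2_eq_square)
    show ?thesis unfolding r unfolding n Dn_Suc kron_assoc kron_mult_complex[OF Dn_carrier cc one_carrier_mat R_carrier]
        kron_mult_complex[OF one_carrier_mat R_carrier Dn_carrier cc] DD_R
        left_mult_one_mat[OF Dn_carrier] right_mult_one_mat[OF Dn_carrier] ..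
  qed
qed simp

lemma Dn_alg: "A \<in> alg n \<Longrightarrow> Dn n * A = A * Dn n"
proof (induction rule: alg.induct)
  case (alg_R j)
  then show ?case by (rule Dn_rn)
next
  case (alg_Ri j)
  have c: "rn n j \<in> sq_mats (N ^ n)" "rin n j \<in> sq_mats (N ^ n)" using alg_Ri by auto
  have "rin n j * (Dn n * rn n j) * rin n j = rin n j * (rn n j * Dn n) * rin n j" using Dn_rn[OF alg_Ri] by simp
  moreover have "rin n j * (Dn n * rn n j) * rin n j = rin n j * Dn n * (rn n j * rin n j)" using c by (simp add: sq_assoc[where d = "N ^ n"])
  moreover have "rin n j * (rn n j * Dn n) * rin n j = (rin n j * rn n j) * (Dn n * rin n j)" using c by (simp add: sq_assoc[where d = "N ^ n"])
  ultimately show ?case using alg_Ri c right_mult_one_mat[OF sq_mult_carrier[OF c(2) Dn_carrier]] by (simp add: inv_n left_mult_one_mat[of _ "N ^ n" "N ^ n"])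
next
  case (alg_add A B)
  then show ?case using add_mult_distrib_mat[OF alg_carrier[OF alg_add(1)] alg_carrier[OF alg_add(2)] Dn_carrier]
    mult_add_distrib_mat[OF Dn_carrier alg_carrier[OF alg_add(1)] alg_carrier[OF alg_add(2)]] by simp
next
  case (alg_mult A B)
  note c = alg_carrier[OF alg_mult(1)] alg_carrier[OF alg_mult(2)]
  show ?case unfolding assoc_mult_mat[OF Dn_carrier c, symmetric] alg_mult.IH(1) assoc_mult_mat[OF c(1) Dn_carrier c(2)]
    alg_mult.IH(2) by (rule assoc_mult_mat[OF c Dn_carrier, symmetric])
next
  case (alg_smult A c)
  then show ?case using mult_smult_assoc_mat[OF alg_carrier[OF alg_smult(1)] Dn_carrier] mult_smult_distrib[OF Dn_carrier alg_carrier[OF alg_smult(1)]] by simp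
qed (simp add: left_mult_one_mat[OF Dn_carrier] right_mult_one_mat[OF Dn_carrier])

end

section \<open>Products of shifted generator matrices\<close>

lemma kron_one_mult:
  fixes A :: "'a::semiring_1 mat"
  assumes "A \<in> sq_mats a" "B \<in> sq_mats a"
  shows "kron (A * B) (1\<^sub>m e) = kron A (1\<^sub>m e) * kron B (1\<^sub>m e)"
  using kron_mult_ecomm[OF assms(1) one_carrier_mat assms(2) one_carrier_mat, of e] by simp

context qma_pair begin

abbreviation "mb \<equiv> Mbar N F"

lemma M_gen_carrier[simp]: "M_gen N \<in> sq_mats N"
  by (simp add: M_gen_def)

lemma mb_Suc: "0 < i \<Longrightarrow> mb n (Suc i) = cmat (fn n i) * mb n i * cmat (fin n i)"
  by (cases i) (auto simp: Let_def)

lemma mb_carrier[simp]: "0 < i \<Longrightarrow> i \<le> n \<Longrightarrow> mb n i \<in> sq_mats (N ^ n)"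
proof (induction i rule: nat_induct_non_zero)
  case 1
  then show ?case using op_at_carrier[of "M_gen N" N 1 1 n] by simp
next
  case (Suc i)
  then show ?case by (simp add: mb_Suc sq_mult_carrier[of _ "N ^ n"])
qed

lemma kron_cmat_one: "kron (cmat A) (1\<^sub>m e) = cmat (kron A (1\<^sub>m e))"
  by (simp add: cmat_kron)

lemma kron_mb: "0 < i \<Longrightarrow> i \<le> n \<Longrightarrow> kron (mb n i) (1\<^sub>m N) = mb (Suc n) i"
proof (induction i rule: nat_induct_non_zero)
  case 1
  then show ?case using kron_op_at_left[of "M_gen N" N 1 1 n 1] by simp
next
  case (Suc i)
  have k: "kron (op_at N n i 2 Z) (1\<^sub>m N) = op_at N (Suc n) i 2 Z" if "Z \<in> sq_mats (N ^ 2)" for Z :: "complex mat"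
    using kron_op_at_left[of Z N 2 i n 1] that Suc by simp
  have c: "cmat (fn n i) \<in> sq_mats (N ^ n)" "cmat (fin n i) \<in> sq_mats (N ^ n)" "mb n i \<in> sq_mats (N ^ n)"
    using Suc by auto
  show ?case using Suc
    by (simp only: mb_Suc kron_one_mult[OF sq_mult_carrier[OF c(1,3)] c(2)] kron_one_mult[OF c(1,3)] kron_cmat_one k[OF F_carrier] k[OF Fi_carrier])
qed

abbreviation "cV n m \<equiv> cmat (strand F n m)"
abbreviation "cVi n m \<equiv> cmat (strand_inv Fi n m)"

lemma cV_cVi: "m < n \<Longrightarrow> cV n m * cVi n m = 1\<^sub>m (N ^ n)" "m < n \<Longrightarrow> cVi n m * cV n m = 1\<^sub>m (N ^ n)"
  using strand_cancel[OF F_carrier Fi_carrier F_Fi, of m n] strand_inv_cancel[of m n]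
    cmat_mult[of "strand F n m" "N ^ n" "N ^ n" "strand_inv Fi n m" "N ^ n"]
    cmat_mult[of "strand_inv Fi n m" "N ^ n" "N ^ n" "strand F n m" "N ^ n"] by auto

lemma cmat_inv_n: assumes "0 < j" "j < n"
  shows "cmat (fn n j) * cmat (fin n j) = 1\<^sub>m (N ^ n)" "cmat (fin n j) * cmat (fn n j) = 1\<^sub>m (N ^ n)"
  using inv_n[OF assms] assms
    cmat_mult[of "fn n j" "N ^ n" "N ^ n" "fin n j" "N ^ n"] cmat_mult[of "fin n j" "N ^ n" "N ^ n" "fn n j" "N ^ n"] by auto

text \<open>Only the first \<open>F\<close> of the strand touches the first factor. All later ones
  commute with the first \<open>M\<close> and cancel against their inverses.\<close>

lemma mb_two: "0 < m \<Longrightarrow> m < n \<Longrightarrow> cV n m * mb n 1 * cVi n m = mb n 2"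
proof (induction m rule: nat_induct_non_zero)
  case 1
  have c: "fn n 1 \<in> sq_mats (N ^ n)" "fin n 1 \<in> sq_mats (N ^ n)" using 1 by auto
  have "strand F n 1 = fn n 1" "strand_inv Fi n 1 = fin n 1" using c by simp_all
  then show ?case using mb_Suc[of 1 n] by (simp add: numeral_2_eq_2)
next
  case (Suc m)
  have c: "cV n m \<in> sq_mats (N ^ n)" "cVi n m \<in> sq_mats (N ^ n)" "mb n 1 \<in> sq_mats (N ^ n)"
    "cmat (fn n (Suc m)) \<in> sq_mats (N ^ n)" "cmat (fin n (Suc m)) \<in> sq_mats (N ^ n)"
    using Suc by auto
  note a = sq_assoc[where d = "N ^ n"]
  have e: "cV n (Suc m) = cV n m * cmat (fn n (Suc m))" "cVi n (Suc m) = cmat (fin n (Suc m)) * cVi n m"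
    using Suc cmat_mult[of "strand F n m" "N ^ n" "N ^ n" "fn n (Suc m)" "N ^ n"]
      cmat_mult[of "fin n (Suc m)" "N ^ n" "N ^ n" "strand_inv Fi n m" "N ^ n"] by auto
  have comm: "mb n 1 * cmat (fn n (Suc m)) = cmat (fn n (Suc m)) * mb n 1"
    unfolding cmat_op_at Mbar.simps One_nat_def using Suc by (intro op_at_comm) auto
  have "cV n (Suc m) * mb n 1 * cVi n (Suc m)
    = cV n m * (cmat (fn n (Suc m)) * mb n 1) * cmat (fin n (Suc m)) * cVi n m"
    unfolding e using c by (simp add: a)
  also have "\<dots> = cV n m * mb n 1 * (cmat (fn n (Suc m)) * cmat (fin n (Suc m))) * cVi n m"
    unfolding comm[symmetric] using c by (simp add: a)
  also have "\<dots> = cV n m * mb n 1 * cVi n m"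
    using c Suc cmat_inv_n[of "Suc m" n] right_mult_one_mat[OF sq_mult_carrier[OF c(1,3)]] by simp
  finally show ?case using Suc by simp
qed

text \<open>Conjugation by the full strand raises the barred index by one. The start is
  \<open>mb_two\<close>; afterwards the strand shifts the \<open>F\<close> at \<open>i\<close> to
  the one at \<open>Suc i\<close>, by the braid relation of \<open>F\<close>, which reproduces the
  recursion for \<open>M\<close>.\<close>

lemma mb_conj: "0 < i \<Longrightarrow> Suc i \<le> n \<Longrightarrow> mb n (Suc i) = cV n (n - 1) * mb n i * cVi n (n - 1)"
proof (induction i rule: nat_induct_non_zero)
  case 1
  then show ?case using mb_two[of "n - 1" n] by (simp add: numeral_2_eq_2)
next
  case (Suc i)
  let ?V = "strand F n (n - 1)" and ?Vi = "strand_inv Fi n (n - 1)"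
  let ?f = "cmat (fn n i)" and ?g = "cmat (fin n i)" and ?f' = "cmat (fn n (Suc i))" and ?g' = "cmat (fin n (Suc i))"
  note a = sq_assoc[where d = "N ^ n"]
  have co: "?V \<in> sq_mats (N ^ n)" "?Vi \<in> sq_mats (N ^ n)"
     "fn n i \<in> sq_mats (N ^ n)" "fin n i \<in> sq_mats (N ^ n)"
     "fn n (Suc i) \<in> sq_mats (N ^ n)" "fin n (Suc i) \<in> sq_mats (N ^ n)"
    using Suc by auto
  have c: "cmat ?V \<in> sq_mats (N ^ n)" "cmat ?Vi \<in> sq_mats (N ^ n)" "mb n i \<in> sq_mats (N ^ n)"
    "?f \<in> sq_mats (N ^ n)" "?g \<in> sq_mats (N ^ n)"
    "?f' \<in> sq_mats (N ^ n)" "?g' \<in> sq_mats (N ^ n)"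
    using Suc co by auto
  have "fn n (Suc i) * ?V = ?V * fn n i"
    using Suc by (intro strand_slide comp_n) auto
  from arg_cong[OF this, of cmat] have s1: "?f' * cmat ?V = cmat ?V * ?f"
    using cmat_mult[OF co(5,1)] cmat_mult[OF co(1,3)] by simp
  have cc: "cmat ?V * cmat ?Vi = 1\<^sub>m (N ^ n)" "cmat ?Vi * cmat ?V = 1\<^sub>m (N ^ n)"
    using cV_cVi[of "n - 1" n] Suc by auto
  have ii: "?f * ?g = 1\<^sub>m (N ^ n)" "?g * ?f = 1\<^sub>m (N ^ n)" "?f' * ?g' = 1\<^sub>m (N ^ n)" "?g' * ?f' = 1\<^sub>m (N ^ n)"
    using cmat_inv_n[of i n] cmat_inv_n[of "Suc i" n] Suc by auto
  note o = sq_one[where d = "N ^ n"]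
  have s2: "cmat ?Vi * ?g' = ?g * cmat ?Vi"
  proof -
    have "cmat ?Vi * ?g' = (?g * ?f) * cmat ?Vi * ?g'" unfolding ii using c by (simp add: a o)
    also have "\<dots> = ?g * (cmat ?Vi * cmat ?V) * ?f * cmat ?Vi * ?g'" unfolding cc using c by (simp add: a o)
    also have "\<dots> = ?g * cmat ?Vi * (cmat ?V * ?f) * cmat ?Vi * ?g'" using c by (simp add: a)
    also have "\<dots> = ?g * cmat ?Vi * (?f' * (cmat ?V * cmat ?Vi) * ?g')" unfolding s1[symmetric] using c by (simp add: a)
    also have "\<dots> = ?g * cmat ?Vi" unfolding cc using c ii by (simp add: a o)
    finally show ?thesis .
  qed
  have "mb n (Suc (Suc i)) = ?f' * mb n (Suc i) * ?g'" by (rule mb_Suc) simp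
  also have "\<dots> = (?f' * cmat ?V) * mb n i * (cmat ?Vi * ?g')" using Suc c by (simp add: a)
  also have "\<dots> = cmat ?V * (?f * mb n i * ?g) * cmat ?Vi" unfolding s1 s2 using c by (simp add: a)
  also have "?f * mb n i * ?g = mb n (Suc i)" using mb_Suc[of i n] Suc by simp
  finally show ?case .
qed

text \<open>\<open>TS n s m\<close> is the product of the \<open>M\<close> with barred indices \<open>s + 1, \<dots>, s + m\<close>.\<close>

fun TS :: "nat \<Rightarrow> nat \<Rightarrow> nat \<Rightarrow> qpoly mat" where
  "TS n s 0 = 1\<^sub>m (N ^ n)"
| "TS n s (Suc m) = TS n s m * mb n (Suc (s + m))"

lemma TS_carrier[simp]: "s + m \<le> n \<Longrightarrow> TS n s m \<in> sq_mats (N ^ n)"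
  by (induction m) auto

lemma TS_add: "s + m + l \<le> n \<Longrightarrow> TS n s (m + l) = TS n s m * TS n (s + m) l"
proof (induction l)
  case 0
  then show ?case using right_mult_one_mat[OF TS_carrier[of s m n]] by simp
next
  case (Suc l)
  have c: "TS n s m \<in> sq_mats (N ^ n)" "TS n (s + m) l \<in> sq_mats (N ^ n)"
    "mb n (Suc (s + m + l)) \<in> sq_mats (N ^ n)" using Suc by auto
  show ?case using Suc assoc_mult_mat[OF c] by (simp add: add.assoc)
qed

lemma mprod_TS: "m \<le> n \<Longrightarrow> mprod (N ^ n) (map (mb n) [1..<m + 1]) = TS n 0 m"
proof (induction m)
  case 0
  then show ?case by (simp add: mprod_def)
next
  case (Suc m)
  have l: "mprod (N ^ n) (map (mb n) [Suc m]) = mb n (Suc m)"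
    unfolding mprod_def using Suc right_mult_one_mat[OF mb_carrier[of "Suc m" n]] by simp
  have e: "[1..<Suc m + 1] = [1..<m + 1] @ [Suc m]" by simp
  have "mprod (N ^ n) (map (mb n) [1..<Suc m + 1]) = mprod (N ^ n) (map (mb n) [1..<m + 1]) * mprod (N ^ n) (map (mb n) [Suc m])"
    unfolding e map_append using Suc by (intro mprod_append) (auto simp del: Mbar.simps)
  then show ?case unfolding l using Suc by simp
qed

lemma TS_shift: "Suc (s + m) \<le> n \<Longrightarrow> TS n (Suc s) m = cV n (n - 1) * TS n s m * cVi n (n - 1)"
proof (induction m)
  case 0
  have c: "cV n (n - 1) \<in> sq_mats (N ^ n)" using 0 by auto
  show ?case using cV_cVi[of "n - 1" n] 0 right_mult_one_mat[OF c] by simp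
next
  case (Suc m)
  note a = sq_assoc[where d = "N ^ n"]
  let ?V = "cV n (n - 1)" and ?Vi = "cVi n (n - 1)"
  have c: "?V \<in> sq_mats (N ^ n)" "?Vi \<in> sq_mats (N ^ n)" "TS n s m \<in> sq_mats (N ^ n)"
    "mb n (Suc (s + m)) \<in> sq_mats (N ^ n)" using Suc by auto
  have "TS n (Suc s) (Suc m) = (?V * TS n s m * ?Vi) * (?V * mb n (Suc (s + m)) * ?Vi)"
    using Suc mb_conj[of "Suc (s + m)" n] by simp
  also have "\<dots> = ?V * TS n s m * (?Vi * ?V) * mb n (Suc (s + m)) * ?Vi" using c by (simp add: a)
  also have "\<dots> = ?V * TS n s (Suc m) * ?Vi" using cV_cVi[of "n - 1" n] Suc c
    by (simp add: a sq_one[where d = "N ^ n"])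
  finally show ?case .
qed

lemma kron_TS: "s + m \<le> n \<Longrightarrow> kron (TS n s m) (1\<^sub>m N) = TS (Suc n) s m"
proof (induction m)
  case 0
  then show ?case by (simp add: mult.commute)
next
  case (Suc m)
  have c: "TS n s m \<in> sq_mats (N ^ n)" "mb n (Suc (s + m)) \<in> sq_mats (N ^ n)" using Suc by auto
  show ?case using Suc kron_mb[of "Suc (s + m)" n] by (simp add: kron_one_mult[OF c] del: Mbar.simps)
qed

lemma kron_TS_pow: "s + m \<le> n \<Longrightarrow> kron (TS n s m) (1\<^sub>m (N ^ l)) = TS (n + l) s m"
proof (induction l)
  case (Suc l)
  have "kron (TS n s m) (1\<^sub>m (N ^ Suc l)) = kron (kron (TS n s m) (1\<^sub>m (N ^ l))) (1\<^sub>m N)"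
    unfolding kron_assoc kron_one by (simp add: mult.commute)
  then show ?case using Suc kron_TS[of s m "n + l"] by simp
qed simp

text \<open>The R-trace over the last factor.\<close>

definition ptr :: "qpoly mat \<Rightarrow> qpoly mat" where
  "ptr X = mat (dim_row X div N) (dim_col X div N)
     (\<lambda>(a, b). \<Sum>s<N. \<Sum>t<N. const (D $$ (s, t)) * X $$ (a * N + t, b * N + s))"

lemma ptr_carrier[simp]: "X \<in> carrier_mat (a * N) (b * N) \<Longrightarrow> ptr X \<in> carrier_mat a b"
  using N0 by (auto simp: ptr_def)

lemma ptr_carrier_pow[simp]: "X \<in> sq_mats (N ^ Suc n) \<Longrightarrow> ptr X \<in> sq_mats (N ^ n)"
  by (rule ptr_carrier) (simp add: mult.commute)

lemma ptr_index: "X \<in> carrier_mat (a * N) (b * N) \<Longrightarrow> i < a \<Longrightarrow> j < b \<Longrightarrow>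
   ptr X $$ (i, j) = (\<Sum>s<N. \<Sum>t<N. const (D $$ (s, t)) * X $$ (i * N + t, j * N + s))"
  using N0 by (auto simp: ptr_def)

lemma qdelta: "t < N \<Longrightarrow> (\<Sum>u<N. f u * (if t = u then 1 else 0)) = (f t :: qpoly)"
  "t < N \<Longrightarrow> (\<Sum>u<N. (if t = u then 1 else 0) * f u) = (f t :: qpoly)"
  "t < N \<Longrightarrow> (\<Sum>u<N. f u * (if u = t then 1 else 0)) = (f t :: qpoly)"
  by (simp_all add: if_distrib[of "\<lambda>z. _ * z"] if_distrib[of "\<lambda>z. z * _"] cong: if_cong)

lemma kron_one_index_left:
  fixes A :: "qpoly mat"
  assumes A: "A \<in> carrier_mat a b" and X: "X \<in> carrier_mat (b * N) e" and i: "i < a" "t < N" "j < e"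
  shows "(kron A (1\<^sub>m N) * X) $$ (i * N + t, j) = (\<Sum>c<b. A $$ (i, c) * X $$ (c * N + t, j))"
proof -
  have "(kron A (1\<^sub>m N) * X) $$ (i * N + t, j) = (\<Sum>c<b. \<Sum>u<N. kron A (1\<^sub>m N) $$ (i * N + t, c * N + u) * X $$ (c * N + u, j))"
    using index_mult_mat_sum[OF kron_carrier[OF A one_carrier_mat] X pair_index_less[OF i(1,2)] i(3)]
    by (simp add: sum_split_mult)
  also have "\<dots> = (\<Sum>c<b. \<Sum>u<N. (if t = u then 1 else 0) * (A $$ (i, c) * X $$ (c * N + u, j)))"
    using i by (intro sum.cong refl) (auto simp: kron_index_pair[OF A one_carrier_mat])
  finally show ?thesis using i by (simp only: qdelta)
qed

lemma kron_one_index_right: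
  fixes B :: "qpoly mat"
  assumes B: "B \<in> carrier_mat a b" and X: "X \<in> carrier_mat e (a * N)" and i: "i < e" "j < b" "s < N"
  shows "(X * kron B (1\<^sub>m N)) $$ (i, j * N + s) = (\<Sum>c<a. X $$ (i, c * N + s) * B $$ (c, j))"
proof -
  have "(X * kron B (1\<^sub>m N)) $$ (i, j * N + s) = (\<Sum>c<a. \<Sum>u<N. X $$ (i, c * N + u) * kron B (1\<^sub>m N) $$ (c * N + u, j * N + s))"
    using index_mult_mat_sum[OF X kron_carrier[OF B one_carrier_mat] i(1) pair_index_less[OF i(2,3)]]
    by (simp add: sum_split_mult)
  also have "\<dots> = (\<Sum>c<a. \<Sum>u<N. (X $$ (i, c * N + u) * B $$ (c, j)) * (if u = s then 1 else 0))"
    using i by (intro sum.cong refl) (auto simp: kron_index_pair[OF B one_carrier_mat])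
  finally show ?thesis using i by (simp only: qdelta)
qed

text \<open>The entries of \<open>D\<close> enter as central scalars, so they pass the
  noncommutative entries of \<open>A\<close>.\<close>

lemma ptr_left:
  assumes A: "A \<in> sq_mats a" and X: "X \<in> sq_mats (a * N)"
  shows "ptr (kron A (1\<^sub>m N) * X) = A * ptr X"
proof (rule eq_matI)
  have c: "kron A (1\<^sub>m N) * X \<in> sq_mats (a * N)" using A X by auto
  fix i j assume "i < dim_row (A * ptr X)" "j < dim_col (A * ptr X)"
  then have ij: "i < a" "j < a" using A ptr_carrier[OF X] by auto
  have "ptr (kron A (1\<^sub>m N) * X) $$ (i, j)
    = (\<Sum>s<N. \<Sum>t<N. \<Sum>c<a. const (D $$ (s, t)) * (A $$ (i, c) * X $$ (c * N + t, j * N + s)))"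
    unfolding ptr_index[OF c ij] using ij
    by (intro sum.cong refl) (simp add: kron_one_index_left[OF A X] pair_index_less sum_distrib_left del: index_mult_mat)
  also have "\<dots> = (\<Sum>s<N. \<Sum>c<a. \<Sum>t<N. const (D $$ (s, t)) * (A $$ (i, c) * X $$ (c * N + t, j * N + s)))"
    by (rule sum.cong[OF refl], rule sum.swap)
  also have "\<dots> = (\<Sum>c<a. \<Sum>s<N. \<Sum>t<N. const (D $$ (s, t)) * (A $$ (i, c) * X $$ (c * N + t, j * N + s)))"
    by (rule sum.swap)
  also have "\<dots> = (\<Sum>c<a. A $$ (i, c) * ptr X $$ (c, j))"
  proof (rule sum.cong[OF refl])
    fix c assume "c \<in> {..<a}"
    have "const z * (A $$ (i, c) * y) = A $$ (i, c) * (const z * y)" for z y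
      by (metis const_central mult.assoc)
    then show "(\<Sum>s<N. \<Sum>t<N. const (D $$ (s, t)) * (A $$ (i, c) * X $$ (c * N + t, j * N + s))) = A $$ (i, c) * ptr X $$ (c, j)"
      using \<open>c \<in> _\<close> ij by (simp add: ptr_index[OF X] sum_distrib_left)
  qed
  also have "\<dots> = (A * ptr X) $$ (i, j)" using index_mult_mat_sum[OF A ptr_carrier[OF X] ij] by simp
  finally show "ptr (kron A (1\<^sub>m N) * X) $$ (i, j) = (A * ptr X) $$ (i, j)" .
next
  have "kron A (1\<^sub>m N) * X \<in> sq_mats (a * N)" using A X by auto
  from ptr_carrier[OF this] show "dim_row (ptr (kron A (1\<^sub>m N) * X)) = dim_row (A * ptr X)" "dim_col (ptr (kron A (1\<^sub>m N) * X)) = dim_col (A * ptr X)"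
    using A ptr_carrier[OF X] by auto
qed

lemma ptr_right:
  assumes B: "B \<in> sq_mats a" and X: "X \<in> sq_mats (a * N)"
  shows "ptr (X * kron B (1\<^sub>m N)) = ptr X * B"
proof (rule eq_matI)
  have c: "X * kron B (1\<^sub>m N) \<in> sq_mats (a * N)" using B X by auto
  fix i j assume "i < dim_row (ptr X * B)" "j < dim_col (ptr X * B)"
  then have ij: "i < a" "j < a" using B ptr_carrier[OF X] by auto
  have "ptr (X * kron B (1\<^sub>m N)) $$ (i, j)
    = (\<Sum>s<N. \<Sum>t<N. \<Sum>c<a. const (D $$ (s, t)) * (X $$ (i * N + t, c * N + s) * B $$ (c, j)))"
    unfolding ptr_index[OF c ij] using ij
    by (intro sum.cong refl) (simp add: kron_one_index_right[OF B X] pair_index_less sum_distrib_left del: index_mult_mat)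
  also have "\<dots> = (\<Sum>s<N. \<Sum>c<a. \<Sum>t<N. const (D $$ (s, t)) * (X $$ (i * N + t, c * N + s) * B $$ (c, j)))"
    by (rule sum.cong[OF refl], rule sum.swap)
  also have "\<dots> = (\<Sum>c<a. \<Sum>s<N. \<Sum>t<N. const (D $$ (s, t)) * (X $$ (i * N + t, c * N + s) * B $$ (c, j)))"
    by (rule sum.swap)
  also have "\<dots> = (\<Sum>c<a. ptr X $$ (i, c) * B $$ (c, j))"
    using ij by (intro sum.cong refl) (simp add: ptr_index[OF X] sum_distrib_right mult.assoc)
  also have "\<dots> = (ptr X * B) $$ (i, j)" using index_mult_mat_sum[OF ptr_carrier[OF X] B ij] by simp
  finally show "ptr (X * kron B (1\<^sub>m N)) $$ (i, j) = (ptr X * B) $$ (i, j)" .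
next
  have "X * kron B (1\<^sub>m N) \<in> sq_mats (a * N)" using B X by auto
  from ptr_carrier[OF this] show "dim_row (ptr (X * kron B (1\<^sub>m N))) = dim_row (ptr X * B)" "dim_col (ptr (X * kron B (1\<^sub>m N))) = dim_col (ptr X * B)"
    using B ptr_carrier[OF X] by auto
qed

lemma trace_conj_F: assumes "x < N" "y < N" "p < N" "r < N"
  shows "(\<Sum>e<N. \<Sum>s<N. \<Sum>t<N. D $$ (s, t) * en F x t p e * en Fi r e y s) = (if x = y then D $$ (r, p) else 0)"
proof (rule trace_conj_index[OF F_carrier Fi_carrier Fi_F _ assms])
  let ?r = "op_at N 3 1 2 R" and ?s = "op_at N 3 2 2 R" and ?f = "op_at N 3 1 2 F" and ?g = "op_at N 3 2 2 F"
    and ?fi = "op_at N 3 1 2 Fi" and ?gi = "op_at N 3 2 2 Fi"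
  note c3 = op3_carrier[OF R_carrier] op3_carrier[OF F_carrier] op3_carrier[OF Fi_carrier]
  have inv: "?fi * ?f = 1\<^sub>m (N ^ 3)" "?g * ?gi = 1\<^sub>m (N ^ 3)"
    using inv_n[of 1 3] inv_n[of 2 3] by auto
  have k: "?s * ?f * ?g = ?f * ?g * ?r" using comp unfolding compatible_pair_def by auto
  show "?g * (?r * ?gi) = ?fi * (?s * ?f)" by (rule conj_swap[OF c3(2,1,4,6,3,5) inv(2,1) k])
qed

lemma cmat_en: "A \<in> sq_mats (N ^ 2) \<Longrightarrow> a < N \<Longrightarrow> b < N \<Longrightarrow> c < N \<Longrightarrow> d < N \<Longrightarrow>
   cmat A $$ (a * N + b, c * N + d) = const (en A a b c d)"
  using pair_lt by (simp add: cmat_index en_def)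

text \<open>\<open>trace_conj_F\<close> extended linearly to \<open>X\<close> with entries in the
  free algebra. The traced factor moves from the last but one to the last place, and the identity
  remains on the factor it has left.\<close>

lemma ptr_conj:
  assumes X: "X \<in> sq_mats (a * N)"
  shows "ptr (kron (1\<^sub>m a) (cmat F) * kron X (1\<^sub>m N) * kron (1\<^sub>m a) (cmat Fi)) = kron (ptr X) (1\<^sub>m N)"
proof -
  let ?e = "a * N * N"
  have cF: "kron (1\<^sub>m a) (cmat F) \<in> sq_mats ?e" "kron (1\<^sub>m a) (cmat Fi) \<in> sq_mats ?e"
    using kron_carrier[OF one_carrier_mat[of a] cmat_carrier[OF F_carrier]] kron_carrier[OF one_carrier_mat[of a] cmat_carrier[OF Fi_carrier]]
    by (simp_all add: power2_eq_square mult.assoc)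
  have cX: "kron X (1\<^sub>m N) \<in> sq_mats ?e" using X by auto
  have lt: "(i * N + x) * N + t < ?e" if "i < a" "x < N" "t < N" for i x t
    using that by (intro pair_index_less)
  have e3: "(i * N + x) * N + t = i * N ^ 2 + (x * N + t)" for i x t
    by (simp add: power2_eq_square algebra_simps)
  have Fe: "kron (1\<^sub>m a) (cmat A) $$ ((i * N + x) * N + t, (j * N + y) * N + s) = (if i = j then const (en A x t y s) else 0)"
    if "A \<in> sq_mats (N ^ 2)" "i < a" "x < N" "t < N" "j < a" "y < N" "s < N" for A i x t j y s
    unfolding e3 using that pair_lt
    by (simp add: kron_index_pair[OF one_carrier_mat cmat_carrier[OF that(1)]] cmat_en)
  have Xe: "kron X (1\<^sub>m N) $$ ((i * N + x) * N + t, (j * N + y) * N + s) = (if t = s then X $$ (i * N + x, j * N + y) else 0)"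
    if "i < a" "x < N" "t < N" "j < a" "y < N" "s < N" for i x t j y s
    using that by (simp add: kron_index_pair[OF X one_carrier_mat] pair_index_less)
  have inner: "(kron X (1\<^sub>m N) * kron (1\<^sub>m a) (cmat Fi)) $$ ((i * N + p) * N + e, (j * N + y) * N + s)
     = (\<Sum>r<N. X $$ (i * N + p, j * N + r) * const (en Fi r e y s))"
    if "i < a" "p < N" "e < N" "j < a" "y < N" "s < N" for i p e j y s
  proof -
    have "(kron X (1\<^sub>m N) * kron (1\<^sub>m a) (cmat Fi)) $$ ((i * N + p) * N + e, (j * N + y) * N + s)
      = (\<Sum>c<a. \<Sum>r<N. \<Sum>u<N. kron X (1\<^sub>m N) $$ ((i * N + p) * N + e, (c * N + r) * N + u) * kron (1\<^sub>m a) (cmat Fi) $$ ((c * N + r) * N + u, (j * N + y) * N + s))"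
      using index_mult_mat_sum[OF cX cF(2) lt lt] that by (simp add: sum_split_mult)
    also have "\<dots> = (\<Sum>c<a. if c = j then \<Sum>r<N. \<Sum>u<N. (X $$ (i * N + p, j * N + r) * const (en Fi r u y s)) * (if e = u then 1 else 0) else 0)"
      using that by (intro sum.cong refl) (auto simp: Xe Fe[OF Fi_carrier] intro!: sum.cong sum.neutral)
    also have "\<dots> = (\<Sum>r<N. \<Sum>u<N. (X $$ (i * N + p, j * N + r) * const (en Fi r u y s)) * (if e = u then 1 else 0))"
      using that by simp
    finally show ?thesis using that by (simp only: qdelta)
  qed
  have cY: "kron X (1\<^sub>m N) * kron (1\<^sub>m a) (cmat Fi) \<in> sq_mats ?e" using cX cF by auto
  have outer: "(kron (1\<^sub>m a) (cmat F) * (kron X (1\<^sub>m N) * kron (1\<^sub>m a) (cmat Fi))) $$ ((i * N + x) * N + t, (j * N + y) * N + s)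
     = (\<Sum>p<N. \<Sum>e<N. const (en F x t p e) * (\<Sum>r<N. X $$ (i * N + p, j * N + r) * const (en Fi r e y s)))"
    if "i < a" "x < N" "t < N" "j < a" "y < N" "s < N" for i x t j y s
  proof -
    have "(kron (1\<^sub>m a) (cmat F) * (kron X (1\<^sub>m N) * kron (1\<^sub>m a) (cmat Fi))) $$ ((i * N + x) * N + t, (j * N + y) * N + s)
      = (\<Sum>c<a. \<Sum>p<N. \<Sum>e<N. kron (1\<^sub>m a) (cmat F) $$ ((i * N + x) * N + t, (c * N + p) * N + e) *
          (kron X (1\<^sub>m N) * kron (1\<^sub>m a) (cmat Fi)) $$ ((c * N + p) * N + e, (j * N + y) * N + s))"
      using index_mult_mat_sum[OF cF(1) cY lt lt] that by (simp add: sum_split_mult del: index_mult_mat)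
    also have "\<dots> = (\<Sum>c<a. if c = i then \<Sum>p<N. \<Sum>e<N. const (en F x t p e) * (\<Sum>r<N. X $$ (i * N + p, j * N + r) * const (en Fi r e y s)) else 0)"
      using that by (intro sum.cong refl) (auto simp: inner Fe[OF F_carrier] simp del: index_mult_mat intro!: sum.cong sum.neutral)
    finally show ?thesis using that by simp
  qed
  have cZ: "kron (1\<^sub>m a) (cmat F) * (kron X (1\<^sub>m N) * kron (1\<^sub>m a) (cmat Fi)) \<in> sq_mats ?e" using cX cF by auto
  have as: "kron (1\<^sub>m a) (cmat F) * kron X (1\<^sub>m N) * kron (1\<^sub>m a) (cmat Fi) = kron (1\<^sub>m a) (cmat F) * (kron X (1\<^sub>m N) * kron (1\<^sub>m a) (cmat Fi))"
    using assoc_mult_mat[OF cF(1) cX cF(2)] .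
  show ?thesis unfolding as
  proof (rule eq_mat_pairI[where a = a and b = a and c = N and d = N])
    show "ptr (kron (1\<^sub>m a) (cmat F) * (kron X (1\<^sub>m N) * kron (1\<^sub>m a) (cmat Fi))) \<in> sq_mats (a * N)"
      using ptr_carrier[OF cZ] .
    show "kron (ptr X) (1\<^sub>m N) \<in> sq_mats (a * N)" using ptr_carrier[OF X] by auto
    fix i x j y assume i: "i < a" "x < N" "j < a" "y < N"
    let ?Z = "kron (1\<^sub>m a) (cmat F) * (kron X (1\<^sub>m N) * kron (1\<^sub>m a) (cmat Fi))"
    have com: "const z * (const w * (u * const v)) = const (z * w * v) * u" for z w v u
      by (simp add: const_mult mult.assoc const_central[of v u])
    have "ptr ?Z $$ (i * N + x, j * N + y) = (\<Sum>s<N. \<Sum>t<N. const (D $$ (s, t)) * ?Z $$ ((i * N + x) * N + t, (j * N + y) * N + s))"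
      using ptr_index[OF cZ] i by (simp add: pair_index_less del: index_mult_mat)
    also have "\<dots> = (\<Sum>s<N. \<Sum>t<N. \<Sum>p<N. \<Sum>e<N. \<Sum>r<N. const (D $$ (s, t) * en F x t p e * en Fi r e y s) * X $$ (i * N + p, j * N + r))"
      using i outer by (simp add: sum_distrib_left com del: index_mult_mat)
    also have "\<dots> = (\<Sum>p<N. \<Sum>r<N. \<Sum>e<N. \<Sum>s<N. \<Sum>t<N. const (D $$ (s, t) * en F x t p e * en Fi r e y s) * X $$ (i * N + p, j * N + r))"
    proof -
      have "(\<Sum>s<N. \<Sum>t<N. \<Sum>p<N. \<Sum>e<N. \<Sum>r<N. h s t p e r) = (\<Sum>p<N. \<Sum>r<N. \<Sum>e<N. \<Sum>s<N. \<Sum>t<N. h s t p e r)"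
        for h :: "nat \<Rightarrow> nat \<Rightarrow> nat \<Rightarrow> nat \<Rightarrow> nat \<Rightarrow> qpoly"
        by (simp only: sum.cartesian_product)
          (rule sum.reindex_bij_witness[of _ "\<lambda>(p, r, e, s, t). (s, t, p, e, r)" "\<lambda>(s, t, p, e, r). (p, r, e, s, t)"], auto)
      then show ?thesis .
    qed
    also have "\<dots> = (\<Sum>p<N. \<Sum>r<N. const (if x = y then D $$ (r, p) else 0) * X $$ (i * N + p, j * N + r))"
    proof (intro sum.cong refl)
      fix p r assume "p \<in> {..<N}" "r \<in> {..<N}"
      then show "(\<Sum>e<N. \<Sum>s<N. \<Sum>t<N. const (D $$ (s, t) * en F x t p e * en Fi r e y s) * X $$ (i * N + p, j * N + r))
        = const (if x = y then D $$ (r, p) else 0) * X $$ (i * N + p, j * N + r)"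
        using trace_conj_F[of x y p r] i by (simp flip: sum_distrib_right const_sum)
    qed
    also have "\<dots> = (\<Sum>r<N. \<Sum>p<N. const (if x = y then D $$ (r, p) else 0) * X $$ (i * N + p, j * N + r))" by (rule sum.swap)
    also have "\<dots> = kron (ptr X) (1\<^sub>m N) $$ (i * N + x, j * N + y)"
      using i ptr_index[OF X i(1) i(3)] by (simp add: kron_index_pair[OF ptr_carrier[OF X] one_carrier_mat])
    finally show "ptr ?Z $$ (i * N + x, j * N + y) = kron (ptr X) (1\<^sub>m N) $$ (i * N + x, j * N + y)" .
  qed
qed

definition rt :: "nat \<Rightarrow> qpoly mat \<Rightarrow> qpoly" where
  "rt n X = mat_trace (cmat (Dn n) * X)"

lemma R_trace_rt: "R_trace N R n X = rt n X"
  unfolding R_trace_def rt_def Dn_def ..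

lemma rt_index: "X \<in> sq_mats (N ^ n) \<Longrightarrow> rt n X = (\<Sum>i<N ^ n. \<Sum>j<N ^ n. const (Dn n $$ (i, j)) * X $$ (j, i))"
  unfolding rt_def mat_trace_def
  using index_mult_mat_sum[OF cmat_carrier[OF Dn_carrier[of n]], of X "N ^ n"] carrier_matD[OF Dn_carrier[of n]]
  by (simp add: cmat_index del: index_mult_mat(1))

lemma rt_Suc: assumes X: "X \<in> sq_mats (N ^ Suc n)" shows "rt (Suc n) X = rt n (ptr X)"
proof -
  let ?a = "N ^ n"
  have X': "X \<in> sq_mats (?a * N)" using X by (simp add: mult.commute)
  have "rt (Suc n) X = (\<Sum>i<?a * N. \<Sum>j<?a * N. const (Dn (Suc n) $$ (i, j)) * X $$ (j, i))"
    using rt_index[OF X] by (simp add: mult.commute)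
  also have "\<dots> = (\<Sum>i<?a. \<Sum>s<N. \<Sum>j<?a. \<Sum>t<N. const (Dn n $$ (i, j)) * (const (D $$ (s, t)) * X $$ (j * N + t, i * N + s)))"
    unfolding sum_split_mult Dn_Suc
    by (intro sum.cong refl) (simp add: kron_index_pair[OF Dn_carrier D_carrier] const_mult mult.assoc)
  also have "\<dots> = (\<Sum>i<?a. \<Sum>j<?a. \<Sum>s<N. \<Sum>t<N. const (Dn n $$ (i, j)) * (const (D $$ (s, t)) * X $$ (j * N + t, i * N + s)))"
    by (rule sum.cong[OF refl], rule sum.swap)
  also have "\<dots> = rt n (ptr X)"
    using ptr_carrier[OF X'] by (simp add: rt_index ptr_index[OF X'] sum_distrib_left)
  finally show ?thesis .
qed

lemma rt_add: "X \<in> sq_mats (N ^ (n + m)) \<Longrightarrow> rt (n + m) X = rt n ((ptr ^^ m) X)"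
proof (induction m arbitrary: X)
  case (Suc m)
  then have X: "X \<in> sq_mats (N ^ Suc (n + m))" by simp
  show ?case using rt_Suc[OF X] Suc.IH[OF ptr_carrier_pow[OF X]] by (simp add: funpow_swap1)
qed simp

lemma ptr_pow_carrier: "X \<in> sq_mats (N ^ (n + m)) \<Longrightarrow> (ptr ^^ m) X \<in> sq_mats (N ^ n)"
proof (induction m arbitrary: X)
  case (Suc m)
  then have X: "X \<in> sq_mats (N ^ Suc (n + m))" by simp
  show ?case using Suc.IH[OF ptr_carrier_pow[OF X]] by (simp add: funpow_swap1)
qed simp

lemma ptr_pow_sandwich:
  assumes A: "A \<in> sq_mats (N ^ n)" and B: "B \<in> sq_mats (N ^ n)"
  shows "X \<in> sq_mats (N ^ (n + m)) \<Longrightarrow>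
    (ptr ^^ m) (kron A (1\<^sub>m (N ^ m)) * X * kron B (1\<^sub>m (N ^ m))) = A * (ptr ^^ m) X * B"
proof (induction m arbitrary: X)
  case (Suc m)
  let ?a = "N ^ (n + m)"
  have X: "X \<in> sq_mats (?a * N)" using Suc.prems by (simp add: ac_simps)
  let ?A = "kron A (1\<^sub>m (N ^ m))" and ?B = "kron B (1\<^sub>m (N ^ m))"
  have AB: "?A \<in> sq_mats ?a" "?B \<in> sq_mats ?a" using A B by (auto simp: power_add)
  have e: "kron A (1\<^sub>m (N ^ Suc m)) = kron ?A (1\<^sub>m N)" "kron B (1\<^sub>m (N ^ Suc m)) = kron ?B (1\<^sub>m N)"
    unfolding kron_assoc kron_one by (simp_all add: mult.commute)
  have kA: "kron ?A (1\<^sub>m N) \<in> sq_mats (?a * N)" using AB by auto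
  have "ptr (kron A (1\<^sub>m (N ^ Suc m)) * X * kron B (1\<^sub>m (N ^ Suc m))) = ?A * ptr X * ?B"
    unfolding e ptr_right[OF AB(2) mult_carrier_mat[OF kA X]] ptr_left[OF AB(1) X] ..
  then show ?case using Suc.IH[OF ptr_carrier[OF X]] by (simp add: funpow_swap1 del: power_Suc)
qed (use A B in simp)

lemma strand_kron: "X \<in> sq_mats (N ^ 2) \<Longrightarrow> m < n \<Longrightarrow> kron (strand X n m) (1\<^sub>m N) = strand X (Suc n) m"
proof (induction m)
  case 0
  then show ?case by (simp add: mult.commute)
next
  case (Suc m)
  have c: "strand X n m \<in> sq_mats (N ^ n)" "op_at N n (Suc m) 2 X \<in> sq_mats (N ^ n)" using Suc by auto
  show ?case using Suc kron_op_at_left[of X N 2 "Suc m" n 1] by (simp add: kron_one_mult[OF c])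
qed

lemma strand_inv_kron: "X \<in> sq_mats (N ^ 2) \<Longrightarrow> m < n \<Longrightarrow> kron (strand_inv X n m) (1\<^sub>m N) = strand_inv X (Suc n) m"
proof (induction m)
  case 0
  then show ?case by (simp add: mult.commute)
next
  case (Suc m)
  have c: "strand_inv X n m \<in> sq_mats (N ^ n)" "op_at N n (Suc m) 2 X \<in> sq_mats (N ^ n)" using Suc by auto
  show ?case using Suc kron_op_at_left[of X N 2 "Suc m" n 1] by (simp add: kron_one_mult[OF c(2,1)])
qed

text \<open>The last \<open>F\<close> of the strand and the last inverse are exactly the pair
  removed by \<open>ptr_conj\<close>; each of the \<open>m\<close> traces shortens the strand by
  one, down to length \<open>s\<close>.\<close>

lemma ptr_pow_conj:
  "Z \<in> sq_mats (N ^ (s + m)) \<Longrightarrow>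
   (ptr ^^ m) (cV (Suc (s + m)) (s + m) * kron Z (1\<^sub>m N) * cVi (Suc (s + m)) (s + m))
   = cV (Suc s) s * kron ((ptr ^^ m) Z) (1\<^sub>m N) * cVi (Suc s) s"
proof (induction m arbitrary: Z)
  case (Suc m)
  let ?b = "s + m" and ?n = "Suc (s + m)"
  let ?a = "N ^ ?b"
  have Z: "Z \<in> sq_mats (?a * N)" using Suc.prems by (simp add: mult.commute)
  let ?V = "cV ?n ?b" and ?Vi = "cVi ?n ?b" and ?k = "kron (1\<^sub>m ?a) (cmat F)" and ?ki = "kron (1\<^sub>m ?a) (cmat Fi)"
  let ?d = "?a * N * N"
  have an: "N ^ ?n = ?a * N" by simp
  have Vc: "?V \<in> sq_mats (?a * N)" "?Vi \<in> sq_mats (?a * N)"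
    unfolding an[symmetric] by (intro cmat_carrier strand_carrier strand_inv_carrier F_carrier Fi_carrier; simp)+
  have kc: "?k \<in> sq_mats ?d" "?ki \<in> sq_mats ?d"
    using kron_carrier[OF one_carrier_mat[of ?a] cmat_carrier[OF F_carrier]] kron_carrier[OF one_carrier_mat[of ?a] cmat_carrier[OF Fi_carrier]]
    by (simp_all add: power2_eq_square mult.assoc)
  have Zc: "kron Z (1\<^sub>m N) \<in> sq_mats ?d" using Z by auto
  have Vk: "kron ?V (1\<^sub>m N) \<in> sq_mats ?d" "kron ?Vi (1\<^sub>m N) \<in> sq_mats ?d" using Vc by auto
  have fe: "fn (Suc ?n) ?n = kron (1\<^sub>m ?a) F" "fin (Suc ?n) ?n = kron (1\<^sub>m ?a) Fi" by (simp_all add: op_at_def)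
  have sc: "strand F (Suc ?n) ?b \<in> sq_mats (N ^ Suc ?n)" "fn (Suc ?n) ?n \<in> sq_mats (N ^ Suc ?n)"
    "strand_inv Fi (Suc ?n) ?b \<in> sq_mats (N ^ Suc ?n)" "fin (Suc ?n) ?n \<in> sq_mats (N ^ Suc ?n)"
    by (intro op_at_carrier strand_carrier strand_inv_carrier F_carrier Fi_carrier; simp)+
  have V1: "cV (Suc ?n) ?n = kron ?V (1\<^sub>m N) * ?k"
    using cmat_mult[OF sc(1,2)] unfolding strand.simps fe cmat_kron cmat_one kron_cmat_one strand_kron[OF F_carrier lessI] by simp
  have V2: "cVi (Suc ?n) ?n = ?ki * kron ?Vi (1\<^sub>m N)"
    using cmat_mult[OF sc(4,3)] unfolding strand_inv.simps fe cmat_kron cmat_one kron_cmat_one strand_inv_kron[OF Fi_carrier lessI] by simp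
  note a = sq_assoc[where d = ?d]
  have "cV (Suc ?n) ?n * kron Z (1\<^sub>m N) * cVi (Suc ?n) ?n
     = kron ?V (1\<^sub>m N) * (?k * kron Z (1\<^sub>m N) * ?ki) * kron ?Vi (1\<^sub>m N)"
    unfolding V1 V2 using Vk kc Zc by (simp add: a)
  moreover have "ptr (kron ?V (1\<^sub>m N) * (?k * kron Z (1\<^sub>m N) * ?ki) * kron ?Vi (1\<^sub>m N)) = ?V * kron (ptr Z) (1\<^sub>m N) * ?Vi"
    using Vk kc Zc Vc
    by (subst ptr_right[OF Vc(2)], simp, subst ptr_left[OF Vc(1)], simp, simp only: ptr_conj[OF Z])
  ultimately have p: "ptr (cV (Suc ?n) ?n * kron Z (1\<^sub>m N) * cVi (Suc ?n) ?n) = ?V * kron (ptr Z) (1\<^sub>m N) * ?Vi" by simp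
  have "(ptr ^^ Suc m) (cV (Suc ?n) ?n * kron Z (1\<^sub>m N) * cVi (Suc ?n) ?n) = (ptr ^^ m) (?V * kron (ptr Z) (1\<^sub>m N) * ?Vi)"
    using p by (simp add: funpow_swap1)
  also have "\<dots> = cV (Suc s) s * kron ((ptr ^^ m) (ptr Z)) (1\<^sub>m N) * cVi (Suc s) s"
    using Suc.IH[OF ptr_carrier[OF Z]] .
  finally show ?case by (simp add: funpow_swap1)
qed simp

text \<open>Here \<open>c\<close> is an element of the free algebra and need not be central, but it
  commutes with the complex entries of \<open>A\<close> and \<open>B\<close>.\<close>

lemma cmat_scalar_sandwich:
  assumes A: "A \<in> sq_mats d" and B: "B \<in> sq_mats d"
  shows "cmat A * (c \<cdot>\<^sub>m 1\<^sub>m d) * cmat B = c \<cdot>\<^sub>m cmat (A * B)"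
proof -
  have 1: "cmat A * (c \<cdot>\<^sub>m 1\<^sub>m d) = c \<cdot>\<^sub>m cmat A"
  proof (rule eq_matI)
    fix i j assume "i < dim_row (c \<cdot>\<^sub>m cmat A)" "j < dim_col (c \<cdot>\<^sub>m cmat A)"
    then have ij: "i < d" "j < d" using A by auto
    have "(cmat A * (c \<cdot>\<^sub>m 1\<^sub>m d)) $$ (i, j) = (\<Sum>k<d. cmat A $$ (i, k) * (c \<cdot>\<^sub>m 1\<^sub>m d) $$ (k, j))"
      using index_mult_mat_sum[OF cmat_carrier[OF A], of "c \<cdot>\<^sub>m 1\<^sub>m d" d i j] ij by simp
    also have "\<dots> = (\<Sum>k<d. if k = j then c * cmat A $$ (i, j) else 0)"
      using ij A by (intro sum.cong refl) (auto simp: cmat_index const_central)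
    also have "\<dots> = (c \<cdot>\<^sub>m cmat A) $$ (i, j)" using ij A by simp
    finally show "(cmat A * (c \<cdot>\<^sub>m 1\<^sub>m d)) $$ (i, j) = (c \<cdot>\<^sub>m cmat A) $$ (i, j)" .
  qed (use A in auto)
  have "(c \<cdot>\<^sub>m cmat A) * cmat B = c \<cdot>\<^sub>m (cmat A * cmat B)"
  proof (rule eq_matI)
    fix i j assume "i < dim_row (c \<cdot>\<^sub>m (cmat A * cmat B))" "j < dim_col (c \<cdot>\<^sub>m (cmat A * cmat B))"
    then have ij: "i < d" "j < d" using A B by auto
    have "((c \<cdot>\<^sub>m cmat A) * cmat B) $$ (i, j) = (\<Sum>k<d. (c \<cdot>\<^sub>m cmat A) $$ (i, k) * cmat B $$ (k, j))"
      using ij by (intro index_mult_mat_sum[of _ d d _ d]) (use A B in auto)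
    also have "\<dots> = c * (\<Sum>k<d. cmat A $$ (i, k) * cmat B $$ (k, j))"
      using ij A by (simp add: sum_distrib_left mult.assoc)
    also have "(\<Sum>k<d. cmat A $$ (i, k) * cmat B $$ (k, j)) = (cmat A * cmat B) $$ (i, j)"
      using ij by (intro index_mult_mat_sum[of _ d d _ d, symmetric]) (use A B in auto)
    finally show "((c \<cdot>\<^sub>m cmat A) * cmat B) $$ (i, j) = (c \<cdot>\<^sub>m (cmat A * cmat B)) $$ (i, j)"
      using ij A B by simp
  qed (use A B in auto)
  then show ?thesis unfolding 1 cmat_mult[OF A B] .
qed

text \<open>\<open>cp n (\<rho>\<^sub>R \<alpha>)\<close> is a representative of \<open>ch \<alpha>\<close> in the free algebra.\<close>

definition cp :: "nat \<Rightarrow> complex mat \<Rightarrow> qpoly" where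
  "cp n X = rt n (TS n 0 n * cmat X)"

text \<open>A conjugation by the strand \<open>F\<^sub>1 F\<^sub>2 \<dots>\<close> shifts both the \<open>M\<close> and the operators in \<open>alg m\<close> by one
  factor, so the trace over the last \<open>m\<close> factors is a scalar that does not depend on the shift.\<close>

lemma ptr_pow_shifted:
  assumes Y: "Y \<in> alg m"
  shows "(ptr ^^ m) (TS (s + m) s m * cmat (op_at N (s + m) (Suc s) m Y)) = cp m Y \<cdot>\<^sub>m 1\<^sub>m (N ^ s)"
proof (induction s)
  case 0
  let ?X = "TS m 0 m * cmat Y"
  have X: "?X \<in> sq_mats (N ^ (0 + m))" using Y by simp
  have c: "(ptr ^^ m) ?X \<in> sq_mats 1" using ptr_pow_carrier[OF X] by simp
  have "cp m Y = rt 0 ((ptr ^^ m) ?X)" unfolding cp_def using rt_add[OF X] by simp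
  also have "\<dots> = (ptr ^^ m) ?X $$ (0, 0)" using rt_index[of "(ptr ^^ m) ?X" 0] c by (simp add: Dn_0)
  finally have "(ptr ^^ m) ?X = cp m Y \<cdot>\<^sub>m 1\<^sub>m 1" using c by (intro eq_matI) auto
  then show ?case by simp
next
  case (Suc s)
  let ?n = "s + m"
  let ?Z = "op_at N ?n (Suc s) m Y"
  let ?V = "strand F (Suc ?n) ?n" and ?Vi = "strand_inv Fi (Suc ?n) ?n"
  let ?d = "N ^ Suc ?n"
  have Zalg: "?Z \<in> alg ?n" using Y by (intro alg_op_at) auto
  have Zc: "?Z \<in> sq_mats (N ^ ?n)" using Zalg by simp
  have Vc: "?V \<in> sq_mats ?d" "?Vi \<in> sq_mats ?d"
    by (intro strand_carrier strand_inv_carrier F_carrier Fi_carrier; simp)+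
  have Z1c: "kron ?Z (1\<^sub>m N) \<in> sq_mats ?d" using kron_carrier[OF Zc one_carrier_mat[of N]] by (simp add: mult.commute)
  have VVi: "?V * ?Vi = 1\<^sub>m ?d" by (rule strand_cancel[OF F_carrier Fi_carrier F_Fi]) simp
  have z2: "op_at N (Suc ?n) 2 ?n ?Z = op_at N (Suc ?n) (Suc (Suc s)) m Y"
    using op_at_op_at[of Y N m 2 ?n "Suc ?n" "Suc s"] Y by simp
  have z2c: "op_at N (Suc ?n) (Suc (Suc s)) m Y \<in> sq_mats ?d" using Y by (intro op_at_carrier) auto
  have "op_at N (Suc ?n) 2 ?n ?Z * ?V = ?V * kron ?Z (1\<^sub>m N)"
    using slide_alg[OF Zalg] op_at_left[OF Zc, of 1] by simp
  then have "op_at N (Suc ?n) (Suc (Suc s)) m Y * ?V * ?Vi = ?V * kron ?Z (1\<^sub>m N) * ?Vi" unfolding z2 by simp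
  then have opV: "op_at N (Suc ?n) (Suc (Suc s)) m Y = ?V * kron ?Z (1\<^sub>m N) * ?Vi"
    using assoc_mult_mat[OF z2c Vc] VVi right_mult_one_mat[OF z2c] by simp
  have copV: "cmat (op_at N (Suc ?n) (Suc (Suc s)) m Y) = cmat ?V * kron (cmat ?Z) (1\<^sub>m N) * cmat ?Vi"
    unfolding opV using cmat_mult[OF sq_mult_carrier[OF Vc(1) Z1c] Vc(2)] cmat_mult[OF Vc(1) Z1c] by (simp add: cmat_kron)
  have TSV: "TS (Suc ?n) (Suc s) m = cmat ?V * kron (TS ?n s m) (1\<^sub>m N) * cmat ?Vi"
    using TS_shift[of s m "Suc ?n"] kron_TS[of s m ?n] by simp
  have TSc: "TS ?n s m \<in> sq_mats (N ^ ?n)" by simp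
  have cs: "cmat ?V \<in> sq_mats ?d" "cmat ?Vi \<in> sq_mats ?d" "kron (TS ?n s m) (1\<^sub>m N) \<in> sq_mats ?d"
    "kron (cmat ?Z) (1\<^sub>m N) \<in> sq_mats ?d"
    using Vc kron_carrier[OF TSc one_carrier_mat[of N]] kron_carrier[OF cmat_carrier[OF Zc] one_carrier_mat[of N]]
    by (simp_all add: mult.commute)
  note a = sq_assoc[where d = ?d]
  \<comment> \<open>The same strand conjugates the product of the \<open>M\<close> and the operator,
    so the two inner strands cancel and the whole product is one conjugate, ready for
    \<open>ptr_pow_conj\<close>.\<close>
  have "TS (Suc ?n) (Suc s) m * cmat (op_at N (Suc ?n) (Suc (Suc s)) m Y)
    = cmat ?V * kron (TS ?n s m) (1\<^sub>m N) * (cmat ?Vi * cmat ?V) * kron (cmat ?Z) (1\<^sub>m N) * cmat ?Vi"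
    unfolding TSV copV using cs by (simp add: a del: power_Suc)
  also have "cmat ?Vi * cmat ?V = 1\<^sub>m ?d" by (rule cV_cVi) simp
  also have "cmat ?V * kron (TS ?n s m) (1\<^sub>m N) * 1\<^sub>m ?d * kron (cmat ?Z) (1\<^sub>m N) * cmat ?Vi
     = cmat ?V * (kron (TS ?n s m) (1\<^sub>m N) * kron (cmat ?Z) (1\<^sub>m N)) * cmat ?Vi"
    unfolding right_mult_one_mat[OF sq_mult_carrier[OF cs(1,3)]] assoc_mult_mat[OF cs(1,3,4)] ..
  also have "kron (TS ?n s m) (1\<^sub>m N) * kron (cmat ?Z) (1\<^sub>m N) = kron (TS ?n s m * cmat ?Z) (1\<^sub>m N)"
    using kron_one_mult[OF TSc cmat_carrier[OF Zc]] by simp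
  finally have e: "TS (Suc ?n) (Suc s) m * cmat (op_at N (Suc ?n) (Suc (Suc s)) m Y)
    = cmat ?V * kron (TS ?n s m * cmat ?Z) (1\<^sub>m N) * cmat ?Vi" .
  have Tc: "TS ?n s m * cmat ?Z \<in> sq_mats (N ^ ?n)" using TSc Zc by simp
  have sc: "strand F (Suc s) s \<in> sq_mats (N ^ Suc s)" "strand_inv Fi (Suc s) s \<in> sq_mats (N ^ Suc s)"
    by (intro strand_carrier strand_inv_carrier F_carrier Fi_carrier; simp)+
  have "(ptr ^^ m) (TS (Suc ?n) (Suc s) m * cmat (op_at N (Suc ?n) (Suc (Suc s)) m Y))
     = cV (Suc s) s * kron (cp m Y \<cdot>\<^sub>m 1\<^sub>m (N ^ s)) (1\<^sub>m N) * cVi (Suc s) s"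
    unfolding e ptr_pow_conj[OF Tc] Suc.IH ..
  also have "kron (cp m Y \<cdot>\<^sub>m 1\<^sub>m (N ^ s)) (1\<^sub>m N) = cp m Y \<cdot>\<^sub>m 1\<^sub>m (N ^ Suc s)"
    by (simp add: kron_smult_left mult.commute)
  also have "cV (Suc s) s * (cp m Y \<cdot>\<^sub>m 1\<^sub>m (N ^ Suc s)) * cVi (Suc s) s = cp m Y \<cdot>\<^sub>m 1\<^sub>m (N ^ Suc s)"
    unfolding cmat_scalar_sandwich[OF sc] strand_cancel[OF F_carrier Fi_carrier F_Fi lessI] by simp
  finally show ?case by simp
qed

text \<open>An identity in the free algebra, before any relation is imposed. The product of all
  \<open>M\<close> splits after \<open>n\<close> factors, and the trace over the last
  \<open>m\<close> factors turns the second half together with \<open>Y\<close> into the scalar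
  \<open>cp m Y\<close> by \<open>ptr_pow_shifted\<close>.\<close>

theorem cp_mult:
  assumes X: "X \<in> sq_mats (N ^ n)" and Y: "Y \<in> alg m"
  shows "cp n X * cp m Y = cp (n + m) (kron X Y)"
proof -
  let ?d = "N ^ (n + m)" and ?c = "cp m Y"
  let ?Y = "op_at N (n + m) (Suc n) m Y"
  have Yc: "Y \<in> sq_mats (N ^ m)" using Y by simp
  have Y1: "?Y = kron (1\<^sub>m (N ^ n)) Y" by (simp add: op_at_def)
  have Y1c: "?Y \<in> sq_mats ?d" using Yc by simp
  have X1c: "kron X (1\<^sub>m (N ^ m)) \<in> sq_mats ?d" using kron_carrier[OF X one_carrier_mat[of "N ^ m"]] by (simp add: power_add)
  \<comment> \<open>\<open>Y\<close> is written to the left of \<open>X\<close> so that it stands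
    next to the last \<open>m\<close> matrices \<open>M\<close>, with \<open>X\<close> as the outer
    right factor of \<open>ptr_pow_sandwich\<close>.\<close>
  have "kron X Y = ?Y * kron X (1\<^sub>m (N ^ m))"
    unfolding Y1 using kron_mult_complex[OF one_carrier_mat Yc X one_carrier_mat] left_mult_one_mat[OF X] right_mult_one_mat[OF Yc] by simp
  then have cXY: "cmat (kron X Y) = cmat ?Y * kron (cmat X) (1\<^sub>m (N ^ m))"
    using cmat_mult[OF Y1c X1c] by (simp add: cmat_kron)
  have T: "TS (n + m) 0 (n + m) = kron (TS n 0 n) (1\<^sub>m (N ^ m)) * TS (n + m) n m"
    using TS_add[of 0 n m "n + m"] kron_TS_pow[of 0 n n m] by simp
  have Tc: "TS n 0 n \<in> sq_mats (N ^ n)" by simp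
  have cs: "kron (TS n 0 n) (1\<^sub>m (N ^ m)) \<in> sq_mats ?d" "TS (n + m) n m \<in> sq_mats ?d" "cmat ?Y \<in> sq_mats ?d"
     "kron (cmat X) (1\<^sub>m (N ^ m)) \<in> sq_mats ?d"
    using kron_carrier[OF Tc one_carrier_mat[of "N ^ m"]] kron_carrier[OF cmat_carrier[OF X] one_carrier_mat[of "N ^ m"]]
      TS_carrier[of n m "n + m"] cmat_carrier[OF Y1c]
    unfolding power_add by simp_all
  have "TS (n + m) 0 (n + m) * cmat (kron X Y)
     = kron (TS n 0 n) (1\<^sub>m (N ^ m)) * (TS (n + m) n m * cmat ?Y) * kron (cmat X) (1\<^sub>m (N ^ m))"
    unfolding T cXY using cs by (simp add: sq_assoc[where d = ?d])
  moreover have "TS (n + m) 0 (n + m) * cmat (kron X Y) \<in> sq_mats ?d"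
    unfolding cXY using cs by (intro sq_mult_carrier) auto
  ultimately have "cp (n + m) (kron X Y) = rt n (TS n 0 n * (?c \<cdot>\<^sub>m 1\<^sub>m (N ^ n)) * cmat X)"
    unfolding cp_def[of "n + m"] using rt_add ptr_pow_sandwich[OF Tc cmat_carrier[OF X], of "TS (n + m) n m * cmat ?Y" m]
      ptr_pow_shifted[OF Y, of n] cs by simp
  also have "\<dots> = rt n (TS n 0 n * cmat X) * ?c"
  proof -
    let ?T = "TS n 0 n" and ?a = "N ^ n"
    have c1: "?T * (?c \<cdot>\<^sub>m 1\<^sub>m ?a) \<in> sq_mats ?a" "?T * (?c \<cdot>\<^sub>m 1\<^sub>m ?a) * cmat X \<in> sq_mats ?a" "?T * cmat X \<in> sq_mats ?a"
      using Tc X by auto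
    have 1: "(?T * (?c \<cdot>\<^sub>m 1\<^sub>m ?a)) $$ (j, k) = ?T $$ (j, k) * ?c" if "j < ?a" "k < ?a" for j k
    proof -
      have "(?T * (?c \<cdot>\<^sub>m 1\<^sub>m ?a)) $$ (j, k) = (\<Sum>l<?a. ?T $$ (j, l) * (?c \<cdot>\<^sub>m 1\<^sub>m ?a) $$ (l, k))"
        using that by (intro index_mult_mat_sum[OF Tc]) auto
      also have "\<dots> = (\<Sum>l<?a. if l = k then ?T $$ (j, k) * ?c else 0)"
        using that by (intro sum.cong refl) auto
      finally show ?thesis using that by simp
    qed
    have 2: "(?T * (?c \<cdot>\<^sub>m 1\<^sub>m ?a) * cmat X) $$ (j, i) = (?T * cmat X) $$ (j, i) * ?c" if "j < ?a" "i < ?a" for j i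
    proof -
      have "(?T * (?c \<cdot>\<^sub>m 1\<^sub>m ?a) * cmat X) $$ (j, i) = (\<Sum>k<?a. ?T $$ (j, k) * ?c * const (X $$ (k, i)))"
        using index_mult_mat_sum[OF c1(1) cmat_carrier[OF X] that] that X 1 by (simp add: cmat_index)
      also have "\<dots> = (\<Sum>k<?a. ?T $$ (j, k) * const (X $$ (k, i))) * ?c"
        by (simp add: sum_distrib_right mult.assoc const_central)
      also have "(\<Sum>k<?a. ?T $$ (j, k) * const (X $$ (k, i))) = (?T * cmat X) $$ (j, i)"
        using index_mult_mat_sum[OF Tc cmat_carrier[OF X] that] that X by (simp add: cmat_index)
      finally show ?thesis .
    qed
    show ?thesis unfolding rt_index[OF c1(2)] rt_index[OF c1(3)]
      by (simp add: 2 sum_distrib_right mult.assoc del: index_mult_mat)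
  qed
  finally show ?thesis unfolding cp_def[of n] by simp
qed

end

section \<open>Congruence modulo the defining relations\<close>

context presented begin

definition FM :: "nat \<Rightarrow> 'x ncpoly mat set" where
  "FM d = {A \<in> sq_mats d. \<forall>i<d. \<forall>j<d. A $$ (i, j) \<in> carrier FA}"

text \<open>Entrywise congruence modulo the relations. Membership in \<open>FM\<close> is part of it
  because the ideal absorbs only elements of the free algebra on the given generators.\<close>

definition meq :: "nat \<Rightarrow> 'x ncpoly mat \<Rightarrow> 'x ncpoly mat \<Rightarrow> bool" where
  "meq d A B \<longleftrightarrow> A \<in> FM d \<and> B \<in> FM d \<and> (\<forall>i<d. \<forall>j<d. A $$ (i, j) - B $$ (i, j) \<in> I)"

lemma FM_carrier: "A \<in> FM d \<Longrightarrow> A \<in> sq_mats d"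
  by (simp add: FM_def)

lemma FM_mult: assumes "A \<in> FM d" "B \<in> FM d" shows "A * B \<in> FM d"
proof -
  have c: "A \<in> sq_mats d" "B \<in> sq_mats d" using assms by (auto simp: FM_def)
  have "(A * B) $$ (i, j) \<in> carrier FA" if "i < d" "j < d" for i j
    unfolding index_mult_mat_sum[OF c that] using assms that
    by (intro free_sum free_mult) (auto simp: FM_def)
  then show ?thesis using c by (simp add: FM_def del: index_mult_mat)
qed

lemma FM_one: "1\<^sub>m d \<in> FM d"
  by (auto simp: FM_def intro: free_one free_zero)

lemma FM_kron: assumes "A \<in> FM d" "B \<in> FM e" shows "kron A B \<in> FM (d * e)"
proof -
  have c: "A \<in> sq_mats d" "B \<in> sq_mats e" using assms by (auto simp: FM_def)
  show ?thesis using assms kron_carrier[OF c] index_split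
    by (auto simp: FM_def kron_index[OF c] intro!: free_mult)
qed

lemma meq_refl: "A \<in> FM d \<Longrightarrow> meq d A A"
  by (simp add: meq_def I_zero)

lemma meq_sym: assumes "meq d A B" shows "meq d B A"
proof -
  have "B $$ (i, j) - A $$ (i, j) \<in> I" if "i < d" "j < d" for i j
    using I_uminus[of "A $$ (i, j) - B $$ (i, j)"] assms that by (auto simp: meq_def)
  then show ?thesis using assms by (simp add: meq_def)
qed

lemma meq_trans: assumes "meq d A B" "meq d B C" shows "meq d A C"
proof -
  have "A $$ (i, j) - C $$ (i, j) \<in> I" if "i < d" "j < d" for i j
    using I_add[of "A $$ (i, j) - B $$ (i, j)" "B $$ (i, j) - C $$ (i, j)"] assms that by (auto simp: meq_def)
  then show ?thesis using assms by (simp add: meq_def)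
qed

text \<open>The difference is \<open>(A - B) C + B (C - E)\<close>, and the ideal is
  two-sided.\<close>

lemma meq_mult: assumes "meq d A B" "meq d C E" shows "meq d (A * C) (B * E)"
proof -
  have F: "A \<in> FM d" "B \<in> FM d" "C \<in> FM d" "E \<in> FM d" using assms by (auto simp: meq_def)
  note c = F[THEN FM_carrier]
  have "(A * C) $$ (i, j) - (B * E) $$ (i, j) \<in> I" if ij: "i < d" "j < d" for i j
  proof -
    have e: "(A * C) $$ (i, j) - (B * E) $$ (i, j) =
      (\<Sum>k<d. (A $$ (i, k) - B $$ (i, k)) * C $$ (k, j) + B $$ (i, k) * (C $$ (k, j) - E $$ (k, j)))"
      unfolding index_mult_mat_sum[OF c(1,3) ij] index_mult_mat_sum[OF c(2,4) ij] sum_subtractf[symmetric]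
      by (simp add: algebra_simps)
    show ?thesis unfolding e
    proof (rule I_sum)
      fix k assume "k \<in> {..<d}"
      then have k: "k < d" by simp
      have 1: "A $$ (i, k) - B $$ (i, k) \<in> I" "C $$ (k, j) - E $$ (k, j) \<in> I" using assms ij k by (simp_all add: meq_def)
      have 2: "C $$ (k, j) \<in> carrier FA" "B $$ (i, k) \<in> carrier FA" using F ij k by (simp_all add: FM_def)
      show "(A $$ (i, k) - B $$ (i, k)) * C $$ (k, j) + B $$ (i, k) * (C $$ (k, j) - E $$ (k, j)) \<in> I"
        by (rule I_add[OF I_mult_right[OF 1(1) 2(1)] I_mult_left[OF 1(2) 2(2)]])
    qed
  qed
  then show ?thesis using FM_mult F by (simp add: meq_def del: index_mult_mat)
qed

lemma meq_kron_one: assumes "meq d A B" shows "meq (d * e) (kron A (1\<^sub>m e)) (kron B (1\<^sub>m e))"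
proof -
  have F: "A \<in> FM d" "B \<in> FM d" using assms by (auto simp: meq_def)
  note c = F[THEN FM_carrier]
  have "kron A (1\<^sub>m e) $$ (i, j) - kron B (1\<^sub>m e) $$ (i, j) \<in> I" if "i < d * e" "j < d * e" for i j
    using assms that index_split[OF that(1)] index_split[OF that(2)]
    by (auto simp: kron_index[OF c(1) one_carrier_mat] kron_index[OF c(2) one_carrier_mat] meq_def I_zero)
  then show ?thesis using FM_kron[OF F(1) FM_one] FM_kron[OF F(2) FM_one] by (simp add: meq_def)
qed

lemma meq_add: assumes "meq d A B" "meq d C E" shows "meq d (A + C) (B + E)"
proof -
  have F: "A \<in> FM d" "B \<in> FM d" "C \<in> FM d" "E \<in> FM d" using assms by (auto simp: meq_def)
  note c = F[THEN FM_carrier]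
  have "(A + C) $$ (i, j) - (B + E) $$ (i, j) \<in> I" if "i < d" "j < d" for i j
    using I_add[of "A $$ (i, j) - B $$ (i, j)" "C $$ (i, j) - E $$ (i, j)"] assms that c
    by (simp add: meq_def algebra_simps)
  then show ?thesis using F by (auto simp: meq_def FM_def intro!: free_add)
qed

lemma meq_trace: assumes "meq d A B" shows "mat_trace A - mat_trace B \<in> I"
proof -
  have "A \<in> sq_mats d" "B \<in> sq_mats d" using assms by (auto simp: meq_def FM_def)
  then have "mat_trace A - mat_trace B = (\<Sum>i<d. A $$ (i, i) - B $$ (i, i))"
    by (simp add: mat_trace_def sum_subtractf)
  then show ?thesis using assms by (auto simp: meq_def intro!: I_sum)
qed

lemma FM_trace: "A \<in> FM d \<Longrightarrow> mat_trace A \<in> carrier FA"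
  by (auto simp: mat_trace_def FM_def intro!: free_sum)

end

lemma conj_commute:
  fixes X :: "'a::semiring_1 mat"
  assumes c: "X \<in> sq_mats d" "X' \<in> sq_mats d" "G \<in> sq_mats d" "Gi \<in> sq_mats d" "A \<in> sq_mats d"
    and GG: "G * Gi = 1\<^sub>m d" "Gi * G = 1\<^sub>m d" and s: "X * G = G * X'"
  shows "X * (G * A * Gi) = G * (X' * A) * Gi" "(G * A * Gi) * X = G * (A * X') * Gi"
proof -
  note a = sq_assoc[where d = d] sq_one[where d = d]
  have "X * (G * A * Gi) = (X * G) * A * Gi" using c by (simp add: a)
  then show "X * (G * A * Gi) = G * (X' * A) * Gi" unfolding s using c by (simp add: a)
  have "Gi * X = Gi * X * (G * Gi)" unfolding GG using c by (simp add: a)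
  also have "\<dots> = Gi * (X * G) * Gi" using c by (simp add: a)
  also have "\<dots> = (Gi * G) * X' * Gi" unfolding s using c by (simp add: a)
  also have "\<dots> = X' * Gi" unfolding GG using c by (simp add: a)
  finally have "Gi * X = X' * Gi" .
  moreover have "(G * A * Gi) * X = G * A * (Gi * X)" using c by (simp add: a)
  ultimately show "(G * A * Gi) * X = G * (A * X') * Gi" using c by (simp add: a)
qed

lemma mult_const_left:
  assumes X: "X \<in> sq_mats d" shows "cmat (b \<cdot>\<^sub>m 1\<^sub>m d) * X = const b \<cdot>\<^sub>m X"
proof (rule eq_matI)
  fix i j assume "i < dim_row (const b \<cdot>\<^sub>m X)" "j < dim_col (const b \<cdot>\<^sub>m X)"
  then have ij: "i < d" "j < d" using X by auto
  have B: "cmat (b \<cdot>\<^sub>m 1\<^sub>m d) \<in> sq_mats d" by simp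
  have "(cmat (b \<cdot>\<^sub>m 1\<^sub>m d) * X) $$ (i, j) = (\<Sum>k<d. if k = i then const b * X $$ (i, j) else 0)"
    unfolding index_mult_mat_sum[OF B X ij] using ij by (intro sum.cong refl) (auto simp: cmat_index)
  then show "(cmat (b \<cdot>\<^sub>m 1\<^sub>m d) * X) $$ (i, j) = (const b \<cdot>\<^sub>m X) $$ (i, j)" using ij X by simp
qed (use X in auto)

lemma mult_const_right:
  assumes X: "X \<in> sq_mats d" shows "X * cmat (b \<cdot>\<^sub>m 1\<^sub>m d) = const b \<cdot>\<^sub>m X"
proof (rule eq_matI)
  fix i j assume "i < dim_row (const b \<cdot>\<^sub>m X)" "j < dim_col (const b \<cdot>\<^sub>m X)"
  then have ij: "i < d" "j < d" using X by auto
  have B: "cmat (b \<cdot>\<^sub>m 1\<^sub>m d) \<in> sq_mats d" by simp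
  have "(X * cmat (b \<cdot>\<^sub>m 1\<^sub>m d)) $$ (i, j) = (\<Sum>k<d. if k = j then const b * X $$ (i, j) else 0)"
    unfolding index_mult_mat_sum[OF X B ij] using ij by (intro sum.cong refl) (auto simp: cmat_index const_central)
  then show "(X * cmat (b \<cdot>\<^sub>m 1\<^sub>m d)) $$ (i, j) = (const b \<cdot>\<^sub>m X) $$ (i, j)" using ij X by simp
qed (use X in auto)

section \<open>The product of the generator matrices modulo the defining relations\<close>

context qma_pair begin

lemma entry_M_gen: "a < N \<Longrightarrow> b < N \<Longrightarrow> M_gen N $$ (a, b) \<in> carrier (free_algebra (qma_gens N))"
  by (auto simp: M_gen_def qma_gens_def intro!: free_gen)

text \<open>A copy of \<open>FM\<close> that is available before the relations are known to lie in
  the free algebra, a fact that itself needs these closure properties. They are borrowed from the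
  presentation with the same generators and no relations.\<close>

definition FQ :: "nat \<Rightarrow> qpoly mat set" where
  "FQ d = {A \<in> sq_mats d. \<forall>i<d. \<forall>j<d. A $$ (i, j) \<in> carrier (free_algebra (qma_gens N))}"

interpretation gens: presented "qma_gens N" "{}"
  by standard simp

lemma FQ_FM: "FQ = gens.FM"
  by (simp add: FQ_def gens.FM_def fun_eq_iff)

lemmas FQ_mult = gens.FM_mult[folded FQ_FM] and FQ_one = gens.FM_one[folded FQ_FM]
  and FQ_kron = gens.FM_kron[folded FQ_FM]

lemma FQ_cmat: "A \<in> sq_mats d \<Longrightarrow> cmat A \<in> FQ d"
  by (auto simp: FQ_def cmat_index free_const)

lemma FQ_mb: "0 < i \<Longrightarrow> i \<le> n \<Longrightarrow> mb n i \<in> FQ (N ^ n)"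
proof (induction i rule: nat_induct_non_zero)
  case 1
  have "M_gen N \<in> FQ N" using entry_M_gen by (auto simp: FQ_def)
  then have "kron (1\<^sub>m 1) (kron (M_gen N) (1\<^sub>m (N ^ (n - 1)))) \<in> FQ (1 * (N * N ^ (n - 1)))"
    by (intro FQ_kron FQ_one)
  moreover have "N * N ^ (n - 1) = N ^ n" using 1 by (cases n) auto
  ultimately show ?case by (simp add: op_at_def)
next
  case (Suc i)
  then show ?case by (simp add: mb_Suc FQ_mult FQ_cmat)
qed

lemma FQ_TS: "s + m \<le> n \<Longrightarrow> TS n s m \<in> FQ (N ^ n)"
  by (induction m) (simp_all add: FQ_one FQ_mult FQ_mb)

lemma relations_carrier: "qma_relations N R F \<subseteq> carrier (free_algebra (qma_gens N))"
proof -
  let ?A = "cmat R * mb 2 1 * mb 2 2" and ?B = "mb 2 1 * mb 2 2 * cmat R"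
  have F: "?A \<in> FQ (N ^ 2)" "?B \<in> FQ (N ^ 2)" by (intro FQ_mult FQ_cmat FQ_mb R_carrier; simp)+
  have "A - B \<in> FQ d" if "A \<in> FQ d" "B \<in> FQ d" for A B d
    using that by (auto simp: FQ_def intro!: free_diff)
  from this[OF F] show ?thesis unfolding qma_relations_def
    by (auto simp: FQ_def elements_mat_def simp del: index_mult_mat index_minus_mat)
qed

sublocale qa: presented "qma_gens N" "qma_relations N R F"
  by standard (rule relations_carrier)

lemma FQ_eq: "FQ = qa.FM"
  by (simp add: FQ_def qa.FM_def fun_eq_iff)

lemmas qFM_cmat = FQ_cmat[unfolded FQ_eq] and qFM_TS = FQ_TS[unfolded FQ_eq] and qFM_mb = FQ_mb[unfolded FQ_eq]

lemma TS_two: "s + 2 \<le> n \<Longrightarrow> TS n s 2 = mb n (Suc s) * mb n (Suc (Suc s))"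
  using left_mult_one_mat[OF mb_carrier[of "Suc s" n]] by (simp add: numeral_2_eq_2)

lemma meq_relation: "qa.meq (N ^ 2) (cmat R * TS 2 0 2) (TS 2 0 2 * cmat R)"
proof -
  have m: "mb 2 1 \<in> sq_mats (N ^ 2)" "mb 2 2 \<in> sq_mats (N ^ 2)" by (intro mb_carrier; simp)+
  have T: "TS 2 0 2 = mb 2 1 * mb 2 2" using TS_two[of 0 2] by (simp add: numeral_2_eq_2)
  let ?A = "cmat R * (mb 2 1 * mb 2 2)" and ?B = "mb 2 1 * mb 2 2 * cmat R"
  have c: "?A \<in> sq_mats (N ^ 2)" "?B \<in> sq_mats (N ^ 2)"
    by (intro sq_mult_carrier m cmat_carrier R_carrier)+
  have F: "?A \<in> qa.FM (N ^ 2)" "?B \<in> qa.FM (N ^ 2)"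
    by (intro qa.FM_mult qFM_cmat qFM_mb R_carrier; simp)+
  have "?A $$ (i, j) - ?B $$ (i, j) \<in> qa.I" if "i < N ^ 2" "j < N ^ 2" for i j
  proof -
    have "?A $$ (i, j) - ?B $$ (i, j) = (?A - ?B) $$ (i, j)" using that c
      by (metis (no_types, lifting) index_minus_mat(1) carrier_matD)
    also have "\<dots> \<in> elements_mat (?A - ?B)" using that minus_carrier_mat[OF c(2), of ?A]
      by (intro elements_matI[of _ "N ^ 2" "N ^ 2"]) auto
    also have "\<dots> = qma_relations N R F"
      unfolding qma_relations_def assoc_mult_mat[OF cmat_carrier[OF R_carrier] m] ..
    also have "\<dots> \<subseteq> qa.I" by (rule qa.S_I)
    finally show ?thesis .
  qed
  then show ?thesis unfolding T qa.meq_def using F by blast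
qed

lemma mb_kron: assumes "0 < i" "i \<le> n" shows "mb (n + l) i = kron (mb n i) (1\<^sub>m (N ^ l))"
proof (induction l)
  case (Suc l)
  have "mb (n + Suc l) i = kron (mb (n + l) i) (1\<^sub>m N)" using kron_mb[of i "n + l"] assms by simp
  also have "\<dots> = kron (mb n i) (1\<^sub>m (N ^ Suc l))" unfolding Suc.IH kron_assoc kron_one by (simp add: mult.commute)
  finally show ?case .
qed simp

text \<open>For \<open>s = 0\<close> this is the defining relation, tensored with an identity. The
  strand of \<open>F\<close> then shifts both \<open>R\<close> and the two matrices \<open>M\<close>
  by one factor.\<close>

lemma meq_TS_two: "s + 2 \<le> n \<Longrightarrow> qa.meq (N ^ n) (cmat (rn n (Suc s)) * TS n s 2) (TS n s 2 * cmat (rn n (Suc s)))"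
proof (induction s)
  case 0
  then obtain l where n: "n = 2 + l" by (auto simp: le_iff_add)
  have c: "cmat R \<in> sq_mats (N ^ 2)" "TS 2 0 2 \<in> sq_mats (N ^ 2)" by simp_all
  have r: "cmat (rn n (Suc 0)) = kron (cmat R) (1\<^sub>m (N ^ l))"
    unfolding n cmat_op_at using op_at_left[OF c(1), of l] by simp
  have t: "TS n 0 2 = kron (TS 2 0 2) (1\<^sub>m (N ^ l))"
    unfolding n using kron_TS_pow[of 0 2 2 l] by simp
  show ?case unfolding r t kron_one_mult[OF c, symmetric] kron_one_mult[OF c(2,1), symmetric]
    using qa.meq_kron_one[OF meq_relation, of "N ^ l"] unfolding n power_add .
next
  case (Suc s)
  let ?V = "strand F n (n - 1)" and ?r = "rn n (Suc s)" and ?r' = "rn n (Suc (Suc s))"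
  have co: "?V \<in> sq_mats (N ^ n)" "strand_inv Fi n (n - 1) \<in> sq_mats (N ^ n)"
    "?r \<in> sq_mats (N ^ n)" "?r' \<in> sq_mats (N ^ n)"
    using Suc.prems by auto
  have "?r' * ?V = ?V * ?r" using Suc.prems by (intro strand_slide comp_n) auto
  from arg_cong[OF this, of cmat] have sl: "cmat ?r' * cmat ?V = cmat ?V * cmat ?r"
    using cmat_mult[OF co(4,1)] cmat_mult[OF co(1,3)] by simp
  have T: "TS n (Suc s) 2 = cV n (n - 1) * TS n s 2 * cVi n (n - 1)" using Suc.prems by (intro TS_shift) simp
  have VV: "cV n (n - 1) * cVi n (n - 1) = 1\<^sub>m (N ^ n)" "cVi n (n - 1) * cV n (n - 1) = 1\<^sub>m (N ^ n)"
    using cV_cVi[of "n - 1" n] Suc.prems by auto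
  have Tc: "TS n s 2 \<in> sq_mats (N ^ n)" using Suc.prems by simp
  note cc = conj_commute[OF co(4,3,1,2)[THEN cmat_carrier] Tc VV sl]
  show ?case unfolding T cc
    using Suc.prems co by (intro qa.meq_mult qa.meq_refl qFM_cmat Suc.IH) auto
qed

text \<open>For \<open>i = l + 2\<close> the matrix \<open>M\<close> is a conjugate of the one at
  \<open>l\<close> by \<open>F\<close> at \<open>Suc l\<close> and \<open>l\<close>. Compatibility
  moves \<open>R\<close> through these as \<open>R\<close> at \<open>Suc l\<close>, which misses the
  first \<open>l\<close> factors where that \<open>M\<close> acts. Further factors \<open>F\<close>
  are far from \<open>R\<close>.\<close>

lemma rn_mb_above:
  assumes "0 < l" "l + 2 \<le> i" "i \<le> n"
  shows "cmat (rn n l) * mb n i = mb n i * cmat (rn n l)"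
  using assms(2,3)
proof (induction i rule: nat_induct_at_least)
  case base
  let ?f = "fn n l" and ?g = "fn n (Suc l)" and ?fi = "fin n l" and ?gi = "fin n (Suc l)"
    and ?r = "rn n l" and ?s = "rn n (Suc l)" and ?d = "N ^ n"
  have co: "?f \<in> sq_mats ?d" "?g \<in> sq_mats ?d" "?fi \<in> sq_mats ?d" "?gi \<in> sq_mats ?d"
    "?r \<in> sq_mats ?d" "?s \<in> sq_mats ?d"
    using assms(1) base by auto
  have m: "mb n l \<in> sq_mats ?d" using assms(1) base by simp
  note a = sq_assoc[where d = ?d] sq_one[where d = ?d]
  have "?r * (?g * ?f) = (?g * ?f) * ?s" using comp_n'[of l n] assms(1) base co by (simp add: a)
  from arg_cong[OF this, of cmat] have sl: "cmat ?r * cmat (?g * ?f) = cmat (?g * ?f) * cmat ?s"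
    using cmat_mult[OF co(5) sq_mult_carrier[OF co(2,1)]] cmat_mult[OF sq_mult_carrier[OF co(2,1)] co(6)] by simp
  have "(?g * ?f) * (?fi * ?gi) = ?g * (?f * ?fi) * ?gi" using co by (simp add: a)
  also have "\<dots> = 1\<^sub>m ?d" using inv_n[of l n] inv_n[of "Suc l" n] assms(1) base co by (simp add: a)
  finally have 1: "cmat (?g * ?f) * cmat (?fi * ?gi) = 1\<^sub>m ?d"
    using cmat_mult[OF sq_mult_carrier[OF co(2,1)] sq_mult_carrier[OF co(3,4)]] by simp
  have "(?fi * ?gi) * (?g * ?f) = ?fi * (?gi * ?g) * ?f" using co by (simp add: a)
  also have "\<dots> = 1\<^sub>m ?d" using inv_n[of l n] inv_n[of "Suc l" n] assms(1) base co by (simp add: a)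
  finally have 2: "cmat (?fi * ?gi) * cmat (?g * ?f) = 1\<^sub>m ?d"
    using cmat_mult[OF sq_mult_carrier[OF co(3,4)] sq_mult_carrier[OF co(2,1)]] by simp
  have M: "mb n (l + 2) = cmat (?g * ?f) * mb n l * cmat (?fi * ?gi)"
    using mb_Suc[of "Suc l" n] mb_Suc[of l n] assms(1) co m cmat_mult[OF co(2,1)] cmat_mult[OF co(3,4)]
    by (simp add: a)
  obtain e where e: "n = l + e" using base le_add1[of l 2] le_iff_add[of l n] by auto
  have "mb n l = op_at N n 1 l (mb l l)" unfolding e using op_at_left[OF mb_carrier[OF assms(1) order_refl], of e] mb_kron[OF assms(1) order_refl, of e] by simp
  then have s: "cmat ?s * mb n l = mb n l * cmat ?s"
    using op_at_comm[of "mb l l" N l "cmat R" 2 1 "Suc l" n] assms(1) base by (simp add: cmat_op_at)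
  note cc = conj_commute[OF co(5,6)[THEN cmat_carrier] sq_mult_carrier[OF co(2,1), THEN cmat_carrier]
     sq_mult_carrier[OF co(3,4), THEN cmat_carrier] m 1 2 sl]
  show ?case unfolding M cc s ..
next
  case (Suc i)
  let ?d = "N ^ n"
  have co: "fn n i \<in> sq_mats ?d" "fin n i \<in> sq_mats ?d" "rn n l \<in> sq_mats ?d" using assms(1) Suc by auto
  have m: "mb n i \<in> sq_mats ?d" using assms(1) Suc by simp
  have "rn n l * fn n i = fn n i * rn n l" using assms(1) Suc by (intro op_at_comm) auto
  from arg_cong[OF this, of cmat] have sl: "cmat (rn n l) * cmat (fn n i) = cmat (fn n i) * cmat (rn n l)"
    using cmat_mult[OF co(3,1)] cmat_mult[OF co(1,3)] by simp
  have ff: "cmat (fn n i) * cmat (fin n i) = 1\<^sub>m ?d" "cmat (fin n i) * cmat (fn n i) = 1\<^sub>m ?d"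
    using cmat_inv_n[of i n] Suc assms(1) by auto
  note cc = conj_commute[OF co(3,3,1,2)[THEN cmat_carrier] m ff sl]
  have M: "mb n (Suc i) = cmat (fn n i) * mb n i * cmat (fin n i)" using Suc assms(1) by (intro mb_Suc) simp
  show ?case using Suc unfolding M cc by simp
qed

lemma rn_TS_above: "0 < l \<Longrightarrow> Suc l \<le> s \<Longrightarrow> s + m \<le> n \<Longrightarrow> cmat (rn n l) * TS n s m = TS n s m * cmat (rn n l)"
proof (induction m)
  case 0
  have "cmat (rn n l) \<in> sq_mats (N ^ n)" using 0 by (intro cmat_carrier op_at_carrier) auto
  from left_mult_one_mat[OF this] right_mult_one_mat[OF this] show ?case by simp
next
  case (Suc m)
  have c: "cmat (rn n l) \<in> sq_mats (N ^ n)" "TS n s m \<in> sq_mats (N ^ n)"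
    "mb n (Suc (s + m)) \<in> sq_mats (N ^ n)" using Suc by auto
  have "cmat (rn n l) * mb n (Suc (s + m)) = mb n (Suc (s + m)) * cmat (rn n l)" using Suc by (intro rn_mb_above) auto
  then show ?case using Suc assoc_mult_mat[OF c] assoc_mult_mat[OF c(2,1,3)] assoc_mult_mat[OF c(2,3,1)] by simp
qed

lemma rn_TS_below: assumes "m < l" "l < n" shows "cmat (rn n l) * TS n 0 m = TS n 0 m * cmat (rn n l)"
proof -
  obtain e where e: "n = m + e" using assms by (metis less_imp_le le_Suc_ex order.trans)
  have "TS n 0 m = op_at N n 1 m (TS m 0 m)"
    unfolding e using kron_TS_pow[of 0 m m e] op_at_left[OF TS_carrier[of 0 m m], of e] by simp
  then show ?thesis using op_at_comm[of "TS m 0 m" N m "cmat R" 2 1 l n] assms by (simp add: cmat_op_at)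
qed

text \<open>The product is cut around the two matrices with barred indices \<open>j\<close> and
  \<open>j + 1\<close>. \<open>R\<close> passes the earlier ones as they act in other factors, the
  pair by the relations, and the later ones by \<open>rn_TS_above\<close>; only the pair needs a
  congruence.\<close>

lemma meq_rn_TS: assumes "0 < j" "j < n"
  shows "qa.meq (N ^ n) (cmat (rn n j) * TS n 0 n) (TS n 0 n * cmat (rn n j))"
proof -
  let ?r = "cmat (rn n j)" and ?A = "TS n 0 (j - 1)" and ?B = "TS n (j - 1) 2" and ?C = "TS n (j + 1) (n - j - 1)" and ?d = "N ^ n"
  have c: "?r \<in> sq_mats ?d" "?A \<in> sq_mats ?d" "?B \<in> sq_mats ?d" "?C \<in> sq_mats ?d"
    using assms by auto
  have F: "?r \<in> qa.FM ?d" "?A \<in> qa.FM ?d" "?B \<in> qa.FM ?d" "?C \<in> qa.FM ?d"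
    using assms by (auto intro!: qFM_cmat qFM_TS)
  have T: "TS n 0 n = ?A * ?B * ?C"
    using TS_add[of 0 "j - 1" 2 n] TS_add[of 0 "j + 1" "n - j - 1" n] assms by simp
  note a = sq_assoc[where d = ?d]
  have "?r * TS n 0 n = (?r * ?A) * ?B * ?C" unfolding T using c by (simp add: a)
  also have "?r * ?A = ?A * ?r" using assms by (intro rn_TS_below) auto
  also have "?A * ?r * ?B * ?C = ?A * (?r * ?B) * ?C" using c by (simp add: a)
  finally have 1: "?r * TS n 0 n = ?A * (?r * ?B) * ?C" .
  have "TS n 0 n * ?r = ?A * ?B * (?C * ?r)" unfolding T using c by (simp add: a)
  also have "?C * ?r = ?r * ?C" using assms by (intro rn_TS_above[symmetric]) auto
  also have "?A * ?B * (?r * ?C) = ?A * (?B * ?r) * ?C" using c by (simp add: a)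
  finally have 2: "TS n 0 n * ?r = ?A * (?B * ?r) * ?C" .
  have "qa.meq ?d (?r * ?B) (?B * ?r)" using meq_TS_two[of "j - 1" n] assms by simp
  then show ?thesis unfolding 1 2 by (intro qa.meq_mult[OF qa.meq_mult[OF qa.meq_refl[OF F(2)]] qa.meq_refl[OF F(4)]])
qed

lemma meq_alg_TS: "A \<in> alg n \<Longrightarrow> qa.meq (N ^ n) (cmat A * TS n 0 n) (TS n 0 n * cmat A)"
proof (induction rule: alg.induct)
  case alg_one
  then show ?case using qa.meq_refl[OF qFM_TS[of 0 n n]] left_mult_one_mat[OF TS_carrier[of 0 n n]] right_mult_one_mat[OF TS_carrier[of 0 n n]] by simp
next
  case (alg_R j)
  then show ?case by (rule meq_rn_TS)
next
  case (alg_Ri j)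
  let ?T = "TS n 0 n" and ?r = "cmat (rn n j)" and ?i = "cmat (rin n j)" and ?d = "N ^ n"
  have c: "?T \<in> sq_mats ?d" "?r \<in> sq_mats ?d" "?i \<in> sq_mats ?d" using alg_Ri by auto
  have F: "?T \<in> qa.FM ?d" "?r \<in> qa.FM ?d" "?i \<in> qa.FM ?d" using alg_Ri by (auto intro!: qFM_cmat qFM_TS)
  have "?r * ?i = 1\<^sub>m ?d" "?i * ?r = 1\<^sub>m ?d"
    using inv_n[OF alg_Ri] alg_Ri cmat_mult[of "rn n j" ?d ?d "rin n j" ?d] cmat_mult[of "rin n j" ?d ?d "rn n j" ?d] by auto
  note v = this
  note a = sq_assoc[where d = ?d] sq_one[where d = ?d]
  have "?i * (?T * ?r) * ?i = ?i * ?T * (?r * ?i)" using c by (simp add: a)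
  then have 1: "?i * (?T * ?r) * ?i = ?i * ?T" unfolding v using c by (simp add: a)
  have "?i * (?r * ?T) * ?i = (?i * ?r) * ?T * ?i" using c by (simp add: a)
  then have 2: "?i * (?r * ?T) * ?i = ?T * ?i" unfolding v using c by (simp add: a)
  \<comment> \<open>The congruence for \<open>R\<close>, multiplied by its inverse on both sides,
    becomes the one for the inverse.\<close>
  have "qa.meq ?d (?i * (?T * ?r) * ?i) (?i * (?r * ?T) * ?i)"
    by (intro qa.meq_mult[OF qa.meq_mult[OF qa.meq_refl[OF F(3)]] qa.meq_refl[OF F(3)]] qa.meq_sym[OF meq_rn_TS[OF alg_Ri]])
  then show ?case unfolding 1 2 .
next
  case (alg_add A B)
  have c: "TS n 0 n \<in> sq_mats (N ^ n)" "cmat A \<in> sq_mats (N ^ n)" "cmat B \<in> sq_mats (N ^ n)"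
    using alg_add by auto
  have e: "cmat (A + B) * TS n 0 n = cmat A * TS n 0 n + cmat B * TS n 0 n" "TS n 0 n * cmat (A + B) = TS n 0 n * cmat A + TS n 0 n * cmat B"
    using cmat_add[OF alg_carrier[OF alg_add(1)] alg_carrier[OF alg_add(2)]] c
    by (simp_all add: add_mult_distrib_mat[OF c(2,3,1)] mult_add_distrib_mat[OF c])
  show ?case unfolding e using alg_add.IH by (rule qa.meq_add)
next
  case (alg_mult A B)
  let ?T = "TS n 0 n" and ?d = "N ^ n"
  have c: "?T \<in> sq_mats ?d" "cmat A \<in> sq_mats ?d" "cmat B \<in> sq_mats ?d" using alg_mult by auto
  have F: "cmat A \<in> qa.FM ?d" "cmat B \<in> qa.FM ?d" using alg_mult by (auto intro!: qFM_cmat)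
  have e: "cmat (A * B) = cmat A * cmat B" by (rule cmat_mult[OF alg_carrier[OF alg_mult(1)] alg_carrier[OF alg_mult(2)]])
  have "qa.meq ?d (cmat A * (cmat B * ?T)) (cmat A * (?T * cmat B))" by (intro qa.meq_mult qa.meq_refl F alg_mult.IH)
  moreover have "qa.meq ?d ((cmat A * ?T) * cmat B) ((?T * cmat A) * cmat B)" by (intro qa.meq_mult qa.meq_refl F alg_mult.IH)
  ultimately show ?case unfolding e using qa.meq_trans[of ?d "cmat A * cmat B * ?T" "cmat A * ?T * cmat B" "?T * (cmat A * cmat B)"] c
    by (simp add: sq_assoc[where d = ?d])
next
  case (alg_smult A b)
  let ?T = "TS n 0 n" and ?d = "N ^ n"
  have c: "?T \<in> sq_mats ?d" "cmat A \<in> sq_mats ?d" using alg_smult by auto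
  have b1: "b \<cdot>\<^sub>m 1\<^sub>m ?d \<in> sq_mats ?d" by simp
  have Ac: "A \<in> sq_mats ?d" using alg_smult by simp
  have s: "b \<cdot>\<^sub>m A = (b \<cdot>\<^sub>m 1\<^sub>m ?d) * A" using mult_smult_assoc_mat[OF one_carrier_mat Ac, of b] left_mult_one_mat[OF Ac] by simp
  have f: "cmat (b \<cdot>\<^sub>m 1\<^sub>m ?d) * X = const b \<cdot>\<^sub>m X" "X * cmat (b \<cdot>\<^sub>m 1\<^sub>m ?d) = const b \<cdot>\<^sub>m X" if "X \<in> sq_mats ?d" for X
    using mult_const_left[OF that] mult_const_right[OF that] by auto
  have z: "cmat (b \<cdot>\<^sub>m A) = cmat (b \<cdot>\<^sub>m 1\<^sub>m ?d) * cmat A"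
    unfolding s by (rule cmat_mult[OF b1 Ac])
  have cb: "cmat (b \<cdot>\<^sub>m 1\<^sub>m ?d) \<in> sq_mats ?d" by simp
  have "?T * cmat (b \<cdot>\<^sub>m A) = (?T * cmat (b \<cdot>\<^sub>m 1\<^sub>m ?d)) * cmat A" unfolding z using assoc_mult_mat[OF c(1) cb c(2)] by simp
  also have "\<dots> = (cmat (b \<cdot>\<^sub>m 1\<^sub>m ?d) * ?T) * cmat A" unfolding f[OF c(1)] ..
  finally have 1: "?T * cmat (b \<cdot>\<^sub>m A) = cmat (b \<cdot>\<^sub>m 1\<^sub>m ?d) * (?T * cmat A)" using assoc_mult_mat[OF cb c] by simp
  have 2: "cmat (b \<cdot>\<^sub>m A) * ?T = cmat (b \<cdot>\<^sub>m 1\<^sub>m ?d) * (cmat A * ?T)" unfolding z using assoc_mult_mat[OF cb c(2,1)] .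
  show ?case unfolding 1 2 by (intro qa.meq_mult qa.meq_refl qFM_cmat alg_smult.IH) auto
qed

end

lemma mat_trace_cmat_comm:
  assumes A: "A \<in> sq_mats d" and X: "X \<in> sq_mats d"
  shows "mat_trace (A * cmat X) = mat_trace (cmat X * A)"
proof -
  note c = cmat_carrier[OF X]
  have "mat_trace (A * cmat X) = (\<Sum>i<d. \<Sum>j<d. A $$ (i, j) * cmat X $$ (j, i))"
    using A X by (simp add: mat_trace_def index_mult_mat_sum[OF A c] del: index_mult_mat(1))
  also have "\<dots> = (\<Sum>i<d. \<Sum>j<d. cmat X $$ (j, i) * A $$ (i, j))"
    using X by (intro sum.cong refl) (simp add: cmat_index const_central)
  also have "\<dots> = (\<Sum>j<d. \<Sum>i<d. cmat X $$ (j, i) * A $$ (i, j))" by (rule sum.swap)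
  also have "\<dots> = mat_trace (cmat X * A)"
    using A X by (simp add: mat_trace_def index_mult_mat_sum[OF c A] del: index_mult_mat(1))
  finally show ?thesis .
qed

section \<open>Cyclicity and commutation of the characters\<close>

context qma_pair begin

lemma cp_closed: "X \<in> sq_mats (N ^ n) \<Longrightarrow> cp n X \<in> carrier qa.FA"
  unfolding cp_def rt_def by (intro qa.FM_trace[of _ "N ^ n"] qa.FM_mult qFM_cmat qFM_TS Dn_carrier) simp

lemma cp_smult: assumes X: "X \<in> sq_mats (N ^ n)" shows "cp n (c \<cdot>\<^sub>m X) = const c * cp n X"
proof -
  let ?d = "N ^ n"
  have T: "TS n 0 n * cmat X \<in> sq_mats ?d" "TS n 0 n \<in> sq_mats ?d" using X by auto
  have "TS n 0 n * cmat (c \<cdot>\<^sub>m X) \<in> sq_mats ?d" using X by auto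
  note T' = this
  have "(TS n 0 n * cmat (c \<cdot>\<^sub>m X)) $$ (j, i) = const c * (TS n 0 n * cmat X) $$ (j, i)" if "j < ?d" "i < ?d" for i j
  proof -
    have "(TS n 0 n * cmat (c \<cdot>\<^sub>m X)) $$ (j, i) = (\<Sum>k<?d. TS n 0 n $$ (j, k) * (const c * const (X $$ (k, i))))"
      using index_mult_mat_sum[OF T(2) cmat_carrier[OF smult_carrier_mat[OF X]] that] that X by (simp add: cmat_index const_mult)
    also have "\<dots> = (\<Sum>k<?d. const c * (TS n 0 n $$ (j, k) * const (X $$ (k, i))))"
      by (intro sum.cong refl) (metis const_central mult.assoc)
    also have "\<dots> = const c * (TS n 0 n * cmat X) $$ (j, i)"
      using index_mult_mat_sum[OF T(2) cmat_carrier[OF X] that] that X by (simp add: cmat_index sum_distrib_left)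
    finally show ?thesis .
  qed
  note e = this
  have "const (Dn n $$ (i, j)) * (const c * p) = const c * (const (Dn n $$ (i, j)) * p)" for i j p
    by (metis const_central mult.assoc)
  then show ?thesis unfolding cp_def rt_index[OF T'] rt_index[OF T(1)] sum_distrib_left
    by (intro sum.cong refl) (simp add: e del: index_mult_mat)
qed

text \<open>The operator \<open>X\<close> commutes with the weight by \<open>Dn_alg\<close> and,
  modulo the relations, with the product of the \<open>M\<close> by \<open>meq_alg_TS\<close>. Only
  \<open>X\<close> has to come from the braid algebra.\<close>

lemma cp_cyclic:
  assumes X: "X \<in> alg n" and Y: "Y \<in> sq_mats (N ^ n)"
  shows "cp n (X * Y) - cp n (Y * X) \<in> qa.I"
proof -
  let ?d = "N ^ n" and ?D = "cmat (Dn n)" and ?T = "TS n 0 n" and ?X = "cmat X" and ?Y = "cmat Y"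
  have c: "?D \<in> sq_mats ?d" "?T \<in> sq_mats ?d" "?X \<in> sq_mats ?d" "?Y \<in> sq_mats ?d"
    using X Y by auto
  have F: "?D \<in> qa.FM ?d" "?Y \<in> qa.FM ?d" using X Y by (auto intro!: qFM_cmat)
  note a = sq_assoc[where d = ?d]
  have 1: "cp n (X * Y) = mat_trace (?D * (?T * ?X) * ?Y)"
    unfolding cp_def rt_def cmat_mult[OF alg_carrier[OF X] Y] using c by (simp add: a)
  have DX: "?X * ?D = ?D * ?X"
    using Dn_alg[OF X] cmat_mult[OF Dn_carrier alg_carrier[OF X]] cmat_mult[OF alg_carrier[OF X] Dn_carrier] by simp
  have "cp n (Y * X) = mat_trace (?D * ?T * ?Y * ?X)"
    unfolding cp_def rt_def cmat_mult[OF Y alg_carrier[OF X]] using c by (simp add: a)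
  also have "\<dots> = mat_trace (?X * (?D * ?T * ?Y))" using c X by (intro mat_trace_cmat_comm[of _ ?d]) auto
  also have "?X * (?D * ?T * ?Y) = (?X * ?D) * ?T * ?Y" using c by (simp add: a)
  also have "\<dots> = ?D * (?X * ?T) * ?Y" unfolding DX using c by (simp add: a)
  finally have 2: "cp n (Y * X) = mat_trace (?D * (?X * ?T) * ?Y)" .
  show ?thesis unfolding 1 2
    by (intro qa.meq_trace[of ?d] qa.meq_mult[OF qa.meq_mult[OF qa.meq_refl[OF F(1)] qa.meq_sym[OF meq_alg_TS[OF X]]] qa.meq_refl[OF F(2)]])
qed

lemma strand_R_alg: "m < n \<Longrightarrow> strand R n m \<in> alg n"
  by (induction m) (auto intro: alg_one alg_mult alg_R)

lemma strand_inv_R_alg: "m < n \<Longrightarrow> strand_inv Ri n m \<in> alg n"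
  by (induction m) (auto intro: alg_one alg_mult alg_Ri)

text \<open>The strand is defined by splitting off its last factor; splitting off the first as well
  lets \<open>cp_commute\<close> compare two factorisations of one strand.\<close>

lemma strand_peel: "X \<in> sq_mats (N ^ 2) \<Longrightarrow> Suc m < n \<Longrightarrow>
   strand X n (Suc m) = op_at N n 1 2 X * op_at N n 2 (n - 1) (strand X (n - 1) m)"
proof (induction m)
  case 0
  have "op_at N n 1 2 X \<in> sq_mats (N ^ n)" using 0 by (intro op_at_carrier) auto
  note left_mult_one_mat[OF this] right_mult_one_mat[OF this]
  moreover have "op_at N n 2 (n - 1) (1\<^sub>m (N ^ (n - 1)) :: complex mat) = 1\<^sub>m (N ^ n)" using 0 by simp
  ultimately show ?case using 0 by simp
next
  case (Suc m)
  have c: "strand X (n - 1) m \<in> sq_mats (N ^ (n - 1))" "op_at N (n - 1) (Suc m) 2 X \<in> sq_mats (N ^ (n - 1))"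
    using Suc by auto
  have d: "op_at N n 1 2 X \<in> sq_mats (N ^ n)" "op_at N n 2 (n - 1) (strand X (n - 1) m) \<in> sq_mats (N ^ n)"
    "op_at N n (Suc (Suc m)) 2 X \<in> sq_mats (N ^ n)"
    using Suc c by (intro op_at_carrier; auto)+
  have "op_at N n 2 (n - 1) (strand X (n - 1) (Suc m)) = op_at N n 2 (n - 1) (strand X (n - 1) m) * op_at N n (Suc (Suc m)) 2 X"
    unfolding strand.simps op_at_mult[OF c] using Suc by (simp add: op_at_op_at)
  then show ?case using Suc assoc_mult_mat[OF d] by simp
qed

text \<open>The square of the strand \<open>R\<^sub>1 \<dots> R\<^sub>n\<^sub>+\<^sub>1\<close> moves the first \<open>n\<close> factors past the last two, so it
  conjugates \<open>X \<otimes> Y\<close> into \<open>Y \<otimes> X\<close>.\<close>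

lemma cp_commute:
  assumes Y: "Y \<in> alg n" and X: "X \<in> alg 2"
  shows "cp n Y * cp 2 X - cp 2 X * cp n Y \<in> qa.I"
proof -
  define p where "p = n + 2"
  have p: "n + 1 < p" "Suc (Suc n) \<le> p" "p - 1 = n + 1" "Suc n < p" "p - Suc 0 = n + 1" by (simp_all add: p_def)
  let ?d = "N ^ p"
  define V where "V = strand R p (n + 1)"
  define Vi where "Vi = strand_inv Ri p (n + 1)"
  have alg: "V \<in> alg p" "Vi \<in> alg p" unfolding V_def Vi_def by (intro strand_R_alg strand_inv_R_alg p)+
  then have c: "V \<in> sq_mats ?d" "Vi \<in> sq_mats ?d" by auto
  have VVi: "V * Vi = 1\<^sub>m ?d" unfolding V_def Vi_def by (intro strand_cancel R_carrier Ri_carrier R_Ri p)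
  then have ViV: "Vi * V = 1\<^sub>m ?d" by (intro mat_mult_left_right_inverse[OF c])
  have slide: "rn p (Suc j) * V = V * rn p j" if "0 < j" "j < n + 1" for j
    unfolding V_def using that p by (intro strand_slide comp_n) auto
  let ?U = "V * V"
  have U: "?U \<in> sq_mats ?d" using c by simp
  note a = sq_assoc[where d = ?d]
  \<comment> \<open>The one crossing that wraps around. Splitting \<open>V\<close> at its first and
    at its last factor gives \<open>V = R_1 W = W' R_(n+1)\<close>, and sliding gives
    \<open>W V = V W'\<close>; hence
    \<open>V V R_(n+1) = R_1 V W' R_(n+1) = R_1 V V\<close>.\<close>
  have last: "rn p 1 * ?U = ?U * rn p (n + 1)"
  proof -
    let ?W = "op_at N p 2 (n + 1) (strand R (n + 1) n)" and ?W' = "op_at N p 1 (n + 1) (strand R (n + 1) n)"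
    have sc: "strand R (n + 1) n \<in> sq_mats (N ^ (n + 1))" by (intro strand_carrier R_carrier) simp
    have wc: "?W \<in> sq_mats ?d" "?W' \<in> sq_mats ?d" using p by (intro op_at_carrier[OF sc]; simp)+
    have rc: "rn p 1 \<in> sq_mats ?d" "rn p (n + 1) \<in> sq_mats ?d" using p by (intro op_at_carrier R_carrier; simp)+
    have 1: "V = rn p 1 * ?W" unfolding V_def using strand_peel[OF R_carrier, of n p] p by simp
    have 2: "V = ?W' * rn p (n + 1)" unfolding V_def
      using strand_kron[OF R_carrier, of n "n + 1"] op_at_left[OF sc, of 1] by (simp add: p_def)
    have 3: "?W * V = V * ?W'"
    proof (rule alg_intertwine[OF c(1)])
      show "strand R (n + 1) n \<in> alg (n + 1)" by (rule strand_R_alg) simp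
      show "rn p (2 + j - 1) * V = V * rn p (1 + j - 1)" if "0 < j" "j < n + 1" for j
        using slide[OF that] by simp
    qed (use p in auto)
    have "?U * rn p (n + 1) = rn p 1 * (?W * V) * rn p (n + 1)" 
      unfolding assoc_mult_mat[OF rc(1) wc(1) c(1), symmetric] 1[symmetric] ..
    also have "\<dots> = rn p 1 * (V * (?W' * rn p (n + 1)))" unfolding 3 using wc rc c by (simp add: a)
    also have "?W' * rn p (n + 1) = V" using 2 by simp
    finally show ?thesis ..
  qed
  have 1: "op_at N p 1 2 X * ?U = ?U * op_at N p (n + 1) 2 X"
  proof (rule alg_intertwine[OF U _ _ _ _ _ X])
    fix j :: nat assume "0 < j" "j < 2"
    then have "j = 1" by simp
    then show "rn p (1 + j - 1) * ?U = ?U * rn p (n + 1 + j - 1)" using last by simp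
  qed (use p in auto)
  have 2: "op_at N p 3 n Y * ?U = ?U * op_at N p 1 n Y"
  proof (rule alg_intertwine[OF U _ _ _ _ _ Y])
    fix j assume j: "0 < j" "j < n"
    have r: "rn p j \<in> sq_mats ?d" "rn p (Suc j) \<in> sq_mats ?d" "rn p (Suc (Suc j)) \<in> sq_mats ?d" using j p by auto
    have "rn p (Suc (Suc j)) * ?U = (rn p (Suc (Suc j)) * V) * V" using r c by (simp add: a)
    also have "\<dots> = V * (rn p (Suc j) * V)" using slide[of "Suc j"] j p r c by (simp add: a)
    also have "\<dots> = ?U * rn p j" using slide[of j] j p r c by (simp add: a)
    finally show "rn p (3 + j - 1) * ?U = ?U * rn p (1 + j - 1)" by (simp add: numeral_3_eq_3)
  qed (use p in auto)
  have Xc: "X \<in> sq_mats (N ^ 2)" and Yc: "Y \<in> sq_mats (N ^ n)" using X Y by auto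
  have pc: "op_at N p 1 2 X \<in> sq_mats ?d" "op_at N p (n + 1) 2 X \<in> sq_mats ?d"
    "op_at N p 3 n Y \<in> sq_mats ?d" "op_at N p 1 n Y \<in> sq_mats ?d"
    using Xc Yc p by (intro op_at_carrier; simp)+
  have kYX: "kron Y X = op_at N p 1 n Y * op_at N p (n + 1) 2 X"
    using op_at_left[OF Yc, of 2] op_at_right[OF Xc, of n]
      kron_mult_complex[OF Yc one_carrier_mat one_carrier_mat Xc] left_mult_one_mat[OF Xc] right_mult_one_mat[OF Yc] by (simp add: p_def)
  have kXY: "kron X Y = op_at N p 3 n Y * op_at N p 1 2 X"
    using op_at_left[OF Xc, of n] op_at_right[OF Yc, of 2]
      kron_mult_complex[OF one_carrier_mat Yc Xc one_carrier_mat] left_mult_one_mat[OF Xc] right_mult_one_mat[OF Yc]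
    by (simp add: add.commute numeral_3_eq_3 numeral_2_eq_2 p_def)
  have kc: "kron X Y \<in> sq_mats ?d" "kron Y X \<in> sq_mats ?d" unfolding kYX kXY using pc by simp_all
  have "kron X Y * ?U = op_at N p 3 n Y * (op_at N p 1 2 X * ?U)" unfolding kXY using assoc_mult_mat[OF pc(3,1) U] .
  also have "\<dots> = (op_at N p 3 n Y * ?U) * op_at N p (n + 1) 2 X" unfolding 1 using assoc_mult_mat[OF pc(3) U pc(2)] by simp
  also have "\<dots> = ?U * kron Y X" unfolding 2 kYX using assoc_mult_mat[OF U pc(4,2)] by simp
  finally have k: "kron X Y * ?U = ?U * kron Y X" .
  have i: "Vi * Vi * ?U = 1\<^sub>m ?d"
  proof -
    have "Vi * Vi * ?U = Vi * (Vi * V) * V" using c by (simp add: a)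
    then show ?thesis unfolding ViV using c ViV right_mult_one_mat[OF c(2)] by simp
  qed
  have i': "?U * (Vi * Vi) = 1\<^sub>m ?d" using c i by (intro mat_mult_left_right_inverse[OF _ _ i]) auto
  have e1: "kron Y X = Vi * Vi * (kron X Y * ?U)"
    unfolding k using i assoc_mult_mat[of "Vi * Vi" ?d ?d ?U ?d "kron Y X" ?d] c kc left_mult_one_mat[OF kc(2)] by simp
  have e2: "kron X Y * ?U * (Vi * Vi) = kron X Y"
    using i' assoc_mult_mat[of "kron X Y" ?d ?d ?U ?d "Vi * Vi" ?d] c kc right_mult_one_mat[OF kc(1)] by simp
  \<comment> \<open>The conjugating operator lies in the image of the braid algebra, so cyclicity
    makes the characters of the two conjugate operators congruent.\<close>
  have "Vi * Vi \<in> alg p" using alg by (intro alg_mult)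
  then have "cp p (Vi * Vi * (kron X Y * ?U)) - cp p (kron X Y * ?U * (Vi * Vi)) \<in> qa.I"
    using kc U by (intro cp_cyclic) auto
  then show ?thesis unfolding cp_mult[OF Yc X] cp_mult[OF Xc Y] e1[symmetric] e2 by (simp add: add.commute p_def)
qed

end

section \<open>Antisymmetrizers of rank one\<close>

lemma mat_smult_mult:
  fixes A :: "complex mat"
  assumes "A \<in> carrier_mat a b" "B \<in> carrier_mat b c"
  shows "(x \<cdot>\<^sub>m A) * B = x \<cdot>\<^sub>m (A * B)" "A * (x \<cdot>\<^sub>m B) = x \<cdot>\<^sub>m (A * B)"
  using mult_smult_assoc_mat[OF assms] mult_smult_distrib[OF assms] by auto

lemma one_smult_mat: "1 \<cdot>\<^sub>m A = (A :: complex mat)"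
  by (intro eq_matI) auto

text \<open>With \<open>P = T T\<^sub>2 B\<close> and \<open>Q = B S\<^sub>2 S\<close> the hypotheses give \<open>Q P = x y B\<close>. Adding \<open>1 - B\<close> to
  both factors turns this into a left inverse of a square matrix, hence \<open>P Q = x y B\<close> as well.\<close>

lemma swap_projections:
  fixes A B S T S2 T2 :: "complex mat"
  assumes A: "A \<in> sq_mats a" and B: "B \<in> sq_mats b" and S: "S \<in> carrier_mat a b" and T: "T \<in> carrier_mat b a"
    and S2: "S2 \<in> carrier_mat b a" and T2: "T2 \<in> carrier_mat a b"
    and BB: "B * B = B"
    and ST: "S * T = x \<cdot>\<^sub>m A" and ST2: "S2 * T2 = y \<cdot>\<^sub>m B" and SB: "S * B = S" and BT: "B * T = T"
    and AT2: "A * T2 = T2" and x: "x \<noteq> 0" and y: "y \<noteq> 0"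
  shows "T * S = x \<cdot>\<^sub>m B"
proof -
  define P where "P = T * T2 * B"
  define Q where "Q = (1 / (x * y)) \<cdot>\<^sub>m (B * S2 * S)"
  define C where "C = 1\<^sub>m b - B"
  have c: "P \<in> sq_mats b" "Q \<in> sq_mats b" "C \<in> sq_mats b"
    unfolding P_def Q_def C_def using A B S T S2 T2 by (auto intro: minus_carrier_mat)
  have BC: "B * C = 0\<^sub>m b b" unfolding C_def using B BB by (subst mult_minus_distrib_mat[OF B one_carrier_mat B]) auto
  have CB: "C * B = 0\<^sub>m b b" unfolding C_def using B BB by (subst minus_mult_distrib_mat[OF one_carrier_mat B]) auto
  have CC: "C * C = C"
    using minus_mult_distrib_mat[OF one_carrier_mat B c(3)] BC left_mult_one_mat[OF c(3)] c(3) unfolding C_def[symmetric] by auto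
  have BP: "B * P = P" unfolding P_def using assoc_mult_mat[OF B T mult_carrier_mat[OF T2 B]] assoc_mult_mat[OF T T2 B] BT by (metis assoc_mult_mat[OF B T])
  have PB: "P * B = P" unfolding P_def using assoc_mult_mat[OF mult_carrier_mat[OF T T2] B B] BB by simp
  have BQ: "B * Q = Q" unfolding Q_def using B S S2 BB
    by (simp add: mat_smult_mult(2)[of B b b _ b] assoc_mult_mat[of B b b S2 a S b] assoc_mult_mat[of B b b B b "S2 * S" b, symmetric])
  have "B * S2 * S * B = B * S2 * S" using assoc_mult_mat[OF mult_carrier_mat[OF B S2] S B] SB by simp
  then have QB: "Q * B = Q" unfolding Q_def using mat_smult_mult(1)[OF mult_carrier_mat[OF mult_carrier_mat[OF B S2] S] B] by simp
  have CP: "C * P = 0\<^sub>m b b" using assoc_mult_mat[OF c(3) B c(1)] BP CB left_mult_zero_mat[OF c(1)] by simp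
  have PC: "P * C = 0\<^sub>m b b" using assoc_mult_mat[OF c(1) B c(3)] PB BC right_mult_zero_mat[OF c(1)] by simp
  have CQ: "C * Q = 0\<^sub>m b b" using assoc_mult_mat[OF c(3) B c(2)] BQ CB left_mult_zero_mat[OF c(2)] by simp
  have QC: "Q * C = 0\<^sub>m b b" using assoc_mult_mat[OF c(2) B c(3)] QB BC right_mult_zero_mat[OF c(2)] by simp
  have "B * S2 * S * P = x * y \<cdot>\<^sub>m B"
  proof -
    have "B * S2 * S * P = B * (S2 * ((S * T) * (T2 * B)))"
      unfolding P_def assoc_mult_mat[OF T T2 B] assoc_mult_mat[OF B S2 S]
        assoc_mult_mat[OF B mult_carrier_mat[OF S2 S] mult_carrier_mat[OF T mult_carrier_mat[OF T2 B]]]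
        assoc_mult_mat[OF S2 S mult_carrier_mat[OF T mult_carrier_mat[OF T2 B]]]
        assoc_mult_mat[OF S T mult_carrier_mat[OF T2 B]] ..
    also have "(S * T) * (T2 * B) = x \<cdot>\<^sub>m (T2 * B)" unfolding ST using A B T2 AT2
      by (simp add: mat_smult_mult(1)[of _ a a _ b] assoc_mult_mat[of A a a T2 b B b, symmetric])
    also have "B * (S2 * (x \<cdot>\<^sub>m (T2 * B))) = x \<cdot>\<^sub>m (B * ((S2 * T2) * B))" using B S2 T2
      by (simp add: mat_smult_mult(2)[of _ b a _ b] mat_smult_mult(2)[of _ b b _ b] assoc_mult_mat[of S2 b a T2 b B b])
    also have "\<dots> = x * y \<cdot>\<^sub>m B" unfolding ST2 using B BB
      by (simp add: mat_smult_mult[of _ b b _ b] smult_smult_mat)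
    finally show ?thesis .
  qed
  then have QP: "Q * P = B" unfolding Q_def using B S S2 c(1) x y
    by (simp add: mat_smult_mult(1)[of _ b b _ b] smult_smult_mat one_smult_mat)
  have add: "(U + C) * (W + C) = U * W + U * C + (C * W + C * C)"
    if UW: "U \<in> sq_mats b" "W \<in> sq_mats b" for U W
    using add_mult_distrib_mat[OF UW(1) c(3) add_carrier_mat[OF c(3), of W]]
      mult_add_distrib_mat[OF UW(1,2) c(3)] mult_add_distrib_mat[OF c(3) UW(2) c(3)] by simp
  have BC1: "B + C = 1\<^sub>m b" unfolding C_def using B by auto
  have "(Q + C) * (P + C) = 1\<^sub>m b" unfolding add[OF c(2,1)] QP QC CP CC using B c BC1 by simp
  then have "(P + C) * (Q + C) = 1\<^sub>m b" using c by (intro mat_mult_left_right_inverse[of "Q + C" b]) auto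
  then have PQ1: "P * Q + C = 1\<^sub>m b" unfolding add[OF c(1,2)] PC CQ CC using c by simp
  have PQ: "P * Q = B"
  proof -
    have pq: "P * Q \<in> sq_mats b" using c by simp
    have "(P * Q) $$ (i, j) = B $$ (i, j)" if ij: "i < b" "j < b" for i j
      using arg_cong[OF PQ1, of "\<lambda>M. M $$ (i, j)"] ij c B unfolding C_def by (simp del: index_mult_mat(1))
    then show ?thesis using pq B by (intro eq_matI) (auto simp del: index_mult_mat(1))
  qed
  \<comment> \<open>Replacing \<open>B\<close> by \<open>P Q\<close> creates the inner product
    \<open>S T\<close>, which is \<open>x A\<close> and disappears into \<open>T2\<close>; what is
    left is \<open>x P Q\<close> again.\<close>
  have "T * S = T * S * (P * Q)" unfolding PQ using assoc_mult_mat[OF T S B] SB by simp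
  also have "\<dots> = T * (S * (T * (T2 * B))) * Q"
    unfolding assoc_mult_mat[OF mult_carrier_mat[OF T S] c(1,2), symmetric] assoc_mult_mat[OF T S c(1)]
    unfolding P_def assoc_mult_mat[OF T T2 B] ..
  also have "S * (T * (T2 * B)) = x \<cdot>\<^sub>m (T2 * B)"
  proof -
    have "S * (T * (T2 * B)) = (S * T) * (T2 * B)" using assoc_mult_mat[OF S T mult_carrier_mat[OF T2 B]] by simp
    also have "\<dots> = x \<cdot>\<^sub>m (A * T2 * B)" unfolding ST using A B T2
      by (simp add: mat_smult_mult(1)[of _ a a _ b] assoc_mult_mat[of A a a T2 b B b])
    finally show ?thesis unfolding AT2 .
  qed
  also have "T * (x \<cdot>\<^sub>m (T2 * B)) = x \<cdot>\<^sub>m P" unfolding P_def using B T T2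
    by (simp add: mat_smult_mult(2)[of _ b a _ b] assoc_mult_mat[of T b a T2 b B b])
  also have "x \<cdot>\<^sub>m P * Q = x \<cdot>\<^sub>m B" using mat_smult_mult(1)[OF c(1,2)] PQ by simp
  finally show ?thesis .
qed

text \<open>The matrix situation behind the cups, with \<open>p\<close>, \<open>a\<close>,
  \<open>b\<close>, \<open>g\<close> standing for \<open>N\<close> to the powers \<open>k\<close>,
  \<open>i\<close>, \<open>m\<close>, \<open>2 * m\<close>. The two ways of splitting the same
  tensor power, into \<open>k + m\<close> and into \<open>i + 2 * m\<close> factors, are recorded by
  \<open>dim\<close>.\<close>

locale rank_one_cup =
  fixes p a b g :: nat and u v Ak Ai Bm E Wd Wu :: "complex mat" and \<kappa> :: complex
  assumes dim: "p * b = a * g"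
    and u: "u \<in> carrier_mat p 1" and v: "v \<in> carrier_mat 1 p" and Ak: "Ak = u * v" and vu: "v * u = 1\<^sub>m 1"
    and Ai: "Ai \<in> sq_mats a" and Bm: "Bm \<in> sq_mats b" and E: "E \<in> sq_mats g"
    and Wd: "Wd \<in> sq_mats (p * b)" and Wu: "Wu \<in> sq_mats (p * b)"
    and Wd_Wu: "Wd * kron Ak (1\<^sub>m b) * Wu = \<kappa> \<cdot>\<^sub>m kron Ai E"
    and Wd_B: "Wd * kron Ak (1\<^sub>m b) * kron (1\<^sub>m p) Bm = Wd * kron Ak (1\<^sub>m b)"
    and B_Wu: "kron (1\<^sub>m p) Bm * (kron Ak (1\<^sub>m b) * Wu) = kron Ak (1\<^sub>m b) * Wu"
begin

abbreviation "D \<equiv> p * b"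
text \<open>Rank one lets the first \<open>k\<close> factors be stripped off: \<open>U * V\<close>
  is \<open>Ak\<close> on these factors and \<open>V * U\<close> is the identity on the remaining
  ones. \<open>J\<close> and \<open>L\<close> are the cups with this line inserted.\<close>

definition "U = kron u (1\<^sub>m b)"
definition "V = kron v (1\<^sub>m b)"
definition "J = Wd * U"
definition "L = V * Wu"

lemma UV: "U \<in> carrier_mat D b" "V \<in> carrier_mat b D" "U * V = kron Ak (1\<^sub>m b)" "V * U = 1\<^sub>m b"
  unfolding U_def V_def Ak using kron_carrier[OF u one_carrier_mat[of b]] kron_carrier[OF v one_carrier_mat[of b]]
    kron_mult_complex[OF u one_carrier_mat v one_carrier_mat, of b]
    kron_mult_complex[OF v one_carrier_mat u one_carrier_mat, of b] vu by simp_all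

lemma J: "J \<in> carrier_mat D b" and L: "L \<in> carrier_mat b D"
  unfolding J_def L_def using UV Wd Wu by auto

lemma UB: "U * Bm = kron (1\<^sub>m p) Bm * U" and BV: "Bm * V = V * kron (1\<^sub>m p) Bm"
proof -
  have B1: "Bm = kron (1\<^sub>m 1) Bm" using kron_one_left[of Bm] by simp
  show "U * Bm = kron (1\<^sub>m p) Bm * U" unfolding U_def
    using kron_mult_complex[OF u one_carrier_mat one_carrier_mat Bm] kron_mult_complex[OF one_carrier_mat Bm u one_carrier_mat]
      left_mult_one_mat[OF u] right_mult_one_mat[OF u] left_mult_one_mat[OF Bm] right_mult_one_mat[OF Bm] B1 by simp
  show "Bm * V = V * kron (1\<^sub>m p) Bm" unfolding V_def
    using kron_mult_complex[OF v one_carrier_mat one_carrier_mat Bm] kron_mult_complex[OF one_carrier_mat Bm v one_carrier_mat]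
      left_mult_one_mat[OF v] right_mult_one_mat[OF v] left_mult_one_mat[OF Bm] right_mult_one_mat[OF Bm] B1 by simp
qed

lemma kB: "kron (1\<^sub>m p) Bm \<in> sq_mats D"
  using Bm by auto

lemma JB: "J * Bm = J"
proof -
  have U: "U = kron Ak (1\<^sub>m b) * U"
    unfolding UV(3)[symmetric] assoc_mult_mat[OF UV(1,2,1)] UV(4) right_mult_one_mat[OF UV(1)] ..
  have kA: "kron Ak (1\<^sub>m b) \<in> sq_mats D" unfolding UV(3)[symmetric] by (rule mult_carrier_mat[OF UV(1,2)])
  have comm: "kron (1\<^sub>m p) Bm * kron Ak (1\<^sub>m b) = kron Ak (1\<^sub>m b) * kron (1\<^sub>m p) Bm"
    using kron_mult_complex[OF one_carrier_mat Bm _ one_carrier_mat, of Ak p p] kron_mult_complex[OF _ one_carrier_mat one_carrier_mat Bm, of Ak p p]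
      u v Ak Bm by simp
  have "J * Bm = Wd * (kron (1\<^sub>m p) Bm * U)" unfolding J_def UB[symmetric] using assoc_mult_mat[OF Wd UV(1) Bm] .
  also have "\<dots> = Wd * (kron (1\<^sub>m p) Bm * (kron Ak (1\<^sub>m b) * U))" using U by simp
  also have "\<dots> = Wd * (kron Ak (1\<^sub>m b) * kron (1\<^sub>m p) Bm * U)" using assoc_mult_mat[OF kB kA UV(1)] comm by simp
  also have "\<dots> = Wd * kron Ak (1\<^sub>m b) * kron (1\<^sub>m p) Bm * U"
    using assoc_mult_mat[OF Wd sq_mult_carrier[OF kA kB] UV(1)] assoc_mult_mat[OF Wd kA kB] by simp
  also have "\<dots> = Wd * (kron Ak (1\<^sub>m b) * U)" unfolding Wd_B by (rule assoc_mult_mat[OF Wd kA UV(1)])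
  finally show ?thesis unfolding J_def using U by simp
qed

lemma BL: "Bm * L = L"
proof -
  have kA: "kron Ak (1\<^sub>m b) \<in> sq_mats D" unfolding UV(3)[symmetric] by (rule mult_carrier_mat[OF UV(1,2)])
  have V: "V = V * kron Ak (1\<^sub>m b)"
    unfolding UV(3)[symmetric] assoc_mult_mat[OF UV(2,1,2), symmetric] UV(4) left_mult_one_mat[OF UV(2)] ..
  have comm: "kron (1\<^sub>m p) Bm * kron Ak (1\<^sub>m b) = kron Ak (1\<^sub>m b) * kron (1\<^sub>m p) Bm"
    using kron_mult_complex[OF one_carrier_mat Bm _ one_carrier_mat, of Ak p p] kron_mult_complex[OF _ one_carrier_mat one_carrier_mat Bm, of Ak p p]
      u v Ak Bm by simp
  have VW: "V * (kron Ak (1\<^sub>m b) * Wu) = L" unfolding L_def using V assoc_mult_mat[OF UV(2) kA Wu] by simp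
  have "Bm * L = V * kron (1\<^sub>m p) Bm * Wu" unfolding L_def BV[symmetric] using assoc_mult_mat[OF Bm UV(2) Wu] by simp
  also have "\<dots> = V * kron Ak (1\<^sub>m b) * kron (1\<^sub>m p) Bm * Wu" using V by simp
  also have "\<dots> = V * (kron (1\<^sub>m p) Bm * kron Ak (1\<^sub>m b)) * Wu" unfolding comm using assoc_mult_mat[OF UV(2) kA kB] by simp
  also have "\<dots> = V * (kron (1\<^sub>m p) Bm * (kron Ak (1\<^sub>m b) * Wu))"
    using assoc_mult_mat[OF UV(2) sq_mult_carrier[OF kB kA] Wu] assoc_mult_mat[OF kB kA Wu] by simp
  also have "\<dots> = L" unfolding B_Wu VW ..
  finally show ?thesis .
qed

lemma JL: "J * L = \<kappa> \<cdot>\<^sub>m kron Ai E"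
proof -
  have "J * L = Wd * (U * V) * Wu" unfolding J_def L_def
    using assoc_mult_mat[OF mult_carrier_mat[OF Wd UV(1)] UV(2) Wu] assoc_mult_mat[OF Wd UV(1,2)] by simp
  then show ?thesis unfolding UV Wd_Wu .
qed

text \<open>\<open>L * J\<close> is the operator e of the overview; its precise form is still to be
  found.\<close>

lemma Ak_Wu_Wd_Ak: "kron Ak (1\<^sub>m b) * Wu * (Wd * kron Ak (1\<^sub>m b)) = kron Ak (L * J)"
proof -
  have LJ: "L * J \<in> sq_mats b" using J L by auto
  have 1: "kron Ak (1\<^sub>m b) * Wu = U * L" "Wd * kron Ak (1\<^sub>m b) = J * V"
    unfolding UV(3)[symmetric] L_def J_def using assoc_mult_mat[OF UV(1,2) Wu] assoc_mult_mat[OF Wd UV(1,2)] by simp_all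
  have "U * L * (J * V) = U * (L * J) * V"
    using assoc_mult_mat[OF UV(1) L mult_carrier_mat[OF J UV(2)]] assoc_mult_mat[OF L J UV(2)] assoc_mult_mat[OF UV(1) LJ UV(2)] by simp
  also have "\<dots> = kron Ak (L * J)" unfolding U_def V_def Ak
    using kron_mult_complex[OF u one_carrier_mat one_carrier_mat LJ] kron_mult_complex[OF u LJ v one_carrier_mat]
      right_mult_one_mat[OF u] left_mult_one_mat[OF LJ] right_mult_one_mat[OF LJ] kron_one_left[of "L * J"] by simp
  finally show ?thesis unfolding 1 .
qed

text \<open>Coordinate vectors on the factors where \<open>E\<close> acts. Enclosing
  \<open>E\<close> between them leaves one entry of \<open>E\<close>, so that for a nonzero entry
  \<open>S w\<close> and \<open>T w'\<close> are maps between the ranges of \<open>Ai\<close> and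
  \<open>Bm\<close> with product a nonzero multiple of \<open>Ai\<close>.\<close>

definition "row_of w = mat 1 g (\<lambda>(i, j). if j = w then 1 else (0 :: complex))"
definition "col_of w = mat g 1 (\<lambda>(i, j). if i = w then 1 else (0 :: complex))"
definition "S w = kron (1\<^sub>m a) (row_of w) * J"
definition "T w = L * kron (1\<^sub>m a) (col_of w)"

lemma row_col: "row_of w \<in> carrier_mat 1 g" "col_of w \<in> carrier_mat g 1"
  by (auto simp: row_of_def col_of_def)

lemma kron_row_col: "kron (1\<^sub>m a) (row_of w) \<in> carrier_mat a D" "kron (1\<^sub>m a) (col_of w) \<in> carrier_mat D a"
  using kron_carrier[OF one_carrier_mat row_col(1), of a w] kron_carrier[OF one_carrier_mat row_col(2), of a w] dim by auto

lemma S: "S w \<in> carrier_mat a b" and T: "T w \<in> carrier_mat b a"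
  unfolding S_def T_def by (rule mult_carrier_mat[OF kron_row_col(1) J], rule mult_carrier_mat[OF L kron_row_col(2)])

lemma SB: "S w * Bm = S w"
  unfolding S_def using assoc_mult_mat[OF kron_row_col(1) J Bm] JB by simp

lemma BT: "Bm * T w = T w"
  unfolding T_def using assoc_mult_mat[OF Bm L kron_row_col(2)] BL by simp

lemma row_E_col: "w < g \<Longrightarrow> w' < g \<Longrightarrow> row_of w * E * col_of w' = E $$ (w, w') \<cdot>\<^sub>m 1\<^sub>m 1"
proof (rule eq_matI)
  assume w: "w < g" "w' < g"
  have c: "row_of w * E \<in> carrier_mat 1 g" by (rule mult_carrier_mat[OF row_col(1) E])
  have r: "(row_of w * E) $$ (0, j) = E $$ (w, j)" if "j < g" for j
  proof -
    have "(row_of w * E) $$ (0, j) = (\<Sum>l<g. row_of w $$ (0, l) * E $$ (l, j))"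
      by (rule index_mult_mat_sum[OF row_col(1) E]) (use that in auto)
    also have "\<dots> = (\<Sum>l<g. if l = w then E $$ (w, j) else 0)"
      by (intro sum.cong refl) (auto simp: row_of_def)
    finally show ?thesis using w by simp
  qed
  have e: "(row_of w * E * col_of w') $$ (0, 0) = E $$ (w, w')"
  proof -
    have "(row_of w * E * col_of w') $$ (0, 0) = (\<Sum>l<g. (row_of w * E) $$ (0, l) * col_of w' $$ (l, 0))"
      by (rule index_mult_mat_sum[OF c row_col(2)]) auto
    also have "\<dots> = (\<Sum>l<g. if l = w' then E $$ (w, w') else 0)"
      by (intro sum.cong refl) (auto simp: col_of_def r simp del: index_mult_mat)
    finally show ?thesis using w by simp
  qed
  fix i j assume "i < dim_row (E $$ (w, w') \<cdot>\<^sub>m 1\<^sub>m 1)" "j < dim_col (E $$ (w, w') \<cdot>\<^sub>m 1\<^sub>m 1)"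
  then show "(row_of w * E * col_of w') $$ (i, j) = (E $$ (w, w') \<cdot>\<^sub>m 1\<^sub>m 1) $$ (i, j)" using e by simp
qed (auto simp: row_of_def col_of_def)

lemma ST: assumes "w < g" "w' < g" shows "S w * T w' = (\<kappa> * E $$ (w, w')) \<cdot>\<^sub>m Ai"
proof -
  let ?r = "kron (1\<^sub>m a) (row_of w)" and ?c = "kron (1\<^sub>m a) (col_of w')"
  note rc = kron_row_col(1)[of w] kron_row_col(2)[of w']
  have kE: "kron Ai E \<in> sq_mats D" using kron_carrier[OF Ai E] dim by simp
  have "S w * T w' = ?r * (J * L) * ?c" unfolding S_def T_def
    using assoc_mult_mat[OF mult_carrier_mat[OF rc(1) J] L rc(2)] assoc_mult_mat[OF rc(1) J L] by simp
  also have "\<dots> = \<kappa> \<cdot>\<^sub>m (?r * kron Ai E * ?c)" unfolding JL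
    using mat_smult_mult(2)[OF rc(1) kE] mat_smult_mult(1)[OF mult_carrier_mat[OF rc(1) kE] rc(2)] by simp
  also have "?r * kron Ai E = kron Ai (row_of w * E)"
    using kron_mult_complex[OF one_carrier_mat row_col(1) Ai E] left_mult_one_mat[OF Ai] by simp
  also have "kron Ai (row_of w * E) * ?c = kron Ai (row_of w * E * col_of w')"
    using kron_mult_complex[OF Ai mult_carrier_mat[OF row_col(1) E] one_carrier_mat row_col(2)] right_mult_one_mat[OF Ai] by simp
  also have "\<dots> = E $$ (w, w') \<cdot>\<^sub>m Ai" unfolding row_E_col[OF assms] using kron_smult_right[of Ai _ "1\<^sub>m 1"] kron_one_right[of Ai] by simp
  finally show ?thesis by (simp add: smult_smult_mat)
qed

text \<open>\<open>L J\<close> is computed by inserting \<open>T S\<close>, a multiple of \<open>Bm\<close>, on its right.\<close>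

lemma LJ_scalar:
  assumes w: "w < g" "w' < g" "E $$ (w, w') \<noteq> 0" and \<kappa>: "\<kappa> \<noteq> 0"
    and BB: "Bm * Bm = Bm" and Wu_E: "Wu * kron (1\<^sub>m a) E = h \<cdot>\<^sub>m Wu"
    and TS: "T w' * S w = (\<kappa> * E $$ (w, w')) \<cdot>\<^sub>m Bm"
  shows "L * J = (\<kappa> * h) \<cdot>\<^sub>m Bm"
proof -
  let ?f = "E $$ (w, w')"
  let ?c = "kron (1\<^sub>m a) (col_of w')"
  note rc = kron_row_col(2)[of w']
  have kE: "kron Ai E \<in> sq_mats D" "kron (1\<^sub>m a) E \<in> sq_mats D" using kron_carrier[OF Ai E] kron_carrier[OF one_carrier_mat E, of a] dim by simp_all
  have kAE: "kron Ai E = kron (1\<^sub>m a) E * kron Ai (1\<^sub>m g)"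
    using kron_mult_complex[OF one_carrier_mat E Ai one_carrier_mat] left_mult_one_mat[OF Ai] right_mult_one_mat[OF E] by simp
  have A1: "kron Ai (1\<^sub>m g) \<in> sq_mats D" using kron_carrier[OF Ai one_carrier_mat[of g]] dim by simp
  have Ac: "kron Ai (1\<^sub>m g) * ?c = ?c * Ai"
    using kron_mult_complex[OF Ai one_carrier_mat one_carrier_mat row_col(2)[of w']]
      kron_mult_complex[OF one_carrier_mat row_col(2)[of w'] Ai one_carrier_mat] kron_one_right[of Ai]
      left_mult_one_mat[OF Ai] right_mult_one_mat[OF Ai] left_mult_one_mat[OF row_col(2)] right_mult_one_mat[OF row_col(2)] by simp
  have LE: "L * kron (1\<^sub>m a) E = h \<cdot>\<^sub>m L"
    unfolding L_def using assoc_mult_mat[OF UV(2) Wu kE(2)] Wu_E mat_smult_mult(2)[OF UV(2) Wu] by simp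
  have "L * kron Ai E = h \<cdot>\<^sub>m (L * kron Ai (1\<^sub>m g))"
    unfolding kAE assoc_mult_mat[OF L kE(2) A1, symmetric] LE by (rule mat_smult_mult(1)[OF L A1])
  then have LT: "L * kron Ai E * ?c = h \<cdot>\<^sub>m (T w' * Ai)"
    unfolding T_def using mat_smult_mult(1)[OF mult_carrier_mat[OF L A1] rc] assoc_mult_mat[OF L A1 rc] Ac assoc_mult_mat[OF L rc Ai] by simp
  have LJc: "L * J \<in> sq_mats b" using L J by auto
  have "(\<kappa> * ?f) \<cdot>\<^sub>m (L * J) = L * J * (T w' * S w)"
    unfolding TS using mat_smult_mult(2)[OF LJc Bm] assoc_mult_mat[OF L J Bm] JB by simp
  also have "\<dots> = L * (J * L) * ?c * S w"
    unfolding T_def using assoc_mult_mat[OF mult_carrier_mat[OF LJc L] rc S] assoc_mult_mat[OF LJc mult_carrier_mat[OF L rc] S] assoc_mult_mat[OF LJc L rc]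
      assoc_mult_mat[OF L J L] by simp
  also have "L * (J * L) * ?c = (\<kappa> * h) \<cdot>\<^sub>m (T w' * Ai)" unfolding JL
    using mat_smult_mult(2)[OF L kE(1)] mat_smult_mult(1)[OF mult_carrier_mat[OF L kE(1)] rc] LT by (simp add: smult_smult_mat)
  also have "\<dots> * S w = (\<kappa> * h) \<cdot>\<^sub>m (T w' * Ai * S w)" using mat_smult_mult(1)[OF mult_carrier_mat[OF T Ai] S] .
  finally have 1: "(\<kappa> * ?f) \<cdot>\<^sub>m (L * J) = (\<kappa> * h) \<cdot>\<^sub>m (T w' * Ai * S w)" .
  have TSc: "T w' * S w \<in> sq_mats b" by (rule mult_carrier_mat[OF T S])
  \<comment> \<open>The middle \<open>Ai\<close> is a multiple of \<open>S w * T w'\<close>, so this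
    is the square of \<open>T w' * S w\<close>, known from \<open>TS\<close> and idempotency of
    \<open>Bm\<close>.\<close>
  have "(\<kappa> * ?f) \<cdot>\<^sub>m (T w' * Ai * S w) = T w' * (S w * T w') * S w"
    unfolding ST[OF w(1,2)] using mat_smult_mult(2)[OF T Ai] mat_smult_mult(1)[OF mult_carrier_mat[OF T Ai] S] by simp
  also have "\<dots> = (T w' * S w) * (T w' * S w)"
    using assoc_mult_mat[OF T S T] assoc_mult_mat[OF TSc T S] by simp
  also have "\<dots> = (\<kappa> * ?f) * (\<kappa> * ?f) \<cdot>\<^sub>m Bm"
    unfolding TS using mat_smult_mult[OF Bm Bm] mat_smult_mult(1)[OF Bm smult_carrier_mat[OF Bm]] BB by (simp add: smult_smult_mat)
  finally have 2: "(\<kappa> * ?f) \<cdot>\<^sub>m (T w' * Ai * S w) = (\<kappa> * ?f) * (\<kappa> * ?f) \<cdot>\<^sub>m Bm" .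
  have nz: "\<kappa> * ?f \<noteq> 0" using w \<kappa> by simp
  have cancel: "X = Y" if "(\<kappa> * ?f) \<cdot>\<^sub>m X = (\<kappa> * ?f) \<cdot>\<^sub>m Y" for X Y :: "complex mat"
  proof -
    have "(1 / (\<kappa> * ?f)) \<cdot>\<^sub>m ((\<kappa> * ?f) \<cdot>\<^sub>m X) = (1 / (\<kappa> * ?f)) \<cdot>\<^sub>m ((\<kappa> * ?f) \<cdot>\<^sub>m Y)" using that by simp
    then show ?thesis using nz by (simp add: smult_smult_mat one_smult_mat)
  qed
  have 3: "T w' * Ai * S w = (\<kappa> * ?f) \<cdot>\<^sub>m Bm" by (rule cancel) (simp only: 2 smult_smult_mat)
  have "(\<kappa> * ?f) \<cdot>\<^sub>m (L * J) = (\<kappa> * ?f) \<cdot>\<^sub>m ((\<kappa> * h) \<cdot>\<^sub>m Bm)"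
    unfolding 1 3 by (simp add: smult_smult_mat ac_simps)
  then show ?thesis by (rule cancel)
qed

end

text \<open>The second instance, with the roles of \<open>a\<close> and \<open>b\<close> exchanged, supplies the one-sided inverse
  needed in \<open>swap_projections\<close>.\<close>

lemma rank_one_cup_pair:
  assumes 1: "rank_one_cup p a b g u v Ak Ai Bm E Wd Wu \<kappa>" and 2: "rank_one_cup p b a g' u v Ak Bm Ai E' Wd' Wu' \<kappa>'"
    and E: "w < g" "w' < g" "E $$ (w, w') \<noteq> 0" and E': "z < g'" "z' < g'" "E' $$ (z, z') \<noteq> 0"
    and nz: "\<kappa> \<noteq> 0" "\<kappa>' \<noteq> 0" and BB: "Bm * Bm = Bm" and Wu_E: "Wu * kron (1\<^sub>m a) E = h \<cdot>\<^sub>m Wu"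
  shows "kron Ak (1\<^sub>m b) * Wu * (Wd * kron Ak (1\<^sub>m b)) = (\<kappa> * h) \<cdot>\<^sub>m kron Ak Bm"
proof -
  interpret A: rank_one_cup p a b g u v Ak Ai Bm E Wd Wu \<kappa> by (rule 1)
  interpret B: rank_one_cup p b a g' u v Ak Bm Ai E' Wd' Wu' \<kappa>' by (rule 2)
  have "A.T w' * A.S w = (\<kappa> * E $$ (w, w')) \<cdot>\<^sub>m Bm"
    by (rule swap_projections[OF A.Ai A.Bm A.S A.T B.S B.T BB A.ST[OF E(1,2)] B.ST[OF E'(1,2)] A.SB A.BT B.BT])
      (use nz E E' in auto)
  from A.LJ_scalar[OF E nz(1) BB Wu_E this] have LJ: "A.L * A.J = (\<kappa> * h) \<cdot>\<^sub>m Bm" .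
  show ?thesis unfolding A.Ak_Wu_Wd_Ak LJ by (rule kron_smult_right)
qed

text \<open>A maximal independent set of columns consists of one column \<open>c\<close>, by the
  rank. Every column is then a multiple of \<open>c\<close>; \<open>u\<close> is this column and
  \<open>v\<close> the row of the multiples.\<close>

lemma rank_one_factor:
  fixes A :: "complex mat"
  assumes A: "A \<in> sq_mats n" and r: "vec_space.rank n A = 1"
  obtains u v where "u \<in> carrier_mat n 1" "v \<in> carrier_mat 1 n" "A = u * v"
proof -
  interpret vec_space "TYPE(complex)" n .
  let ?P = "\<lambda>T. T \<subseteq> set (cols A) \<and> lin_indpt T"
  have lin0: "lin_indpt {}" by (simp add: lin_dep_def)
  obtain S where S: "maximal S ?P"
    using maximal_exists_superset[of "set (cols A)" ?P "{}"] lin0 by auto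
  have sub: "set (cols A) \<subseteq> carrier_vec n" using A cols_dim by blast
  have "card S = 1" using rank_card_indpt[OF A S] r by simp
  then obtain c where c: "S = {c}" using card_1_singletonE by blast
  have li: "lin_indpt {c}" "c \<in> carrier_vec n" using S sub unfolding maximal_def c by auto
  have "\<exists>t. x = t \<cdot>\<^sub>v c" if x: "x \<in> set (cols A)" for x
  proof (cases "x = c")
    case True
    then have "x = 1 \<cdot>\<^sub>v c" using li by simp
    then show ?thesis by blast
  next
    case False
    have xc: "x \<in> carrier_vec n" using x sub by auto
    have "lin_dep ({c} \<union> {x})"
    proof (rule ccontr)
      assume l: "lin_indpt ({c} \<union> {x})"
      have cA: "c \<in> set (cols A)" and maxi: "\<And>T. {c} \<subseteq> T \<Longrightarrow> ?P T \<Longrightarrow> T = {c}" using S unfolding maximal_def c by blast+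
      have "{c} \<union> {x} = {c}" by (rule maxi) (use l x cA in simp_all)
      then show False using False by auto
    qed
    then have "x \<in> span {c}" using lin_dep_iff_in_span[of "{c}" x] li xc False by auto
    then obtain a where "x = lincomb a {c}" using finite_span[of "{c}"] li by auto
    then show ?thesis using li lincomb_def by auto
  qed
  then obtain t where t: "x = t x \<cdot>\<^sub>v c" if "x \<in> set (cols A)" for x by metis
  define u where "u = mat n 1 (\<lambda>(i, j). c $ i)"
  define v where "v = mat 1 n (\<lambda>(i, j). t (col A j))"
  have uv: "u \<in> carrier_mat n 1" "v \<in> carrier_mat 1 n" by (auto simp: u_def v_def)
  have "A = u * v"
  proof (rule eq_matI)
    fix i j assume "i < dim_row (u * v)" "j < dim_col (u * v)"
    then have ij: "i < n" "j < n" using uv by auto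
    then have "col A j = t (col A j) \<cdot>\<^sub>v c" using A by (intro t) (auto simp: cols_def)
    from arg_cong[OF this, of "\<lambda>x. x $ i"] have "A $$ (i, j) = t (col A j) * c $ i" using A ij li by simp
    also have "\<dots> = (u * v) $$ (i, j)"
      using index_mult_mat_sum[OF uv ij] ij by (simp add: u_def v_def)
    finally show "A $$ (i, j) = (u * v) $$ (i, j)" .
  qed (use A uv in auto)
  with uv that show thesis by blast
qed

text \<open>For \<open>A = u * v\<close> the square of \<open>A\<close> is \<open>A\<close> times
  the scalar \<open>v * u\<close>; for a nonzero idempotent this scalar is 1.\<close>

lemma rank_one_idempotent:
  fixes A :: "complex mat"
  assumes u: "u \<in> carrier_mat n 1" and v: "v \<in> carrier_mat 1 n" and A: "A = u * v" and AA: "A * A = A" and A0: "A \<noteq> 0\<^sub>m n n"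
  shows "v * u = 1\<^sub>m 1"
proof -
  define s where "s = (v * u) $$ (0, 0)"
  have vu: "v * u = s \<cdot>\<^sub>m 1\<^sub>m 1" using u v by (intro eq_matI) (auto simp: s_def)
  have uvc: "u * v \<in> sq_mats n" by (rule mult_carrier_mat[OF u v])
  have "A * A = u * (v * u) * v" unfolding A
    using assoc_mult_mat[OF uvc u v] assoc_mult_mat[OF u v u] by simp
  also have "\<dots> = s \<cdot>\<^sub>m A" unfolding vu A
    using mat_smult_mult(2)[OF u one_carrier_mat] mat_smult_mult(1)[OF u v] right_mult_one_mat[OF u] by simp
  finally have sA: "A = s \<cdot>\<^sub>m A" using AA by simp
  have "\<exists>i<n. \<exists>j<n. A $$ (i, j) \<noteq> 0"
  proof (rule ccontr)
    assume "\<not> ?thesis"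
    then have "A = 0\<^sub>m n n" using uvc A by (intro eq_matI) auto
    then show False using A0 by simp
  qed
  then obtain i j where ij: "i < n" "j < n" "A $$ (i, j) \<noteq> 0" by blast
  have "A $$ (i, j) = s * A $$ (i, j)" using arg_cong[OF sA, of "\<lambda>M. M $$ (i, j)"] ij uvc[folded A] by simp
  with ij(3) have "s = 1" by simp
  then show ?thesis using vu one_smult_mat by simp
qed

section \<open>Reciprocal relations\<close>

locale orth_qma = qma_pair N R F + bm: bmw_mat N q \<mu> R for N R F q \<mu> +
  fixes k :: nat
  assumes qnum_nz: "2 \<le> i \<Longrightarrow> i \<le> k \<Longrightarrow> qnum q i \<noteq> 0"
    and mu_k: "\<mu> = q powi (1 - int k)"
    and Ak_rank: "vec_space.rank (N ^ k) (bm.AM k 0 k) = 1"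
    and Ak_nz: "bm.AM k 0 k \<noteq> 0\<^sub>m (N ^ k) (N ^ k)"

sublocale orth_qma \<subseteq> ba: bmw_antisym lin_scale n q \<mu> "\<lambda>j. block_op (N ^ n) (op_at N n j 2 R)"
  "\<lambda>j. block_op (N ^ n) (op_at N n j 2 (minv R))" "\<lambda>j. block_op (N ^ n) (op_at N n j 2 (K_mat N q \<mu> R))" k for n
proof (intro bmw_antisym.intro bm.rep bmw_antisym_axioms.intro)
  show "qnum q i \<noteq> 0" if "2 \<le> i" "i \<le> k" for i using qnum_nz that .
  show "q * (1 / \<mu>) * (1 / q) ^ (2 * j) + 1 \<noteq> 0" if "0 < j" "j < k" for j
    by (rule O_type_denominator[OF bm.q_ne qnum_nz mu_k]) (use that in auto)
qed

context orth_qma begin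

abbreviation "Km \<equiv> K_mat N q \<mu> R"
abbreviation "kn n j \<equiv> op_at N n j 2 Km"
abbreviation "AM \<equiv> bm.AM"
abbreviation "AA j \<equiv> bm.AM j 0 j"
abbreviation "bop n \<equiv> block_op (N ^ n)"

lemma Nn_pos: "0 < N ^ n"
  using N0 by simp

lemmas bop_mult = block_op_mult[OF Nn_pos] and bop_one = block_op_one[OF Nn_pos]
  and bop_add = block_op_add[OF Nn_pos] and bop_smult = block_op_smult[OF Nn_pos]
  and bop_inject = block_op_inject[OF Nn_pos]

lemma kap_nonzero: "0 < j \<Longrightarrow> j \<le> k \<Longrightarrow> ba.kap j \<noteq> 0"
  unfolding ba.kap_def ba.eta'_def Let_def using O_type_kap_nonzero[OF bm.q_ne qnum_nz mu_k] bm.lam_ne by blast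

lemma kaps_nonzero: "i + m \<le> k \<Longrightarrow> ba.kaps i m \<noteq> 0"
proof (induction m)
  case (Suc m)
  then show ?case using kap_nonzero[of "i + m + 1"] by simp
qed simp

text \<open>The skein relation, solved for \<open>Km\<close>.\<close>

lemma Km_alg: "Km \<in> alg 2"
proof -
  let ?l = "q - 1 / q"
  have "Km = 1\<^sub>m (N ^ 2) + (1 / ?l) \<cdot>\<^sub>m Ri + (- 1 / ?l) \<cdot>\<^sub>m R"
  proof (rule eq_matI)
    fix i j assume "i < dim_row (1\<^sub>m (N ^ 2) + (1 / ?l) \<cdot>\<^sub>m Ri + (- 1 / ?l) \<cdot>\<^sub>m R)" "j < dim_col (1\<^sub>m (N ^ 2) + (1 / ?l) \<cdot>\<^sub>m Ri + (- 1 / ?l) \<cdot>\<^sub>m R)"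
    then have ij: "i < N ^ 2" "j < N ^ 2" using carrier_matD[OF R_carrier] by auto
    have "R $$ (i, j) - Ri $$ (i, j) = ?l * (1\<^sub>m (N ^ 2) $$ (i, j) - Km $$ (i, j))"
      using arg_cong[OF bm.skein, of "\<lambda>M. M $$ (i, j)"] ij carrier_matD[OF Ri_carrier] carrier_matD[OF bm.K_carrier]
      by (simp del: index_one_mat(1))
    moreover have "x = y + 1 / l * a + - 1 / l * b" if "b - a = l * (y - x)" "l \<noteq> 0" for x y a b l :: complex
    proof -
      have "l * (y + 1 / l * a + - 1 / l * b) = l * y - (b - a)" using that(2) by (simp add: field_simps)
      also have "\<dots> = l * x" unfolding that(1) by (simp add: algebra_simps)
      finally show ?thesis using that(2) by simp
    qed
    ultimately have "Km $$ (i, j) = 1\<^sub>m (N ^ 2) $$ (i, j) + 1 / ?l * Ri $$ (i, j) + - 1 / ?l * R $$ (i, j)"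
      using bm.lam_ne by blast
    then show "Km $$ (i, j) = (1\<^sub>m (N ^ 2) + (1 / ?l) \<cdot>\<^sub>m Ri + (- 1 / ?l) \<cdot>\<^sub>m R) $$ (i, j)"
      using ij carrier_matD[OF R_carrier] carrier_matD[OF Ri_carrier] by (simp del: index_one_mat(1))
  qed (use carrier_matD[OF R_carrier] carrier_matD[OF bm.K_carrier] in auto)
  moreover have "R \<in> alg 2" "Ri \<in> alg 2" using alg_R[of 1 2] alg_Ri[of 1 2] by auto
  ultimately show ?thesis by (auto intro!: alg_add alg_smult alg_one)
qed

lemma kn_alg: "0 < j \<Longrightarrow> j < n \<Longrightarrow> kn n j \<in> alg n"
  using Km_alg by (intro alg_op_at) auto

lemma Smat_alg: "0 < j \<Longrightarrow> j < n \<Longrightarrow> bm.Smat n j x \<in> alg n"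
  unfolding bm.Smat_def by (intro alg_add alg_smult alg_one alg_R kn_alg)

lemma AM_alg: "s + j \<le> n \<Longrightarrow> AM n s j \<in> alg n"
  by (induction j rule: induct_nat_012) (auto intro!: alg_one alg_smult alg_mult Smat_alg)

lemma AM_carrier[simp]: "s + j \<le> n \<Longrightarrow> AM n s j \<in> sq_mats (N ^ n)"
  using AM_alg by simp

lemma bop_Smat: assumes "0 < j" "j < n" shows "bop n (bm.Smat n j x) = ba.Sm n j x"
proof -
  have c: "rn n j \<in> sq_mats (N ^ n)" "kn n j \<in> sq_mats (N ^ n)" using assms by auto
  show ?thesis unfolding bm.Smat_def ba.Sm_def using c by (simp add: bop_add bop_smult bop_one)
qed

lemma bop_AM: "s + j \<le> n \<Longrightarrow> bop n (AM n s j) = ba.A n s j"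
proof (induction j rule: induct_nat_012)
  case (ge2 j)
  have c: "AM n s (Suc j) \<in> sq_mats (N ^ n)" "bm.Smat n (s + Suc j) x \<in> sq_mats (N ^ n)" for x
    using ge2 by (auto intro!: alg_carrier Smat_alg)
  have "bop n (AM n s (Suc j)) = ba.A n s (Suc j)" using ge2 by simp
  then show ?case unfolding bm.AM.simps ba.A.simps
    using bop_smult[OF sq_mult_carrier[OF sq_mult_carrier[OF c(1,2)] c(1)]]
      bop_mult[OF sq_mult_carrier[OF c(1,2)] c(1)] bop_mult[OF c(1,2)] bop_Smat[of "s + Suc j" n] ge2 by simp
qed (simp_all add: bop_one)

lemma op_at_Smat: assumes "0 < j" "j < m" "s + m \<le> n"
  shows "op_at N n (Suc s) m (bm.Smat m j x) = bm.Smat n (s + j) x"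
proof -
  have c: "rn m j \<in> sq_mats (N ^ m)" "kn m j \<in> sq_mats (N ^ m)" using assms by auto
  have e: "op_at N n (Suc s) m (rn m j) = rn n (s + j)" "op_at N n (Suc s) m (kn m j) = kn n (s + j)"
    using assms op_at_op_at[of R N 2 "Suc s" m n j] op_at_op_at[of Km N 2 "Suc s" m n j] by simp_all
  show ?thesis unfolding bm.Smat_def using c assms e by (simp add: op_at_add op_at_smult)
qed

lemma op_at_AM: "j \<le> m \<Longrightarrow> s + m \<le> n \<Longrightarrow> op_at N n (Suc s) m (AM m 0 j) = AM n s j"
proof (induction j rule: induct_nat_012)
  case (ge2 j)
  have c: "AM m 0 (Suc j) \<in> sq_mats (N ^ m)" "bm.Smat m (0 + Suc j) x \<in> sq_mats (N ^ m)" for x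
    using ge2 by (auto intro!: alg_carrier Smat_alg)
  have "op_at N n (Suc s) m (AM m 0 (Suc j)) = AM n s (Suc j)" using ge2 by simp
  then show ?case unfolding bm.AM.simps op_at_smult op_at_mult3[OF c(1,2,1)]
    using op_at_Smat[of "0 + Suc j" m s n] ge2 by simp
qed simp_all

lemma kron_AA_left: "kron (AA j) (1\<^sub>m (N ^ m)) = AM (j + m) 0 j"
  using op_at_AM[of j j 0 "j + m"] op_at_left[of "AA j" N j m] by simp

lemma kron_AA_right: "kron (1\<^sub>m (N ^ s)) (AA j) = AM (s + j) s j"
  using op_at_AM[of j j s "s + j"] op_at_right[of "AA j" N j s] by simp

lemma AA_idem: assumes "j \<le> k" shows "AA j * AA j = AA j"
proof -
  have "bop j (AA j * AA j) = bop j (AA j)"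
    using ba.A_A(1)[of j j 0 j] assms by (simp add: bop_mult bop_AM)
  then show ?thesis using bop_inject by simp
qed

text \<open>The m-fold tensor power of \<open>Km\<close>, the matrix counterpart of the adjacent
  arcs in \<open>E\<close>.\<close>

fun Kp :: "nat \<Rightarrow> complex mat" where
  "Kp 0 = 1\<^sub>m 1"
| "Kp (Suc m) = kron (Kp m) Km"

lemma Kp_op: "Kp (Suc m) = op_at N (2 * Suc m) 1 (2 * m) (Kp m) * kn (2 * Suc m) (2 * m + 1)"
  if c: "Kp m \<in> sq_mats (N ^ (2 * m))"
proof -
  have "kron (Kp m) Km = kron (Kp m) (1\<^sub>m (N ^ 2)) * kron (1\<^sub>m (N ^ (2 * m))) Km"
    using kron_mult_complex[OF c one_carrier_mat one_carrier_mat bm.K_carrier] right_mult_one_mat[OF c] left_mult_one_mat[OF bm.K_carrier] by simp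
  then show ?thesis using op_at_left[OF c, of 2] op_at_right[OF bm.K_carrier, of "2 * m"] by (simp add: add.commute)
qed

lemma Kp_alg: "Kp m \<in> alg (2 * m)"
proof (induction m)
  case 0
  then show ?case using alg_one[of 0] by simp
next
  case (Suc m)
  show ?case unfolding Kp_op[OF alg_carrier[OF Suc]]
    by (intro alg_mult alg_op_at kn_alg Suc) auto
qed

lemma Kp_carrier[simp]: "Kp m \<in> sq_mats (N ^ (2 * m))"
  using Kp_alg by (rule alg_carrier)

text \<open>Provides the indices \<open>w\<close>, \<open>w'\<close> for \<open>row_of\<close> and
  \<open>col_of\<close>; an entry of a Kronecker product is a product of entries.\<close>

lemma Kp_nonzero: "\<exists>w w'. w < N ^ (2 * m) \<and> w' < N ^ (2 * m) \<and> Kp m $$ (w, w') \<noteq> 0"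
proof (induction m)
  case (Suc m)
  then obtain w w' where w: "w < N ^ (2 * m)" "w' < N ^ (2 * m)" "Kp m $$ (w, w') \<noteq> 0" by blast
  have "\<exists>a<N ^ 2. \<exists>b<N ^ 2. Km $$ (a, b) \<noteq> 0"
  proof (rule ccontr)
    assume "\<not> ?thesis"
    then have "Km = 0\<^sub>m (N ^ 2) (N ^ 2)" using carrier_matD[OF bm.K_carrier] by (intro eq_matI) auto
    then show False using bm.K_nonzero by simp
  qed
  then obtain a b where a: "a < N ^ 2" "b < N ^ 2" "Km $$ (a, b) \<noteq> 0" by blast
  have e: "N ^ (2 * Suc m) = N ^ (2 * m) * N ^ 2" by (simp add: power2_eq_square)
  have "Kp (Suc m) $$ (w * N ^ 2 + a, w' * N ^ 2 + b) \<noteq> 0"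
    using kron_index_pair[OF Kp_carrier bm.K_carrier w(1) a(1) w(2) a(2)] w a by simp
  moreover have "w * N ^ 2 + a < N ^ (2 * Suc m)" "w' * N ^ 2 + b < N ^ (2 * Suc m)"
    unfolding e using w a by (auto intro: pair_index_less)
  ultimately show ?case by blast
qed simp

lemma bop_Kp: "i + 2 * m \<le> n \<Longrightarrow> bop n (op_at N n (Suc i) (2 * m) (Kp m)) = ba.E n i m"
proof (induction m)
  case 0
  have "op_at N n (Suc i) (2 * 0) (Kp 0) = 1\<^sub>m (N ^ n)" using 0 op_at_one[of "Suc i" 0 n N] by simp
  then show ?case unfolding ba.E.simps by (simp only: bop_one)
next
  case (Suc m)
  let ?s = "2 * Suc m"
  have c1: "op_at N ?s 1 (2 * m) (Kp m) \<in> sq_mats (N ^ ?s)" by (intro op_at_carrier Kp_carrier) auto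
  have c2: "kn ?s (2 * m + 1) \<in> sq_mats (N ^ ?s)" by (intro op_at_carrier bm.K_carrier) auto
  have d: "op_at N n (Suc i) (2 * m) (Kp m) \<in> sq_mats (N ^ n)" "kn n (i + 2 * m + 1) \<in> sq_mats (N ^ n)"
    using Suc.prems by (intro op_at_carrier Kp_carrier bm.K_carrier; simp)+
  have e1: "op_at N n (Suc i) ?s (op_at N ?s 1 (2 * m) (Kp m)) = op_at N n (Suc i) (2 * m) (Kp m)"
    using op_at_op_at[OF Kp_carrier, of "Suc i" ?s n 1] Suc.prems by simp
  have e2: "op_at N n (Suc i) ?s (kn ?s (2 * m + 1)) = kn n (i + 2 * m + 1)"
    using op_at_op_at[OF bm.K_carrier, of "Suc i" ?s n "2 * m + 1"] Suc.prems by simp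
  show ?case unfolding Kp_op[OF Kp_carrier] op_at_mult[OF c1 c2] e1 e2 bop_mult[OF d] ba.E.simps using Suc by simp
qed

text \<open>The cups were built inside \<open>linop\<close>. Membership in this set allows them to
  be replaced by matrices that moreover lie in \<open>alg n\<close>, as cyclicity of the character
  requires.\<close>

definition img :: "nat \<Rightarrow> linop set" where
  "img n = bop n ` alg n"

lemma img_mult: "x \<in> img n \<Longrightarrow> y \<in> img n \<Longrightarrow> x * y \<in> img n"
  unfolding img_def by (auto simp: bop_mult[symmetric] intro!: imageI alg_mult)

lemma img_one: "1 \<in> img n"
  unfolding img_def by (rule image_eqI[of _ _ "1\<^sub>m (N ^ n)"]) (simp_all add: bop_one alg_one)

lemma img_K: "0 < j \<Longrightarrow> j < n \<Longrightarrow> bop n (kn n j) \<in> img n"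
  unfolding img_def by (intro imageI kn_alg)

lemma img_rd: "0 < a \<Longrightarrow> a + l < n \<Longrightarrow> ba.rd n a l \<in> img n"
  by (induction l) (auto intro!: img_mult img_K)

lemma img_ru: "0 < a \<Longrightarrow> a + l < n \<Longrightarrow> ba.ru n a l \<in> img n"
  by (induction l) (auto intro!: img_mult img_K)

lemma img_Wd: "i + 2 * m \<le> n \<Longrightarrow> ba.Wd n i m \<in> img n"
  by (induction m) (auto intro!: img_mult img_rd img_one)

lemma img_Wu: "i + 2 * m \<le> n \<Longrightarrow> ba.Wu n i m \<in> img n"
  by (induction m) (auto intro!: img_mult img_ru img_one)

lemma cups_exist:
  assumes u: "u \<in> carrier_mat (N ^ k) 1" and v: "v \<in> carrier_mat 1 (N ^ k)" and A: "AA k = u * v" and vu: "v * u = 1\<^sub>m 1"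
    and k: "i + m = k"
  obtains Wd Wu where "Wd \<in> alg (k + m)" "Wu \<in> alg (k + m)"
    "rank_one_cup (N ^ k) (N ^ i) (N ^ m) (N ^ (2 * m)) u v (AA k) (AA i) (AA m) (Kp m) Wd Wu (ba.kaps i m)"
    "Wu * kron (1\<^sub>m (N ^ i)) (Kp m) = ba.eta' ^ m \<cdot>\<^sub>m Wu"
proof -
  let ?n = "k + m"
  have n: "i + 2 * m = ?n" using k by simp
  obtain Wd where Wd: "Wd \<in> alg ?n" "bop ?n Wd = ba.Wd ?n i m" using img_Wd[of i m ?n] n unfolding img_def by auto
  obtain Wu where Wu: "Wu \<in> alg ?n" "bop ?n Wu = ba.Wu ?n i m" using img_Wu[of i m ?n] n unfolding img_def by auto
  note Wdc = alg_carrier[OF Wd(1)] and Wuc = alg_carrier[OF Wu(1)]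
  have dim: "N ^ k * N ^ m = N ^ ?n" "N ^ i * N ^ (2 * m) = N ^ ?n" using n by (metis power_add)+
  have kA: "kron (AA k) (1\<^sub>m (N ^ m)) = AM ?n 0 k" by (rule kron_AA_left)
  have kB: "kron (1\<^sub>m (N ^ k)) (AA m) = AM ?n k m" by (rule kron_AA_right)
  have kE: "kron (1\<^sub>m (N ^ i)) (Kp m) = op_at N ?n (Suc i) (2 * m) (Kp m)"
    using op_at_right[OF Kp_carrier[of m], of i] n by simp
  have Aic: "AA i \<in> sq_mats (N ^ i)" by simp
  have kAE: "kron (AA i) (Kp m) = AM ?n 0 i * op_at N ?n (Suc i) (2 * m) (Kp m)"
    unfolding kE[symmetric] using kron_AA_left[of i "2 * m"] n
      kron_mult_complex[OF Aic one_carrier_mat one_carrier_mat Kp_carrier[of m]] right_mult_one_mat[OF Aic] left_mult_one_mat[OF Kp_carrier[of m]] by simp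
  have c: "AM ?n 0 k \<in> sq_mats (N ^ ?n)" "AM ?n k m \<in> sq_mats (N ^ ?n)" "AM ?n 0 i \<in> sq_mats (N ^ ?n)"
    "op_at N ?n (Suc i) (2 * m) (Kp m) \<in> sq_mats (N ^ ?n)"
    using k by (auto intro!: op_at_carrier[OF Kp_carrier])
  have b: "bop ?n (AM ?n 0 k) = ba.A ?n 0 k" "bop ?n (AM ?n k m) = ba.A ?n k m" "bop ?n (AM ?n 0 i) = ba.A ?n 0 i"
    "bop ?n (op_at N ?n (Suc i) (2 * m) (Kp m)) = ba.E ?n i m"
    using k n by (simp_all only: k bop_AM bop_Kp le_add1 add_0 order_refl)
  have h1: "Wd * AM ?n 0 k * Wu = ba.kaps i m \<cdot>\<^sub>m (AM ?n 0 i * op_at N ?n (Suc i) (2 * m) (Kp m))"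
    by (rule iffD1[OF bop_inject[where n = "k + m"]]) (use ba.Wd_A_Wu[of i m ?n] k n Wdc Wuc c in
      \<open>simp_all add: bop_mult bop_smult b Wd Wu\<close>)
  have h2: "Wd * AM ?n 0 k * AM ?n k m = Wd * AM ?n 0 k"
    by (rule iffD1[OF bop_inject[where n = "k + m"]]) (use ba.Wd_absorb[of i m ?n] k n Wdc Wuc c in
      \<open>simp_all add: bop_mult bop_smult b Wd Wu\<close>)
  have h3: "AM ?n k m * (AM ?n 0 k * Wu) = AM ?n 0 k * Wu"
    by (rule iffD1[OF bop_inject[where n = "k + m"]]) (use ba.Wu_absorb[of i m ?n] k n Wdc Wuc c in
      \<open>simp_all add: bop_mult bop_smult b Wd Wu\<close>)
  have h4: "Wu * op_at N ?n (Suc i) (2 * m) (Kp m) = ba.eta' ^ m \<cdot>\<^sub>m Wu"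
    by (rule iffD1[OF bop_inject[where n = "k + m"]]) (use ba.Wu_E[of i m ?n] k n Wdc Wuc c in
      \<open>simp_all add: bop_mult bop_smult b Wd Wu\<close>)
  show thesis
  proof (rule that[OF Wd(1) Wu(1)])
    show "rank_one_cup (N ^ k) (N ^ i) (N ^ m) (N ^ (2 * m)) u v (AA k) (AA i) (AA m) (Kp m) Wd Wu (ba.kaps i m)"
      by unfold_locales (simp_all only: dim kA kB kAE h1 h2 h3 u v A[symmetric] vu Kp_carrier Wdc Wuc AM_carrier add_0 order_refl)
    show "Wu * kron (1\<^sub>m (N ^ i)) (Kp m) = ba.eta' ^ m \<cdot>\<^sub>m Wu" unfolding kE h4 ..
  qed
qed

text \<open>The operator form of the reciprocal relation: the two products of the same two cup
  operators, one for each side.\<close>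

theorem antisym_cups:
  assumes k: "i + m = k"
  obtains Wd Wu where "Wd \<in> alg (k + m)" "Wu \<in> alg (k + m)"
    "Wd * kron (AA k) (1\<^sub>m (N ^ m)) * Wu = ba.kaps i m \<cdot>\<^sub>m kron (AA i) (Kp m)"
    "kron (AA k) (1\<^sub>m (N ^ m)) * Wu * (Wd * kron (AA k) (1\<^sub>m (N ^ m))) = (ba.kaps i m * ba.eta' ^ m) \<cdot>\<^sub>m kron (AA k) (AA m)"
proof -
  obtain u v where uv: "u \<in> carrier_mat (N ^ k) 1" "v \<in> carrier_mat 1 (N ^ k)" "AA k = u * v"
    using rank_one_factor[OF _ Ak_rank] by auto
  have vu: "v * u = 1\<^sub>m 1" using rank_one_idempotent[OF uv AA_idem Ak_nz] by simp
  obtain Wd Wu where W: "Wd \<in> alg (k + m)" "Wu \<in> alg (k + m)"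
    "rank_one_cup (N ^ k) (N ^ i) (N ^ m) (N ^ (2 * m)) u v (AA k) (AA i) (AA m) (Kp m) Wd Wu (ba.kaps i m)"
    "Wu * kron (1\<^sub>m (N ^ i)) (Kp m) = ba.eta' ^ m \<cdot>\<^sub>m Wu"
    using cups_exist[OF uv vu k] by blast
  \<comment> \<open>The instance with \<open>i\<close> and \<open>m\<close> exchanged is taken for
    the same \<open>u\<close> and \<open>v\<close>, so that both refer to one factorisation of the
    rank-one antisymmetrizer.\<close>
  obtain Wd' Wu' where W': "Wd' \<in> alg (k + i)" "Wu' \<in> alg (k + i)"
    "rank_one_cup (N ^ k) (N ^ m) (N ^ i) (N ^ (2 * i)) u v (AA k) (AA m) (AA i) (Kp i) Wd' Wu' (ba.kaps m i)"
    using cups_exist[OF uv vu, of m i] k by (metis add.commute)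
  obtain w w' where w: "w < N ^ (2 * m)" "w' < N ^ (2 * m)" "Kp m $$ (w, w') \<noteq> 0" using Kp_nonzero by blast
  obtain z z' where z: "z < N ^ (2 * i)" "z' < N ^ (2 * i)" "Kp i $$ (z, z') \<noteq> 0" using Kp_nonzero by blast
  have nz: "ba.kaps i m \<noteq> 0" "ba.kaps m i \<noteq> 0" using kaps_nonzero k by auto
  have "AA m * AA m = AA m" using k by (intro AA_idem) simp
  from rank_one_cup_pair[OF W(3) W'(3) w z nz this W(4)] rank_one_cup.Wd_Wu[OF W(3)] that[OF W(1,2)]
  show thesis by blast
qed

abbreviation "g \<equiv> const (1 / eta q \<mu>) * cp 2 Km"

lemma cp_Kp:
  assumes X: "X \<in> sq_mats (N ^ n)"
  shows "cp n X * cp 2 Km ^ m = cp (n + 2 * m) (kron X (Kp m))"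
proof (induction m)
  case 0
  then show ?case by (simp add: kron_one_right[of X, unfolded One_nat_def])
next
  case (Suc m)
  have c: "kron X (Kp m) \<in> sq_mats (N ^ (n + 2 * m))"
    unfolding power_add by (rule kron_carrier[OF X Kp_carrier])
  have "cp n X * cp 2 Km ^ Suc m = cp (n + 2 * m) (kron X (Kp m)) * cp 2 Km"
    unfolding power_Suc2 mult.assoc[symmetric] Suc ..
  also have "\<dots> = cp (n + 2 * m + 2) (kron (kron X (Kp m)) Km)" by (rule cp_mult[OF c Km_alg])
  finally show ?case by (simp add: kron_assoc)
qed

lemma const_mult_power: "(const c * p) ^ m = const (c ^ m) * p ^ m" for p :: qpoly
proof (induction m)
  case (Suc m)
  have "(const c * p) ^ Suc m = const c * (p * const (c ^ m)) * p ^ m" using Suc by (simp add: mult.assoc)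
  also have "p * const (c ^ m) = const (c ^ m) * p" by (rule const_central[symmetric])
  finally show ?case by (simp add: const_mult mult.assoc)
qed simp

lemma reciprocal:
  assumes k: "i + m = k"
  shows "cp i (AA i) * g ^ m - cp k (AA k) * cp m (AA m) \<in> qa.I"
proof -
  let ?n = "k + m" and ?\<kappa> = "ba.kaps i m" and ?\<eta> = "eta q \<mu>"
  let ?A = "kron (AA k) (1\<^sub>m (N ^ m))" and ?P = "cp i (AA i) * cp 2 Km ^ m" and ?Q = "cp k (AA k) * cp m (AA m)"
  obtain Wd Wu where W: "Wd \<in> alg ?n" "Wu \<in> alg ?n" "Wd * ?A * Wu = ?\<kappa> \<cdot>\<^sub>m kron (AA i) (Kp m)"
    "?A * Wu * (Wd * ?A) = (?\<kappa> * ba.eta' ^ m) \<cdot>\<^sub>m kron (AA k) (AA m)"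
    using antisym_cups[OF k] by blast
  have n: "i + 2 * m = ?n" using k by simp
  have A: "?A \<in> alg ?n" unfolding kron_AA_left by (intro AM_alg) simp
  note c = W(1)[THEN alg_carrier] A[THEN alg_carrier] W(2)[THEN alg_carrier]
  have AAk: "AA k \<in> sq_mats (N ^ k)" and AAm: "AA m \<in> sq_mats (N ^ m)" and AAi: "AA i \<in> sq_mats (N ^ i)" by simp_all
  have AAA: "?A * ?A = ?A" using kron_one_mult[OF AAk AAk, of "N ^ m"] AA_idem by simp
  have kc: "kron (AA k) (AA m) \<in> sq_mats (N ^ ?n)" "kron (AA i) (Kp m) \<in> sq_mats (N ^ ?n)"
    using kron_carrier[OF AAk AAm] kron_carrier[OF AAi Kp_carrier[of m]] unfolding power_add[symmetric] n by auto
  \<comment> \<open>Doubling the idempotent \<open>?A\<close> splits the first product into two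
    factors whose product in the opposite order is the second one.\<close>
  have "Wd * ?A * (?A * Wu) = Wd * (?A * ?A) * Wu"
    using assoc_mult_mat[OF sq_mult_carrier[OF c(1,2)] c(2,3)] assoc_mult_mat[OF c(1,2,2)] by simp
  then have 1: "Wd * ?A * (?A * Wu) = ?\<kappa> \<cdot>\<^sub>m kron (AA i) (Kp m)" unfolding AAA W .
  have "cp ?n (Wd * ?A * (?A * Wu)) - cp ?n (?A * Wu * (Wd * ?A)) \<in> qa.I"
    using W A c by (intro cp_cyclic alg_mult) auto
  moreover have "cp ?n (kron (AA i) (Kp m)) = ?P" using cp_Kp[OF AAi, of m] n by simp
  moreover have "cp ?n (kron (AA k) (AA m)) = ?Q" using cp_mult[OF AAk, of "AA m" m] AM_alg[of 0 m m] by simp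
  moreover have eta: "ba.eta' = ?\<eta>" unfolding ba.eta'_def bm.eta_eq ..
  ultimately have "const ?\<kappa> * ?P - const (?\<kappa> * ?\<eta> ^ m) * ?Q \<in> qa.I"
    unfolding 1 W(4) cp_smult[OF kc(1)] cp_smult[OF kc(2)] by simp
  \<comment> \<open>Division by \<open>c * eta^m\<close>, with c nonzero by
    \<open>kaps_nonzero\<close> and eta nonzero because \<open>\<mu>\<close> differs from
    \<open>q\<close> and \<open>-1/q\<close>. The surviving \<open>(1 / eta)^m\<close> turns the
    powers of \<open>cp 2 Km\<close> into powers of \<open>g\<close>.\<close>
  from qa.I_mult_left[OF this free_const[of "1 / (?\<kappa> * ?\<eta> ^ m)"]]
  have "const (1 / (?\<kappa> * ?\<eta> ^ m) * ?\<kappa>) * ?P - const (1 / (?\<kappa> * ?\<eta> ^ m) * (?\<kappa> * ?\<eta> ^ m)) * ?Q \<in> qa.I"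
    unfolding const_mult by (simp only: right_diff_distrib mult.assoc)
  moreover have nz: "?\<kappa> \<noteq> 0" "?\<eta> ^ m \<noteq> 0" using kaps_nonzero[of i m] k bm.eta_ne by auto
  then have "1 / (?\<kappa> * ?\<eta> ^ m) * ?\<kappa> = (1 / ?\<eta>) ^ m" "1 / (?\<kappa> * ?\<eta> ^ m) * (?\<kappa> * ?\<eta> ^ m) = 1"
    by (simp_all add: power_one_over)
  moreover have "cp i (AA i) * g ^ m = const ((1 / ?\<eta>) ^ m) * ?P"
    unfolding const_mult_power mult.assoc[symmetric] const_central[of _ "cp i (AA i)"] ..
  ultimately show ?thesis by simp
qed

lemma g_closed: "g \<in> carrier qa.FA"
  by (intro free_mult free_const cp_closed bm.K_carrier)

lemma a_closed: "cp i (AA i) \<in> carrier qa.FA"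
  by (intro cp_closed AM_carrier) simp

lemma g_commute: "cp i (AA i) * g ^ m - g ^ m * cp i (AA i) \<in> qa.I"
proof (induction m)
  case 0
  then show ?case by (simp add: qa.I_zero)
next
  case (Suc m)
  let ?a = "cp i (AA i)" and ?c = "const (1 / eta q \<mu>)"
  have gm: "g ^ m \<in> carrier qa.FA" using qa.cl_pow[OF g_closed] by blast
  have "?c * (?a * cp 2 Km - cp 2 Km * ?a) \<in> qa.I"
    by (intro qa.I_mult_left cp_commute AM_alg Km_alg free_const) simp
  moreover have "?c * (?a * cp 2 Km - cp 2 Km * ?a) = ?a * g - g * ?a"
    using const_central[of "1 / eta q \<mu>" ?a] by (simp add: right_diff_distrib flip: mult.assoc)
  ultimately have "?a * g - g * ?a \<in> qa.I" by simp
  then have "(?a * g ^ m - g ^ m * ?a) * g + g ^ m * (?a * g - g * ?a) \<in> qa.I"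
    by (intro qa.I_add qa.I_mult_left qa.I_mult_right gm g_closed Suc)
  moreover have "(?a * g ^ m - g ^ m * ?a) * g + g ^ m * (?a * g - g * ?a) = ?a * g ^ Suc m - g ^ Suc m * ?a"
    unfolding power_Suc2 by (simp add: left_diff_distrib right_diff_distrib mult.assoc del: power_Suc)
  ultimately show ?case by (simp only:)
qed

lemma ch_class: "ch N R F n \<alpha> = qa.cl (cp n (rho N R n \<alpha>))"
  unfolding ch_def qma_class_def R_trace_rt cp_def mprod_TS[OF order_refl] ..

text \<open>Makes \<open>a_0 = 1\<close> the case \<open>i = 0\<close> of the same formula as all
  other \<open>a_i\<close>.\<close>

lemma cp_0: "cp 0 (1\<^sub>m 1) = 1"
proof -
  have c: "TS 0 0 0 * cmat (1\<^sub>m 1) \<in> sq_mats (N ^ 0)" by simp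
  have "TS 0 0 0 * cmat (1\<^sub>m 1) = 1\<^sub>m 1" by simp
  then show ?thesis unfolding cp_def rt_index[OF c] by (simp add: Dn_0)
qed

lemma a_elem_class: "a_elem N R F q \<mu> i = qa.cl (cp i (AA i))"
proof (cases "i = 0")
  case True
  then show ?thesis using cp_0 by (simp add: a_elem_def qma_def qa.cl_one)
next
  case False
  then show ?thesis unfolding a_elem_def ch_class using bm.reps_rho[OF bm.reps_antisym[of i i]] by simp
qed

lemma contraction_class: "contraction N R F q \<mu> = qa.cl g"
proof -
  have "rho N R 2 (kappa 2 q \<mu> 1) = Km" using bm.reps_rho[OF bm.reps_kappa[of 1 2]] by simp
  then show ?thesis unfolding contraction_def ch_class qma_class_def qma_def
    by (simp add: qa.cl_mult free_const cp_closed)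
qed

theorem reciprocal_relations:
  assumes "i \<le> k"
  shows "contraction N R F q \<mu> [^]\<^bsub>qma N R F\<^esub> (k - i) \<otimes>\<^bsub>qma N R F\<^esub> a_elem N R F q \<mu> i =
    a_elem N R F q \<mu> k \<otimes>\<^bsub>qma N R F\<^esub> a_elem N R F q \<mu> (k - i)"
proof -
  let ?m = "k - i" and ?a = "\<lambda>i. cp i (AA i)"
  have gm: "qa.cl g [^]\<^bsub>qa.PA\<^esub> ?m = qa.cl (g ^ ?m)" "g ^ ?m \<in> carrier qa.FA" using qa.cl_pow[OF g_closed] by auto
  \<comment> \<open>\<open>reciprocal\<close> has the power of \<open>g\<close> on the right of
    \<open>a_i\<close>; subtracting the commutator brings it to the left.\<close>
  have "(?a i * g ^ ?m - ?a k * ?a ?m) - (?a i * g ^ ?m - g ^ ?m * ?a i) \<in> qa.I"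
    using assms by (intro qa.I_diff reciprocal g_commute) simp
  then have "qa.cl (g ^ ?m * ?a i) = qa.cl (?a k * ?a ?m)"
    using gm(2) a_closed by (subst qa.cl_iff) (auto intro: free_mult)
  then show ?thesis unfolding contraction_class a_elem_class qma_def gm(1)
    using gm(2) a_closed by (simp add: qa.cl_mult)
qed

end

theorem theorem4p9:
  fixes N k :: nat and q \<mu> :: complex and R F :: "complex mat"
  assumes "q \<notin> {0, 1, -1}"
    and "\<mu> \<notin> {0, q, - (1 / q)}"
    and "k \<ge> 2"
    and "R_matrix N R" and "R_matrix N F"
    and "strict_skew_invertible N R" and "strict_skew_invertible N F"
    and "compatible_pair N R F"
    and "type_O N q \<mu> k R"
  shows "\<forall>i \<in> {0..k}.
    contraction N R F q \<mu> [^]\<^bsub>qma N R F\<^esub> (k - i) \<otimes>\<^bsub>qma N R F\<^esub> a_elem N R F q \<mu> i =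
    a_elem N R F q \<mu> k \<otimes>\<^bsub>qma N R F\<^esub> a_elem N R F q \<mu> (k - i)"
proof -
  have O: "BMW_type N q \<mu> R" "\<And>i. 2 \<le> i \<Longrightarrow> i \<le> k \<Longrightarrow> qnum q i \<noteq> 0" "\<mu> = q powi (1 - int k)"
    "rho N R k (antisym k q \<mu> k) \<noteq> 0\<^sub>m (N ^ k) (N ^ k)" "vec_space.rank (N ^ k) (rho N R k (antisym k q \<mu> k)) = 1"
    using assms(3,9) unfolding type_O_def by auto
  interpret bm: bmw_mat N q \<mu> R by unfold_locales (use assms(1,2) O(1) in auto)
  \<comment> \<open>Carries the hypotheses on rank and nonvanishing over from the class in the braid
    algebra to the explicit matrix.\<close>
  have rho: "rho N R k (antisym k q \<mu> k) = bm.AM k 0 k" by (rule bm.reps_rho[OF bm.reps_antisym]) simp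
  interpret orth_qma N R F q \<mu> k
  proof unfold_locales
    show "0 < N" by (rule bm.N_pos)
    show "skew_invertible N R" using assms(6) unfolding strict_skew_invertible_def by blast
    show "\<mu> = q powi (1 - int k)" by (rule O(3))
  qed (use assms O rho in \<open>auto simp: R_matrix_def\<close>)
  show ?thesis using reciprocal_relations by simp
qed

end
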